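(* Suppose there is a solution to the auxiliary randomised mean-field FBSDE (R) in the context. Then there exists $U_0\in\mathcal B(U)$ with $m(U_0)=1$ so that, for each $u\in U_0$, there is a probability measure $\bar{\mathbb P}^u$ on $\bar{\mathcal F}$ and an $S_1$-valued quadruple of progressive processes $(\hat X^u,\hat Y^u,\hat Z^u,\hat\Lambda^u)$ which satisfies, on $(\bar\Omega,\bar{\mathcal F},\bar{\mathbb P}^u)$, the FBSDE $$\begin{aligned}d\hat X^u_t&=b^u(t,\hat X^u_t,\hat Y^u_t,\hat Z^u_t,\hat\Lambda^u_t,(\hat{\mathbb P}^{\tilde u}_t)_{\tilde u})dt+\sigma^u(t,\hat X^u_t,\hat Y^u_t,\hat Z^u_t,\hat\Lambda^u_t,(\hat{\mathbb P}^{\tilde u}_t)_{\tilde u})d\hat B^u_t,\\-d\hat Y^u_t&=f^u(t,\hat X^u_t,\hat Y^u_t,\hat Z^u_t,\hat\Lambda^u_t,(\hat{\mathbb P}^{\tilde u}_t)_{\tilde u})dt-\hat Z^u_td\hat B^u_t,\end{aligned}$$ with $\hat X^u_0=\hat\chi^u_0$ and $\hat Y^u_T=G^u(\hat X^u_T,(\hat{\mathbb P}^{\tilde u}_{T,1})_{\tilde u})$ ($\hat{\mathbb P}^u_{T,1}$ the first marginal of $\hat{\mathbb P}^u_T$), such that (i) $\hat{\mathbb P}^u_t=\mathrm{Law}(\hat X^u_t,\hat Y^u_t,\hat Z^u_t,\hat\Lambda^u_t)$ for $t\in[0,T]$; (ii) $(x_t,y_t,z_t,\lambda_t)\circ(\hat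 X^u,\hat Y^u,\hat Z^u,\hat\Lambda^u)=(\hat X^u_t,\hat Y^u_t,\hat Z^u_t,\hat\Lambda^u_t)$ for $t\in[0,T]$; (iii) $\hat{\mathbb P}^u:=\bar{\mathbb P}^u\circ(\hat X^u,\hat Y^u,\hat Z^u,\hat\Lambda^u)^{-1}$ is a Markov kernel for $\mathcal U$; (iv) $\int_0^T\mathbb E^{\bar{\mathbb P}^u}[|\hat\Lambda^u_s-\Lambda^u(s,\hat\chi^u_0,\hat B^u_{\cdot\wedge s})|^2]ds=0$. Here $\hat B^u$ is a Brownian motion and $\hat\chi^u_0$ is an independent random variable distributed according to $\mathrm{Law}(\chi^u_0)$ on $(\bar\Omega,\bar{\mathcal F},\bar{\mathbb P}^u)$. Moreover, $(\hat X^u,\hat Y^u,\hat Z^u,\hat\Lambda^u)_{u\in U_0}$ is in $\mathcal S^2_m\times\mathcal H^2_m$.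
   Context: **Setting.** $T>0$, $n,l,d,k\ge1$, $E:=\mathbb R^n\times\mathbb R^l\times\mathbb R^{l\times d}\times\mathbb R^k$. $U$ is a Polish space, $m$ a probability measure on $\mathcal B(U)$, $\mathcal U$ the $m$-completion of $\mathcal B(U)$ ($m$ also denotes the extension). $(\cdot)_u$ abbreviates $(\cdot)_{u\in U}$; $(\mathrm{Law}(\chi^u_0))_u$ is a given Markov kernel of laws on $\mathbb R^n$. A family $(\mu^u)_u$ of Borel probability measures on a Polish space is a Markov kernel (for $\mathcal U$) if $u\mapsto\mu^u(A)$ is $\mathcal U$-measurable for every Borel $A$. For Euclidean $F$, $\mathcal P^2_m(F)$ is the set of Markov kernels $(\mu^u)_u$ of probability measures on $F$ with finite second moments and $\int\int_F|x|^2d\mu^u(x)dm(u)<\infty$, with distance $W_{2,m}(\mu,\nu)=(\int W_2^2(\mu^u,\nu^u)dm(u))^{1/2}$. $\mathcal S^2_m\times\mathcal H^2_m$ denotes families $(X^u,Y^u,Z^u,\Lambda^u)$ of progressive processes (for the respective filtrations) whose laws form a Markov kernel, such that $N^u:=\mathbb E[\sup_t|X^u_t|^2]+\mathbb E[\sup_t|Y^u_t|^2]+\int_0^T\mathbb E[|Z^u_t|^2+|\Lambda^u_t|^2]dt$ is finite for each $u$ and $\int N^udm(u)<\infty$. Families of laws indexed only by a set $U_0$ of full $m$-measure may be inserted in the coefficients, as values on $m$-null sets are irrelevant. **Coefficients.** $b,\sigma,f:U\times[0,T]\times E\times\mathcal P^2_m(E)\to\mathbb R^n,\mathbb R^{n\times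 d},\mathbb R^l$, $G:U\times\mathbb R^n\times\mathcal P^2_m(\mathbb R^n)\to\mathbb R^l$, $\Lambda:U\times[0,T]\times\mathbb R^n\times C([0,T],\mathbb R^d)\to\mathbb R^k$ are Borel measurable ($u$ written as superscript), with $\int_0^T\mathbb E|\Lambda^u(t,\chi^u_0,B^u_{\cdot\wedge t})|^2dt$ finite for every $u$ and $m$-integrable in $u$ ($B^u$ a Brownian motion independent of $\chi^u_0$). **Path spaces.** $S_1:=C([0,T],\mathbb R^n)\times C([0,T],\mathbb R^l)\times L^2([0,T],\mathbb R^{l\times d})\times L^2([0,T],\mathbb R^k)$, $S_2:=C([0,T],\mathbb R^d)\times\mathbb R^n$, $\bar\Omega:=S_1\times S_2$, $\bar{\mathcal F}:=\mathcal B(S_1\times S_2)$. The canonical process on $S_1$ is $(x_t,y_t,z_t,\lambda_t)(x,y,[z],[\lambda])=(x(t),y(t),\bar z(t),\bar\lambda(t))$, where (entrywise) $\bar z(t)=\hat z(t)\mathbf 1_{\hat z(t)\in\mathbb R}$, $\hat z(t)=\liminf_{\varepsilon\downarrow0}\frac1\varepsilon\int_{[(t-\varepsilon)\vee0,t]}z(s)ds$, and $\bar\lambda$ likewise; the canonical process on $S_2$ is $(w_\cdot,\chi)$. Progressive measurability on $\bar\Omega$ is with respect to the filtration generated by these canonical processes, $\sigma(x_s,y_s,z_s,\lambda_s,w_s,\chi:s\le t)$, augmented by the null sets of $\bar{\mathbb P}^u$. **Auxiliary FBSDE (R).** $(\hat\Omega,\hat{\mathcal F},\hat{\mathbb P})$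 is a complete probability space supporting a $d$-dimensional Brownian motion $\hat B$ and random variables $\hat\chi_0\in\mathbb R^n$, $\mathfrak u\in U$, with $(\hat\chi_0,\mathfrak u)$ independent of $\hat B$, $\mathrm{Law}(\mathfrak u)=m$, and conditional law of $\hat\chi_0$ given $\mathfrak u$ equal to the kernel $(\mathrm{Law}(\chi^u_0))_u$; $\hat{\mathbb F}$ is the filtration generated by $(\hat B,\hat\chi_0,\mathfrak u)$ augmented by the null sets. $\hat{\mathcal H}^2$ is the set of $\hat{\mathbb F}$-progressive $E$-valued quadruples with $\hat{\mathbb E}[\sup_t|\hat X_t|^2]+\hat{\mathbb E}[\sup_t|\hat Y_t|^2]+\int_0^T\hat{\mathbb E}|\hat Z_t|^2dt+\int_0^T\hat{\mathbb E}|\hat\Lambda_t|^2dt<\infty$. A solution of (R) is $(\hat X,\hat Y,\hat Z,\hat\Lambda)\in\hat{\mathcal H}^2$ with $$\begin{aligned}d\hat X_t&=b^{\mathfrak u}(t,\hat X_t,\hat Y_t,\hat Z_t,\hat\Lambda_t,(\hat{\mathbf P}^u_t)_u)dt+\sigma^{\mathfrak u}(t,\hat X_t,\hat Y_t,\hat Z_t,\hat\Lambda_t,(\hat{\mathbf P}^u_t)_u)d\hat B_t,\\-d\hat Y_t&=f^{\mathfrak u}(t,\hat X_t,\hat Y_t,\hat Z_t,\hat\Lambda_t,(\hat{\mathbf P}^u_t)_u)dt-\hat Z_td\hat B_t,\end{aligned}\tag{R}$$ $\hat X_0=\hat\chi_0$, $\hat Y_T=G^{\mathfrak u}(\hat X_T,(\hat{\mathbf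 P}^u_{T,1})_u)$, such that: each $(\hat{\mathbf P}^u_t)_u$ is a Markov kernel giving the conditional law of $(\hat X_t,\hat Y_t,\hat Z_t,\hat\Lambda_t)$ given $\mathfrak u$ ($\hat{\mathbf P}^u_{T,1}$ the $\hat X$-marginal of $\hat{\mathbf P}^u_T$); $(\hat X,\hat Y,\hat Z,\hat\Lambda):\hat\Omega\to S_1$ with $(x_t,y_t,z_t,\lambda_t)\circ(\hat X,\hat Y,\hat Z,\hat\Lambda)=(\hat X_t,\hat Y_t,\hat Z_t,\hat\Lambda_t)$ for $t\in[0,T]$; and $\int_0^T\hat{\mathbb E}|\hat\Lambda_t-\Lambda^{\mathfrak u}(t,\hat\chi_0,\hat B_{\cdot\wedge t})|^2dt=0$. *)

theory Defs
  imports "HOL-Probability.Probability"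
begin

section \<open>Topologies and Borel sigma-algebras\<close>

definition borel_of :: "'a topology \<Rightarrow> 'a measure" where
  "borel_of X = sigma (topspace X) {S. openin X S}"

text \<open>The topology generated by a distance function; the distance may be a pseudometric only.\<close>

definition dist_topology :: "'a set \<Rightarrow> ('a \<Rightarrow> 'a \<Rightarrow> real) \<Rightarrow> 'a topology" where
  "dist_topology M d =
     topology (\<lambda>S. S \<subseteq> M \<and> (\<forall>x\<in>S. \<exists>e>0. \<forall>y\<in>M. d x y < e \<longrightarrow> y \<in> S))"

lemma openin_dist_topology:
  "openin (dist_topology M d) S \<longleftrightarrow> S \<subseteq> M \<and> (\<forall>x\<in>S. \<exists>e>0. \<forall>y\<in>M. d x y < e \<longrightarrow> y \<in> S)"
proof -
  have "istopology (\<lambda>S. S \<subseteq> M \<and> (\<forall>x\<in>S. \<exists>e>0. \<forall>y\<in>M. d x y < e \<longrightarrow> y \<in> S))"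
    unfolding istopology_def
  proof (intro conjI allI impI)
    fix S R
    assume S: "S \<subseteq> M \<and> (\<forall>x\<in>S. \<exists>e>0. \<forall>y\<in>M. d x y < e \<longrightarrow> y \<in> S)"
      and R: "R \<subseteq> M \<and> (\<forall>x\<in>R. \<exists>e>0. \<forall>y\<in>M. d x y < e \<longrightarrow> y \<in> R)"
    show "S \<inter> R \<subseteq> M" using S by blast
    show "\<forall>x\<in>S \<inter> R. \<exists>e>0. \<forall>y\<in>M. d x y < e \<longrightarrow> y \<in> S \<inter> R"
    proof
      fix x assume "x \<in> S \<inter> R"
      then obtain e1 e2 where "e1 > 0" "\<forall>y\<in>M. d x y < e1 \<longrightarrow> y \<in> S"
        "e2 > 0" "\<forall>y\<in>M. d x y < e2 \<longrightarrow> y \<in> R" using S R by blast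
      then show "\<exists>e>0. \<forall>y\<in>M. d x y < e \<longrightarrow> y \<in> S \<inter> R"
        by (intro exI[of _ "min e1 e2"]) auto
    qed
  next
    fix K
    assume K: "\<forall>S\<in>K. S \<subseteq> M \<and> (\<forall>x\<in>S. \<exists>e>0. \<forall>y\<in>M. d x y < e \<longrightarrow> y \<in> S)"
    show "\<Union>K \<subseteq> M" using K by blast
    show "\<forall>x\<in>\<Union>K. \<exists>e>0. \<forall>y\<in>M. d x y < e \<longrightarrow> y \<in> \<Union>K"
      using K by (meson UnionE UnionI)
  qed
  then show ?thesis unfolding dist_topology_def by simp
qed

lemma topspace_dist_topology [simp]: "topspace (dist_topology M d) = M"
proof -
  have "openin (dist_topology M d) M"
    unfolding openin_dist_topology by (auto intro: exI[of _ 1])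
  then show ?thesis
    by (metis openin_dist_topology openin_subset openin_topspace subset_antisym)
qed


section \<open>Kernels and the space \<open>P\<^sup>2\<^sub>m\<close>\<close>

text \<open>
  A Markov kernel for the \<open>m\<close>-completion of the Borel sets of \<open>U\<close> is an element of
  \<^term>\<open>completion m \<rightarrow>\<^sub>M prob_algebra N\<close>.
\<close>

definition wasserstein2 :: "'a::euclidean_space measure \<Rightarrow> 'a measure \<Rightarrow> real" where
  "wasserstein2 \<mu> \<nu> = sqrt (enn2real
     (INF \<pi>\<in>{\<pi> :: ('a \<times> 'a) measure. sets \<pi> = sets borel \<and> distr \<pi> borel fst = \<mu> \<and> distr \<pi> borel snd = \<nu>}.
        \<integral>\<^sup>+p. ennreal ((norm (fst p - snd p))\<^sup>2) \<partial>\<pi>))"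

definition P2m :: "'u::polish_space measure \<Rightarrow> ('u \<Rightarrow> 'a::euclidean_space measure) set" where
  "P2m m = {\<kappa> \<in> completion m \<rightarrow>\<^sub>M prob_algebra borel.
     (\<forall>u. (\<integral>\<^sup>+x. ennreal ((norm x)\<^sup>2) \<partial>\<kappa> u) < \<infinity>) \<and>
     (\<integral>\<^sup>+u. (\<integral>\<^sup>+x. ennreal ((norm x)\<^sup>2) \<partial>\<kappa> u) \<partial>completion m) < \<infinity>}"

definition W2m :: "'u::polish_space measure \<Rightarrow> ('u \<Rightarrow> 'a::euclidean_space measure) \<Rightarrow> ('u \<Rightarrow> 'a measure) \<Rightarrow> real" where
  "W2m m \<kappa> \<kappa>' = sqrt (enn2real (\<integral>\<^sup>+u. ennreal ((wasserstein2 (\<kappa> u) (\<kappa>' u))\<^sup>2) \<partial>completion m))"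

abbreviation P2m_top :: "'u::polish_space measure \<Rightarrow> ('u \<Rightarrow> 'a::euclidean_space measure) topology" where
  "P2m_top m \<equiv> dist_topology (P2m m) (W2m m)"

text \<open>
  Insertion of a family of laws into a coefficient \<open>c\<close> with domain \<^term>\<open>P2m m\<close>.  Only the
  \<open>m\<close>-a.e. class of \<open>\<kappa>\<close> matters, so \<open>\<kappa>\<close> may be meaningful on a set of full measure only; the
  choice of the representative is immaterial for Borel \<open>c\<close>, as Borel sets of the pseudometric
  \<^term>\<open>W2m m\<close> do not separate a.e. equal kernels.  The value 0 outside the domain is a convention
  for the \<open>dt\<close>-null set of times at which a square integrable process need not have finite
  second moment.
\<close>

definition at_family :: "'u::polish_space measure \<Rightarrow> (('u \<Rightarrow> 'a::euclidean_space measure) \<Rightarrow> 'b::zero)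
    \<Rightarrow> ('u \<Rightarrow> 'a measure) \<Rightarrow> 'b" where
  "at_family m c \<kappa> =
     (if \<exists>\<kappa>'\<in>P2m m. AE u in m. \<kappa>' u = \<kappa> u
      then c (SOME \<kappa>'. \<kappa>' \<in> P2m m \<and> (AE u in m. \<kappa>' u = \<kappa> u)) else 0)"


section \<open>Path spaces\<close>

text \<open>
  Elements of \<open>C([0,T])\<close> are functions on the reals that are \<^const>\<open>undefined\<close> off \<open>[0,T]\<close>.
  Elements of \<open>L\<^sup>2([0,T])\<close> are equivalence classes of functions on the reals; values
  off \<open>[0,T]\<close> are irrelevant for the equivalence.
\<close>

abbreviation C_top :: "real \<Rightarrow> (real \<Rightarrow> 'a::euclidean_space) topology" where
  "C_top T \<equiv> mtopology_of (cfunspace (top_of_set {0..T}) euclidean_metric)"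

definition sq_int :: "real \<Rightarrow> (real \<Rightarrow> 'a::euclidean_space) set" where
  "sq_int T = {z \<in> borel_measurable (restrict_space lborel {0..T}).
     (\<integral>\<^sup>+t. ennreal ((norm (z t))\<^sup>2) \<partial>restrict_space lborel {0..T}) < \<infinity>}"

definition L2_rel :: "real \<Rightarrow> ((real \<Rightarrow> 'a::euclidean_space) \<times> (real \<Rightarrow> 'a)) set" where
  "L2_rel T = {(z, z'). z \<in> sq_int T \<and> z' \<in> sq_int T \<and> (AE t in restrict_space lborel {0..T}. z t = z' t)}"

lemma equiv_L2_rel: "equiv (sq_int T) (L2_rel T)"
proof (rule equivI)
  show "L2_rel T \<subseteq> sq_int T \<times> sq_int T" by (auto simp: L2_rel_def)
  show "refl_on (sq_int T) (L2_rel T)" by (auto simp: refl_on_def L2_rel_def)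
  show "sym (L2_rel T)" by (auto simp: sym_def L2_rel_def)
  show "trans (L2_rel T)" by (auto simp: trans_def L2_rel_def)
qed

definition L2_class :: "real \<Rightarrow> (real \<Rightarrow> 'a::euclidean_space) \<Rightarrow> (real \<Rightarrow> 'a) set" where
  "L2_class T z = L2_rel T `` {z}"

definition L2_repr :: "(real \<Rightarrow> 'a) set \<Rightarrow> real \<Rightarrow> 'a" where
  "L2_repr c = (SOME z. z \<in> c)"

definition L2_dist :: "real \<Rightarrow> (real \<Rightarrow> 'a::euclidean_space) set \<Rightarrow> (real \<Rightarrow> 'a) set \<Rightarrow> real" where
  "L2_dist T c c' =
     sqrt (\<integral>t. (norm (L2_repr c t - L2_repr c' t))\<^sup>2 \<partial>restrict_space lborel {0..T})"

abbreviation L2_top :: "real \<Rightarrow> (real \<Rightarrow> 'a::euclidean_space) set topology" where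
  "L2_top T \<equiv> dist_topology (sq_int T // L2_rel T) (L2_dist T)"

type_synonym ('n, 'l, 'd, 'k) E =
  "(real^'n) \<times> (real^'l) \<times> (real^'d^'l) \<times> (real^'k)"

type_synonym ('n, 'l, 'd, 'k) S1 =
  "(real \<Rightarrow> real^'n) \<times> (real \<Rightarrow> real^'l) \<times> (real \<Rightarrow> real^'d^'l) set \<times> (real \<Rightarrow> real^'k) set"

type_synonym ('n, 'd) S2 = "(real \<Rightarrow> real^'d) \<times> (real^'n)"

definition S1_top :: "real \<Rightarrow> ('n::finite, 'l::finite, 'd::finite, 'k::finite) S1 topology" where
  "S1_top T = prod_topology (C_top T) (prod_topology (C_top T) (prod_topology (L2_top T) (L2_top T)))"

definition S2_top :: "real \<Rightarrow> ('n::finite, 'd::finite) S2 topology" where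
  "S2_top T = prod_topology (C_top T) euclidean"

definition Omega_bar :: "real \<Rightarrow> (('n::finite, 'l::finite, 'd::finite, 'k::finite) S1 \<times> ('n, 'd) S2) measure" where
  "Omega_bar T = borel_of (prod_topology (S1_top T) (S2_top T))"

text \<open>
  The precise representative of an \<open>L\<^sup>2\<close> class, entry by entry.  Infinite lower limits give 0
  because \<^const>\<open>real_of_ereal\<close> maps both infinities to 0.
\<close>

definition precise :: "(real \<Rightarrow> 'a::euclidean_space) set \<Rightarrow> real \<Rightarrow> 'a" where
  "precise c t = (\<Sum>b\<in>Basis. real_of_ereal
     (Liminf (at_right 0) (\<lambda>\<epsilon>. ereal (1 / \<epsilon> * (LINT s:{max (t - \<epsilon>) 0..t}|lborel. L2_repr c s \<bullet> b)))) *\<^sub>R b)"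

definition canon_S1 :: "real \<Rightarrow> ('n::finite, 'l::finite, 'd::finite, 'k::finite) S1 \<Rightarrow> ('n, 'l, 'd, 'k) E" where
  "canon_S1 t = (\<lambda>(x, y, z, l). (x t, y t, precise z t, precise l t))"

definition quad :: "(real \<Rightarrow> 'w \<Rightarrow> 'a) \<Rightarrow> (real \<Rightarrow> 'w \<Rightarrow> 'b) \<Rightarrow> (real \<Rightarrow> 'w \<Rightarrow> 'c) \<Rightarrow> (real \<Rightarrow> 'w \<Rightarrow> 'e)
    \<Rightarrow> real \<Rightarrow> 'w \<Rightarrow> 'a \<times> 'b \<times> 'c \<times> 'e" where
  "quad X Y Z L t \<omega> = (X t \<omega>, Y t \<omega>, Z t \<omega>, L t \<omega>)"

definition S1_path :: "real \<Rightarrow> (real \<Rightarrow> 'w \<Rightarrow> real^'n) \<Rightarrow> (real \<Rightarrow> 'w \<Rightarrow> real^'l)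
    \<Rightarrow> (real \<Rightarrow> 'w \<Rightarrow> real^'d^'l) \<Rightarrow> (real \<Rightarrow> 'w \<Rightarrow> real^'k)
    \<Rightarrow> 'w \<Rightarrow> ('n::finite, 'l::finite, 'd::finite, 'k::finite) S1" where
  "S1_path T X Y Z L \<omega> = (\<lambda>t\<in>{0..T}. X t \<omega>, \<lambda>t\<in>{0..T}. Y t \<omega>,
     L2_class T (\<lambda>t. Z t \<omega>), L2_class T (\<lambda>t. L t \<omega>))"


section \<open>Stochastic calculus on \<open>[0,T]\<close>\<close>

definition gen_filtration :: "'w set \<Rightarrow> (real \<Rightarrow> 'w \<Rightarrow> 'v::topological_space) \<Rightarrow> real \<Rightarrow> 'w measure" where
  "gen_filtration \<Omega> V t = sigma \<Omega> {V s -` A \<inter> \<Omega> | s A. s \<in> {0..t} \<and> A \<in> sets borel}"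

definition augmented :: "'w measure \<Rightarrow> (real \<Rightarrow> 'w measure) \<Rightarrow> real \<Rightarrow> 'w measure" where
  "augmented M F t = sigma (space M) (sets (F t) \<union> null_sets (completion M))"

definition progressive :: "real \<Rightarrow> (real \<Rightarrow> 'w measure) \<Rightarrow> (real \<Rightarrow> 'w \<Rightarrow> 'b::topological_space) \<Rightarrow> bool" where
  "progressive T F X \<longleftrightarrow>
     (\<forall>t\<in>{0..T}. (\<lambda>(s, \<omega>). X s \<omega>) \<in> borel_measurable (restrict_space borel {0..t} \<Otimes>\<^sub>M F t))"

text \<open>
  Independence of two random variables (the library's \<open>indep_var\<close> requires a common value type).
\<close>

definition indep_rv :: "'w measure \<Rightarrow> 'a measure \<Rightarrow> ('w \<Rightarrow> 'a) \<Rightarrow> 'b measure \<Rightarrow> ('w \<Rightarrow> 'b) \<Rightarrow> bool" where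
  "indep_rv M N X N' Y \<longleftrightarrow> X \<in> M \<rightarrow>\<^sub>M N \<and> Y \<in> M \<rightarrow>\<^sub>M N' \<and>
     prob_space.indep_set M (sets (vimage_algebra (space M) X N)) (sets (vimage_algebra (space M) Y N'))"

definition indep_process :: "real \<Rightarrow> 'w measure \<Rightarrow> (real \<Rightarrow> 'w \<Rightarrow> 'a::topological_space)
    \<Rightarrow> ('w \<Rightarrow> 'b::topological_space) \<Rightarrow> bool" where
  "indep_process T M B Y \<longleftrightarrow>
     indep_rv M (\<Pi>\<^sub>M t\<in>{0..T}. borel) (\<lambda>\<omega>. \<lambda>t\<in>{0..T}. B t \<omega>) borel Y"

definition gaussian :: "real \<Rightarrow> (real^'d::finite) measure" where
  "gaussian v = density lborel (\<lambda>x. ennreal (\<Prod>i\<in>UNIV. normal_density 0 (sqrt v) (x $ i)))"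

definition brownian_motion :: "real \<Rightarrow> 'w measure \<Rightarrow> (real \<Rightarrow> 'w measure) \<Rightarrow> (real \<Rightarrow> 'w \<Rightarrow> real^'d::finite) \<Rightarrow> bool" where
  "brownian_motion T M F B \<longleftrightarrow>
     (\<forall>t\<in>{0..T}. B t \<in> borel_measurable (F t)) \<and>
     (\<forall>\<omega>\<in>space M. continuous_on {0..T} (\<lambda>t. B t \<omega>)) \<and>
     (AE \<omega> in M. B 0 \<omega> = 0) \<and>
     (\<forall>s t. 0 \<le> s \<and> s < t \<and> t \<le> T \<longrightarrow>
        distr M borel (\<lambda>\<omega>. B t \<omega> - B s \<omega>) = gaussian (t - s) \<and>
        prob_space.indep_set M (sets (F s))
          (sets (vimage_algebra (space M) (\<lambda>\<omega>. B t \<omega> - B s \<omega>) borel)))"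

definition stopped_path :: "real \<Rightarrow> (real \<Rightarrow> 'w \<Rightarrow> 'a) \<Rightarrow> real \<Rightarrow> 'w \<Rightarrow> real \<Rightarrow> 'a" where
  "stopped_path T B t \<omega> = (\<lambda>s\<in>{0..T}. B (min s t) \<omega>)"

definition tends_to_0_in_prob :: "'w measure \<Rightarrow> (nat \<Rightarrow> 'w \<Rightarrow> ennreal) \<Rightarrow> bool" where
  "tends_to_0_in_prob M f \<longleftrightarrow> (\<forall>j. f j \<in> borel_measurable M) \<and>
     (\<forall>\<epsilon>>0::real. (\<lambda>j. measure M {\<omega> \<in> space M. f j \<omega> > ennreal \<epsilon>}) \<longlonglongrightarrow> 0)"

definition simple_data :: "real \<Rightarrow> 'w measure \<Rightarrow> (real \<Rightarrow> 'w measure) \<Rightarrow> nat \<Rightarrow> (nat \<Rightarrow> real)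
    \<Rightarrow> (nat \<Rightarrow> 'w \<Rightarrow> real^'d::finite^'m::finite) \<Rightarrow> bool" where
  "simple_data T M F N \<tau> \<xi> \<longleftrightarrow> \<tau> 0 = 0 \<and> \<tau> N = T \<and> (\<forall>i<N. \<tau> i \<le> \<tau> (Suc i)) \<and>
     (\<forall>i<N. \<xi> i \<in> borel_measurable (F (\<tau> i)) \<and> (\<exists>C. \<forall>\<omega>\<in>space M. norm (\<xi> i \<omega>) \<le> C))"

definition simple_process :: "nat \<Rightarrow> (nat \<Rightarrow> real) \<Rightarrow> (nat \<Rightarrow> 'w \<Rightarrow> real^'d::finite^'m::finite)
    \<Rightarrow> real \<Rightarrow> 'w \<Rightarrow> real^'d^'m" where
  "simple_process N \<tau> \<xi> s \<omega> = (\<Sum>i<N. indicator {\<tau> i<..\<tau> (Suc i)} s *\<^sub>R \<xi> i \<omega>)"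

definition simple_integral :: "(real \<Rightarrow> 'w \<Rightarrow> real^'d::finite) \<Rightarrow> nat \<Rightarrow> (nat \<Rightarrow> real)
    \<Rightarrow> (nat \<Rightarrow> 'w \<Rightarrow> real^'d^'m::finite) \<Rightarrow> real \<Rightarrow> 'w \<Rightarrow> real^'m" where
  "simple_integral B N \<tau> \<xi> t \<omega> = (\<Sum>i<N. \<xi> i \<omega> *v (B (min t (\<tau> (Suc i))) \<omega> - B (min t (\<tau> i)) \<omega>))"

text \<open>
  \<open>I\<close> is (a continuous version of) the Ito integral process \<open>\<integral>\<^sub>0\<^sup>\<cdot> H dB\<close> for a progressive \<open>H\<close> with
  \<open>\<integral>\<^sub>0\<^sup>T |H|\<^sup>2 dt < \<infinity>\<close> a.s.: the limit, uniformly on \<open>[0,T]\<close> in probability, of the integrals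
  of simple processes converging to \<open>H\<close> in \<open>L\<^sup>2([0,T])\<close> in probability.
\<close>

definition has_ito_integral :: "real \<Rightarrow> 'w measure \<Rightarrow> (real \<Rightarrow> 'w measure) \<Rightarrow> (real \<Rightarrow> 'w \<Rightarrow> real^'d::finite)
    \<Rightarrow> (real \<Rightarrow> 'w \<Rightarrow> real^'d^'m::finite) \<Rightarrow> (real \<Rightarrow> 'w \<Rightarrow> real^'m) \<Rightarrow> bool" where
  "has_ito_integral T M F B H I \<longleftrightarrow>
     progressive T F H \<and>
     (AE \<omega> in M. (\<integral>\<^sup>+s\<in>{0..T}. ennreal ((norm (H s \<omega>))\<^sup>2) \<partial>lborel) < \<infinity>) \<and>
     (\<forall>t\<in>{0..T}. I t \<in> borel_measurable (F t)) \<and>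
     (\<forall>\<omega>\<in>space M. continuous_on {0..T} (\<lambda>t. I t \<omega>)) \<and>
     (\<exists>N \<tau> \<xi>. (\<forall>j. simple_data T M F (N j) (\<tau> j) (\<xi> j)) \<and>
        tends_to_0_in_prob M (\<lambda>j \<omega>. \<integral>\<^sup>+s\<in>{0..T}.
          ennreal ((norm (simple_process (N j) (\<tau> j) (\<xi> j) s \<omega> - H s \<omega>))\<^sup>2) \<partial>lborel) \<and>
        tends_to_0_in_prob M (\<lambda>j \<omega>. SUP t\<in>{0..T}.
          ennreal (norm (simple_integral B (N j) (\<tau> j) (\<xi> j) t \<omega> - I t \<omega>))))"

definition cond_law :: "'w measure \<Rightarrow> 'u::polish_space measure \<Rightarrow> ('w \<Rightarrow> 'u) \<Rightarrow> ('w \<Rightarrow> 'a::euclidean_space)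
    \<Rightarrow> ('u \<Rightarrow> 'a measure) \<Rightarrow> bool" where
  "cond_law M m v X \<kappa> \<longleftrightarrow> \<kappa> \<in> completion m \<rightarrow>\<^sub>M prob_algebra borel \<and>
     (\<forall>A\<in>sets borel. AE \<omega> in M.
        real_cond_exp M (vimage_algebra (space M) v borel) (\<lambda>\<omega>. indicator A (X \<omega>)) \<omega> = measure (\<kappa> (v \<omega>)) A)"

definition energy :: "real \<Rightarrow> 'w measure \<Rightarrow> (real \<Rightarrow> 'w \<Rightarrow> real^'n::finite) \<Rightarrow> (real \<Rightarrow> 'w \<Rightarrow> real^'l::finite)
    \<Rightarrow> (real \<Rightarrow> 'w \<Rightarrow> real^'d::finite^'l) \<Rightarrow> (real \<Rightarrow> 'w \<Rightarrow> real^'k::finite) \<Rightarrow> ennreal" where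
  "energy T M X Y Z L =
     (\<integral>\<^sup>+\<omega>. (SUP t\<in>{0..T}. ennreal ((norm (X t \<omega>))\<^sup>2)) \<partial>M) +
     (\<integral>\<^sup>+\<omega>. (SUP t\<in>{0..T}. ennreal ((norm (Y t \<omega>))\<^sup>2)) \<partial>M) +
     (\<integral>\<^sup>+t\<in>{0..T}. (\<integral>\<^sup>+\<omega>. ennreal ((norm (Z t \<omega>))\<^sup>2 + (norm (L t \<omega>))\<^sup>2) \<partial>M) \<partial>lborel)"

text \<open>
  The mean-field FBSDE on a filtered probability space, with a (possibly random) label \<open>v\<close> in the
  coefficients and a family \<open>P t\<close> of laws inserted at time \<open>t\<close>.
\<close>

definition solves_fbsde :: "real \<Rightarrow> 'u::polish_space measure
    \<Rightarrow> ('u \<Rightarrow> real \<Rightarrow> ('n::finite, 'l::finite, 'd::finite, 'k::finite) E \<Rightarrow> ('u \<Rightarrow> ('n, 'l, 'd, 'k) E measure) \<Rightarrow> real^'n)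
    \<Rightarrow> ('u \<Rightarrow> real \<Rightarrow> ('n, 'l, 'd, 'k) E \<Rightarrow> ('u \<Rightarrow> ('n, 'l, 'd, 'k) E measure) \<Rightarrow> real^'d^'n)
    \<Rightarrow> ('u \<Rightarrow> real \<Rightarrow> ('n, 'l, 'd, 'k) E \<Rightarrow> ('u \<Rightarrow> ('n, 'l, 'd, 'k) E measure) \<Rightarrow> real^'l)
    \<Rightarrow> ('u \<Rightarrow> real^'n \<Rightarrow> ('u \<Rightarrow> (real^'n) measure) \<Rightarrow> real^'l)
    \<Rightarrow> 'w measure \<Rightarrow> (real \<Rightarrow> 'w measure) \<Rightarrow> (real \<Rightarrow> 'w \<Rightarrow> real^'d) \<Rightarrow> ('w \<Rightarrow> real^'n) \<Rightarrow> ('w \<Rightarrow> 'u)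
    \<Rightarrow> (real \<Rightarrow> 'u \<Rightarrow> ('n, 'l, 'd, 'k) E measure)
    \<Rightarrow> (real \<Rightarrow> 'w \<Rightarrow> real^'n) \<Rightarrow> (real \<Rightarrow> 'w \<Rightarrow> real^'l) \<Rightarrow> (real \<Rightarrow> 'w \<Rightarrow> real^'d^'l) \<Rightarrow> (real \<Rightarrow> 'w \<Rightarrow> real^'k) \<Rightarrow> bool" where
  "solves_fbsde T m b \<sigma> f G M F B ini v P X Y Z L \<longleftrightarrow>
     (let bt = (\<lambda>t \<omega>. at_family m (b (v \<omega>) t (quad X Y Z L t \<omega>)) (P t));
          \<sigma>t = (\<lambda>t \<omega>. at_family m (\<sigma> (v \<omega>) t (quad X Y Z L t \<omega>)) (P t));
          ft = (\<lambda>t \<omega>. at_family m (f (v \<omega>) t (quad X Y Z L t \<omega>)) (P t))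
      in (AE \<omega> in M. set_integrable lborel {0..T} (\<lambda>s. bt s \<omega>)) \<and>
         (AE \<omega> in M. set_integrable lborel {0..T} (\<lambda>s. ft s \<omega>)) \<and>
         (\<exists>I. has_ito_integral T M F B \<sigma>t I \<and>
            (AE \<omega> in M. \<forall>t\<in>{0..T}. X t \<omega> = X 0 \<omega> + (LINT s:{0..t}|lborel. bt s \<omega>) + I t \<omega>)) \<and>
         (\<exists>J. has_ito_integral T M F B Z J \<and>
            (AE \<omega> in M. \<forall>t\<in>{0..T}. Y t \<omega> = Y T \<omega> + (LINT s:{t..T}|lborel. ft s \<omega>) - (J T \<omega> - J t \<omega>))) \<and>
         (AE \<omega> in M. X 0 \<omega> = ini \<omega>) \<and>
         (AE \<omega> in M. Y T \<omega> = at_family m (G (v \<omega>) (X T \<omega>)) (\<lambda>u. distr (P T u) borel fst)))"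

text \<open>
  The processes define an \<open>S\<^sub>1\<close>-valued random variable that is read off at time \<open>t\<close> by the canonical
  process; in particular the chosen versions of \<open>Z\<close> and \<open>L\<close> are the precise ones.
\<close>

definition S1_valued :: "real \<Rightarrow> 'w measure \<Rightarrow> (real \<Rightarrow> 'w \<Rightarrow> real^'n::finite) \<Rightarrow> (real \<Rightarrow> 'w \<Rightarrow> real^'l::finite)
    \<Rightarrow> (real \<Rightarrow> 'w \<Rightarrow> real^'d::finite^'l) \<Rightarrow> (real \<Rightarrow> 'w \<Rightarrow> real^'k::finite) \<Rightarrow> bool" where
  "S1_valued T M X Y Z L \<longleftrightarrow> S1_path T X Y Z L \<in> M \<rightarrow>\<^sub>M borel_of (S1_top T)"

definition canonical_read_off :: "real \<Rightarrow> 'w measure \<Rightarrow> (real \<Rightarrow> 'w \<Rightarrow> real^'n::finite) \<Rightarrow> (real \<Rightarrow> 'w \<Rightarrow> real^'l::finite)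
    \<Rightarrow> (real \<Rightarrow> 'w \<Rightarrow> real^'d::finite^'l) \<Rightarrow> (real \<Rightarrow> 'w \<Rightarrow> real^'k::finite) \<Rightarrow> bool" where
  "canonical_read_off T M X Y Z L \<longleftrightarrow>
     (\<forall>\<omega>\<in>space M. \<forall>t\<in>{0..T}. canon_S1 t (S1_path T X Y Z L \<omega>) = quad X Y Z L t \<omega>)"

definition S2H2m :: "real \<Rightarrow> 'u::polish_space measure \<Rightarrow> 'u set \<Rightarrow> ('u \<Rightarrow> 'w measure) \<Rightarrow> ('u \<Rightarrow> real \<Rightarrow> 'w measure)
    \<Rightarrow> ('u \<Rightarrow> real \<Rightarrow> 'w \<Rightarrow> real^'n::finite) \<Rightarrow> ('u \<Rightarrow> real \<Rightarrow> 'w \<Rightarrow> real^'l::finite)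
    \<Rightarrow> ('u \<Rightarrow> real \<Rightarrow> 'w \<Rightarrow> real^'d::finite^'l) \<Rightarrow> ('u \<Rightarrow> real \<Rightarrow> 'w \<Rightarrow> real^'k::finite) \<Rightarrow> bool" where
  "S2H2m T m U0 M F X Y Z L \<longleftrightarrow>
     (\<forall>u\<in>U0. progressive T (F u) (quad (X u) (Y u) (Z u) (L u)) \<and>
        S1_valued T (M u) (X u) (Y u) (Z u) (L u) \<and>
        energy T (M u) (X u) (Y u) (Z u) (L u) < \<infinity>) \<and>
     (\<lambda>u. distr (M u) (borel_of (S1_top T)) (S1_path T (X u) (Y u) (Z u) (L u)))
        \<in> restrict_space (completion m) U0 \<rightarrow>\<^sub>M prob_algebra (borel_of (S1_top T)) \<and>
     (\<integral>\<^sup>+u\<in>U0. energy T (M u) (X u) (Y u) (Z u) (L u) \<partial>completion m) < \<infinity>"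

definition canonical_filtration :: "real
    \<Rightarrow> (('n::finite, 'l::finite, 'd::finite, 'k::finite) S1 \<times> ('n, 'd) S2) measure
    \<Rightarrow> real \<Rightarrow> (('n, 'l, 'd, 'k) S1 \<times> ('n, 'd) S2) measure" where
  "canonical_filtration T P = augmented P
     (gen_filtration (space (Omega_bar T)) (\<lambda>s (p, w, c). (canon_S1 s p, w s, c)))"


section \<open>The auxiliary randomised FBSDE\<close>

definition aux_filtration :: "'w measure \<Rightarrow> (real \<Rightarrow> 'w \<Rightarrow> real^'d::finite) \<Rightarrow> ('w \<Rightarrow> real^'n::finite) \<Rightarrow> ('w \<Rightarrow> 'u::polish_space)
    \<Rightarrow> real \<Rightarrow> 'w measure" where
  "aux_filtration M B ini v = augmented M (gen_filtration (space M) (\<lambda>s \<omega>. (B s \<omega>, ini \<omega>, v \<omega>)))"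

definition aux_space :: "real \<Rightarrow> 'u::polish_space measure \<Rightarrow> ('u \<Rightarrow> (real^'n::finite) measure)
    \<Rightarrow> 'w measure \<Rightarrow> (real \<Rightarrow> 'w \<Rightarrow> real^'d::finite) \<Rightarrow> ('w \<Rightarrow> real^'n) \<Rightarrow> ('w \<Rightarrow> 'u) \<Rightarrow> bool" where
  "aux_space T m law_ini M B ini v \<longleftrightarrow>
     prob_space M \<and> complete_measure M \<and>
     brownian_motion T M (gen_filtration (space M) B) B \<and>
     indep_process T M B (\<lambda>\<omega>. (ini \<omega>, v \<omega>)) \<and>
     distr M borel v = m \<and> cond_law M m v ini law_ini"

definition aux_solution :: "real \<Rightarrow> 'u::polish_space measure
    \<Rightarrow> ('u \<Rightarrow> real \<Rightarrow> ('n::finite, 'l::finite, 'd::finite, 'k::finite) E \<Rightarrow> ('u \<Rightarrow> ('n, 'l, 'd, 'k) E measure) \<Rightarrow> real^'n)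
    \<Rightarrow> ('u \<Rightarrow> real \<Rightarrow> ('n, 'l, 'd, 'k) E \<Rightarrow> ('u \<Rightarrow> ('n, 'l, 'd, 'k) E measure) \<Rightarrow> real^'d^'n)
    \<Rightarrow> ('u \<Rightarrow> real \<Rightarrow> ('n, 'l, 'd, 'k) E \<Rightarrow> ('u \<Rightarrow> ('n, 'l, 'd, 'k) E measure) \<Rightarrow> real^'l)
    \<Rightarrow> ('u \<Rightarrow> real^'n \<Rightarrow> ('u \<Rightarrow> (real^'n) measure) \<Rightarrow> real^'l)
    \<Rightarrow> ('u \<Rightarrow> real \<Rightarrow> real^'n \<Rightarrow> (real \<Rightarrow> real^'d) \<Rightarrow> real^'k)
    \<Rightarrow> 'w measure \<Rightarrow> (real \<Rightarrow> 'w \<Rightarrow> real^'d) \<Rightarrow> ('w \<Rightarrow> real^'n) \<Rightarrow> ('w \<Rightarrow> 'u)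
    \<Rightarrow> (real \<Rightarrow> 'w \<Rightarrow> real^'n) \<Rightarrow> (real \<Rightarrow> 'w \<Rightarrow> real^'l) \<Rightarrow> (real \<Rightarrow> 'w \<Rightarrow> real^'d^'l) \<Rightarrow> (real \<Rightarrow> 'w \<Rightarrow> real^'k) \<Rightarrow> bool" where
  "aux_solution T m b \<sigma> f G \<Lambda> M B ini v X Y Z L \<longleftrightarrow>
     progressive T (aux_filtration M B ini v) (quad X Y Z L) \<and>
     energy T M X Y Z L < \<infinity> \<and>
     S1_valued T M X Y Z L \<and> canonical_read_off T M X Y Z L \<and>
     (\<exists>P. (\<forall>t\<in>{0..T}. cond_law M m v (quad X Y Z L t) (P t)) \<and>
        solves_fbsde T m b \<sigma> f G M (aux_filtration M B ini v) B ini v P X Y Z L) \<and>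
     (\<integral>\<^sup>+t\<in>{0..T}. (\<integral>\<^sup>+\<omega>. ennreal ((norm (L t \<omega> - \<Lambda> (v \<omega>) t (ini \<omega>) (stopped_path T B t \<omega>)))\<^sup>2) \<partial>M) \<partial>lborel) = 0"


section \<open>Coefficients\<close>

definition coeff_measurable :: "real \<Rightarrow> 'u::polish_space measure
    \<Rightarrow> ('u \<Rightarrow> real \<Rightarrow> 'e::euclidean_space \<Rightarrow> ('u \<Rightarrow> 'e measure) \<Rightarrow> 'b::topological_space) \<Rightarrow> bool" where
  "coeff_measurable T m c \<longleftrightarrow> (\<lambda>(u, t, e, \<kappa>). c u t e \<kappa>) \<in> borel_measurable
     (borel_of (prod_topology euclidean (prod_topology (top_of_set {0..T}) (prod_topology euclidean (P2m_top m)))))"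

definition terminal_measurable :: "'u::polish_space measure
    \<Rightarrow> ('u \<Rightarrow> 'e::euclidean_space \<Rightarrow> ('u \<Rightarrow> 'e measure) \<Rightarrow> 'b::topological_space) \<Rightarrow> bool" where
  "terminal_measurable m g \<longleftrightarrow> (\<lambda>(u, x, \<kappa>). g u x \<kappa>) \<in> borel_measurable
     (borel_of (prod_topology euclidean (prod_topology euclidean (P2m_top m))))"

definition control_measurable :: "real
    \<Rightarrow> ('u::polish_space \<Rightarrow> real \<Rightarrow> 'e::euclidean_space \<Rightarrow> (real \<Rightarrow> 'c::euclidean_space) \<Rightarrow> 'b::topological_space) \<Rightarrow> bool" where
  "control_measurable T \<Lambda> \<longleftrightarrow> (\<lambda>(u, t, x, w). \<Lambda> u t x w) \<in> borel_measurable
     (borel_of (prod_topology euclidean (prod_topology (top_of_set {0..T}) (prod_topology euclidean (C_top T)))))"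

end

theory Submission
  imports Defs
begin

text \<open>
  Every process adapted to the auxiliary filtration is, up to null sets, a functional of the label,
  the initial value and the noise path, and the conditional law of the last two given the label \<open>u\<close>
  is the product of \<open>Law(\<chi>\<^sub>0\<^sup>u)\<close> and Wiener measure \<open>W\<close>.  So no abstract disintegration is needed:
  fixing \<open>u\<close> in the functionals gives, for almost every \<open>u\<close>, processes on the noise space with the
  measure \<open>Law(\<chi>\<^sub>0\<^sup>u) \<otimes> W\<close>, and every almost sure identity of the randomised equation holds there by
  Fubini.  Stochastic integrals disintegrate because the approximation by simple integrals converges
  almost surely along a subsequence.  The laws inserted into the coefficients are
  the laws of the functionals, and they depend measurably on time because \<open>W\<^sub>2\<^sub>,\<^sub>m\<close> is bounded by the
  \<open>L\<^sup>2\<close>-distance of the functionals.  The solution for \<open>u\<close> is finally carried to the canonical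
  space by a measure under which the \<open>S\<^sub>1\<close>-component is a constant.
\<close>

text \<open>A null set of the randomised space leaves a null set on the fibre of \<open>u\<close>
  only for almost every \<open>u\<close>, and the exceptional labels vary with the null set.
  Uncountably many almost sure statements, one for each time or for each event of an augmented
  filtration, therefore cannot be carried over one by one. This shapes the representations: a
  process is represented with one exceptional set for all times, identities are tested on the
  countable set \<open>Icc_dense T\<close> and extended by continuity, and adaptedness on a fibre is
  checked at those times only, where the process agrees almost surely with a functional of the label
  and of the unaugmented noise up to that time. The read-off condition, by contrast, holds at every
  point, so functionals are set to zero where they misbehave; the zero process is its own precise
  representative. Labels are treated under the completion of \<open>m\<close>, because the kernels
  are measurable there; the passage back to \<open>m\<close> at the very end makes the exceptional
  set, and with it \<open>U0\<close>, Borel.\<close>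

text \<open>
  Without separability of \<^term>\<open>P2m_top m\<close> and of the path spaces, measurability into the Borel sets
  of a product does not reduce to the components.  The following property of a map does, and it replaces
  proofs of separability of the target spaces.
\<close>

definition countably_based :: "'a measure \<Rightarrow> 'b topology \<Rightarrow> ('a \<Rightarrow> 'b) \<Rightarrow> bool" where
  "countably_based M X f \<longleftrightarrow> (\<exists>\<B>. countable \<B> \<and> \<B> \<subseteq> sets M \<and>
     (\<forall>a\<in>space M. f a \<in> topspace X \<and>
        (\<forall>V. openin X V \<and> f a \<in> V \<longrightarrow> (\<exists>B\<in>\<B>. a \<in> B \<and> B \<subseteq> f -` V))))"

lemma countably_basedI:
  assumes "countable \<B>" "\<B> \<subseteq> sets M" "\<And>a. a \<in> space M \<Longrightarrow> f a \<in> topspace X"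
    and "\<And>a V. a \<in> space M \<Longrightarrow> openin X V \<Longrightarrow> f a \<in> V \<Longrightarrow> \<exists>B\<in>\<B>. a \<in> B \<and> B \<subseteq> f -` V"
  shows "countably_based M X f"
  unfolding countably_based_def by (intro exI[of _ \<B>] conjI ballI allI impI) (use assms in simp_all)

lemma countably_basedE:
  assumes "countably_based M X f"
  obtains \<B> where "countable \<B>" "\<B> \<subseteq> sets M" "\<And>a. a \<in> space M \<Longrightarrow> f a \<in> topspace X"
    "\<And>a V. a \<in> space M \<Longrightarrow> openin X V \<Longrightarrow> f a \<in> V \<Longrightarrow> \<exists>B\<in>\<B>. a \<in> B \<and> B \<subseteq> f -` V"
proof -
  from assms obtain \<B> where B: "countable \<B> \<and> \<B> \<subseteq> sets M \<and>
     (\<forall>a\<in>space M. f a \<in> topspace X \<and>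
        (\<forall>V. openin X V \<and> f a \<in> V \<longrightarrow> (\<exists>B\<in>\<B>. a \<in> B \<and> B \<subseteq> f -` V)))"
    unfolding countably_based_def by (elim exE)
  show thesis by (rule that[of \<B>]) (use B in simp_all)
qed

section \<open>Borel sigma-algebras of topologies and countably based maps\<close>

lemma space_borel_of [simp]: "space (borel_of X) = topspace X"
  unfolding borel_of_def by (rule space_measure_of) (auto dest: openin_subset)

lemma sets_borel_of: "sets (borel_of X) = sigma_sets (topspace X) {S. openin X S}"
  unfolding borel_of_def by (rule sets_measure_of) (auto dest: openin_subset)

lemma openin_borel_of: "openin X S \<Longrightarrow> S \<in> sets (borel_of X)"
  unfolding sets_borel_of by (rule sigma_sets.Basic) simp

lemma closedin_borel_of: "closedin X S \<Longrightarrow> S \<in> sets (borel_of X)"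
proof -
  assume S: "closedin X S"
  then have "topspace X - (topspace X - S) = S" by (auto dest: closedin_subset)
  moreover have "topspace X - (topspace X - S) \<in> sets (borel_of X)"
    using S openin_borel_of[of X "topspace X - S"] sets.compl_sets[of "topspace X - S" "borel_of X"]
    by (simp add: closedin_def)
  ultimately show ?thesis by simp
qed

lemma measurable_borel_ofI:
  assumes "\<And>a. a \<in> space M \<Longrightarrow> f a \<in> topspace X"
    and "\<And>V. openin X V \<Longrightarrow> f -` V \<inter> space M \<in> sets M"
  shows "f \<in> M \<rightarrow>\<^sub>M borel_of X"
  unfolding borel_of_def
  by (rule measurable_measure_of) (use assms in \<open>auto dest: openin_subset\<close>)

lemma measurable_continuous_map:
  assumes "continuous_map X Y f" shows "f \<in> borel_of X \<rightarrow>\<^sub>M borel_of Y"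
proof (rule measurable_borel_ofI)
  fix V assume "openin Y V"
  then have "openin X {x \<in> topspace X. f x \<in> V}" using assms by (auto simp: continuous_map_def)
  moreover have "f -` V \<inter> space (borel_of X) = {x \<in> topspace X. f x \<in> V}" by auto
  ultimately show "f -` V \<inter> space (borel_of X) \<in> sets (borel_of X)" by (simp add: openin_borel_of)
qed (use assms in \<open>auto simp: continuous_map_def\<close>)

lemma borel_of_euclidean: "borel_of (euclidean :: 'a::topological_space topology) = borel"
  unfolding borel_of_def borel_def by simp

text \<open>The preimage of an open set is the union of those members of the countable family that
  it contains, hence a countable union of measurable sets, however many open sets the target
  has.\<close>

lemma countably_based_measurable:
  assumes "countably_based M X f" shows "f \<in> M \<rightarrow>\<^sub>M borel_of X"
proof -
  obtain \<B> where B: "countable \<B>" "\<B> \<subseteq> sets M" "\<And>a. a \<in> space M \<Longrightarrow> f a \<in> topspace X"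
    "\<And>a V. a \<in> space M \<Longrightarrow> openin X V \<Longrightarrow> f a \<in> V \<Longrightarrow> \<exists>B\<in>\<B>. a \<in> B \<and> B \<subseteq> f -` V"
    by (rule countably_basedE[OF assms], rule that)
  show ?thesis
  proof (rule measurable_borel_ofI)
    fix V assume V: "openin X V"
    have "f -` V \<inter> space M = \<Union>{B\<in>\<B>. B \<subseteq> f -` V}"
    proof
      show "f -` V \<inter> space M \<subseteq> \<Union>{B\<in>\<B>. B \<subseteq> f -` V}"
      proof
        fix a assume a: "a \<in> f -` V \<inter> space M"
        then obtain B where "B \<in> \<B>" "a \<in> B" "B \<subseteq> f -` V" using B(4)[of a V] V by auto
        then show "a \<in> \<Union>{B\<in>\<B>. B \<subseteq> f -` V}" by auto
      qed
      show "\<Union>{B\<in>\<B>. B \<subseteq> f -` V} \<subseteq> f -` V \<inter> space M"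
        using B(2) by (auto dest: sets.sets_into_space)
    qed
    moreover have "countable {B\<in>\<B>. B \<subseteq> f -` V}" by (rule countable_subset[OF _ B(1)]) auto
    ultimately show "f -` V \<inter> space M \<in> sets M"
      using B(2) by (auto intro!: sets.countable_Union)
  qed (use B(3) in auto)
qed

text \<open>Boxes form a base of the product topology, so intersections of one member from each
  family suffice. This stability under pairing is the point of the notion: the Borel sets of a
  product of non-separable spaces may exceed the product sigma-algebra.\<close>

lemma countably_based_pair:
  assumes "countably_based M X f" "countably_based M Y g"
  shows "countably_based M (prod_topology X Y) (\<lambda>a. (f a, g a))"
proof -
  obtain \<B> where B: "countable \<B>" "\<B> \<subseteq> sets M" "\<And>a. a \<in> space M \<Longrightarrow> f a \<in> topspace X"
    "\<And>a V. a \<in> space M \<Longrightarrow> openin X V \<Longrightarrow> f a \<in> V \<Longrightarrow> \<exists>B\<in>\<B>. a \<in> B \<and> B \<subseteq> f -` V"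
    by (rule countably_basedE[OF assms(1)], rule that)
  obtain \<C> where C: "countable \<C>" "\<C> \<subseteq> sets M" "\<And>a. a \<in> space M \<Longrightarrow> g a \<in> topspace Y"
    "\<And>a V. a \<in> space M \<Longrightarrow> openin Y V \<Longrightarrow> g a \<in> V \<Longrightarrow> \<exists>B\<in>\<C>. a \<in> B \<and> B \<subseteq> g -` V"
    by (rule countably_basedE[OF assms(2)], rule that)
  show ?thesis
  proof (rule countably_basedI)
    show "countable ((\<lambda>(B, C). B \<inter> C) ` (\<B> \<times> \<C>))" using B(1) C(1) by auto
    show "(\<lambda>(B, C). B \<inter> C) ` (\<B> \<times> \<C>) \<subseteq> sets M" using B(2) C(2) by auto
    show "(f a, g a) \<in> topspace (prod_topology X Y)" if "a \<in> space M" for a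
      using that B(3) C(3) by auto
    fix a V assume a: "a \<in> space M" and V: "openin (prod_topology X Y) V" "(f a, g a) \<in> V"
    from V have "\<exists>V1 V2. openin X V1 \<and> openin Y V2 \<and> f a \<in> V1 \<and> g a \<in> V2 \<and> V1 \<times> V2 \<subseteq> V"
      unfolding openin_prod_topology_alt by simp
    then obtain V1 V2 where V12: "openin X V1" "openin Y V2" "f a \<in> V1" "g a \<in> V2" "V1 \<times> V2 \<subseteq> V"
      by (elim exE conjE) (rule that)
    obtain B1 where B1: "B1 \<in> \<B>" "a \<in> B1" "B1 \<subseteq> f -` V1" using B(4)[OF a V12(1,3)] by auto
    obtain C1 where C1: "C1 \<in> \<C>" "a \<in> C1" "C1 \<subseteq> g -` V2" using C(4)[OF a V12(2,4)] by auto
    show "\<exists>B\<in>(\<lambda>(B, C). B \<inter> C) ` (\<B> \<times> \<C>). a \<in> B \<and> B \<subseteq> (\<lambda>a. (f a, g a)) -` V"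
      by (rule bexI[of _ "B1 \<inter> C1"]) (use B1 C1 in \<open>auto intro!: subsetD[OF V12(5)]\<close>)
  qed
qed

lemma countably_based_compose:
  assumes "countably_based M X f" and h: "h \<in> N \<rightarrow>\<^sub>M M"
  shows "countably_based N X (\<lambda>a. f (h a))"
proof -
  obtain \<B> where B: "countable \<B>" "\<B> \<subseteq> sets M" "\<And>a. a \<in> space M \<Longrightarrow> f a \<in> topspace X"
    "\<And>a V. a \<in> space M \<Longrightarrow> openin X V \<Longrightarrow> f a \<in> V \<Longrightarrow> \<exists>B\<in>\<B>. a \<in> B \<and> B \<subseteq> f -` V"
    by (rule countably_basedE[OF assms(1)], rule that)
  show ?thesis
  proof (rule countably_basedI)
    show "countable ((\<lambda>B. h -` B \<inter> space N) ` \<B>)" using B(1) by auto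
    show "(\<lambda>B. h -` B \<inter> space N) ` \<B> \<subseteq> sets N" using B(2) h by (auto intro: measurable_sets)
    show "f (h a) \<in> topspace X" if "a \<in> space N" for a using that B(3) measurable_space[OF h] by auto
    fix a V assume a: "a \<in> space N" and V: "openin X V" "f (h a) \<in> V"
    obtain B1 where B1: "B1 \<in> \<B>" "h a \<in> B1" "B1 \<subseteq> f -` V"
      using B(4)[OF _ V] measurable_space[OF h a] by auto
    show "\<exists>B\<in>(\<lambda>B. h -` B \<inter> space N) ` \<B>. a \<in> B \<and> B \<subseteq> (\<lambda>a. f (h a)) -` V"
      by (rule bexI[of _ "h -` B1 \<inter> space N"]) (use B1 a in auto)
  qed
qed

lemma countably_based_top_of_set:
  fixes f :: "'a \<Rightarrow> 'b::second_countable_topology"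
  assumes f[measurable]: "f \<in> borel_measurable M" and S: "\<And>a. a \<in> space M \<Longrightarrow> f a \<in> S"
  shows "countably_based M (top_of_set S) f"
proof -
  obtain \<C> :: "'b set set" where C: "countable \<C>" "topological_basis \<C>"
    using ex_countable_basis by auto
  show ?thesis
  proof (rule countably_basedI)
    show "countable ((\<lambda>B. f -` B \<inter> space M) ` \<C>)" using C(1) by auto
    show "(\<lambda>B. f -` B \<inter> space M) ` \<C> \<subseteq> sets M"
    proof
      fix A assume "A \<in> (\<lambda>B. f -` B \<inter> space M) ` \<C>"
      then obtain B where "B \<in> \<C>" "A = f -` B \<inter> space M" by auto
      then show "A \<in> sets M" using topological_basis_open[OF C(2)] measurable_sets[OF f, of B] by simp
    qed
    show "f a \<in> topspace (top_of_set S)" if "a \<in> space M" for a using S that by simp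
    fix a V assume a: "a \<in> space M" and V: "openin (top_of_set S) V" "f a \<in> V"
    then obtain V' where V': "open V'" "V = S \<inter> V'" by (auto simp: openin_open)
    obtain B where B: "B \<in> \<C>" "f a \<in> B" "B \<subseteq> V'"
      using topological_basisE[OF C(2) V'(1), of "f a"] V V'(2) by auto
    show "\<exists>B\<in>(\<lambda>B. f -` B \<inter> space M) ` \<C>. a \<in> B \<and> B \<subseteq> f -` V"
      by (rule bexI[of _ "f -` B \<inter> space M"]) (use B a V'(2) S in auto)
  qed
qed

lemma countably_based_euclidean:
  fixes f :: "'a \<Rightarrow> 'b::second_countable_topology"
  assumes "f \<in> borel_measurable M"
  shows "countably_based M euclidean f"
  using countably_based_top_of_set[OF assms, of UNIV] by simp

text \<open>The form in which the property is applied: a coefficient that is Borel for the product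
  topology of its whole domain is composed with a tuple of arguments.\<close>

lemma countably_based_subset:
  assumes "f \<in> borel_measurable (borel_of X)" "countably_based M X g"
  shows "(\<lambda>a. f (g a)) \<in> borel_measurable M"
  using measurable_compose[OF countably_based_measurable[OF assms(2)] assms(1)] .

section \<open>Continuity on compact intervals and the space of continuous paths\<close>

lemma closure_Ioo_Rats:
  fixes l r :: real assumes "l < r" shows "closure ({l<..<r} \<inter> \<rat>) = {l..r}"
proof -
  have "closure ({l<..<r} \<inter> \<rat>) = closure {l<..<r}"
    by (rule closure_open_Int_superset) (simp_all add: Rats_closure_real)
  then show ?thesis using assms by simp
qed

text \<open>Rational points of the open interval are dense in the closed one, and a continuous
  function that maps a dense set into a closed set maps the closure into it. Tubes, suprema over
  time and lower limits are reduced to countably many conditions in this way.\<close>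

lemma continuous_on_closed_Icc_iff:
  fixes g :: "real \<Rightarrow> 'a::topological_space"
  assumes "l < r" "continuous_on {l..r} g" "closed C"
  shows "(\<forall>t\<in>{l..r}. g t \<in> C) \<longleftrightarrow> (\<forall>t\<in>{l<..<r} \<inter> \<rat>. g t \<in> C)"
proof
  assume *: "\<forall>t\<in>{l<..<r} \<inter> \<rat>. g t \<in> C"
  have "g ` closure ({l<..<r} \<inter> \<rat>) \<subseteq> C"
    by (rule image_closure_subset) (use assms * in \<open>auto simp: closure_Ioo_Rats\<close>)
  then show "\<forall>t\<in>{l..r}. g t \<in> C" using assms by (auto simp: closure_Ioo_Rats)
qed auto

lemma countable_Ioo_Rats: "countable ({l<..<r::real} \<inter> \<rat>)"
  by (rule countable_subset[OF _ countable_rat]) auto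

lemma sets_continuous_closed_Icc:
  fixes f :: "'a \<Rightarrow> real \<Rightarrow> 'b::metric_space"
  assumes "l < r" "\<And>a. a \<in> space M \<Longrightarrow> continuous_on {l..r} (f a)" "closed C"
    and "\<And>t. t \<in> {l..r} \<Longrightarrow> (\<lambda>a. f a t) \<in> borel_measurable M"
  shows "{a \<in> space M. \<forall>t\<in>{l..r}. f a t \<in> C} \<in> sets M"
proof -
  have "{a \<in> space M. \<forall>t\<in>{l..r}. f a t \<in> C} = {a \<in> space M. \<forall>t\<in>{l<..<r} \<inter> \<rat>. f a t \<in> C}"
    using continuous_on_closed_Icc_iff[OF assms(1,2,3)] by auto
  also have "\<dots> \<in> sets M"
  proof (rule sets.sets_Collect_countable_All'[OF _ countable_Ioo_Rats])
    fix t assume "t \<in> {l<..<r} \<inter> \<rat>"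
    then have "(\<lambda>a. f a t) -` C \<inter> space M \<in> sets M"
      using assms(3,4) by (intro measurable_sets[of _ _ borel]) auto
    then show "{a \<in> space M. f a t \<in> C} \<in> sets M" by (simp add: vimage_def Int_def conj_commute)
  qed
  finally show ?thesis .
qed

text \<open>Members of the function space are bounded by definition; on the compact interval this
  follows from continuity.\<close>

lemma mspace_C:
  fixes T :: real
  shows "mspace (cfunspace (top_of_set {0..T}) (euclidean_metric :: 'a::euclidean_space metric)) =
     {w \<in> extensional {0..T}. continuous_on {0..T} w}"
proof -
  have "compactin (top_of_set {0..T}) (topspace (top_of_set {0..T::real}))"
    by (simp add: compactin_subtopology compact_Icc)
  from compactin_mspace_cfunspace[OF this, of "euclidean_metric :: 'a metric"] show ?thesis
    by auto
qed

lemma topspace_C_top: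
  "topspace (C_top T :: (real \<Rightarrow> 'a::euclidean_space) topology) =
     {w \<in> extensional {0..T}. continuous_on {0..T} w}"
  unfolding topspace_mtopology_of mspace_C ..

lemma openin_C_topD:
  fixes w :: "real \<Rightarrow> 'a::euclidean_space"
  assumes "openin (C_top T) V" "w \<in> V"
  shows "\<exists>e>0. \<forall>w'\<in>topspace (C_top T). (\<forall>t\<in>{0..T}. dist (w t) (w' t) \<le> e) \<longrightarrow> w' \<in> V"
proof -
  let ?m = "cfunspace (top_of_set {0..T}) (euclidean_metric :: 'a metric)"
  interpret Metric_space "mspace ?m" "mdist ?m" by (rule Metric_space_mspace_mdist)
  obtain r where r: "r > 0" "mball w r \<subseteq> V"
    using assms unfolding mtopology_of_def openin_mtopology by meson
  have wV: "w \<in> mspace ?m" using assms openin_subset[OF assms(1)]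
    by (simp add: topspace_mtopology_of subset_iff del: mspace_cfunspace)
  show ?thesis
  \<comment> \<open>The distance is a supremum, which pointwise bounds control only non-strictly;
    half the radius leaves room for the open ball.\<close>
  proof (intro exI[of _ "r / 2"] conjI ballI impI)
    show "r / 2 > 0" using r by simp
    fix w' assume w': "w' \<in> topspace (C_top T)" "\<forall>t\<in>{0..T}. dist (w t) (w' t) \<le> r / 2"
    have "mdist ?m w w' \<le> r / 2"
      by (rule mdist_cfunspace_le) (use r w' in simp_all)
    moreover have "w' \<in> mspace ?m" using w'(1) by (simp add: topspace_mtopology_of del: mspace_cfunspace)
    ultimately have "w' \<in> mball w r" using wV r by (simp add: in_mball del: mspace_cfunspace)
    then show "w' \<in> V" using r by (auto simp del: mspace_cfunspace)
  qed
qed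

text \<open>Evaluation is 1-Lipschitz for the uniform distance. It is what makes the coordinates of
  the noise Borel on the canonical space.\<close>

lemma continuous_map_C_eval:
  assumes "t \<in> {0..T}"
  shows "continuous_map (C_top T) (euclidean :: 'a::euclidean_space topology) (\<lambda>w. w t)"
  unfolding continuous_map_def
proof (intro conjI allI impI)
  let ?m = "cfunspace (top_of_set {0..T}) (euclidean_metric :: 'a metric)"
  interpret Metric_space "mspace ?m" "mdist ?m" by (rule Metric_space_mspace_mdist)
  fix U :: "'a set" assume U: "openin euclidean U"
  show "openin (C_top T) {w \<in> topspace (C_top T). w t \<in> U}"
    unfolding mtopology_of_def openin_mtopology
  proof (intro conjI allI impI)
    fix w assume "w \<in> {w \<in> topspace mtopology. w t \<in> U}"
    then have w: "w \<in> mspace ?m" "w t \<in> U" by (auto simp del: mspace_cfunspace)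
    obtain e where e: "e > 0" "ball (w t) e \<subseteq> U" using U w(2) by (auto elim: openE)
    have "mball w (e/2) \<subseteq> {w \<in> topspace mtopology. w t \<in> U}"
    proof
      fix w' assume "w' \<in> mball w (e/2)"
      then have w': "w' \<in> mspace ?m" "mdist ?m w w' \<le> e/2" by (auto simp: in_mball simp del: mspace_cfunspace)
      have "dist (w t) (w' t) \<le> e/2"
        using mdist_cfunspace_imp_mdist_le[OF w(1) w', of t] assms by simp
      then have "w' t \<in> ball (w t) e" using e(1) by simp
      then have "w' t \<in> U" using e(2) by (rule subsetD[rotated])
      then show "w' \<in> {w \<in> topspace mtopology. w t \<in> U}" using w'(1) by (simp del: mspace_cfunspace)
    qed
    then show "\<exists>r>0. mball w r \<subseteq> {w \<in> topspace mtopology. w t \<in> U}" using e(1)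
      by (intro exI[of _ "e/2"]) simp
  qed (auto simp del: mspace_cfunspace)
qed auto

text \<open>Balls are replaced by tubes around step functions, so no dense set of continuous paths is
  required.\<close>

lemma countably_based_C:
  fixes f :: "'a \<Rightarrow> real \<Rightarrow> 'b::euclidean_space"
  assumes T: "T > 0" and cont: "\<And>a. a \<in> space M \<Longrightarrow> continuous_on {0..T} (f a)"
    and meas: "\<And>t. t \<in> {0..T} \<Longrightarrow> (\<lambda>a. f a t) \<in> borel_measurable M"
  shows "countably_based M (C_top T) (\<lambda>a. \<lambda>t\<in>{0..T}. f a t)"
proof -
  obtain D :: "'b set" where D: "countable D" "\<And>X. open X \<Longrightarrow> X \<noteq> {} \<Longrightarrow> \<exists>d\<in>D. d \<in> X"
    by (erule countable_dense_setE)
  define cell where "cell n i = {real i * T / real (Suc n) .. real (Suc i) * T / real (Suc n)}" for n i :: nat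
  \<comment> \<open>The levels in \<open>q\<close> will be taken from a countable dense set of
    values, one for each of the \<open>Suc n\<close> cells, so that countably many tubes arise. Two
    paths in one tube are uniformly within twice the tolerance of each other.\<close>
  define tube where "tube n k q = {a \<in> space M. \<forall>i\<in>{..n}. \<forall>t\<in>cell n i. dist (f a t) (q ! i) \<le> 1 / real (Suc k)}"
    for n k :: nat and q :: "'b list"
  have cell_sub: "cell n i \<subseteq> {0..T}" if "i \<le> n" for n i
  proof -
    have "real (Suc i) * T \<le> real (Suc n) * T" using that T by (intro mult_right_mono) auto
    then have *: "real (Suc i) * T / real (Suc n) \<le> T" by (simp add: field_simps)
    have "0 \<le> real i * T / real (Suc n)" using T by simp
    then show ?thesis unfolding cell_def using * by (meson atLeastatMost_subset_iff)
  qed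
  have cell_cover: "\<exists>i\<le>n. t \<in> cell n i" if "t \<in> {0..T}" for n t
  proof (cases "t = T")
    \<comment> \<open>At the right end point the floor used in the other case would give
      \<open>Suc n\<close>, one beyond the last cell.\<close>
    case True
    moreover have "T + T * real n > 0" using T by (simp add: add_pos_nonneg)
    ultimately have "t \<in> cell n n" using T by (auto simp: cell_def field_simps)
    then show ?thesis by auto
  next
    case False
    define x where "x = t * real (Suc n) / T"
    have "t * real (Suc n) < T * real (Suc n)" using False that by (intro mult_strict_right_mono) auto
    then have x: "0 \<le> x" "x < real (Suc n)"
      using that T by (auto simp: x_def pos_divide_less_eq mult.commute simp del: of_nat_Suc)
    define i where "i = nat \<lfloor>x\<rfloor>"
    have i: "real i \<le> x" "x \<le> real (Suc i)" unfolding i_def using x by linarith+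
    have "i \<le> n" using i(1) x(2) by linarith
    moreover have "t = x * T / real (Suc n)" using T by (simp add: x_def)
    then have "t \<in> cell n i" unfolding cell_def using i T
      by (auto intro!: divide_right_mono mult_right_mono simp del: of_nat_Suc)
    ultimately show ?thesis by auto
  qed
  have meas_tube: "tube n k q \<in> sets M" for n k q
    unfolding tube_def
  proof (rule sets.sets_Collect_finite_All)
    fix i assume i: "i \<in> {..n}"
    have "{a \<in> space M. \<forall>t\<in>cell n i. f a t \<in> cball (q ! i) (1 / real (Suc k))} \<in> sets M"
      unfolding cell_def
    proof (rule sets_continuous_closed_Icc)
      show "real i * T / real (Suc n) < real (Suc i) * T / real (Suc n)"
        using T by (intro divide_strict_right_mono mult_strict_right_mono) auto
      show "continuous_on {real i * T / real (Suc n)..real (Suc i) * T / real (Suc n)} (f a)" if "a \<in> space M" for a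
        using continuous_on_subset[OF cont[OF that] cell_sub] i unfolding cell_def by auto
      show "(\<lambda>a. f a t) \<in> borel_measurable M" if "t \<in> {real i * T / real (Suc n)..real (Suc i) * T / real (Suc n)}" for t
        by (rule meas) (use that cell_sub[of i n] i in \<open>auto simp: cell_def simp del: of_nat_Suc\<close>)
    qed auto
    then show "{a \<in> space M. \<forall>t\<in>cell n i. dist (f a t) (q ! i) \<le> 1 / real (Suc k)} \<in> sets M"
      by (simp add: dist_commute)
  qed simp
  have top: "(\<lambda>t\<in>{0..T}. f a t) \<in> topspace (C_top T)" if "a \<in> space M" for a
    using cont[OF that] continuous_on_cong[of "{0..T}" "{0..T}" "restrict (f a) {0..T}" "f a"]
    unfolding topspace_C_top by simp
  show ?thesis
  proof (rule countably_basedI)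
    show "countable ((\<lambda>(n, k, q). tube n k q) ` (UNIV \<times> UNIV \<times> lists D))"
      using D(1) by (intro countable_image countable_SIGMA) auto
    show "(\<lambda>(n, k, q). tube n k q) ` (UNIV \<times> UNIV \<times> lists D) \<subseteq> sets M" using meas_tube by auto
    show "(\<lambda>t\<in>{0..T}. f a t) \<in> topspace (C_top T)" if "a \<in> space M" for a by (rule top[OF that])
    fix a V assume a: "a \<in> space M" and V: "openin (C_top T) V" "(\<lambda>t\<in>{0..T}. f a t) \<in> V"
    obtain e where e: "e > 0" "\<forall>w'\<in>topspace (C_top T).
        (\<forall>t\<in>{0..T}. dist (restrict (f a) {0..T} t) (w' t) \<le> e) \<longrightarrow> w' \<in> V"
      using openin_C_topD[OF V] by blast
    \<comment> \<open>Two paths in one tube differ by at most twice the tolerance, hence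
      \<open>e / 2\<close>. The tolerance is itself halved below: one half for the oscillation of
      the path on a cell, one for the distance from its value at the left end of the cell to the
      dense set.\<close>
    obtain k where k: "1 / real (Suc k) < e / 2" using nat_approx_posE[of "e/2"] e(1) by auto
    have "uniformly_continuous_on {0..T} (f a)"
      by (rule compact_uniformly_continuous[OF cont[OF a] compact_Icc])
    moreover have "1 / real (Suc k) / 2 > 0" by simp
    ultimately obtain d where d: "d > 0" "\<And>s t. s \<in> {0..T} \<Longrightarrow> t \<in> {0..T} \<Longrightarrow> dist s t < d \<Longrightarrow>
        dist (f a s) (f a t) < 1 / real (Suc k) / 2"
      unfolding uniformly_continuous_on_def by meson
    obtain n where n: "T / real (Suc n) < d"
    proof -
      obtain n where "1 / real (Suc n) < d / T" using nat_approx_posE[of "d/T"] d(1) T by auto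
      moreover have "T + T * real n > 0" using T by (simp add: add_pos_nonneg)
      ultimately show ?thesis using that T by (simp add: field_simps)
    qed
    have "\<exists>y\<in>D. dist (f a (real i * T / real (Suc n))) y < 1 / real (Suc k) / 2" for i
      using D(2)[of "ball (f a (real i * T / real (Suc n))) (1 / real (Suc k) / 2)"] by auto
    then obtain y where y: "\<And>i. y i \<in> D" "\<And>i. dist (f a (real i * T / real (Suc n))) (y i) < 1 / real (Suc k) / 2"
      by metis
    define q where "q = map y [0..<Suc n]"
    have q: "q \<in> lists D" "\<And>i. i \<le> n \<Longrightarrow> q ! i = y i" unfolding q_def using y(1)
      by (auto simp: nth_map simp del: upt_Suc)
    have "dist (f a t) (q ! i) \<le> 1 / real (Suc k)" if i: "i \<le> n" and t: "t \<in> cell n i" for i t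
    proof -
      have l: "real i * T / real (Suc n) \<in> cell n i" using T by (auto simp: cell_def intro!: divide_right_mono mult_right_mono)
      have "dist t (real i * T / real (Suc n)) \<le> T / real (Suc n)"
      proof -
        have "real (Suc i) * T / real (Suc n) = real i * T / real (Suc n) + T / real (Suc n)"
          by (simp add: add_divide_distrib[symmetric] algebra_simps)
        then show ?thesis using t by (simp add: cell_def dist_real_def del: of_nat_Suc)
      qed
      then have "dist (f a t) (f a (real i * T / real (Suc n))) < 1 / real (Suc k) / 2"
        using t l cell_sub[OF i] n by (intro d(2)) auto
      moreover have "dist (f a t) (y i) \<le> dist (f a t) (f a (real i * T / real (Suc n))) + dist (f a (real i * T / real (Suc n))) (y i)"
        by (rule dist_triangle)
      ultimately show ?thesis unfolding q(2)[OF i] using y(2)[of i] by linarith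
    qed
    then have a_in: "a \<in> tube n k q" unfolding tube_def using a by auto
    have "tube n k q \<subseteq> (\<lambda>a. \<lambda>t\<in>{0..T}. f a t) -` V"
    proof
      fix a' assume a': "a' \<in> tube n k q"
      have "(\<lambda>t\<in>{0..T}. f a' t) \<in> V"
      proof (rule e(2)[rule_format])
        show "(\<lambda>t\<in>{0..T}. f a' t) \<in> topspace (C_top T)" by (rule top) (use a' in \<open>simp add: tube_def\<close>)
        fix t assume t: "t \<in> {0..T}"
        obtain i where i: "i \<le> n" "t \<in> cell n i" using cell_cover[OF t] by auto
        have "dist (f a t) (q ! i) \<le> 1 / real (Suc k)" "dist (f a' t) (q ! i) \<le> 1 / real (Suc k)"
          using a' a_in i by (auto simp: tube_def)
        then have "dist (f a t) (f a' t) \<le> e" using k dist_triangle2[of "f a t" "f a' t" "q ! i"] by linarith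
        then show "dist (restrict (f a) {0..T} t) (restrict (f a') {0..T} t) \<le> e" using t by simp
      qed
      then show "a' \<in> (\<lambda>a. \<lambda>t\<in>{0..T}. f a t) -` V" by simp
    qed
    then show "\<exists>B\<in>(\<lambda>(n, k, q). tube n k q) ` (UNIV \<times> UNIV \<times> lists D). a \<in> B \<and> B \<subseteq> (\<lambda>a. \<lambda>t\<in>{0..T}. f a t) -` V"
      using a_in q(1) by (intro bexI[of _ "tube n k q"]) auto
  qed
qed

section \<open>Countable approximation of sections in measure and in the mean square\<close>

text \<open>Good-sets argument over rectangles. A section of a rectangle is one of two sets,
  complementation keeps symmetric differences, and a countable union is cut off at a finite stage,
  where finite unions of approximants are again countable in number. The family depends on
  \<open>E\<close>, and so it does the work of separability for an arbitrary finite
  \<open>M\<close>.\<close>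

lemma (in finite_measure) countable_section_approximation:
  assumes "E \<in> sets (N \<Otimes>\<^sub>M M)"
  shows "\<exists>\<D>. countable \<D> \<and> \<D> \<subseteq> sets M \<and>
    (\<forall>a\<in>space N. \<forall>e>0. \<exists>D\<in>\<D>. measure M (sym_diff (Pair a -` E) D) < e)"
proof -
  let ?G = "{A \<times> B | A B. A \<in> sets N \<and> B \<in> sets M}"
  let ?P = "\<lambda>E. \<exists>\<D>. countable \<D> \<and> \<D> \<subseteq> sets M \<and>
    (\<forall>a\<in>space N. \<forall>e>0. \<exists>D\<in>\<D>. measure M (sym_diff (Pair a -` E) D) < e)"
  have sec: "Pair a -` X \<in> sets M" if "X \<in> sigma_sets (space N \<times> space M) ?G" for X a
    using that sets_Pair1[of X N M a] by (simp add: sets_pair_measure)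
  have "Int_stable ?G" by (rule Int_stable_pair_measure_generator)
  moreover have "?G \<subseteq> Pow (space N \<times> space M)" by (rule pair_measure_closed)
  moreover have "E \<in> sigma_sets (space N \<times> space M) ?G" using assms by (simp add: sets_pair_measure)
  ultimately show ?thesis
  proof (induction E rule: sigma_sets_induct_disjoint)
    case (basic X)
    then obtain A B where X: "X = A \<times> B" "A \<in> sets N" "B \<in> sets M" by auto
    have "\<exists>D\<in>{{}, B}. measure M (sym_diff (Pair a -` X) D) < e" if "e > 0" for a e
      using that X by (cases "a \<in> A") auto
    then show ?case using X(3) by (intro exI[of _ "{{}, B}"]) auto
  next
    case empty
    show ?case by (intro exI[of _ "{{}}"]) auto
  next
    case (compl X)
    then obtain \<D> where D: "countable \<D>" "\<D> \<subseteq> sets M"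
      "\<And>a e. a \<in> space N \<Longrightarrow> e > 0 \<Longrightarrow> \<exists>D\<in>\<D>. measure M (sym_diff (Pair a -` X) D) < e" by meson
    show ?case
    proof (intro exI[of _ "(\<lambda>D. space M - D) ` \<D>"] conjI ballI allI impI)
      show "countable ((\<lambda>D. space M - D) ` \<D>)" using D(1) by simp
      show "(\<lambda>D. space M - D) ` \<D> \<subseteq> sets M" using D(2) by auto
      fix a and e :: real assume a: "a \<in> space N" "e > 0"
      obtain D1 where D1: "D1 \<in> \<D>" "measure M (sym_diff (Pair a -` X) D1) < e" using D(3)[OF a] by blast
      have s: "Pair a -` X \<subseteq> space M" "D1 \<subseteq> space M"
        using sets.sets_into_space[OF sec[OF compl(1), of a]] sets.sets_into_space[of D1 M] D(2) D1(1) by auto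
      have "Pair a -` (space N \<times> space M - X) = space M - Pair a -` X" using a by auto
      then have "sym_diff (Pair a -` (space N \<times> space M - X)) (space M - D1) = sym_diff (Pair a -` X) D1"
        using s by blast
      then show "\<exists>D\<in>(\<lambda>D. space M - D) ` \<D>. measure M (sym_diff (Pair a -` (space N \<times> space M - X)) D) < e"
        using D1 by (intro bexI[of _ "space M - D1"]) simp_all
    qed
  next
    case (union A)
    have "\<forall>i. \<exists>\<D>. countable \<D> \<and> \<D> \<subseteq> sets M \<and>
      (\<forall>a\<in>space N. \<forall>e>0. \<exists>D\<in>\<D>. measure M (sym_diff (Pair a -` A i) D) < e)" using union.IH by blast
    then obtain \<D> where D: "\<And>i. countable (\<D> i)" "\<And>i. \<D> i \<subseteq> sets M"
      "\<And>i a e. a \<in> space N \<Longrightarrow> e > 0 \<Longrightarrow> \<exists>D\<in>\<D> i. measure M (sym_diff (Pair a -` A i) D) < e" by metis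
    \<comment> \<open>\<open>PiE\<close> fixes the values of a selection outside
      \<open>{..<n}\<close>, which leaves countably many selections for each
      \<open>n\<close>.\<close>
    define \<U> where "\<U> = (\<Union>n. (\<lambda>F. \<Union>i<n. F i) ` (PiE {..<n} \<D>))"
    show ?case
    proof (intro exI[of _ \<U>] conjI ballI allI impI)
      show "countable \<U>" unfolding \<U>_def using D(1) by (intro countable_UN countable_image countable_PiE) auto
      show "\<U> \<subseteq> sets M" unfolding \<U>_def using D(2) by (auto intro!: sets.finite_UN simp: PiE_iff subset_iff)
      fix a and e :: real assume a: "a \<in> space N" and e: "e > 0"
      have S: "Pair a -` A i \<in> sets M" for i using sec[of "A i" a] union.hyps(2) by (simp add: image_subset_iff)
      have "(\<lambda>n. measure M (\<Union>i\<in>{..<n}. Pair a -` A i)) \<longlonglongrightarrow> measure M (\<Union>n. \<Union>i\<in>{..<n}. Pair a -` A i)"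
        by (rule finite_Lim_measure_incseq) (use S in \<open>auto simp: incseq_def intro: UN_I less_le_trans\<close>)
      moreover have "(\<Union>n. \<Union>i\<in>{..<n}. Pair a -` A i) = Pair a -` (\<Union>i. A i)" by auto
      ultimately have "eventually (\<lambda>n. measure M (\<Union>i\<in>{..<n}. Pair a -` A i) > measure M (Pair a -` (\<Union>i. A i)) - e / 2) sequentially"
        using e by (intro order_tendstoD(1)) auto
      then obtain n where n: "measure M (\<Union>i\<in>{..<n}. Pair a -` A i) > measure M (Pair a -` (\<Union>i. A i)) - e / 2"
        by (auto simp: eventually_sequentially)
      \<comment> \<open>Half of \<open>e\<close> is spent on the tail of the union, the other half
        on the \<open>n\<close> approximants; the denominator with \<open>Suc n\<close> also covers
        \<open>n = 0\<close>.\<close>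
      have "\<forall>i. \<exists>D\<in>\<D> i. measure M (sym_diff (Pair a -` A i) D) < e / (2 * Suc n)"
        using D(3)[OF a] e by simp
      then obtain F where F: "\<And>i. F i \<in> \<D> i" "\<And>i. measure M (sym_diff (Pair a -` A i) (F i)) < e / (2 * Suc n)" by metis
      have Fm: "F i \<in> sets M" for i using F(1) D(2) by auto
      let ?R = "Pair a -` (\<Union>i. A i) - (\<Union>i\<in>{..<n}. Pair a -` A i)"
      have "sym_diff (Pair a -` (\<Union>i. A i)) (\<Union>i<n. F i) \<subseteq> ?R \<union> (\<Union>i\<in>{..<n}. sym_diff (Pair a -` A i) (F i))"
        by auto
      moreover have Sm: "Pair a -` (\<Union>i. A i) \<in> sets M"
        using S by (auto simp: vimage_Union image_image)
      ultimately have "measure M (sym_diff (Pair a -` (\<Union>i. A i)) (\<Union>i<n. F i))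
          \<le> measure M (?R \<union> (\<Union>i\<in>{..<n}. sym_diff (Pair a -` A i) (F i)))"
        using S Fm by (intro finite_measure_mono) auto
      also have "\<dots> \<le> measure M ?R + measure M (\<Union>i\<in>{..<n}. sym_diff (Pair a -` A i) (F i))"
        using S Fm Sm by (intro measure_Un_le) auto
      also have "measure M ?R < e / 2"
        using n S Sm by (subst finite_measure_Diff) auto
      also have "measure M (\<Union>i\<in>{..<n}. sym_diff (Pair a -` A i) (F i)) \<le> (\<Sum>i\<in>{..<n}. measure M (sym_diff (Pair a -` A i) (F i)))"
        using S Fm by (intro finite_measure_subadditive_finite) auto
      also have "\<dots> \<le> (\<Sum>i\<in>{..<n}. e / (2 * Suc n))" using F(2) by (intro sum_mono) (simp add: less_imp_le)
      also have "\<dots> \<le> e / 2" using e by (simp add: field_simps)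
      finally have "measure M (sym_diff (Pair a -` (\<Union>i. A i)) (\<Union>i<n. F i)) < e" by simp
      moreover have "(\<Union>i<n. F i) \<in> \<U>" unfolding \<U>_def using F(1)
        by (intro UN_I[of n] UNIV_I image_eqI[of _ _ "restrict F {..<n}"] SUP_cong) auto
      ultimately show "\<exists>D\<in>\<U>. measure M (sym_diff (Pair a -` (\<Union>i. A i)) D) < e" by blast
    qed
  qed
qed

lemma norm_add_squared_le:
  fixes x y :: "'a::real_normed_vector"
  shows "(norm (x + y))\<^sup>2 \<le> 2 * (norm x)\<^sup>2 + 2 * (norm y)\<^sup>2"
proof -
  have "(norm (x + y))\<^sup>2 \<le> (norm x + norm y)\<^sup>2" by (intro power_mono norm_triangle_ineq) simp
  also have "\<dots> \<le> 2 * (norm x)\<^sup>2 + 2 * (norm y)\<^sup>2"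
    using sum_squares_bound[of "norm x" "norm y"] by (simp add: power2_sum)
  finally show ?thesis .
qed

lemma nn_integral_norm_diff_squared_le:
  fixes f g k :: "'a \<Rightarrow> 'b::euclidean_space"
  assumes [measurable]: "f \<in> borel_measurable M" "g \<in> borel_measurable M" "k \<in> borel_measurable M"
  shows "(\<integral>\<^sup>+x. ennreal ((norm (f x - k x))\<^sup>2) \<partial>M) \<le>
    2 * (\<integral>\<^sup>+x. ennreal ((norm (f x - g x))\<^sup>2) \<partial>M) + 2 * (\<integral>\<^sup>+x. ennreal ((norm (g x - k x))\<^sup>2) \<partial>M)"
proof -
  have "(\<integral>\<^sup>+x. ennreal ((norm (f x - k x))\<^sup>2) \<partial>M) \<le>
      (\<integral>\<^sup>+x. 2 * ennreal ((norm (f x - g x))\<^sup>2) + 2 * ennreal ((norm (g x - k x))\<^sup>2) \<partial>M)"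
  proof (rule nn_integral_mono)
    fix x
    have "(norm (f x - k x))\<^sup>2 \<le> 2 * (norm (f x - g x))\<^sup>2 + 2 * (norm (g x - k x))\<^sup>2"
      using norm_add_squared_le[of "f x - g x" "g x - k x"] by simp
    then have "ennreal ((norm (f x - k x))\<^sup>2) \<le> ennreal (2 * (norm (f x - g x))\<^sup>2 + 2 * (norm (g x - k x))\<^sup>2)"
      by (rule ennreal_leI)
    then show "ennreal ((norm (f x - k x))\<^sup>2) \<le> 2 * ennreal ((norm (f x - g x))\<^sup>2) + 2 * ennreal ((norm (g x - k x))\<^sup>2)"
      by (simp add: ennreal_mult')
  qed
  also have "\<dots> = 2 * (\<integral>\<^sup>+x. ennreal ((norm (f x - g x))\<^sup>2) \<partial>M) + 2 * (\<integral>\<^sup>+x. ennreal ((norm (g x - k x))\<^sup>2) \<partial>M)"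
    by (simp add: nn_integral_add nn_integral_cmult)
  finally show ?thesis .
qed

text \<open>Simple functions dominated by twice the norm of \<open>h\<close> converge to
  \<open>h\<close> in the mean square on every section. Each takes finitely many values, and the
  sections of its level sets are approximated by members of countable families; hence countably many
  simple functions of the second variable come close to all sections.\<close>

lemma (in finite_measure) L2_countable_dense:
  fixes h :: "'b \<times> 'a \<Rightarrow> 'c::euclidean_space"
  assumes h[measurable]: "h \<in> borel_measurable (N \<Otimes>\<^sub>M M)"
    and fin: "\<And>a. a \<in> space N \<Longrightarrow> (\<integral>\<^sup>+x. ennreal ((norm (h (a, x)))\<^sup>2) \<partial>M) < \<infinity>"
  shows "\<exists>\<G>. countable \<G> \<and> \<G> \<subseteq> borel_measurable M \<and>
    (\<forall>a\<in>space N. \<forall>e>0. \<exists>g\<in>\<G>. (\<integral>\<^sup>+x. ennreal ((norm (h (a, x) - g x))\<^sup>2) \<partial>M) < ennreal e)"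
proof -
  obtain F where F: "\<And>i. simple_function (N \<Otimes>\<^sub>M M) (F i)"
    "\<And>z. z \<in> space (N \<Otimes>\<^sub>M M) \<Longrightarrow> (\<lambda>i. F i z) \<longlonglongrightarrow> h z"
    "\<And>i z. z \<in> space (N \<Otimes>\<^sub>M M) \<Longrightarrow> dist (F i z) 0 \<le> 2 * dist (h z) 0"
    using borel_measurable_implies_sequence_metric[OF h, of 0] by blast
  have [measurable]: "F i \<in> borel_measurable (N \<Otimes>\<^sub>M M)" for i
    by (rule borel_measurable_simple_function[OF F(1)])
  define R where "R i = F i ` space (N \<Otimes>\<^sub>M M)" for i
  have finR: "finite (R i)" for i unfolding R_def by (rule simple_functionD(1)[OF F(1)])
  define E where "E i y = F i -` {y} \<inter> space (N \<Otimes>\<^sub>M M)" for i y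
  have E: "E i y \<in> sets (N \<Otimes>\<^sub>M M)" for i y unfolding E_def by (rule simple_functionD(2)[OF F(1)])
  have "\<forall>i y. \<exists>\<D>. countable \<D> \<and> \<D> \<subseteq> sets M \<and>
    (\<forall>a\<in>space N. \<forall>e>0. \<exists>D\<in>\<D>. measure M (sym_diff (Pair a -` E i y) D) < e)"
    using countable_section_approximation[OF E] by blast
  then obtain \<D> where D: "\<And>i y. countable (\<D> i y)" "\<And>i y. \<D> i y \<subseteq> sets M"
    "\<And>i y a e. a \<in> space N \<Longrightarrow> e > 0 \<Longrightarrow> \<exists>D\<in>\<D> i y. measure M (sym_diff (Pair a -` E i y) D) < e"
    by metis
  define \<G> where "\<G> = (\<Union>i. (\<lambda>D x. \<Sum>y\<in>R i. indicator (D y) x *\<^sub>R y) ` PiE (R i) (\<D> i))"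
  show ?thesis
  proof (intro exI[of _ \<G>] conjI ballI allI impI)
    show "countable \<G>" unfolding \<G>_def using D(1) finR by (intro countable_UN countable_image countable_PiE) auto
    show "\<G> \<subseteq> borel_measurable M"
    proof
      fix g assume "g \<in> \<G>"
      then obtain i D1 where g: "g = (\<lambda>x. \<Sum>y\<in>R i. indicator (D1 y) x *\<^sub>R y)" "D1 \<in> PiE (R i) (\<D> i)"
        unfolding \<G>_def by blast
      have "D1 y \<in> sets M" if "y \<in> R i" for y using g(2) D(2) that by (auto simp: PiE_iff)
      then show "g \<in> borel_measurable M" unfolding g(1)
        by (intro borel_measurable_sum borel_measurable_scaleR borel_measurable_indicator) auto
    qed
    fix a and e :: real assume a: "a \<in> space N" and e: "e > 0"
    have [measurable]: "(\<lambda>x. h (a, x)) \<in> borel_measurable M" "(\<lambda>x. F i (a, x)) \<in> borel_measurable M" for i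
      using a by measurable
    have az: "(a, x) \<in> space (N \<Otimes>\<^sub>M M)" if "x \<in> space M" for x using a that by (simp add: space_pair_measure)
    have "(\<lambda>i. \<integral>\<^sup>+x. ennreal ((norm (h (a, x) - F i (a, x)))\<^sup>2) \<partial>M) \<longlonglongrightarrow> (\<integral>\<^sup>+x. 0 \<partial>M)"
    proof (rule nn_integral_dominated_convergence[where w = "\<lambda>x. 9 * ennreal ((norm (h (a, x)))\<^sup>2)"])
      show "(\<integral>\<^sup>+x. 9 * ennreal ((norm (h (a, x)))\<^sup>2) \<partial>M) < \<infinity>"
        using fin[OF a] by (simp add: nn_integral_cmult ennreal_mult_less_top)
      show "AE x in M. (\<lambda>i. ennreal ((norm (h (a, x) - F i (a, x)))\<^sup>2)) \<longlonglongrightarrow> 0"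
      proof (rule AE_I2)
        fix x assume x: "x \<in> space M"
        have "(\<lambda>i. (norm (h (a, x) - F i (a, x)))\<^sup>2) \<longlonglongrightarrow> (norm (h (a, x) - h (a, x)))\<^sup>2"
          by (intro tendsto_intros F(2) az x)
        then show "(\<lambda>i. ennreal ((norm (h (a, x) - F i (a, x)))\<^sup>2)) \<longlonglongrightarrow> 0"
          using tendsto_ennrealI by fastforce
      qed
      show "AE x in M. ennreal ((norm (h (a, x) - F i (a, x)))\<^sup>2) \<le> 9 * ennreal ((norm (h (a, x)))\<^sup>2)" for i
      proof (rule AE_I2)
        fix x assume x: "x \<in> space M"
        \<comment> \<open>Since \<open>F i\<close> is bounded by twice the norm of \<open>h\<close>,
          the difference is bounded by three times that norm, and the square gives the 9 of the
          majorant.\<close>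
        have "norm (h (a, x) - F i (a, x)) \<le> 3 * norm (h (a, x))"
          using norm_triangle_ineq4[of "h (a, x)" "F i (a, x)"] F(3)[OF az[OF x], of i] by simp
        then have "(norm (h (a, x) - F i (a, x)))\<^sup>2 \<le> (3 * norm (h (a, x)))\<^sup>2" by (intro power_mono) auto
        then have "ennreal ((norm (h (a, x) - F i (a, x)))\<^sup>2) \<le> ennreal (9 * (norm (h (a, x)))\<^sup>2)"
          by (intro ennreal_leI) (simp add: power_mult_distrib)
        then show "ennreal ((norm (h (a, x) - F i (a, x)))\<^sup>2) \<le> 9 * ennreal ((norm (h (a, x)))\<^sup>2)"
          by (simp add: ennreal_mult')
      qed
    qed measurable
    then have "eventually (\<lambda>i. (\<integral>\<^sup>+x. ennreal ((norm (h (a, x) - F i (a, x)))\<^sup>2) \<partial>M) < ennreal (e / 8)) sequentially"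
      using e by (intro order_tendstoD(2)) auto
    then obtain i where i: "(\<integral>\<^sup>+x. ennreal ((norm (h (a, x) - F i (a, x)))\<^sup>2) \<partial>M) < ennreal (e / 8)"
      by (auto simp: eventually_sequentially)
    define K where "K = (\<Sum>y\<in>R i. norm y)"
    have K: "K \<ge> 0" unfolding K_def by (rule sum_nonneg) simp
    define c where "c = real (card (R i))"
    \<comment> \<open>The two simple functions agree outside the symmetric differences and differ by
      at most \<open>K\<close> on them. This choice keeps \<open>K\<^sup>2\<close> times the measure
      of \<open>c\<close> such sets below \<open>e / 8\<close>; the added ones keep the denominator
      positive.\<close>
    define e' where "e' = e / (8 * (K\<^sup>2 + 1) * (c + 1))"
    have c: "c \<ge> 0" unfolding c_def by simp
    have e': "e' > 0" unfolding e'_def using e c by (intro divide_pos_pos mult_pos_pos) (auto simp: add_nonneg_pos)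
    have "\<forall>y. \<exists>D\<in>\<D> i y. measure M (sym_diff (Pair a -` E i y) D) < e'" using D(3)[OF a e'] by blast
    then obtain D1 where D1: "\<And>y. D1 y \<in> \<D> i y" "\<And>y. measure M (sym_diff (Pair a -` E i y) (D1 y)) < e'" by metis
    define g where "g = (\<lambda>x. \<Sum>y\<in>R i. indicator (D1 y) x *\<^sub>R y)"
    have "g = (\<lambda>D x. \<Sum>y\<in>R i. indicator (D y) x *\<^sub>R y) (restrict D1 (R i))"
      unfolding g_def by (intro ext sum.cong) auto
    then have gG: "g \<in> \<G>" unfolding \<G>_def using D1(1) by (intro UN_I[of i] UNIV_I image_eqI[of _ _ "restrict D1 (R i)"]) auto
    have D1m[measurable]: "D1 y \<in> sets M" for y using D1(1) D(2) by blast
    have Em[measurable]: "Pair a -` E i y \<in> sets M" for y by (rule sets_Pair1[OF E])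
    have gm[measurable]: "g \<in> borel_measurable M" unfolding g_def by measurable
    let ?S = "\<Union>y\<in>R i. sym_diff (Pair a -` E i y) (D1 y)"
    have "(norm (F i (a, x) - g x))\<^sup>2 \<le> K\<^sup>2 * indicator ?S x" if x: "x \<in> space M" for x
    proof -
      have "F i (a, x) = (\<Sum>y\<in>R i. if F i (a, x) = y then y else 0)"
        using finR[of i] az[OF x] by (simp add: R_def)
      also have "\<dots> = (\<Sum>y\<in>R i. indicator (Pair a -` E i y) x *\<^sub>R y)"
        using az[OF x] by (intro sum.cong) (auto simp: E_def indicator_def)
      finally have "F i (a, x) - g x = (\<Sum>y\<in>R i. (indicator (Pair a -` E i y) x - indicator (D1 y) x) *\<^sub>R y)"
        unfolding g_def by (simp add: sum_subtractf scaleR_left_diff_distrib)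
      then have "norm (F i (a, x) - g x) \<le> (\<Sum>y\<in>R i. norm ((indicator (Pair a -` E i y) x - indicator (D1 y) x) *\<^sub>R y))"
        by (simp only: norm_sum)
      also have "\<dots> \<le> (\<Sum>y\<in>R i. norm y * indicator ?S x)"
        by (intro sum_mono) (auto simp: indicator_def)
      also have "\<dots> = K * indicator ?S x" by (simp add: K_def sum_distrib_right)
      finally have "(norm (F i (a, x) - g x))\<^sup>2 \<le> (K * indicator ?S x)\<^sup>2" by (intro power_mono) auto
      also have "\<dots> = K\<^sup>2 * indicator ?S x"
        by (cases "x \<in> ?S") (simp_all add: power_mult_distrib del: UN_iff)
      finally show ?thesis .
    qed
    then have "ennreal ((norm (F i (a, x) - g x))\<^sup>2) \<le> ennreal (K\<^sup>2) * indicator ?S x" if "x \<in> space M" for x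
      using ennreal_leI[of "(norm (F i (a, x) - g x))\<^sup>2" "K\<^sup>2 * indicator ?S x"] that
      by (simp add: ennreal_mult' ennreal_indicator del: UN_iff)
    then have "(\<integral>\<^sup>+x. ennreal ((norm (F i (a, x) - g x))\<^sup>2) \<partial>M) \<le> (\<integral>\<^sup>+x. ennreal (K\<^sup>2) * indicator ?S x \<partial>M)"
      by (rule nn_integral_mono)
    also have "\<dots> = ennreal (K\<^sup>2) * emeasure M ?S" using finR[of i] by (intro nn_integral_cmult_indicator) auto
    also have "\<dots> = ennreal (K\<^sup>2 * measure M ?S)" by (simp add: emeasure_eq_measure ennreal_mult)
    also have "\<dots> \<le> ennreal (e / 8)"
    proof (rule ennreal_leI)
      have "measure M ?S \<le> (\<Sum>y\<in>R i. measure M (sym_diff (Pair a -` E i y) (D1 y)))"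
        by (rule finite_measure_subadditive_finite) (use finR in auto)
      also have "\<dots> \<le> (\<Sum>y\<in>R i. e')" using D1(2) by (intro sum_mono) (simp add: less_imp_le)
      also have "\<dots> = c * e'" by (simp add: c_def)
      also have "\<dots> \<le> (c + 1) * e'" using e' by (intro mult_right_mono) auto
      finally have "K\<^sup>2 * measure M ?S \<le> (K\<^sup>2 + 1) * ((c + 1) * e')"
        using e' c by (intro mult_mono) auto
      also have "\<dots> = e / 8"
      proof -
        have "K\<^sup>2 + 1 \<noteq> 0" "c + 1 \<noteq> 0" using c by (auto simp: add_nonneg_eq_0_iff)
        moreover have "(k::real) * (d * (e / (8 * k * d))) = e / 8" if "k \<noteq> 0" "d \<noteq> 0" for k d
          using that by (simp add: divide_simps)
        ultimately show ?thesis unfolding e'_def by blast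
      qed
      finally show "K\<^sup>2 * measure M ?S \<le> e / 8" .
    qed
    finally have g: "(\<integral>\<^sup>+x. ennreal ((norm (F i (a, x) - g x))\<^sup>2) \<partial>M) \<le> ennreal (e / 8)" .
    have "(\<integral>\<^sup>+x. ennreal ((norm (h (a, x) - g x))\<^sup>2) \<partial>M) \<le>
      2 * (\<integral>\<^sup>+x. ennreal ((norm (h (a, x) - F i (a, x)))\<^sup>2) \<partial>M) + 2 * (\<integral>\<^sup>+x. ennreal ((norm (F i (a, x) - g x))\<^sup>2) \<partial>M)"
      by (rule nn_integral_norm_diff_squared_le) measurable
    also have "\<dots> \<le> 2 * ennreal (e / 8) + 2 * ennreal (e / 8)"
      using i g by (intro add_mono mult_left_mono) auto
    also have "\<dots> = ennreal (e / 2)" using e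
      by (simp add: ennreal_mult'[symmetric] ennreal_plus[symmetric] del: ennreal_plus flip: ennreal_numeral)
    also have "\<dots> < ennreal e" using e by (simp add: ennreal_less_iff)
    finally show "\<exists>g\<in>\<G>. (\<integral>\<^sup>+x. ennreal ((norm (h (a, x) - g x))\<^sup>2) \<partial>M) < ennreal e" using gG by blast
  qed
qed

text \<open>The members are preimages of balls with rational radius around the countable dense
  family. It is applied twice with the roles of the variables exchanged: with time as the
  integration variable for classes of paths, and with time as the parameter for the laws inserted
  into the coefficients.\<close>

lemma (in finite_measure) L2_countable_base:
  fixes h :: "'b \<times> 'a \<Rightarrow> 'c::euclidean_space"
  assumes h[measurable]: "h \<in> borel_measurable (N \<Otimes>\<^sub>M M)"
    and fin: "\<And>a. a \<in> space N \<Longrightarrow> (\<integral>\<^sup>+x. ennreal ((norm (h (a, x)))\<^sup>2) \<partial>M) < \<infinity>"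
  shows "\<exists>\<B>. countable \<B> \<and> \<B> \<subseteq> sets N \<and> (\<forall>a\<in>space N. \<forall>e>0. \<exists>B\<in>\<B>. a \<in> B \<and>
    (\<forall>a'\<in>B. (\<integral>\<^sup>+x. ennreal ((norm (h (a, x) - h (a', x)))\<^sup>2) \<partial>M) < ennreal e))"
proof -
  obtain \<G> where G: "countable \<G>" "\<G> \<subseteq> borel_measurable M"
    "\<And>a e. a \<in> space N \<Longrightarrow> e > 0 \<Longrightarrow> \<exists>g\<in>\<G>. (\<integral>\<^sup>+x. ennreal ((norm (h (a, x) - g x))\<^sup>2) \<partial>M) < ennreal e"
    using L2_countable_dense[OF h fin] by meson
  define B where "B g r = {a \<in> space N. (\<integral>\<^sup>+x. ennreal ((norm (h (a, x) - g x))\<^sup>2) \<partial>M) < ennreal r}" for g r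
  show ?thesis
  proof (intro exI[of _ "(\<lambda>(g, r). B g r) ` (\<G> \<times> \<rat>)"] conjI ballI allI impI)
    show "countable ((\<lambda>(g, r). B g r) ` (\<G> \<times> \<rat>))" using G(1) countable_rat by auto
    show "(\<lambda>(g, r). B g r) ` (\<G> \<times> \<rat>) \<subseteq> sets N"
    proof clarify
      fix g r assume "g \<in> \<G>"
      then have [measurable]: "g \<in> borel_measurable M" using G(2) by auto
      show "B g r \<in> sets N" unfolding B_def by measurable
    qed
    fix a and e :: real assume a: "a \<in> space N" and e: "e > 0"
    \<comment> \<open>Passing through the centre \<open>g\<close> costs a factor 2 on each of two
      squared distances below \<open>r\<close>, in total \<open>4 * r\<close>.\<close>
    obtain r where r: "r \<in> \<rat>" "0 < r" "r < e / 4" using Rats_dense_in_real[of 0 "e/4"] e by auto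
    obtain g where g: "g \<in> \<G>" "(\<integral>\<^sup>+x. ennreal ((norm (h (a, x) - g x))\<^sup>2) \<partial>M) < ennreal r"
      using G(3)[OF a r(2)] by blast
    have [measurable]: "g \<in> borel_measurable M" using G(2) g(1) by auto
    have aB: "a \<in> B g r" unfolding B_def using a g(2) by simp
    have "(\<integral>\<^sup>+x. ennreal ((norm (h (a, x) - h (a', x)))\<^sup>2) \<partial>M) < ennreal e" if a': "a' \<in> B g r" for a'
    proof -
      have [measurable]: "a' \<in> space N" using a' unfolding B_def by simp
      have [measurable]: "(\<lambda>x. h (a, x)) \<in> borel_measurable M" "(\<lambda>x. h (a', x)) \<in> borel_measurable M"
        using a by measurable
      have "(\<integral>\<^sup>+x. ennreal ((norm (h (a, x) - h (a', x)))\<^sup>2) \<partial>M) \<le>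
        2 * (\<integral>\<^sup>+x. ennreal ((norm (h (a, x) - g x))\<^sup>2) \<partial>M) + 2 * (\<integral>\<^sup>+x. ennreal ((norm (g x - h (a', x)))\<^sup>2) \<partial>M)"
        by (rule nn_integral_norm_diff_squared_le) measurable
      also have "\<dots> \<le> 2 * ennreal r + 2 * ennreal r"
        using a' g(2) unfolding B_def by (intro add_mono mult_left_mono) (auto simp: norm_minus_commute)
      also have "\<dots> = ennreal (4 * r)" using r
        by (simp add: ennreal_mult'[symmetric] ennreal_plus[symmetric] del: ennreal_plus flip: ennreal_numeral)
      also have "\<dots> < ennreal e" using r by (simp add: ennreal_less_iff)
      finally show ?thesis .
    qed
    then show "\<exists>B\<in>(\<lambda>(g, r). B g r) ` (\<G> \<times> \<rat>). a \<in> B \<and>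
      (\<forall>a'\<in>B. (\<integral>\<^sup>+x. ennreal ((norm (h (a, x) - h (a', x)))\<^sup>2) \<partial>M) < ennreal e)"
      using aB g(1) r(1) by (intro bexI[of _ "B g r"]) auto
  qed
qed

section \<open>Classes of square integrable functions of time\<close>

abbreviation Icc_measure :: "real \<Rightarrow> real measure" where
  "Icc_measure T \<equiv> restrict_space lborel {0..T}"

lemma finite_measure_Icc: "finite_measure (Icc_measure T)"
  by (rule finite_measureI)
    (simp add: emeasure_restrict_space space_restrict_space emeasure_lborel_Icc_eq)

lemma sq_intD:
  assumes "z \<in> sq_int T"
  shows "z \<in> borel_measurable (Icc_measure T)" "(\<integral>\<^sup>+t. ennreal ((norm (z t))\<^sup>2) \<partial>Icc_measure T) < \<infinity>"
  using assms by (auto simp: sq_int_def)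

lemma L2_class_in: "z \<in> sq_int T \<Longrightarrow> L2_class T z \<in> sq_int T // L2_rel T"
  unfolding L2_class_def by (rule quotientI)

lemma L2_repr_class:
  assumes "z \<in> sq_int T"
  shows "L2_repr (L2_class T z) \<in> sq_int T" "AE t in Icc_measure T. L2_repr (L2_class T z) t = z t"
proof -
  have "z \<in> L2_class T z" using assms by (auto simp: L2_class_def L2_rel_def)
  then have "L2_repr (L2_class T z) \<in> L2_class T z" unfolding L2_repr_def by (rule someI[of "\<lambda>y. y \<in> L2_class T z"])
  then have "(z, L2_repr (L2_class T z)) \<in> L2_rel T" by (simp add: L2_class_def)
  then show "L2_repr (L2_class T z) \<in> sq_int T" "AE t in Icc_measure T. L2_repr (L2_class T z) t = z t"
    by (auto simp: L2_rel_def elim!: eventually_mono)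
qed

lemma L2_class_eq_iff:
  assumes "z \<in> sq_int T" "z' \<in> sq_int T"
  shows "L2_class T z = L2_class T z' \<longleftrightarrow> (AE t in Icc_measure T. z t = z' t)"
  unfolding L2_class_def using assms equiv_class_eq_iff[OF equiv_L2_rel, of z z'] by (auto simp: L2_rel_def)

text \<open>The distance is defined through chosen representatives. They agree almost everywhere
  with the given functions, so the choice disappears from here on.\<close>

lemma L2_dist_class:
  assumes "z \<in> sq_int T" "z' \<in> sq_int T"
  shows "L2_dist T (L2_class T z) (L2_class T z') =
    sqrt (enn2real (\<integral>\<^sup>+t. ennreal ((norm (z t - z' t))\<^sup>2) \<partial>Icc_measure T))"
proof -
  have [measurable]: "L2_repr (L2_class T z) \<in> borel_measurable (Icc_measure T)"
      "L2_repr (L2_class T z') \<in> borel_measurable (Icc_measure T)"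
    using L2_repr_class(1)[OF assms(1)] L2_repr_class(1)[OF assms(2)] by (auto dest: sq_intD(1))
  have "(\<integral>t. (norm (L2_repr (L2_class T z) t - L2_repr (L2_class T z') t))\<^sup>2 \<partial>Icc_measure T) =
    enn2real (\<integral>\<^sup>+t. ennreal ((norm (L2_repr (L2_class T z) t - L2_repr (L2_class T z') t))\<^sup>2) \<partial>Icc_measure T)"
    by (rule integral_eq_nn_integral) auto
  also have "(\<integral>\<^sup>+t. ennreal ((norm (L2_repr (L2_class T z) t - L2_repr (L2_class T z') t))\<^sup>2) \<partial>Icc_measure T) =
      (\<integral>\<^sup>+t. ennreal ((norm (z t - z' t))\<^sup>2) \<partial>Icc_measure T)"
    using L2_repr_class(2)[OF assms(1)] L2_repr_class(2)[OF assms(2)] by (intro nn_integral_cong_AE) auto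
  finally show ?thesis by (simp add: L2_dist_def)
qed

lemma countably_based_L2:
  fixes h :: "'a \<Rightarrow> real \<Rightarrow> 'b::euclidean_space"
  assumes h[measurable]: "(\<lambda>(a, t). h a t) \<in> borel_measurable (N \<Otimes>\<^sub>M Icc_measure T)"
    and sq: "\<And>a. a \<in> space N \<Longrightarrow> h a \<in> sq_int T"
  shows "countably_based N (L2_top T) (\<lambda>a. L2_class T (h a))"
proof -
  interpret finite_measure "Icc_measure T" by (rule finite_measure_Icc)
  obtain \<B> where B: "countable \<B>" "\<B> \<subseteq> sets N" "\<And>a e. a \<in> space N \<Longrightarrow> e > 0 \<Longrightarrow> \<exists>B\<in>\<B>. a \<in> B \<and>
    (\<forall>a'\<in>B. (\<integral>\<^sup>+x. ennreal ((norm (h a x - h a' x))\<^sup>2) \<partial>Icc_measure T) < ennreal e)"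
    using L2_countable_base[OF h] sq_intD(2)[OF sq] by auto
  show ?thesis
  proof (rule countably_basedI[OF B(1,2)])
    show "L2_class T (h a) \<in> topspace (L2_top T)" if "a \<in> space N" for a
      using L2_class_in[OF sq[OF that]] by simp
    fix a V assume a: "a \<in> space N" and V: "openin (L2_top T) V" "L2_class T (h a) \<in> V"
    obtain e where e: "e > 0" "\<forall>c\<in>sq_int T // L2_rel T. L2_dist T (L2_class T (h a)) c < e \<longrightarrow> c \<in> V"
      using V unfolding openin_dist_topology by blast
    \<comment> \<open>The square appears because the distance of classes is the root of the
      integral.\<close>
    obtain B1 where B1: "B1 \<in> \<B>" "a \<in> B1"
      "\<And>a'. a' \<in> B1 \<Longrightarrow> (\<integral>\<^sup>+x. ennreal ((norm (h a x - h a' x))\<^sup>2) \<partial>Icc_measure T) < ennreal (e\<^sup>2)"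
      using B(3)[OF a, of "e\<^sup>2"] e(1) by auto
    have "L2_class T (h a') \<in> V" if a': "a' \<in> B1" for a'
    proof -
      have a'N: "a' \<in> space N" using a' B1(1) B(2) sets.sets_into_space by blast
      have "enn2real (\<integral>\<^sup>+x. ennreal ((norm (h a x - h a' x))\<^sup>2) \<partial>Icc_measure T) < e\<^sup>2"
        using B1(3)[OF a'] by (subst enn2real_less_iff) (auto simp: top.not_eq_extremum intro: less_trans)
      then have "L2_dist T (L2_class T (h a)) (L2_class T (h a')) < e"
        unfolding L2_dist_class[OF sq[OF a] sq[OF a'N]] using e(1) by (simp add: real_less_lsqrt)
      then show ?thesis using e(2) L2_class_in[OF sq[OF a'N]] by blast
    qed
    then show "\<exists>B\<in>\<B>. a \<in> B \<and> B \<subseteq> (\<lambda>a. L2_class T (h a)) -` V" using B1(1,2) by blast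
  qed
qed

lemma closedin_L2_singleton:
  assumes "z \<in> sq_int T"
  shows "closedin (L2_top T) {L2_class T z}"
proof -
  have "openin (L2_top T) (sq_int T // L2_rel T - {L2_class T z})"
    unfolding openin_dist_topology
  proof (intro conjI ballI)
    fix c assume c: "c \<in> sq_int T // L2_rel T - {L2_class T z}"
    then obtain z' where z': "z' \<in> sq_int T" "c = L2_class T z'" by (auto elim!: quotientE simp: L2_class_def)
    have [measurable]: "z \<in> borel_measurable (Icc_measure T)" "z' \<in> borel_measurable (Icc_measure T)"
      using sq_intD(1)[OF assms] sq_intD(1)[OF z'(1)] by auto
    let ?d = "L2_dist T c (L2_class T z)" let ?J = "\<integral>\<^sup>+t. ennreal ((norm (z' t - z t))\<^sup>2) \<partial>Icc_measure T"
    have "?d \<noteq> 0"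
    proof
      assume "?d = 0"
      \<comment> \<open>\<open>enn2real\<close> vanishes at infinity as well as at zero, so the
        infinite case must be excluded before concluding that the integral is zero.\<close>
      moreover have "?J < \<infinity>"
      proof -
        have "?J \<le> 2 * (\<integral>\<^sup>+t. ennreal ((norm (z' t - 0))\<^sup>2) \<partial>Icc_measure T) + 2 * (\<integral>\<^sup>+t. ennreal ((norm (0 - z t))\<^sup>2) \<partial>Icc_measure T)"
          by (rule nn_integral_norm_diff_squared_le) auto
        also have "\<dots> < \<infinity>" using sq_intD(2)[OF assms] sq_intD(2)[OF z'(1)] by (simp add: ennreal_mult_less_top)
        finally show ?thesis .
      qed
      ultimately have "?J = 0" unfolding z'(2) L2_dist_class[OF z'(1) assms] by (auto simp: enn2real_eq_0_iff)
      then have "AE t in Icc_measure T. z' t = z t" by (subst (asm) nn_integral_0_iff_AE) auto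
      then show False using c L2_class_eq_iff[OF z'(1) assms] z'(2) by simp
    qed
    moreover have "?d \<ge> 0" unfolding L2_dist_def by simp
    ultimately have d: "?d > 0" by simp
    show "\<exists>e>0. \<forall>y\<in>sq_int T // L2_rel T. L2_dist T c y < e \<longrightarrow> y \<in> sq_int T // L2_rel T - {L2_class T z}"
      by (rule exI[of _ ?d]) (use d in auto)
  qed auto
  then show ?thesis unfolding closedin_def using L2_class_in[OF assms] by simp
qed

subsection \<open>Functional representation\<close>

lemma
  assumes "space (F t) = space M"
  shows space_augmented: "space (augmented M F t) = space M"
    and sets_augmented: "sets (augmented M F t) = sigma_sets (space M) (sets (F t) \<union> null_sets (completion M))"
proof -
  have "sets (F t) \<union> null_sets (completion M) \<subseteq> Pow (space M)"
    using sets.sets_into_space[of _ "F t"] sets.sets_into_space[of _ "completion M"] assms by (auto simp: null_sets_def)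
  then show "space (augmented M F t) = space M"
    "sets (augmented M F t) = sigma_sets (space M) (sets (F t) \<union> null_sets (completion M))"
    unfolding augmented_def by (simp_all add: space_measure_of_conv)
qed

lemma sets_augmented_base: "space (F t) = space M \<Longrightarrow> A \<in> sets (F t) \<Longrightarrow> A \<in> sets (augmented M F t)"
  by (simp add: sets_augmented[where F=F and t=t] sigma_sets.Basic)

lemma sets_augmented_null: "space (F t) = space M \<Longrightarrow> A \<in> null_sets (completion M) \<Longrightarrow> A \<in> sets (augmented M F t)"
  by (simp add: sets_augmented[where F=F and t=t] sigma_sets.Basic)

lemma sets_augmented_mono:
  assumes "space (F s) = space M" "space (F t) = space M" "sets (F s) \<subseteq> sets (F t)"
  shows "sets (augmented M F s) \<subseteq> sets (augmented M F t)"
  unfolding sets_augmented[where F=F and t=s, OF assms(1)] sets_augmented[where F=F and t=t, OF assms(2)]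
  using assms(3) by (intro sigma_sets_mono') auto

text \<open>Every subset of a null set of the completion belongs to the augmented sigma-algebra.
  Hence a preimage under \<open>g\<close> is a preimage under \<open>f\<close> altered by sets that
  are all available.\<close>

lemma measurable_augmented_AE_cong:
  fixes f g :: "'a \<Rightarrow> 'b::topological_space"
  assumes sp: "space (F t) = space M" and f: "f \<in> borel_measurable (augmented M F t)"
    and ae: "AE x in M. f x = g x"
  shows "g \<in> borel_measurable (augmented M F t)"
proof (rule measurableI)
  fix A :: "'b set" assume A: "A \<in> sets borel"
  have "AE x in completion M. f x = g x" using ae by (rule AE_completion)
  then obtain N where N: "N \<in> null_sets (completion M)" "{x \<in> space M. f x \<noteq> g x} \<subseteq> N"
    by (rule AE_E3) (auto simp: subset_eq)
  have n: "X \<in> sets (augmented M F t)" if "X \<subseteq> N" for X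
    using null_sets_completion_subset[OF that N(1)] by (rule sets_augmented_null[where F=F and t=t, OF sp])
  have "f -` A \<inter> space M \<in> sets (augmented M F t)"
    using measurable_sets[OF f A] by (simp add: space_augmented[where F=F and t=t, OF sp])
  then have "((f -` A \<inter> space M) - N) \<union> (g -` A \<inter> space M \<inter> N) \<in> sets (augmented M F t)"
    using n[of N] n[of "g -` A \<inter> space M \<inter> N"] by (intro sets.Un sets.Diff) auto
  moreover have "((f -` A \<inter> space M) - N) \<union> (g -` A \<inter> space M \<inter> N) = g -` A \<inter> space M"
    using N(2) by auto
  ultimately show "g -` A \<inter> space (augmented M F t) \<in> sets (augmented M F t)"
    by (simp only: space_augmented[where F=F and t=t, OF sp])
qed simp

lemma space_gen_filtration [simp]: "space (gen_filtration \<Omega> V t) = \<Omega>"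
  unfolding gen_filtration_def by (rule space_measure_of) auto

lemma sets_gen_filtration:
  "sets (gen_filtration \<Omega> V t) = sigma_sets \<Omega> {V s -` A \<inter> \<Omega> | s A. s \<in> {0..t} \<and> A \<in> sets borel}"
  unfolding gen_filtration_def by (rule sets_measure_of) auto

lemma measurable_gen_filtration:
  assumes "s \<in> {0..t}" shows "V s \<in> borel_measurable (gen_filtration \<Omega> V t)"
  by (rule measurableI) (use assms in \<open>auto simp: sets_gen_filtration intro!: sigma_sets.Basic\<close>)

lemma sets_gen_filtration_mono: "s \<le> t \<Longrightarrow> sets (gen_filtration \<Omega> V s) \<subseteq> sets (gen_filtration \<Omega> V t)"
  unfolding sets_gen_filtration by (intro sigma_sets_mono') force

lemma measurable_into_gen_filtration:
  assumes h: "h \<in> space N \<rightarrow> \<Omega>" and m: "\<And>s. s \<in> {0..t} \<Longrightarrow> (\<lambda>x. V s (h x)) \<in> borel_measurable N"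
  shows "h \<in> N \<rightarrow>\<^sub>M gen_filtration \<Omega> V t"
  unfolding gen_filtration_def
proof (rule measurable_measure_of)
  fix y assume "y \<in> {V s -` A \<inter> \<Omega> |s A. s \<in> {0..t} \<and> A \<in> sets borel}"
  then obtain s A where y: "y = V s -` A \<inter> \<Omega>" "s \<in> {0..t}" "A \<in> sets borel" by auto
  have "h -` y \<inter> space N = (\<lambda>x. V s (h x)) -` A \<inter> space N" using h y(1) by auto
  then show "h -` y \<inter> space N \<in> sets N" using measurable_sets[OF m[OF y(2)] y(3)] by simp
qed (use h in auto)

text \<open>The Doob-Dynkin principle for the unaugmented filtration: preimages under
  \<open>\<xi>\<close> form a sigma-algebra, and it contains the generators because \<open>V\<close>
  factors through \<open>\<xi>\<close> up to time \<open>t\<close>. The identity is exact, without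
  null sets.\<close>

lemma sets_gen_filtration_vimage:
  assumes xi: "\<xi> \<in> \<Omega> \<rightarrow> space K" and V: "\<And>s \<omega>. s \<in> {0..t} \<Longrightarrow> \<omega> \<in> \<Omega> \<Longrightarrow> V s \<omega> = V' s (\<xi> \<omega>)"
    and V': "\<And>s. s \<in> {0..t} \<Longrightarrow> V' s \<in> borel_measurable K"
    and A: "A \<in> sets (gen_filtration \<Omega> V t)"
  shows "\<exists>C\<in>sets K. A = \<xi> -` C \<inter> \<Omega>"
proof -
  have "A \<in> sigma_sets \<Omega> {V s -` A \<inter> \<Omega> | s A. s \<in> {0..t} \<and> A \<in> sets borel}"
    using A by (simp add: sets_gen_filtration)
  then show ?thesis
  proof induction
    case (Basic a)
    then obtain s A where a: "a = V s -` A \<inter> \<Omega>" "s \<in> {0..t}" "A \<in> sets borel" by auto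
    have "a = \<xi> -` (V' s -` A \<inter> space K) \<inter> \<Omega>" unfolding a(1) using V[OF a(2)] xi by auto
    then show ?case using measurable_sets[OF V'[OF a(2)] a(3)] by blast
  next
    case Empty then show ?case by (intro bexI[of _ "{}"]) auto
  next
    case (Compl a)
    then obtain C where "C \<in> sets K" "a = \<xi> -` C \<inter> \<Omega>" by auto
    then show ?case using xi by (intro bexI[of _ "space K - C"]) auto
  next
    case (Union a)
    then have "\<forall>i. \<exists>C. C \<in> sets K \<and> a i = \<xi> -` C \<inter> \<Omega>" by blast
    then obtain C where "\<And>i. C i \<in> sets K" "\<And>i. a i = \<xi> -` C i \<inter> \<Omega>" by metis
    then show ?case by (intro bexI[of _ "\<Union>i. C i"]) auto
  qed
qed

text \<open>The sets that agree almost everywhere with a preimage under \<open>\<xi>\<close> are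
  closed under complements and countable unions. The principle serves both augmented filtrations,
  that of the auxiliary space and the canonical one.\<close>

lemma sigma_sets_AE_representation:
  assumes xi: "\<xi> \<in> space M \<rightarrow> space K"
    and S: "\<And>A. A \<in> S \<Longrightarrow> \<exists>C\<in>sets K. AE \<omega> in M. \<omega> \<in> A \<longleftrightarrow> \<xi> \<omega> \<in> C"
    and A: "A \<in> sigma_sets (space M) S"
  shows "\<exists>C\<in>sets K. AE \<omega> in M. \<omega> \<in> A \<longleftrightarrow> \<xi> \<omega> \<in> C"
  using A
proof induction
  case (Basic a) then show ?case by (rule S)
next
  case Empty then show ?case by (intro bexI[of _ "{}"]) auto
next
  case (Compl a)
  then obtain C where C: "C \<in> sets K" "AE \<omega> in M. \<omega> \<in> a \<longleftrightarrow> \<xi> \<omega> \<in> C" by blast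
  from C(2) AE_space have "AE \<omega> in M. \<omega> \<in> space M - a \<longleftrightarrow> \<xi> \<omega> \<in> space K - C"
    by eventually_elim (use xi in auto)
  then show ?case using C(1) by blast
next
  case (Union a)
  then have "\<forall>i. \<exists>C. C \<in> sets K \<and> (AE \<omega> in M. \<omega> \<in> a i \<longleftrightarrow> \<xi> \<omega> \<in> C)" by blast
  then obtain C where C: "\<And>i. C i \<in> sets K" "\<And>i. AE \<omega> in M. \<omega> \<in> a i \<longleftrightarrow> \<xi> \<omega> \<in> C i" by metis
  have "AE \<omega> in M. \<forall>i. \<omega> \<in> a i \<longleftrightarrow> \<xi> \<omega> \<in> C i" using C(2) by (simp add: AE_all_countable)
  then have "AE \<omega> in M. \<omega> \<in> (\<Union>i. a i) \<longleftrightarrow> \<xi> \<omega> \<in> (\<Union>i. C i)" by eventually_elim auto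
  then show ?case using C(1) by (intro bexI[of _ "\<Union>i. C i"]) auto
qed

lemma augmented_set_representation:
  assumes sp: "space (F t) = space M" and xi: "\<xi> \<in> space M \<rightarrow> space K"
    and F: "\<And>A. A \<in> sets (F t) \<Longrightarrow> \<exists>C\<in>sets K. A = \<xi> -` C \<inter> space M"
    and A: "A \<in> sets (augmented M F t)"
  shows "\<exists>C\<in>sets K. AE \<omega> in M. \<omega> \<in> A \<longleftrightarrow> \<xi> \<omega> \<in> C"
proof (rule sigma_sets_AE_representation[OF xi])
  show "A \<in> sigma_sets (space M) (sets (F t) \<union> null_sets (completion M))"
    using A by (simp add: sets_augmented[where F=F and t=t, OF sp])
  fix a assume "a \<in> sets (F t) \<union> null_sets (completion M)"
  then consider "a \<in> sets (F t)" | "a \<in> null_sets (completion M)" by blast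
  then show "\<exists>C\<in>sets K. AE \<omega> in M. \<omega> \<in> a \<longleftrightarrow> \<xi> \<omega> \<in> C"
  proof cases
    case 1
    then obtain C where C: "C \<in> sets K" "a = \<xi> -` C \<inter> space M" using F by blast
    then have "AE \<omega> in M. \<omega> \<in> a \<longleftrightarrow> \<xi> \<omega> \<in> C" by (intro AE_I2) auto
    then show ?thesis using C(1) by blast
  next
    case 2
    then have "AE \<omega> in completion M. \<omega> \<notin> a" by (rule AE_not_in)
    then have "AE \<omega> in M. \<omega> \<in> a \<longleftrightarrow> \<xi> \<omega> \<in> {}" by (simp add: AE_completion_iff)
    then show ?thesis by blast
  qed
qed

text \<open>The exceptional null set does not depend on \<open>s\<close>: for a rectangle it comes
  from the second side alone, and complements and countable unions keep this. Thus a process is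
  represented at all times at once.\<close>

lemma pair_augmented_set_representation:
  assumes sp: "space (F t) = space M" and xi: "\<xi> \<in> space M \<rightarrow> space K"
    and F: "\<And>A. A \<in> sets (F t) \<Longrightarrow> \<exists>C\<in>sets K. A = \<xi> -` C \<inter> space M"
    and E: "E \<in> sets (N \<Otimes>\<^sub>M augmented M F t)"
  shows "\<exists>C\<in>sets (N \<Otimes>\<^sub>M K). AE \<omega> in M. \<forall>s\<in>space N. (s, \<omega>) \<in> E \<longleftrightarrow> (s, \<xi> \<omega>) \<in> C"
proof -
  have "E \<in> sigma_sets (space N \<times> space M) {A \<times> B | A B. A \<in> sets N \<and> B \<in> sets (augmented M F t)}"
    using E by (simp add: sets_pair_measure space_augmented[where F=F and t=t, OF sp])
  then show ?thesis
  proof induction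
    case (Basic a)
    then obtain A B where a: "a = A \<times> B" "A \<in> sets N" "B \<in> sets (augmented M F t)" by auto
    obtain C where C: "C \<in> sets K" "AE \<omega> in M. \<omega> \<in> B \<longleftrightarrow> \<xi> \<omega> \<in> C"
      using augmented_set_representation[where F=F and t=t, OF sp xi F a(3)] by blast
    from C(2) have "AE \<omega> in M. \<forall>s\<in>space N. (s, \<omega>) \<in> a \<longleftrightarrow> (s, \<xi> \<omega>) \<in> A \<times> C"
      by eventually_elim (use a in auto)
    then show ?case using a(2) C(1) by (intro bexI[of _ "A \<times> C"]) auto
  next
    case Empty then show ?case by (intro bexI[of _ "{}"]) auto
  next
    case (Compl a)
    then obtain C where C: "C \<in> sets (N \<Otimes>\<^sub>M K)" "AE \<omega> in M. \<forall>s\<in>space N. (s, \<omega>) \<in> a \<longleftrightarrow> (s, \<xi> \<omega>) \<in> C" by blast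
    from C(2) AE_space have "AE \<omega> in M. \<forall>s\<in>space N. (s, \<omega>) \<in> space N \<times> space M - a \<longleftrightarrow> (s, \<xi> \<omega>) \<in> space (N \<Otimes>\<^sub>M K) - C"
      by eventually_elim (use xi in \<open>auto simp: space_pair_measure\<close>)
    then show ?case using C(1) by blast
  next
    case (Union a)
    then have "\<forall>i. \<exists>C. C \<in> sets (N \<Otimes>\<^sub>M K) \<and> (AE \<omega> in M. \<forall>s\<in>space N. (s, \<omega>) \<in> a i \<longleftrightarrow> (s, \<xi> \<omega>) \<in> C)" by blast
    then have "\<exists>C. \<forall>i. C i \<in> sets (N \<Otimes>\<^sub>M K) \<and> (AE \<omega> in M. \<forall>s\<in>space N. (s, \<omega>) \<in> a i \<longleftrightarrow> (s, \<xi> \<omega>) \<in> C i)"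
      by (rule choice)
    then obtain C where "\<forall>i. C i \<in> sets (N \<Otimes>\<^sub>M K) \<and> (AE \<omega> in M. \<forall>s\<in>space N. (s, \<omega>) \<in> a i \<longleftrightarrow> (s, \<xi> \<omega>) \<in> C i)"
      by (elim exE)
    then have C: "\<And>i. C i \<in> sets (N \<Otimes>\<^sub>M K)"
      "\<And>i. AE \<omega> in M. \<forall>s\<in>space N. (s, \<omega>) \<in> a i \<longleftrightarrow> (s, \<xi> \<omega>) \<in> C i" by simp_all
    have "AE \<omega> in M. \<forall>i. \<forall>s\<in>space N. (s, \<omega>) \<in> a i \<longleftrightarrow> (s, \<xi> \<omega>) \<in> C i" using C(2) by (simp add: AE_all_countable)
    then have "AE \<omega> in M. \<forall>s\<in>space N. (s, \<omega>) \<in> (\<Union>i. a i) \<longleftrightarrow> (s, \<xi> \<omega>) \<in> (\<Union>i. C i)" by eventually_elim auto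
    then show ?case using C(1) by (intro bexI[of _ "\<Union>i. C i"]) auto
  qed
qed

text \<open>The level sets of approximating simple functions are replaced by represented sets.
  Countably many level sets occur, each with a null set that is uniform in \<open>s\<close>, so the
  limit is identified simultaneously for all \<open>s\<close>.\<close>

lemma functional_representation:
  fixes H :: "'s \<times> 'w \<Rightarrow> 'b::{banach, second_countable_topology}"
  assumes sp: "space (F t) = space M" and xi: "\<xi> \<in> space M \<rightarrow> space K"
    and F: "\<And>A. A \<in> sets (F t) \<Longrightarrow> \<exists>C\<in>sets K. A = \<xi> -` C \<inter> space M"
    and H: "H \<in> borel_measurable (N \<Otimes>\<^sub>M augmented M F t)"
  shows "\<exists>g\<in>borel_measurable (N \<Otimes>\<^sub>M K). AE \<omega> in M. \<forall>s\<in>space N. H (s, \<omega>) = g (s, \<xi> \<omega>)"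
proof -
  let ?Q = "N \<Otimes>\<^sub>M augmented M F t"
  obtain S where S: "\<And>i. simple_function ?Q (S i)" "\<And>z. z \<in> space ?Q \<Longrightarrow> (\<lambda>i. S i z) \<longlonglongrightarrow> H z"
    using borel_measurable_implies_sequence_metric[OF H, of 0] by blast
  define R where "R i = S i ` space ?Q" for i
  have finR: "finite (R i)" for i unfolding R_def by (rule simple_functionD(1)[OF S(1)])
  have E: "S i -` {y} \<inter> space ?Q \<in> sets ?Q" for i y by (rule simple_functionD(2)[OF S(1)])
  define C where "C i y = (SOME C. C \<in> sets (N \<Otimes>\<^sub>M K) \<and>
    (AE \<omega> in M. \<forall>s\<in>space N. (s, \<omega>) \<in> S i -` {y} \<inter> space ?Q \<longleftrightarrow> (s, \<xi> \<omega>) \<in> C))" for i y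
  have "C i y \<in> sets (N \<Otimes>\<^sub>M K) \<and> (AE \<omega> in M. \<forall>s\<in>space N. (s, \<omega>) \<in> S i -` {y} \<inter> space ?Q \<longleftrightarrow> (s, \<xi> \<omega>) \<in> C i y)" for i y
    unfolding C_def
    using pair_augmented_set_representation[where F=F and t=t, OF sp xi F E[of i y]] by (intro someI_ex[where P="\<lambda>C. C \<in> sets (N \<Otimes>\<^sub>M K) \<and>
    (AE \<omega> in M. \<forall>s\<in>space N. (s, \<omega>) \<in> S i -` {y} \<inter> space ?Q \<longleftrightarrow> (s, \<xi> \<omega>) \<in> C)"]) blast
  then have C: "\<And>i y. C i y \<in> sets (N \<Otimes>\<^sub>M K)"
    "\<And>i y. AE \<omega> in M. \<forall>s\<in>space N. (s, \<omega>) \<in> S i -` {y} \<inter> space ?Q \<longleftrightarrow> (s, \<xi> \<omega>) \<in> C i y" by simp_all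
  define g where "g i z = (\<Sum>y\<in>R i. indicator (C i y) z *\<^sub>R y)" for i z
  have [measurable]: "g i \<in> borel_measurable (N \<Otimes>\<^sub>M K)" for i
    unfolding g_def using C(1) by (intro borel_measurable_sum borel_measurable_scaleR borel_measurable_indicator) auto
  have "AE \<omega> in M. \<forall>i. \<forall>y\<in>R i. \<forall>s\<in>space N. (s, \<omega>) \<in> S i -` {y} \<inter> space ?Q \<longleftrightarrow> (s, \<xi> \<omega>) \<in> C i y"
    unfolding AE_all_countable
  proof
    fix i
    show "AE \<omega> in M. \<forall>y\<in>R i. \<forall>s\<in>space N. (s, \<omega>) \<in> S i -` {y} \<inter> space ?Q \<longleftrightarrow> (s, \<xi> \<omega>) \<in> C i y"
      using finR C(2) by (rule AE_finite_allI)
  qed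
  \<comment> \<open>\<open>lim\<close> is total and measurable even where the sequence diverges, so
    the functional is defined on the whole product.\<close>
  then have "AE \<omega> in M. \<forall>s\<in>space N. H (s, \<omega>) = lim (\<lambda>i. g i (s, \<xi> \<omega>))"
    using AE_space
  proof eventually_elim
    case (elim \<omega>)
    show ?case
    proof
      fix s assume s: "s \<in> space N"
      have z: "(s, \<omega>) \<in> space ?Q" using s elim(2) by (simp add: space_pair_measure space_augmented[where F=F and t=t, OF sp])
      have "g i (s, \<xi> \<omega>) = S i (s, \<omega>)" for i
      proof -
        have "g i (s, \<xi> \<omega>) = (\<Sum>y\<in>R i. if S i (s, \<omega>) = y then y else 0)"
          unfolding g_def
        proof (intro sum.cong refl)
          fix y assume "y \<in> R i"
          then have "(s, \<xi> \<omega>) \<in> C i y \<longleftrightarrow> S i (s, \<omega>) = y" using elim(1) s z by blast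
          then show "indicator (C i y) (s, \<xi> \<omega>) *\<^sub>R y = (if S i (s, \<omega>) = y then y else 0)" by simp
        qed
        also have "\<dots> = S i (s, \<omega>)" using finR[of i] z by (simp add: R_def)
        finally show ?thesis .
      qed
      then show "H (s, \<omega>) = lim (\<lambda>i. g i (s, \<xi> \<omega>))" using limI[OF S(2)[OF z]] by simp
    qed
  qed
  then show ?thesis by (intro bexI[of _ "\<lambda>z. lim (\<lambda>i. g i z)"]) auto
qed

corollary functional_representation_static:
  fixes H :: "'w \<Rightarrow> 'b::{banach, second_countable_topology}"
  assumes sp: "space (F t) = space M" and xi: "\<xi> \<in> space M \<rightarrow> space K"
    and F: "\<And>A. A \<in> sets (F t) \<Longrightarrow> \<exists>C\<in>sets K. A = \<xi> -` C \<inter> space M"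
    and H: "H \<in> borel_measurable (augmented M F t)"
  shows "\<exists>g\<in>borel_measurable K. AE \<omega> in M. H \<omega> = g (\<xi> \<omega>)"
proof -
  \<comment> \<open>A one-point parameter space turns a random variable into a process.\<close>
  have "(\<lambda>z. H (snd z)) \<in> borel_measurable (count_space (UNIV :: unit set) \<Otimes>\<^sub>M augmented M F t)"
    using H by measurable
  from functional_representation[where F=F and t=t, OF sp xi F this] obtain g where
    g: "g \<in> borel_measurable (count_space (UNIV :: unit set) \<Otimes>\<^sub>M K)" "AE \<omega> in M. H \<omega> = g ((), \<xi> \<omega>)"
    by auto
  show ?thesis by (rule bexI[of _ "\<lambda>x. g ((), x)"]) (use g in \<open>auto intro: measurable_compose[OF _ g(1)]\<close>)
qed

subsection \<open>Continuous processes\<close>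

text \<open>Freezing the process at the left end of a mesh of width \<open>1 / real (Suc n)\<close>
  gives jointly measurable processes, which converge by continuity. With the sigma-algebra at time
  \<open>t0\<close> in place of \<open>M\<close> this is the progressive measurability of continuous
  adapted processes.\<close>

lemma continuous_progressive:
  fixes f :: "real \<Rightarrow> 'a \<Rightarrow> 'b::{metric_space}"
  assumes t0: "0 \<le> t0" and cont: "\<And>a. a \<in> space M \<Longrightarrow> continuous_on {0..t0} (\<lambda>t. f t a)"
    and meas: "\<And>t. t \<in> {0..t0} \<Longrightarrow> f t \<in> borel_measurable M"
  shows "(\<lambda>(t, a). f t a) \<in> borel_measurable (restrict_space borel {0..t0} \<Otimes>\<^sub>M M)"
proof -
  let ?N = "restrict_space borel {0..t0} :: real measure"
  define k where "k n t = nat \<lfloor>real (Suc n) * t\<rfloor>" for n and t :: real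
  \<comment> \<open>The minimum keeps every mesh point inside the interval, where measurability is
    assumed; at the index that belongs to \<open>t\<close> it is inactive, since that mesh point
    does not exceed \<open>t\<close>.\<close>
  define p where "p n j = min t0 (real j / real (Suc n))" for n j :: nat
  have p: "p n j \<in> {0..t0}" for n j using t0 by (auto simp: p_def)
  have le: "p n (k n t) = real (k n t) / real (Suc n)" "\<bar>p n (k n t) - t\<bar> \<le> 1 / real (Suc n)" if "t \<in> {0..t0}" for n t
  proof -
    have "0 \<le> real (Suc n) * t" using that by simp
    then have *: "real (k n t) \<le> real (Suc n) * t" "real (Suc n) * t \<le> real (k n t) + 1"
      unfolding k_def by linarith+
    have a: "real (k n t) / real (Suc n) \<le> t" using *(1) by (simp add: pos_divide_le_eq mult.commute del: of_nat_Suc)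
    then show eq: "p n (k n t) = real (k n t) / real (Suc n)" using that by (simp add: p_def)
    have "t \<le> real (k n t) / real (Suc n) + 1 / real (Suc n)"
      using *(2) by (simp add: add_divide_distrib[symmetric] pos_le_divide_eq mult.commute del: of_nat_Suc)
    then show "\<bar>p n (k n t) - t\<bar> \<le> 1 / real (Suc n)" using a unfolding eq by (simp add: abs_le_iff)
  qed
  have lim: "(\<lambda>n. p n (k n t)) \<longlonglongrightarrow> t" if "t \<in> {0..t0}" for t
  proof (rule LIM_zero_cancel, rule tendsto_rabs_zero_cancel, rule tendsto_sandwich[where f = "\<lambda>_. 0"])
    show "(\<lambda>n. 1 / real (Suc n)) \<longlonglongrightarrow> 0" by (rule LIMSEQ_Suc[OF lim_1_over_n])
  qed (use le(2)[OF that] in auto)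
  show ?thesis
  proof (rule borel_measurable_LIMSEQ_metric)
    fix n
    have [measurable]: "k n \<in> ?N \<rightarrow>\<^sub>M count_space UNIV" unfolding k_def by (rule measurable_restrict_space1) measurable
    have "(\<lambda>z. f (p n (k n (fst z))) (snd z)) \<in> borel_measurable (?N \<Otimes>\<^sub>M M)"
      by (rule measurable_compose_countable[where f = "\<lambda>j z. f (p n j) (snd z)"])
        (use meas[OF p] in measurable)
    then show "(\<lambda>(t, a). f (p n (k n t)) a) \<in> borel_measurable (?N \<Otimes>\<^sub>M M)" by (simp add: case_prod_beta')
  next
    fix z assume "z \<in> space (?N \<Otimes>\<^sub>M M)"
    then obtain t a where z: "z = (t, a)" "t \<in> {0..t0}" "a \<in> space M" by (auto simp: space_pair_measure space_restrict_space)
    have "(\<lambda>n. f (p n (k n t)) a) \<longlonglongrightarrow> f t a"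
      by (rule continuous_on_tendsto_compose[OF cont[OF z(3)] lim[OF z(2)] z(2)]) (use p in auto)
    then show "(\<lambda>n. case z of (t, a) \<Rightarrow> f (p n (k n t)) a) \<longlonglongrightarrow> (case z of (t, a) \<Rightarrow> f t a)" by (simp add: z(1))
  qed
qed

lemma SUP_continuous_Icc:
  fixes g :: "real \<Rightarrow> real"
  assumes "l < r" "continuous_on {l..r} g"
  shows "(SUP t\<in>{l..r}. ennreal (g t)) = (SUP t\<in>{l<..<r} \<inter> \<rat>. ennreal (g t))"
proof (rule antisym)
  show "(SUP t\<in>{l<..<r} \<inter> \<rat>. ennreal (g t)) \<le> (SUP t\<in>{l..r}. ennreal (g t))"
    by (rule SUP_subset_mono) auto
  let ?s = "SUP t\<in>{l<..<r} \<inter> \<rat>. ennreal (g t)"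
  have "closed {x :: real. ennreal x \<le> ?s}"
    by (intro closed_Collect_le continuous_intros continuous_on_ennreal)
  from continuous_on_closed_Icc_iff[OF assms this] have "\<forall>t\<in>{l..r}. ennreal (g t) \<le> ?s"
    by (auto intro: SUP_upper)
  then show "(SUP t\<in>{l..r}. ennreal (g t)) \<le> ?s" by (auto intro: SUP_least)
qed

lemma borel_measurable_SUP_continuous:
  fixes f :: "real \<Rightarrow> 'a \<Rightarrow> real"
  assumes "l < r" "\<And>a. a \<in> space M \<Longrightarrow> continuous_on {l..r} (\<lambda>t. f t a)"
    and m: "\<And>t. t \<in> {l..r} \<Longrightarrow> f t \<in> borel_measurable M"
  shows "(\<lambda>a. SUP t\<in>{l..r}. ennreal (f t a)) \<in> borel_measurable M"
proof -
  have "(\<lambda>a. SUP t\<in>{l<..<r} \<inter> \<rat>. ennreal (f t a)) \<in> borel_measurable M"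
    using m by (intro borel_measurable_SUP countable_Ioo_Rats measurable_compose[OF _ measurable_ennreal]) auto
  also have "?this \<longleftrightarrow> ?thesis" by (intro measurable_cong) (simp add: SUP_continuous_Icc[OF assms(1,2)])
  finally show ?thesis .
qed

definition Icc_dense :: "real \<Rightarrow> real set" where
  "Icc_dense T = insert 0 (insert T ({0<..<T} \<inter> \<rat>))"

lemma Icc_dense:
  assumes "T > 0"
  shows "countable (Icc_dense T)" "Icc_dense T \<subseteq> {0..T}" "closure (Icc_dense T) = {0..T}" "0 \<in> Icc_dense T" "T \<in> Icc_dense T"
proof -
  show "countable (Icc_dense T)" "Icc_dense T \<subseteq> {0..T}" "0 \<in> Icc_dense T" "T \<in> Icc_dense T"
    using assms countable_Ioo_Rats unfolding Icc_dense_def by auto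
  show "closure (Icc_dense T) = {0..T}"
    unfolding Icc_dense_def closure_insert closure_Ioo_Rats[OF assms] using assms by auto
qed

text \<open>Adaptedness asks for approximation by earlier times, whose values are already measurable
  at \<open>t\<close>. This is why 0 itself belongs to \<open>Icc_dense\<close>: no other element
  could approximate it from the left.\<close>

lemma Icc_dense_from_left:
  assumes "T > 0" "t \<in> {0..T}"
  obtains r where "\<And>n. r n \<in> Icc_dense T" "\<And>n. r n \<le> t" "r \<longlonglongrightarrow> t"
proof (cases "t = 0")
  case True then show ?thesis using that[of "\<lambda>_. 0"] Icc_dense[OF assms(1)] by auto
next
  case False
  then have "closure ({0<..<t} \<inter> \<rat>) = {0..t}" using assms by (intro closure_Ioo_Rats) auto
  then have "t \<in> closure ({0<..<t} \<inter> \<rat>)" using assms by auto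
  then obtain r where "\<And>n. r n \<in> {0<..<t} \<inter> \<rat>" "r \<longlonglongrightarrow> t" unfolding closure_sequential by blast
  then show ?thesis using assms by (intro that[of r]) (auto simp: Icc_dense_def less_imp_le intro: less_le_trans)
qed

lemma continuous_eq_on_dense:
  fixes f g :: "real \<Rightarrow> 'b::t2_space"
  assumes "T > 0" "continuous_on {0..T} f" "continuous_on {0..T} g" "\<And>t. t \<in> Icc_dense T \<Longrightarrow> f t = g t" "t \<in> {0..T}"
  shows "f t = g t"
proof -
  obtain r where r: "\<And>n. r n \<in> Icc_dense T" "r \<longlonglongrightarrow> t" using Icc_dense_from_left[OF assms(1,5)] by metis
  have r': "r n \<in> {0..T}" for n using r(1)[of n] Icc_dense(2)[OF assms(1)] by blast
  have "(\<lambda>n. f (r n)) \<longlonglongrightarrow> f t" "(\<lambda>n. g (r n)) \<longlonglongrightarrow> g t"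
    using r' by (auto intro!: continuous_on_tendsto_compose[OF assms(2) r(2) assms(5)] continuous_on_tendsto_compose[OF assms(3) r(2) assms(5)])
  then show ?thesis using assms(4)[OF r(1)] LIMSEQ_unique by auto
qed

text \<open>A family given only at countably many times extends continuously exactly where it is
  uniformly continuous on them. The result is continuous for every \<open>x\<close>, and it recovers
  any continuous function that \<open>g\<close> samples.\<close>

lemma continuous_extension_from_dense:
  fixes g :: "real \<Rightarrow> 'a \<Rightarrow> 'b::{banach, second_countable_topology}"
  assumes T: "T > 0" and g[measurable]: "\<And>r. r \<in> Icc_dense T \<Longrightarrow> g r \<in> borel_measurable K"
  shows "\<exists>\<eta>. (\<forall>t\<in>{0..T}. \<eta> t \<in> borel_measurable K) \<and> (\<forall>x. continuous_on {0..T} (\<lambda>t. \<eta> t x)) \<and>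
    (\<forall>x\<in>space K. \<forall>h. continuous_on {0..T} h \<and> (\<forall>r\<in>Icc_dense T. g r x = h r) \<longrightarrow> (\<forall>t\<in>{0..T}. \<eta> t x = h t))"
proof -
  define D where "D = Icc_dense T"
  note D = Icc_dense[OF T, folded D_def]
  \<comment> \<open>Uniform continuity with tolerances and moduli of the form
    \<open>1 / real (Suc n)\<close>: only countable quantifiers occur, so the set is
    measurable.\<close>
  define Gd where "Gd = {x \<in> space K. \<forall>k::nat. \<exists>n::nat. \<forall>r\<in>D. \<forall>s\<in>D. dist r s < 1 / real (Suc n) \<longrightarrow> dist (g r x) (g s x) \<le> 1 / real (Suc k)}"
  have Gd_meas: "Gd \<in> sets K"
    unfolding Gd_def
  proof (intro sets.sets_Collect_countable_All sets.sets_Collect_countable_Ex sets.sets_Collect_countable_All' sets.sets_Collect_imp sets.sets_Collect_const D(1))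
    fix k :: nat and r s assume "r \<in> D" "s \<in> D"
    then have [measurable]: "g r \<in> borel_measurable K" "g s \<in> borel_measurable K" using g by (auto simp: D_def)
    show "{x \<in> space K. dist (g r x) (g s x) \<le> 1 / real (Suc k)} \<in> sets K" by measurable
  qed
  have Gd_uc: "x \<in> Gd \<longleftrightarrow> uniformly_continuous_on D (\<lambda>r. g r x)" if "x \<in> space K" for x
  proof
    assume x: "x \<in> Gd"
    show "uniformly_continuous_on D (\<lambda>r. g r x)"
      unfolding uniformly_continuous_on_def
    proof (intro allI impI)
      fix e :: real assume "e > 0"
      then obtain k where k: "1 / real (Suc k) < e" using nat_approx_posE by blast
      obtain n where n: "\<forall>r\<in>D. \<forall>s\<in>D. dist r s < 1 / real (Suc n) \<longrightarrow> dist (g r x) (g s x) \<le> 1 / real (Suc k)"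
        using x unfolding Gd_def by blast
      show "\<exists>d>0. \<forall>x'\<in>D. \<forall>x''\<in>D. dist x'' x' < d \<longrightarrow> dist (g x'' x) (g x' x) < e"
        using n k by (intro exI[of _ "1 / real (Suc n)"]) (auto intro: le_less_trans)
    qed
  next
    assume u: "uniformly_continuous_on D (\<lambda>r. g r x)"
    have "\<exists>n::nat. \<forall>r\<in>D. \<forall>s\<in>D. dist r s < 1 / real (Suc n) \<longrightarrow> dist (g r x) (g s x) \<le> 1 / real (Suc k)" for k :: nat
    proof -
      have "1 / real (Suc k) > 0" by simp
      then obtain d where d: "d > 0" "\<forall>r\<in>D. \<forall>s\<in>D. dist s r < d \<longrightarrow> dist (g s x) (g r x) < 1 / real (Suc k)"
        using u unfolding uniformly_continuous_on_def by meson
      obtain n where "1 / real (Suc n) < d" using nat_approx_posE[OF d(1)] by blast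
      then show ?thesis using d(2) by (intro exI[of _ n]) (force simp: dist_commute)
    qed
    then show "x \<in> Gd" unfolding Gd_def using that by auto
  qed
  have "\<exists>h. uniformly_continuous_on {0..T} h \<and> (\<forall>r\<in>D. h r = g r x)" if x: "x \<in> Gd" for x
  proof -
    have "uniformly_continuous_on D (\<lambda>r. g r x)" using Gd_uc[of x] x by (auto simp: Gd_def)
    from uniformly_continuous_on_extension_on_closure[OF this] D(3) show ?thesis by metis
  qed
  then obtain h where h: "\<And>x. x \<in> Gd \<Longrightarrow> uniformly_continuous_on {0..T} (h x)" "\<And>x r. x \<in> Gd \<Longrightarrow> r \<in> D \<Longrightarrow> h x r = g r x"
    by metis
  \<comment> \<open>The value zero off \<open>Gd\<close> makes the path continuous at every
    point.\<close>
  define \<eta> where "\<eta> t x = (if x \<in> Gd then h x t else 0)" for t x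
  have cont: "continuous_on {0..T} (\<lambda>t. \<eta> t x)" for x
    unfolding \<eta>_def using h(1)[of x] by (cases "x \<in> Gd") (auto intro: uniformly_continuous_imp_continuous)
  have measD: "\<eta> r \<in> borel_measurable K" if "r \<in> D" for r
  proof -
    have "\<eta> r = (\<lambda>x. if x \<in> Gd then g r x else 0)" using h(2) that by (auto simp: \<eta>_def)
    then show ?thesis using Gd_meas g that by (auto simp: D_def intro!: measurable_If_set)
  qed
  have meas: "\<eta> t \<in> borel_measurable K" if t: "t \<in> {0..T}" for t
  proof -
    obtain r where r: "\<And>n. r n \<in> D" "r \<longlonglongrightarrow> t" using Icc_dense_from_left[OF T t] unfolding D_def by metis
    show ?thesis
    proof (rule borel_measurable_LIMSEQ_metric[where f = "\<lambda>n. \<eta> (r n)"])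
      show "\<eta> (r n) \<in> borel_measurable K" for n by (rule measD[OF r(1)])
      have "r n \<in> {0..T}" for n using r(1)[of n] D(2) by blast
      then show "(\<lambda>n. \<eta> (r n) x) \<longlonglongrightarrow> \<eta> t x" for x
        by (intro continuous_on_tendsto_compose[OF cont r(2) t]) simp
    qed
  qed
  have "\<eta> t x = k t" if x: "x \<in> space K" and k: "continuous_on {0..T} k" "\<forall>r\<in>D. g r x = k r" and t: "t \<in> {0..T}" for x k t
  proof -
    have "uniformly_continuous_on D k"
      using compact_uniformly_continuous[OF k(1) compact_Icc] D(2)
      unfolding uniformly_continuous_on_def by (meson subsetD)
    then have "uniformly_continuous_on D (\<lambda>r. g r x)"
      using k(2) unfolding uniformly_continuous_on_def by auto
    then have "x \<in> Gd" using Gd_uc[OF x] by simp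
    then have "\<eta> r x = k r" if "r \<in> D" for r using h(2)[of x r] k(2) that by (simp add: \<eta>_def)
    then show ?thesis by (intro continuous_eq_on_dense[OF T cont k(1) _ t]) (simp add: D_def)
  qed
  then show ?thesis using meas cont by (intro exI[of _ \<eta>]) (auto simp: D_def)
qed

subsection \<open>Path space and laws\<close>

text \<open>Continuous paths with the sigma-algebra of the coordinates, the one in which
  independence of a process is stated. Its link with the uniform topology is
  \<open>countably_based_CS\<close>.\<close>

definition CS :: "real \<Rightarrow> (real \<Rightarrow> 'a::euclidean_space) measure" where
  "CS T = restrict_space (\<Pi>\<^sub>M t\<in>{0..T}. borel) {w. continuous_on {0..T} w}"

lemma space_CS: "space (CS T) = {w \<in> extensional {0..T}. continuous_on {0..T} w}"
  by (auto simp: CS_def space_restrict_space space_PiM PiE_def)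

lemma measurable_CS_eval:
  "t \<in> {0..T} \<Longrightarrow> (\<lambda>w. w t) \<in> borel_measurable (CS T)"
  unfolding CS_def by (intro measurable_restrict_space1 measurable_component_singleton)

lemma measurable_into_CS:
  assumes "\<And>x. x \<in> space N \<Longrightarrow> continuous_on {0..T} (h x)"
    and "\<And>t. t \<in> {0..T} \<Longrightarrow> (\<lambda>x. h x t) \<in> borel_measurable N"
  shows "(\<lambda>x. \<lambda>t\<in>{0..T}. h x t) \<in> N \<rightarrow>\<^sub>M CS T"
  unfolding CS_def
proof (rule measurable_restrict_space2)
  show "(\<lambda>x. \<lambda>t\<in>{0..T}. h x t) \<in> space N \<rightarrow> {w. continuous_on {0..T} w}"
    using assms(1) continuous_on_cong[of "{0..T}" "{0..T}" "restrict (h _) {0..T}" "h _"] by auto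
  show "(\<lambda>x. \<lambda>t\<in>{0..T}. h x t) \<in> N \<rightarrow>\<^sub>M (\<Pi>\<^sub>M t\<in>{0..T}. borel)"
    using assms(2) by (intro measurable_restrict) auto
qed

lemma CS_restrict: "w \<in> space (CS T) \<Longrightarrow> (\<lambda>t\<in>{0..T}. w t) = w"
  by (auto simp: space_CS intro: extensional_restrict)

lemma countably_based_cong:
  assumes "countably_based M X f" and eq: "\<And>a. a \<in> space M \<Longrightarrow> f a = g a"
  shows "countably_based M X g"
proof -
  obtain \<B> where B: "countable \<B>" "\<B> \<subseteq> sets M" "\<And>a. a \<in> space M \<Longrightarrow> f a \<in> topspace X"
    "\<And>a V. a \<in> space M \<Longrightarrow> openin X V \<Longrightarrow> f a \<in> V \<Longrightarrow> \<exists>B\<in>\<B>. a \<in> B \<and> B \<subseteq> f -` V"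
    by (rule countably_basedE[OF assms(1)], rule that)
  show ?thesis
  proof (rule countably_basedI[OF B(1,2)])
    show "g a \<in> topspace X" if "a \<in> space M" for a using B(3)[OF that] eq[OF that] by simp
    fix a V assume a: "a \<in> space M" "openin X V" "g a \<in> V"
    then obtain B where B1: "B \<in> \<B>" "a \<in> B" "B \<subseteq> f -` V" using B(4)[of a V] eq[of a] by auto
    have "B \<subseteq> g -` V"
    proof
      fix x assume x: "x \<in> B"
      then have "x \<in> space M" using B1(1) B(2) sets.sets_into_space[of B M] by auto
      then show "x \<in> g -` V" using x B1(3) eq[of x] by auto
    qed
    then show "\<exists>B\<in>\<B>. a \<in> B \<and> B \<subseteq> g -` V" using B1 by auto
  qed
qed

text \<open>A path is its own restriction, so the tubes apply to the identity. In particular the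
  sigma-algebra of the coordinates contains the Borel sets of the uniform topology.\<close>

lemma countably_based_CS:
  assumes "T > 0" shows "countably_based (CS T) (C_top T) (\<lambda>w. w)"
  by (rule countably_based_cong[OF countably_based_C[OF assms, where f = "\<lambda>w. w"]])
    (auto simp: space_CS CS_restrict intro: measurable_CS_eval)

lemma PiM_into_CS_sets:
  assumes "D \<in> sets (CS T)"
  obtains D' where "D' \<in> sets (\<Pi>\<^sub>M t\<in>{0..T}. borel)" "D = D' \<inter> space (CS T)"
proof -
  obtain D' where D': "D' \<in> sets (\<Pi>\<^sub>M t\<in>{0..T}. borel)" "D = {w. continuous_on {0..T} w} \<inter> D'"
    using assms unfolding CS_def sets_restrict_space by auto
  have "D' \<subseteq> extensional {0..T}" using sets.sets_into_space[OF D'(1)] by (auto simp: space_PiM PiE_def)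
  then have "D = D' \<inter> space (CS T)" using D'(2) by (auto simp: space_CS)
  then show ?thesis using D'(1) that by blast
qed

text \<open>The noise space: the first component is the initial value, the second the driving
  path.\<close>

definition YS :: "real \<Rightarrow> ('b::euclidean_space \<times> (real \<Rightarrow> 'a::euclidean_space)) measure" where
  "YS T = borel \<Otimes>\<^sub>M CS T"

lemma space_YS: "space (YS T) = UNIV \<times> space (CS T)"
  by (simp add: YS_def space_pair_measure)

lemma measurable_YS_fst [measurable]: "fst \<in> borel_measurable (YS T)"
  unfolding YS_def by simp

lemma measurable_YS_snd: "snd \<in> YS T \<rightarrow>\<^sub>M CS T"
  unfolding YS_def by simp

lemma measurable_YS_eval:
  "t \<in> {0..T} \<Longrightarrow> (\<lambda>y. snd y t) \<in> borel_measurable (YS T)"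
  by (rule measurable_compose[OF measurable_YS_snd measurable_CS_eval])

lemma YS_continuous: "y \<in> space (YS T) \<Longrightarrow> continuous_on {0..T} (snd y)"
  by (auto simp: space_YS space_CS)

text \<open>The initial value is known from time 0 on, as in the auxiliary filtration.\<close>

definition YF :: "real \<Rightarrow> real \<Rightarrow> ('b::euclidean_space \<times> (real \<Rightarrow> 'a::euclidean_space)) measure" where
  "YF T = gen_filtration (space (YS T)) (\<lambda>s y. (snd y s, fst y))"

lemma space_YF [simp]: "space (YF T t) = space (YS T)"
  by (simp add: YF_def)

lemma sets_YF_mono: "s \<le> t \<Longrightarrow> sets (YF T s) \<subseteq> sets (YF T t)"
  unfolding YF_def by (rule sets_gen_filtration_mono)

lemma sets_YF_sub: "t \<le> T \<Longrightarrow> sets (YF T t) \<subseteq> sets (YS T)"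
proof -
  assume t: "t \<le> T"
  have "(\<lambda>y. y) \<in> YS T \<rightarrow>\<^sub>M YF T t"
    unfolding YF_def by (rule measurable_into_gen_filtration)
      (use t in \<open>auto intro!: borel_measurable_Pair measurable_YS_eval\<close>)
  show ?thesis
  proof
    fix A assume A: "A \<in> sets (YF T t)"
    then have "A \<subseteq> space (YS T)" using sets.sets_into_space[OF A] by simp
    then show "A \<in> sets (YS T)"
      using measurable_sets[OF \<open>(\<lambda>y. y) \<in> YS T \<rightarrow>\<^sub>M YF T t\<close> A] by (simp add: Int_absorb2)
  qed
qed

lemma measurable_YF_eval:
  assumes "s \<in> {0..t}"
  shows "(\<lambda>y. snd y s) \<in> borel_measurable (YF T t)" "fst \<in> borel_measurable (YF T t)"
proof -
  have "(\<lambda>y. (snd y s, fst y)) \<in> borel_measurable (YF T t)"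
    unfolding YF_def by (rule measurable_gen_filtration[OF assms])
  then have p: "(\<lambda>y. (snd y s, fst y)) \<in> YF T t \<rightarrow>\<^sub>M borel \<Otimes>\<^sub>M borel" by (simp add: borel_prod)
  show "(\<lambda>y. snd y s) \<in> borel_measurable (YF T t)" "fst \<in> borel_measurable (YF T t)"
    using measurable_compose[OF p measurable_fst] measurable_compose[OF p measurable_snd] by (simp_all add: fun_eq_iff cong: measurable_cong)
qed

lemma measurable_mono_source:
  "sets N \<subseteq> sets N' \<Longrightarrow> space N = space N' \<Longrightarrow> f \<in> N \<rightarrow>\<^sub>M K \<Longrightarrow> f \<in> N' \<rightarrow>\<^sub>M K"
  unfolding measurable_def by auto

section \<open>Markov kernels, the completed label space and conditional laws\<close>

text \<open>Completeness of \<open>M\<close> makes preimages of \<open>m\<close>-null sets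
  measurable. Kernels that are measurable only for the completion of \<open>m\<close> can therefore
  be composed with the label.\<close>

lemma label_completion:
  assumes "prob_space M" "complete_measure M" "sets m = sets borel" "v \<in> borel_measurable M" "distr M borel v = m"
  shows "v \<in> M \<rightarrow>\<^sub>M completion m" "distr M (completion m) v = completion m"
proof -
  interpret complete_measure M by fact
  have v: "v \<in> M \<rightarrow>\<^sub>M m" using assms(3,4) by (simp cong: measurable_cong_sets)
  have d: "distr M m v = m" using assms(3,5) distr_cong[OF refl assms(3)] by metis
  show "v \<in> M \<rightarrow>\<^sub>M completion m" by (rule measurable_completion2[OF v]) (simp add: d)
  show "distr M (completion m) v = completion m" using completion_distr_eq[OF v] by (simp add: d)
qed

lemma prob_algebraD:
  assumes "\<kappa> \<in> N \<rightarrow>\<^sub>M prob_algebra K" "u \<in> space N"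
  shows "prob_space (\<kappa> u)" "sets (\<kappa> u) = sets K" "space (\<kappa> u) = space K"
  using measurable_space[OF assms] by (auto simp: space_prob_algebra dest: sets_eq_imp_space_eq)

lemma measurable_emeasure_prob_algebra:
  assumes "\<kappa> \<in> N \<rightarrow>\<^sub>M prob_algebra K" "C \<in> sets K"
  shows "(\<lambda>u. emeasure (\<kappa> u) C) \<in> borel_measurable N" "(\<lambda>u. measure (\<kappa> u) C) \<in> borel_measurable N"
proof -
  show "(\<lambda>u. emeasure (\<kappa> u) C) \<in> borel_measurable N"
    using measurable_compose[OF measurable_prob_algebraD[OF assms(1)] measurable_emeasure_subprob_algebra[OF assms(2)]] .
  then show "(\<lambda>u. measure (\<kappa> u) C) \<in> borel_measurable N"
    unfolding measure_def by measurable
qed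

text \<open>The defining property of the conditional expectation, integrated over the event that the
  label lies in \<open>A\<close>. From here on a conditional law enters only through these joint
  probabilities.\<close>

lemma cond_law_emeasure:
  assumes M: "prob_space M" "complete_measure M" and m: "sets m = sets borel"
    and v: "v \<in> borel_measurable M" "distr M borel v = m"
    and X[measurable]: "X \<in> borel_measurable M" and \<kappa>: "cond_law M m v X \<kappa>"
    and A: "A \<in> sets borel" and C[measurable]: "C \<in> sets borel"
  shows "emeasure M {\<omega> \<in> space M. v \<omega> \<in> A \<and> X \<omega> \<in> C} = (\<integral>\<^sup>+u\<in>A. emeasure (\<kappa> u) C \<partial>completion m)"
proof -
  interpret prob_space M by fact
  note vc = label_completion[OF M m v]
  let ?G = "vimage_algebra (space M) v borel"
  have \<kappa>k: "\<kappa> \<in> completion m \<rightarrow>\<^sub>M prob_algebra borel" using \<kappa> by (simp add: cond_law_def)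
  have sub: "subalgebra M ?G"
    unfolding subalgebra_def using v(1) by (auto simp: sets_vimage_algebra2 measurable_sets)
  interpret S: finite_measure_subalgebra M ?G by unfold_locales (rule sub)
  let ?S = "v -` A \<inter> space M"
  have SG: "?S \<in> sets ?G" using A by (auto simp: sets_vimage_algebra2)
  then have SM[measurable]: "?S \<in> sets M" using sub by (auto simp: subalgebra_def)
  let ?i = "\<lambda>\<omega>. indicator C (X \<omega>) :: real" let ?k = "\<lambda>u. measure (\<kappa> u) C"
  have int: "integrable M ?i" by (rule integrable_const_bound[of _ 1]) auto
  have km[measurable]: "?k \<in> borel_measurable (completion m)" by (rule measurable_emeasure_prob_algebra(2)[OF \<kappa>k]) simp
  have k01: "0 \<le> ?k u" "?k u \<le> 1" for u
    using prob_algebraD(1)[OF \<kappa>k, of u] m sets_eq_imp_space_eq[OF m] by (auto simp: prob_space.prob_le_1)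
  have cm: "prob_space (completion m)" using vc(2) prob_space_distr[OF vc(1)] by metis
  have Am[measurable]: "A \<in> sets (completion m)" using A m by simp
  have "measure M {\<omega> \<in> space M. v \<omega> \<in> A \<and> X \<omega> \<in> C} = (\<integral>\<omega>. indicator {\<omega> \<in> space M. v \<omega> \<in> A \<and> X \<omega> \<in> C} \<omega> \<partial>M)"
    using v(1) A by (simp add: measurable_sets)
  also have "\<dots> = (\<integral>\<omega>\<in>?S. ?i \<omega> \<partial>M)"
    unfolding set_lebesgue_integral_def by (intro Bochner_Integration.integral_cong) (auto simp: indicator_def)
  also have "\<dots> = (\<integral>\<omega>\<in>?S. real_cond_exp M ?G ?i \<omega> \<partial>M)" by (rule S.real_cond_exp_intA[OF int SG])
  also have "\<dots> = (\<integral>\<omega>\<in>?S. ?k (v \<omega>) \<partial>M)"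
  proof -
    have "AE \<omega> in M. real_cond_exp M ?G ?i \<omega> = ?k (v \<omega>)" using \<kappa> C by (simp add: cond_law_def)
    moreover have [measurable]: "(\<lambda>\<omega>. ?k (v \<omega>)) \<in> borel_measurable M" by (rule measurable_compose[OF vc(1) km])
    ultimately show ?thesis unfolding set_lebesgue_integral_def
      by (intro integral_cong_AE) auto
  qed
  also have "\<dots> = (\<integral>\<omega>. (\<lambda>u. indicator A u * ?k u) (v \<omega>) \<partial>M)"
    unfolding set_lebesgue_integral_def by (intro Bochner_Integration.integral_cong) (auto simp: indicator_def)
  also have "\<dots> = (\<integral>u. indicator A u * ?k u \<partial>distr M (completion m) v)"
    by (rule integral_distr[OF vc(1), symmetric]) measurable
  also have "\<dots> = (\<integral>u. indicator A u * ?k u \<partial>completion m)" by (simp only: vc(2))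
  finally have "emeasure M {\<omega> \<in> space M. v \<omega> \<in> A \<and> X \<omega> \<in> C} = ennreal (\<integral>u. indicator A u * ?k u \<partial>completion m)"
    by (simp add: emeasure_eq_measure)
  also have "\<dots> = (\<integral>\<^sup>+u. ennreal (indicator A u * ?k u) \<partial>completion m)"
  proof (rule nn_integral_eq_integral[symmetric])
    interpret c: prob_space "completion m" by fact
    show "integrable (completion m) (\<lambda>u. indicator A u * ?k u)"
      by (rule c.integrable_const_bound[of _ 1]) (use k01 in \<open>auto simp: indicator_def\<close>)
  qed (use k01 in auto)
  also have "\<dots> = (\<integral>\<^sup>+u\<in>A. emeasure (\<kappa> u) C \<partial>completion m)"
  proof (rule nn_integral_cong)
    fix u assume "u \<in> space (completion m)"
    then interpret k: prob_space "\<kappa> u" using prob_algebraD(1)[OF \<kappa>k] by blast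
    show "ennreal (indicator A u * ?k u) = emeasure (\<kappa> u) C * indicator A u"
      by (simp add: k.emeasure_eq_measure indicator_def)
  qed
  finally show ?thesis .
qed

section \<open>The joint law of label, initial value and noise\<close>

locale aux_setting =
  fixes T :: real and m :: "'u::polish_space measure" and law_ini :: "'u \<Rightarrow> (real^'n::finite) measure"
    and M :: "'w measure" and B :: "real \<Rightarrow> 'w \<Rightarrow> real^'d::finite" and ini :: "'w \<Rightarrow> real^'n" and v :: "'w \<Rightarrow> 'u"
  assumes T: "T > 0" and prob_m: "prob_space m" and sets_m: "sets m = sets borel"
    and law_kernel: "law_ini \<in> completion m \<rightarrow>\<^sub>M prob_algebra borel"
    and aux: "aux_space T m law_ini M B ini v"
begin

sublocale prob_space M using aux by (simp add: aux_space_def)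
sublocale complete_measure M using aux by (simp add: aux_space_def)

abbreviation path :: "'w \<Rightarrow> real \<Rightarrow> real^'d" where "path \<omega> \<equiv> \<lambda>t\<in>{0..T}. B t \<omega>"

definition W :: "(real \<Rightarrow> real^'d) measure" where "W = distr M (CS T) path"
definition \<nu> :: "'u \<Rightarrow> ((real^'n) \<times> (real \<Rightarrow> real^'d)) measure" where "\<nu> u = law_ini u \<Otimes>\<^sub>M W"
definition \<xi> :: "'w \<Rightarrow> 'u \<times> (real^'n) \<times> (real \<Rightarrow> real^'d)" where "\<xi> \<omega> = (v \<omega>, ini \<omega>, path \<omega>)"
text \<open>Only the measurable sets of this space are used; the law of \<open>\<xi>\<close> on it
  is described by \<open>nn_integral_disintegration\<close>.\<close>

definition Xi :: "('u \<times> (real^'n) \<times> (real \<Rightarrow> real^'d)) measure" where "Xi = m \<Otimes>\<^sub>M YS T"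

lemma space_m [simp]: "space m = UNIV" using sets_eq_imp_space_eq[OF sets_m] by simp

lemma bm: "brownian_motion T M (gen_filtration (space M) B) B" using aux by (simp add: aux_space_def)
lemma B_continuous: "\<omega> \<in> space M \<Longrightarrow> continuous_on {0..T} (\<lambda>t. B t \<omega>)"
  using bm by (simp add: brownian_motion_def)

lemma indep_rv_ini: "indep_rv M (\<Pi>\<^sub>M t\<in>{0..T}. borel) path borel (\<lambda>\<omega>. (ini \<omega>, v \<omega>))"
  using aux by (simp add: aux_space_def indep_process_def)

lemma ini_v_measurable: "(\<lambda>\<omega>. (ini \<omega>, v \<omega>)) \<in> borel_measurable M"
  using indep_rv_ini by (simp add: indep_rv_def)
lemma ini_measurable [measurable]: "ini \<in> borel_measurable M"
  and v_measurable [measurable]: "v \<in> borel_measurable M"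
proof -
  have "(\<lambda>\<omega>. (ini \<omega>, v \<omega>)) \<in> M \<rightarrow>\<^sub>M borel \<Otimes>\<^sub>M borel" using ini_v_measurable by (simp add: borel_prod)
  from measurable_compose[OF this measurable_fst] measurable_compose[OF this measurable_snd]
  show "ini \<in> borel_measurable M" "v \<in> borel_measurable M" by simp_all
qed
lemma v_measurable_m [measurable]: "v \<in> M \<rightarrow>\<^sub>M m"
  using v_measurable sets_m by (simp cong: measurable_cong_sets)
lemma distr_v: "distr M borel v = m" using aux by (simp add: aux_space_def)

lemma B_measurable: "t \<in> {0..T} \<Longrightarrow> B t \<in> borel_measurable M"
proof -
  assume t: "t \<in> {0..T}"
  have "path \<in> M \<rightarrow>\<^sub>M (\<Pi>\<^sub>M t\<in>{0..T}. borel)" using indep_rv_ini by (simp add: indep_rv_def)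
  from measurable_compose[OF this measurable_component_singleton[OF t]] t show ?thesis by simp
qed

lemma path_measurable [measurable]: "path \<in> M \<rightarrow>\<^sub>M CS T"
  by (rule measurable_into_CS[OF B_continuous B_measurable])

lemma \<xi>_measurable [measurable]: "\<xi> \<in> M \<rightarrow>\<^sub>M Xi"
  unfolding \<xi>_def Xi_def YS_def by measurable

lemma prob_W: "prob_space W" unfolding W_def by (rule prob_space_distr) simp
lemma sets_W [simp, measurable_cong]: "sets W = sets (CS T)" by (simp add: W_def)

lemma W_kernel: "(\<lambda>u. W) \<in> completion m \<rightarrow>\<^sub>M prob_algebra (CS T)"
  by (rule measurable_const) (simp add: space_prob_algebra prob_W)

lemma \<nu>_kernel: "\<nu> \<in> completion m \<rightarrow>\<^sub>M prob_algebra (YS T)"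
  unfolding \<nu>_def YS_def by (rule measurable_pair_prob[OF law_kernel W_kernel])

lemma prob_law: "prob_space (law_ini u)" and sets_law [simp, measurable_cong]: "sets (law_ini u) = sets borel"
  using prob_algebraD[OF law_kernel, of u] by simp_all
lemma prob_\<nu>: "prob_space (\<nu> u)" and sets_\<nu> [simp, measurable_cong]: "sets (\<nu> u) = sets (YS T)"
  and space_\<nu> [simp]: "space (\<nu> u) = space (YS T)"
  using prob_algebraD[OF \<nu>_kernel, of u] by simp_all

lemma emeasure_v_ini:
  assumes "A \<in> sets m" "C \<in> sets borel"
  shows "emeasure M {\<omega> \<in> space M. v \<omega> \<in> A \<and> ini \<omega> \<in> C} = (\<integral>\<^sup>+u\<in>A. emeasure (law_ini u) C \<partial>completion m)"
  using cond_law_emeasure[of M m v ini law_ini A C] aux assms sets_m prob_space_axioms complete_measure_axioms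
  by (simp add: aux_space_def)

definition R0 :: "('u \<times> (real^'n)) measure" where "R0 = distr M (m \<Otimes>\<^sub>M borel) (\<lambda>\<omega>. (v \<omega>, ini \<omega>))"

lemma law_pair_kernel:
  "(\<lambda>u. distr (law_ini u) (m \<Otimes>\<^sub>M borel) (Pair u)) \<in> completion m \<rightarrow>\<^sub>M prob_algebra (m \<Otimes>\<^sub>M borel)"
proof (rule measurable_distr_prob_space2[OF law_kernel])
  have "(\<lambda>z. (fst z, snd z)) \<in> completion m \<Otimes>\<^sub>M borel \<rightarrow>\<^sub>M m \<Otimes>\<^sub>M borel"
    by (intro measurable_Pair measurable_compose[OF measurable_fst] measurable_completion) simp_all
  then show "(\<lambda>(x, y). (x, y)) \<in> completion m \<Otimes>\<^sub>M borel \<rightarrow>\<^sub>M m \<Otimes>\<^sub>M borel" by (simp add: case_prod_beta')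
qed

text \<open>Both measures agree on rectangles by \<open>emeasure_v_ini\<close>, and rectangles are a
  generator stable under intersection.\<close>

lemma R0_eq: "R0 = completion m \<bind> (\<lambda>u. distr (law_ini u) (m \<Otimes>\<^sub>M borel) (Pair u))"
proof (rule measure_eqI_generator_eq[OF Int_stable_pair_measure_generator[of m borel] pair_measure_closed[of m borel]])
  let ?E = "{A \<times> C |A C. A \<in> sets m \<and> C \<in> sets (borel :: (real^'n) measure)}"
  let ?K = "\<lambda>u. distr (law_ini u) (m \<Otimes>\<^sub>M borel) (Pair u)"
  note k = measurable_prob_algebraD[OF law_pair_kernel]
  show "sets R0 = sigma_sets (space m \<times> space borel) ?E" by (simp add: R0_def sets_pair_measure)
  show "sets (completion m \<bind> ?K) = sigma_sets (space m \<times> space borel) ?E"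
    by (subst sets_bind[where N = "m \<Otimes>\<^sub>M borel"]) (simp_all add: sets_pair_measure)
  show "range (\<lambda>i. UNIV \<times> UNIV) \<subseteq> ?E" using sets.top[of m] by (auto intro!: exI[of _ UNIV])
  show "(\<Union>i::nat. UNIV \<times> UNIV) = space m \<times> space borel" by simp
  show "emeasure R0 (UNIV \<times> UNIV) \<noteq> \<infinity>" for i :: nat
    using prob_space.emeasure_le_1[OF prob_space_distr, of "\<lambda>\<omega>. (v \<omega>, ini \<omega>)" "m \<Otimes>\<^sub>M borel" "UNIV \<times> UNIV"]
    by (auto simp: R0_def top_unique)
  fix E assume "E \<in> ?E"
  then obtain A C where E: "E = A \<times> C" and [measurable]: "A \<in> sets m" "C \<in> sets borel" by auto
  have "emeasure R0 E = emeasure M {\<omega> \<in> space M. v \<omega> \<in> A \<and> ini \<omega> \<in> C}"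
    unfolding R0_def E by (subst emeasure_distr) (auto intro!: arg_cong[where f = "emeasure M"])
  also have "\<dots> = (\<integral>\<^sup>+u\<in>A. emeasure (law_ini u) C \<partial>completion m)" by (rule emeasure_v_ini) simp_all
  also have "\<dots> = (\<integral>\<^sup>+u. emeasure (?K u) E \<partial>completion m)"
  proof (rule nn_integral_cong)
    fix u
    have "Pair u \<in> law_ini u \<rightarrow>\<^sub>M m \<Otimes>\<^sub>M borel" by (rule measurable_Pair) (auto cong: measurable_cong_sets)
    then have "emeasure (?K u) E = emeasure (law_ini u) (Pair u -` E \<inter> space (law_ini u))"
      by (rule emeasure_distr) (simp add: E)
    also have "Pair u -` E \<inter> space (law_ini u) = (if u \<in> A then C else {})"
      using sets_eq_imp_space_eq[OF sets_law[of u]] by (auto simp: E)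
    finally show "emeasure (law_ini u) C * indicator A u = emeasure (?K u) E" by auto
  qed
  also have "\<dots> = emeasure (completion m \<bind> ?K) E"
    by (rule emeasure_bind[symmetric, OF _ k]) (simp_all add: E)
  finally show "emeasure R0 E = emeasure (completion m \<bind> ?K) E" .
qed

text \<open>Independence of the path from the pair of initial value and label says that the joint
  law is a product on rectangles. The work lies in moving events between the sigma-algebras used
  here and those in which independence is stated.\<close>

lemma R0_W_eq: "distr M ((m \<Otimes>\<^sub>M borel) \<Otimes>\<^sub>M CS T) (\<lambda>\<omega>. ((v \<omega>, ini \<omega>), path \<omega>)) = R0 \<Otimes>\<^sub>M W"
proof (rule pair_measure_eqI[symmetric])
  have pR: "prob_space R0" unfolding R0_def by (rule prob_space_distr) simp
  show "sigma_finite_measure R0" "sigma_finite_measure W"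
    using pR prob_W by (auto intro: prob_space_imp_sigma_finite)
  show "sets (R0 \<Otimes>\<^sub>M W) = sets (distr M ((m \<Otimes>\<^sub>M borel) \<Otimes>\<^sub>M CS T) (\<lambda>\<omega>. ((v \<omega>, ini \<omega>), path \<omega>)))"
    by (simp add: R0_def W_def cong: sets_pair_measure_cong)
  fix E D assume E: "E \<in> sets R0" and D: "D \<in> sets W"
  then have [measurable]: "E \<in> sets (m \<Otimes>\<^sub>M borel)" "D \<in> sets (CS T)" by (auto simp: R0_def)
  obtain D' where D': "D' \<in> sets (\<Pi>\<^sub>M t\<in>{0..T}. borel)" "D = D' \<inter> space (CS T)"
    by (rule PiM_into_CS_sets[of D T]) simp_all
  let ?a = "path -` D \<inter> space M" let ?b = "(\<lambda>\<omega>. (v \<omega>, ini \<omega>)) -` E \<inter> space M"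
  \<comment> \<open>Independence refers to the product sigma-algebra over all functions of time.
    Since \<open>path\<close> takes only continuous values, an event of \<open>CS T\<close> and the
    product set it is cut from have the same preimage.\<close>
  have "?a = path -` D' \<inter> space M" using D'(2) measurable_space[OF path_measurable] by auto
  then have a: "?a \<in> sets (vimage_algebra (space M) path (\<Pi>\<^sub>M t\<in>{0..T}. borel))"
    using D'(1) by (auto simp: sets_vimage_algebra intro!: sigma_sets.Basic)
  have sw: "(\<lambda>p. (snd p, fst p)) \<in> borel \<Otimes>\<^sub>M borel \<rightarrow>\<^sub>M m \<Otimes>\<^sub>M (borel :: (real^'n) measure)"
    using sets_m by (intro measurable_Pair) (auto cong: measurable_cong_sets)
  let ?E' = "(\<lambda>p. (snd p, fst p)) -` E \<inter> space borel"
  have "?b = (\<lambda>\<omega>. (ini \<omega>, v \<omega>)) -` ?E' \<inter> space M" by (auto simp: space_pair_measure)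
  moreover have "?E' \<in> sets borel" using measurable_sets[OF sw[unfolded borel_prod], of E] by simp
  ultimately have b: "?b \<in> sets (vimage_algebra (space M) (\<lambda>\<omega>. (ini \<omega>, v \<omega>)) borel)"
    unfolding sets_vimage_algebra by (intro sigma_sets.Basic) blast
  have "prob (?a \<inter> ?b) = prob ?a * prob ?b"
    using indep_rv_ini a b unfolding indep_rv_def by (intro indep_setD) auto
  moreover have "(\<lambda>\<omega>. ((v \<omega>, ini \<omega>), path \<omega>)) -` (E \<times> D) \<inter> space M = ?a \<inter> ?b" by auto
  ultimately show "emeasure R0 E * emeasure W D =
      emeasure (distr M ((m \<Otimes>\<^sub>M borel) \<Otimes>\<^sub>M CS T) (\<lambda>\<omega>. ((v \<omega>, ini \<omega>), path \<omega>))) (E \<times> D)"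
    unfolding R0_def W_def by (simp add: emeasure_distr emeasure_eq_measure ennreal_mult mult.commute)
qed

lemma measurable_section: "f \<in> Xi \<rightarrow>\<^sub>M K \<Longrightarrow> (\<lambda>y. f (u, y)) \<in> YS T \<rightarrow>\<^sub>M K"
  unfolding Xi_def by (rule measurable_compose[OF measurable_Pair1']) auto

text \<open>Fubini for the product with \<open>W\<close>, followed by the kernel form of the joint
  law of label and initial value. Every passage to the fibres rests on this identity: null sets,
  laws, moments and time integrals.\<close>

lemma nn_integral_disintegration:
  assumes f[measurable]: "f \<in> borel_measurable Xi"
  shows "(\<integral>\<^sup>+\<omega>. f (\<xi> \<omega>) \<partial>M) = (\<integral>\<^sup>+u. \<integral>\<^sup>+y. f (u, y) \<partial>\<nu> u \<partial>completion m)"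
proof -
  have [measurable]: "f \<in> borel_measurable (m \<Otimes>\<^sub>M borel \<Otimes>\<^sub>M CS T)" using f by (simp add: Xi_def YS_def)
  have pR: "prob_space R0" unfolding R0_def by (rule prob_space_distr) simp
  interpret W: prob_space W by (rule prob_W)
  let ?g = "\<lambda>z. f (fst (fst z), snd (fst z), snd z)"
  have sR[measurable_cong]: "sets R0 = sets (m \<Otimes>\<^sub>M borel)" by (simp add: R0_def)
  have "(\<integral>\<^sup>+\<omega>. f (\<xi> \<omega>) \<partial>M) = (\<integral>\<^sup>+\<omega>. ?g ((v \<omega>, ini \<omega>), path \<omega>) \<partial>M)" by (simp add: \<xi>_def)
  also have "\<dots> = (\<integral>\<^sup>+z. ?g z \<partial>distr M ((m \<Otimes>\<^sub>M borel) \<Otimes>\<^sub>M CS T) (\<lambda>\<omega>. ((v \<omega>, ini \<omega>), path \<omega>)))"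
    by (rule nn_integral_distr[symmetric]) measurable
  also have "\<dots> = (\<integral>\<^sup>+z. ?g z \<partial>(R0 \<Otimes>\<^sub>M W))" by (simp only: R0_W_eq)
  also have "\<dots> = (\<integral>\<^sup>+r. \<integral>\<^sup>+w. ?g (r, w) \<partial>W \<partial>R0)" by (rule W.nn_integral_fst[symmetric]) measurable
  also have "\<dots> = (\<integral>\<^sup>+u. \<integral>\<^sup>+r. (\<integral>\<^sup>+w. ?g (r, w) \<partial>W) \<partial>distr (law_ini u) (m \<Otimes>\<^sub>M borel) (Pair u) \<partial>completion m)"
    unfolding R0_eq by (rule nn_integral_bind[OF _ measurable_prob_algebraD[OF law_pair_kernel]]) measurable
  also have "\<dots> = (\<integral>\<^sup>+u. \<integral>\<^sup>+c. (\<integral>\<^sup>+w. ?g ((u, c), w) \<partial>W) \<partial>law_ini u \<partial>completion m)"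
  proof (rule nn_integral_cong)
    fix u
    have "Pair u \<in> law_ini u \<rightarrow>\<^sub>M m \<Otimes>\<^sub>M borel" by (rule measurable_Pair) (auto cong: measurable_cong_sets)
    then show "(\<integral>\<^sup>+r. (\<integral>\<^sup>+w. ?g (r, w) \<partial>W) \<partial>distr (law_ini u) (m \<Otimes>\<^sub>M borel) (Pair u)) = (\<integral>\<^sup>+c. (\<integral>\<^sup>+w. ?g ((u, c), w) \<partial>W) \<partial>law_ini u)"
      by (rule nn_integral_distr) measurable
  qed
  also have "\<dots> = (\<integral>\<^sup>+u. \<integral>\<^sup>+y. f (u, y) \<partial>\<nu> u \<partial>completion m)"
  proof (rule nn_integral_cong)
    fix u
    have "(\<lambda>y. f (u, y)) \<in> borel_measurable (borel \<Otimes>\<^sub>M CS T)" using measurable_section[OF f] by (simp add: YS_def)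
    then have "(\<lambda>y. f (u, y)) \<in> borel_measurable (law_ini u \<Otimes>\<^sub>M W)" by (simp cong: measurable_cong_sets sets_pair_measure_cong)
    from W.nn_integral_fst[OF this] show "(\<integral>\<^sup>+c. (\<integral>\<^sup>+w. ?g ((u, c), w) \<partial>W) \<partial>law_ini u) = (\<integral>\<^sup>+y. f (u, y) \<partial>\<nu> u)"
      by (simp add: \<nu>_def)
  qed
  finally show ?thesis .
qed

lemma measurable_nn_integral_\<nu>:
  assumes "f \<in> borel_measurable Xi"
  shows "(\<lambda>u. \<integral>\<^sup>+y. f (u, y) \<partial>\<nu> u) \<in> borel_measurable (completion m)"
proof (rule nn_integral_measurable_subprob_algebra2[OF _ measurable_prob_algebraD[OF \<nu>_kernel]])
  have "(\<lambda>z. (fst z, snd z)) \<in> completion m \<Otimes>\<^sub>M YS T \<rightarrow>\<^sub>M m \<Otimes>\<^sub>M YS T"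
    by (intro measurable_Pair measurable_compose[OF measurable_fst] measurable_completion) simp_all
  then have "(\<lambda>z. f (fst z, snd z)) \<in> borel_measurable (completion m \<Otimes>\<^sub>M YS T)"
    by (rule measurable_compose) (use assms in \<open>simp add: Xi_def\<close>)
  then show "(\<lambda>(u, y). f (u, y)) \<in> borel_measurable (completion m \<Otimes>\<^sub>M YS T)" by (simp add: case_prod_beta')
qed

text \<open>The indicator of the exceptional set has integral zero, hence integral zero on almost
  every fibre. Measurability of \<open>P\<close> on \<open>Xi\<close> is the price, which is why
  conditions on all times are first brought into countable form.\<close>

lemma AE_disintegration:
  assumes P: "Measurable.pred Xi P" and ae: "AE \<omega> in M. P (\<xi> \<omega>)"
  shows "AE u in completion m. AE y in \<nu> u. P (u, y)"
proof -
  let ?f = "\<lambda>x. indicator {x \<in> space Xi. \<not> P x} x :: ennreal"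
  have S[measurable]: "{x \<in> space Xi. \<not> P x} \<in> sets Xi" using P by measurable
  have f: "?f \<in> borel_measurable Xi" by measurable
  have "(\<integral>\<^sup>+\<omega>. ?f (\<xi> \<omega>) \<partial>M) = 0"
    using ae measurable_compose[OF \<xi>_measurable f] by (subst nn_integral_0_iff_AE) (auto elim!: eventually_mono)
  then have "(\<integral>\<^sup>+u. \<integral>\<^sup>+y. ?f (u, y) \<partial>\<nu> u \<partial>completion m) = 0" by (simp only: nn_integral_disintegration[OF f])
  then have "AE u in completion m. (\<integral>\<^sup>+y. ?f (u, y) \<partial>\<nu> u) = 0"
    using measurable_nn_integral_\<nu>[OF f] by (simp add: nn_integral_0_iff_AE)
  then show ?thesis
  proof eventually_elim
    case (elim u)
    have "(\<lambda>y. ?f (u, y)) \<in> borel_measurable (\<nu> u)" using measurable_section[OF f] by (simp cong: measurable_cong_sets)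
    with elim have "AE y in \<nu> u. ?f (u, y) = 0" by (simp add: nn_integral_0_iff_AE)
    with AE_space show ?case
      by eventually_elim (auto simp: Xi_def space_pair_measure split: split_indicator_asm)
  qed
qed

end

subsection \<open>Indefinite integrals and the precise representative\<close>

lemma sq_int_zero: "(\<lambda>_. 0) \<in> sq_int T"
  by (simp add: sq_int_def)

lemma set_integrable_sq_int:
  assumes "z \<in> sq_int T" shows "set_integrable lborel {0..T} z"
proof -
  interpret finite_measure "Icc_measure T" by (rule finite_measure_Icc)
  note z = sq_intD[OF assms]
  have [measurable]: "z \<in> borel_measurable (Icc_measure T)" by (rule z(1))
  have i2: "integrable (Icc_measure T) (\<lambda>t. (norm (z t))\<^sup>2)"
    using z(2) by (intro integrableI_bounded) auto
  have "integrable (Icc_measure T) z"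
  proof (rule Bochner_Integration.integrable_bound[of _ "\<lambda>t. 1 + (norm (z t))\<^sup>2"])
    show "integrable (Icc_measure T) (\<lambda>t. 1 + (norm (z t))\<^sup>2)" using i2 by simp
    have "norm x \<le> 1 + (norm x)\<^sup>2" for x :: 'a
    proof -
      have "0 \<le> (norm x - 1)\<^sup>2" by simp
      then show ?thesis by (simp add: power2_diff) (smt (verit) norm_ge_zero)
    qed
    then show "AE t in Icc_measure T. norm (z t) \<le> norm (1 + (norm (z t))\<^sup>2)" by (intro AE_I2) (simp add: add_nonneg_nonneg)
  qed simp
  then show ?thesis by (subst (asm) integrable_restrict_space) (simp_all add: set_integrable_def)
qed

lemma LINT_Icc_diff:
  fixes z :: "real \<Rightarrow> 'a::euclidean_space"
  assumes z: "set_integrable lborel {0..T} z" and r: "0 \<le> r" "r \<le> t" "t \<le> T"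
  shows "(LINT s:{r..t}|lborel. z s) = (LINT s:{0..t}|lborel. z s) - (LINT s:{0..r}|lborel. z s)"
proof -
  have i: "set_integrable lborel S z" if "S \<subseteq> {0..T}" "S \<in> sets lborel" for S
    by (rule set_integrable_subset[OF z that(2,1)])
  have "z integrable_on {0..t}" using set_borel_integral_eq_integral(1)[OF i[of "{0..t}"]] r by auto
  from Henstock_Kurzweil_Integration.integral_combine[OF r(1,2) this] show ?thesis
    using r by (simp add: set_borel_integral_eq_integral(2)[OF i] eq_diff_eq add.commute)
qed

lemma continuous_on_LINT:
  fixes z :: "real \<Rightarrow> 'a::euclidean_space"
  assumes z: "set_integrable lborel {0..T} z"
  shows "continuous_on {0..T} (\<lambda>t. LINT s:{0..t}|lborel. z s)"
proof -
  have "continuous_on {0..T} (\<lambda>t. integral {0..t} z)"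
    by (rule indefinite_integral_continuous_1) (rule set_borel_integral_eq_integral(1)[OF z])
  moreover have "(LINT s:{0..t}|lborel. z s) = integral {0..t} z" if "t \<in> {0..T}" for t
    by (rule set_borel_integral_eq_integral(2), rule set_integrable_subset[OF z]) (use that in auto)
  ultimately show ?thesis
    using continuous_on_cong[OF refl, of "{0..T}" "\<lambda>t. LINT s:{0..t}|lborel. z s" "\<lambda>t. integral {0..t} z"] by blast
qed

text \<open>The formula of \<open>precise\<close> written for a primitive \<open>A\<close> instead
  of a class: the lower limit of difference quotients from the left, coordinate by coordinate. In
  this form it is a functional of a continuous path.\<close>

definition left_density :: "(real \<Rightarrow> 'a::euclidean_space) \<Rightarrow> real \<Rightarrow> 'a" where
  "left_density A t = (\<Sum>b\<in>Basis. real_of_ereal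
     (Liminf (at_right 0) (\<lambda>\<epsilon>. ereal (1 / \<epsilon> * ((A t - A (max (t - \<epsilon>) 0)) \<bullet> b)))) *\<^sub>R b)"

lemma eventually_at_right_0I: "(\<And>\<epsilon>::real. 0 < \<epsilon> \<Longrightarrow> P \<epsilon>) \<Longrightarrow> eventually P (at_right 0)"
  unfolding eventually_at_right[OF zero_less_one] by (intro exI[of _ 1]) auto

lemma left_density_const: "left_density (\<lambda>_. c) t = 0"
  unfolding left_density_def by (simp add: zero_ereal_def[symmetric] Liminf_const trivial_limit_at_right_real)

text \<open>Averages over an interval do not see the choice of a representative, and the average
  over the interval behind \<open>t\<close> is a difference quotient of the primitive.\<close>

lemma precise_L2_class:
  fixes z :: "real \<Rightarrow> 'a::euclidean_space"
  assumes z: "z \<in> sq_int T" and t: "t \<in> {0..T}"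
  shows "precise (L2_class T z) t = left_density (\<lambda>t. LINT s:{0..t}|lborel. z s) t"
  unfolding precise_def left_density_def
proof (intro sum.cong refl arg_cong2[where f = "(*\<^sub>R)"] arg_cong[where f = real_of_ereal] Liminf_eq eventually_at_right_0I)
  fix b :: 'a and \<epsilon> :: real assume "0 < \<epsilon>"
  define r where "r = max (t - \<epsilon>) 0"
  have r: "0 \<le> r" "r \<le> t" "t \<le> T" using t \<open>0 < \<epsilon>\<close> by (auto simp: r_def)
  let ?z = "L2_repr (L2_class T z)"
  note zi = set_integrable_sq_int[OF z] and zi' = set_integrable_sq_int[OF L2_repr_class(1)[OF z]]
  have ae: "AE s in lborel. s \<in> {0..T} \<longrightarrow> ?z s = z s"
    using L2_repr_class(2)[OF z] by (subst (asm) AE_restrict_space_iff) auto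
  have zr: "set_integrable lborel {r..t} z" "set_integrable lborel {r..t} ?z"
    by (rule set_integrable_subset[OF zi], use r in auto) (rule set_integrable_subset[OF zi'], use r in auto)
  have "(LINT s:{r..t}|lborel. ?z s \<bullet> b) = (LINT s:{r..t}|lborel. z s \<bullet> b)"
    unfolding set_lebesgue_integral_def
  proof (rule integral_cong_AE)
    show "(\<lambda>x. indicat_real {r..t} x *\<^sub>R (?z x \<bullet> b)) \<in> borel_measurable lborel"
      using borel_measurable_inner[OF borel_measurable_integrable[OF zr(2)[unfolded set_integrable_def]] borel_measurable_const[of b]]
      by (simp only: inner_scaleR_left real_scaleR_def)
    show "(\<lambda>x. indicat_real {r..t} x *\<^sub>R (z x \<bullet> b)) \<in> borel_measurable lborel"
      using borel_measurable_inner[OF borel_measurable_integrable[OF zr(1)[unfolded set_integrable_def]] borel_measurable_const[of b]]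
      by (simp only: inner_scaleR_left real_scaleR_def)
    show "AE x in lborel. indicat_real {r..t} x *\<^sub>R (?z x \<bullet> b) = indicat_real {r..t} x *\<^sub>R (z x \<bullet> b)"
      using ae by eventually_elim (use r in \<open>auto simp: indicator_def\<close>)
  qed
  also have "\<dots> = (LINT s:{r..t}|lborel. z s) \<bullet> b"
    using zr(1) unfolding set_lebesgue_integral_def set_integrable_def
    by (subst integral_inner_left[symmetric]) simp_all
  also have "\<dots> = ((LINT s:{0..t}|lborel. z s) - (LINT s:{0..r}|lborel. z s)) \<bullet> b"
    by (simp only: LINT_Icc_diff[OF zi r])
  finally show "ereal (1 / \<epsilon> * (LINT s:{max (t - \<epsilon>) 0..t}|lborel. ?z s \<bullet> b)) =
      ereal (1 / \<epsilon> * (((LINT s:{0..t}|lborel. z s) - (LINT s:{0..max (t - \<epsilon>) 0}|lborel. z s)) \<bullet> b))"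
    by (simp only: r_def)
qed

text \<open>Continuity in the step width lets rational widths decide each infimum, so that the lower
  limit becomes a countable expression and stays measurable in further variables.\<close>

lemma Liminf_at_right_0_countable:
  fixes g :: "real \<Rightarrow> real"
  assumes g: "continuous_on {0<..} g"
  shows "Liminf (at_right 0) (\<lambda>\<epsilon>. ereal (g \<epsilon>)) = (SUP n. INF \<epsilon>\<in>{0<..<1 / real (Suc n)} \<inter> \<rat>. ereal (g \<epsilon>))"
proof (rule antisym)
  show "Liminf (at_right 0) (\<lambda>\<epsilon>. ereal (g \<epsilon>)) \<le> (SUP n. INF \<epsilon>\<in>{0<..<1 / real (Suc n)} \<inter> \<rat>. ereal (g \<epsilon>))"
    unfolding Liminf_def
  proof (rule SUP_least)
    fix P assume "P \<in> {P. eventually P (at_right (0::real))}"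
    then obtain d where d: "d > 0" "\<And>x. 0 < x \<Longrightarrow> x < d \<Longrightarrow> P x"
      unfolding mem_Collect_eq eventually_at_right[OF zero_less_one] by auto
    obtain n where n: "1 / real (Suc n) < d" using nat_approx_posE[OF d(1)] by blast
    have "Inf ((\<lambda>\<epsilon>. ereal (g \<epsilon>)) ` Collect P) \<le> (INF \<epsilon>\<in>{0<..<1 / real (Suc n)} \<inter> \<rat>. ereal (g \<epsilon>))"
      by (rule INF_superset_mono) (use d n in auto)
    also have "\<dots> \<le> (SUP n. INF \<epsilon>\<in>{0<..<1 / real (Suc n)} \<inter> \<rat>. ereal (g \<epsilon>))" by (rule SUP_upper) simp
    finally show "Inf ((\<lambda>\<epsilon>. ereal (g \<epsilon>)) ` Collect P) \<le> (SUP n. INF \<epsilon>\<in>{0<..<1 / real (Suc n)} \<inter> \<rat>. ereal (g \<epsilon>))" .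
  qed
  show "(SUP n. INF \<epsilon>\<in>{0<..<1 / real (Suc n)} \<inter> \<rat>. ereal (g \<epsilon>)) \<le> Liminf (at_right 0) (\<lambda>\<epsilon>. ereal (g \<epsilon>))"
  proof (rule SUP_least)
    fix n :: nat
    define C where "C = (INF \<epsilon>\<in>{0<..<1 / real (Suc n)} \<inter> \<rat>. ereal (g \<epsilon>))"
    have "C \<le> ereal (g \<epsilon>)" if \<epsilon>: "0 < \<epsilon>" "\<epsilon> < 1 / real (Suc n)" for \<epsilon>
    proof -
      \<comment> \<open>The interval from \<open>\<epsilon> / 2\<close> to \<open>r\<close> contains
        \<open>\<epsilon>\<close> and lies inside the range of the infimum, so its rational points
        control the value at \<open>\<epsilon>\<close>.\<close>
      define r where "r = (\<epsilon> + 1 / real (Suc n)) / 2"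
      have r: "\<epsilon> / 2 < r" "\<epsilon> \<le> r" "r < 1 / real (Suc n)"
        using \<epsilon> by (simp_all add: r_def del: of_nat_Suc)
      have cl: "closed {x :: real. C \<le> ereal x}"
        by (intro closed_Collect_le continuous_intros continuous_on_ereal)
      have cg: "continuous_on {\<epsilon>/2..r} g" by (rule continuous_on_subset[OF g]) (use \<epsilon> in auto)
      have "\<forall>t\<in>{\<epsilon>/2<..<r} \<inter> \<rat>. g t \<in> {x :: real. C \<le> ereal x}"
        using \<epsilon> r unfolding C_def by (auto intro!: INF_lower)
      then have "\<forall>t\<in>{\<epsilon>/2..r}. g t \<in> {x :: real. C \<le> ereal x}"
        by (subst continuous_on_closed_Icc_iff[OF r(1) cg cl])
      then show ?thesis using \<epsilon> r by auto
    qed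
    moreover have "1 / real (Suc n) > 0" by simp
    ultimately have "eventually (\<lambda>\<epsilon>. C \<le> ereal (g \<epsilon>)) (at_right 0)"
      unfolding eventually_at_right[OF zero_less_one] by meson
    then show "(INF \<epsilon>\<in>{0<..<1 / real (Suc n)} \<inter> \<rat>. ereal (g \<epsilon>)) \<le> Liminf (at_right 0) (\<lambda>\<epsilon>. ereal (g \<epsilon>))"
      unfolding C_def[symmetric] by (rule Liminf_bounded)
  qed
qed

text \<open>The difference quotients look back only: \<open>max (t - \<epsilon>) 0\<close> never
  leaves the interval up to \<open>t0\<close>. With the sigma-algebra at time \<open>t0\<close> in
  place of \<open>K\<close>, left densities of continuous adapted processes come out
  progressive.\<close>

lemma measurable_left_density:
  fixes A :: "real \<Rightarrow> 'x \<Rightarrow> 'a::euclidean_space"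
  assumes cont: "\<And>x. x \<in> space K \<Longrightarrow> continuous_on {0..t0} (\<lambda>t. A t x)"
    and A: "(\<lambda>(t, x). A t x) \<in> borel_measurable (restrict_space borel {0..t0} \<Otimes>\<^sub>M K)"
  shows "(\<lambda>(t, x). left_density (\<lambda>t. A t x) t) \<in> borel_measurable (restrict_space borel {0..t0} \<Otimes>\<^sub>M K)"
proof -
  let ?N = "restrict_space borel {0..t0} :: real measure"
  define q where "q b \<epsilon> z = 1 / \<epsilon> * ((A (fst z) (snd z) - A (max (fst z - \<epsilon>) 0) (snd z)) \<bullet> b)" for b :: 'a and \<epsilon> :: real and z
  have q: "q b \<epsilon> \<in> borel_measurable (?N \<Otimes>\<^sub>M K)" if "\<epsilon> > 0" for b \<epsilon>
  proof -
    have m: "(\<lambda>z. max (fst z - \<epsilon>) 0) \<in> ?N \<Otimes>\<^sub>M K \<rightarrow>\<^sub>M ?N"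
    proof (rule measurable_restrict_space2)
      show "(\<lambda>z. max (fst z - \<epsilon>) 0) \<in> space (?N \<Otimes>\<^sub>M K) \<rightarrow> {0..t0}"
        using that by (auto simp: space_pair_measure space_restrict_space)
      have "fst \<in> borel_measurable (?N \<Otimes>\<^sub>M K)"
        by (rule measurable_compose[OF measurable_fst measurable_restrict_space1]) simp
      then show "(\<lambda>z. max (fst z - \<epsilon>) 0) \<in> borel_measurable (?N \<Otimes>\<^sub>M K)" by measurable
    qed
    have A': "(\<lambda>z. A (fst z) (snd z)) \<in> borel_measurable (?N \<Otimes>\<^sub>M K)" using A by (simp add: case_prod_beta')
    have "(\<lambda>z. A (max (fst z - \<epsilon>) 0) (snd z)) \<in> borel_measurable (?N \<Otimes>\<^sub>M K)"
      using measurable_compose[OF measurable_Pair[OF m measurable_snd] A'] by simp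
    then show ?thesis unfolding q_def using A' by (intro borel_measurable_times borel_measurable_inner borel_measurable_diff) auto
  qed
  have eq: "Liminf (at_right 0) (\<lambda>\<epsilon>. ereal (q b \<epsilon> z)) = (SUP n. INF \<epsilon>\<in>{0<..<1 / real (Suc n)} \<inter> \<rat>. ereal (q b \<epsilon> z))"
    if z: "z \<in> space (?N \<Otimes>\<^sub>M K)" for b z
  proof (rule Liminf_at_right_0_countable)
    have z': "fst z \<in> {0..t0}" "snd z \<in> space K" using z by (auto simp: space_pair_measure space_restrict_space)
    have "continuous_on {0<..} (\<lambda>\<epsilon>. A (max (fst z - \<epsilon>) 0) (snd z))"
      by (rule continuous_on_compose2[OF cont[OF z'(2)]]) (use z' in \<open>auto intro!: continuous_intros\<close>)
    then show "continuous_on {0<..} (\<lambda>\<epsilon>. q b \<epsilon> z)" unfolding q_def by (intro continuous_intros) auto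
  qed
  have "(\<lambda>z. SUP n. INF \<epsilon>\<in>{0<..<1 / real (Suc n)} \<inter> \<rat>. ereal (q b \<epsilon> z)) \<in> borel_measurable (?N \<Otimes>\<^sub>M K)" for b
    using q by (intro borel_measurable_SUP borel_measurable_INF countable_Ioo_Rats borel_measurable_ereal) auto
  then have "(\<lambda>z. Liminf (at_right 0) (\<lambda>\<epsilon>. ereal (q b \<epsilon> z))) \<in> borel_measurable (?N \<Otimes>\<^sub>M K)" for b
    using eq by (simp cong: measurable_cong)
  then have "(\<lambda>z. \<Sum>b\<in>Basis. real_of_ereal (Liminf (at_right 0) (\<lambda>\<epsilon>. ereal (q b \<epsilon> z))) *\<^sub>R b) \<in> borel_measurable (?N \<Otimes>\<^sub>M K)"
    by (intro borel_measurable_sum borel_measurable_scaleR borel_measurable_real_of_ereal) auto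
  then show ?thesis by (simp add: left_density_def q_def case_prod_beta')
qed

lemma restrict_space_lborel_borel: "sets (restrict_space lborel S) = sets (restrict_space borel S)"
  by (simp add: sets_restrict_space)

lemma measurable_LINT:
  fixes h :: "real \<Rightarrow> 'x \<Rightarrow> 'a::euclidean_space"
  assumes h: "(\<lambda>(t, x). h t x) \<in> borel_measurable (restrict_space borel {0..T} \<Otimes>\<^sub>M K)" and S: "S \<subseteq> {0..T}" "S \<in> sets borel"
  shows "(\<lambda>x. LINT s:S|lborel. h s x) \<in> borel_measurable K"
proof -
  have "(\<lambda>(x, t). h t x) \<in> borel_measurable (K \<Otimes>\<^sub>M Icc_measure T)"
    using measurable_compose[OF measurable_pair_swap' h]
    by (simp add: case_prod_beta' restrict_space_lborel_borel cong: measurable_cong_sets sets_pair_measure_cong)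
  then have m: "(\<lambda>(x, t). indicat_real S t *\<^sub>R h t x) \<in> borel_measurable (K \<Otimes>\<^sub>M Icc_measure T)"
    using S by (simp add: case_prod_beta') (intro borel_measurable_scaleR borel_measurable_indicator' measurable_compose[OF measurable_snd measurable_restrict_space1]; simp)
  interpret finite_measure "Icc_measure T" by (rule finite_measure_Icc)
  have "(\<lambda>x. \<integral>t. indicat_real S t *\<^sub>R h t x \<partial>Icc_measure T) \<in> borel_measurable K"
    by (rule borel_measurable_lebesgue_integral[OF m])
  moreover have "(\<integral>t. indicat_real S t *\<^sub>R h t x \<partial>Icc_measure T) = (LINT s:S|lborel. h s x)" for x
    unfolding set_lebesgue_integral_def
    by (subst integral_restrict_space) (use S in \<open>auto simp: indicator_def intro!: Bochner_Integration.integral_cong\<close>)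
  ultimately show ?thesis by simp
qed

subsection \<open>Adapted functionals\<close>

lemma measurable_pair_mono:
  assumes "sets A \<subseteq> sets A'" "space A = space A'" "f \<in> N \<Otimes>\<^sub>M A \<rightarrow>\<^sub>M K"
  shows "f \<in> N \<Otimes>\<^sub>M A' \<rightarrow>\<^sub>M K"
proof -
  have "snd \<in> N \<Otimes>\<^sub>M A' \<rightarrow>\<^sub>M A"
    using measurable_snd[of N A'] assms(1,2) unfolding measurable_def by auto
  then have "(\<lambda>z. (fst z, snd z)) \<in> N \<Otimes>\<^sub>M A' \<rightarrow>\<^sub>M N \<Otimes>\<^sub>M A" by (intro measurable_Pair measurable_fst)
  from measurable_compose[OF this assms(3)] show ?thesis by simp
qed

lemma progressiveD:
  assumes "progressive T F X" "t \<in> {0..T}"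
  shows "(\<lambda>(s, \<omega>). X s \<omega>) \<in> borel_measurable (restrict_space borel {0..t} \<Otimes>\<^sub>M F t)"
  using assms by (simp add: progressive_def)

lemma progressive_adapted:
  assumes "progressive T F X" "t \<in> {0..T}"
  shows "X t \<in> borel_measurable (F t)"
proof -
  have "t \<in> space (restrict_space borel {0..t})" using assms(2) by (simp add: space_restrict_space)
  from measurable_compose[OF measurable_Pair1'[OF this] progressiveD[OF assms]] show ?thesis by simp
qed

context aux_setting
begin

definition FA0 :: "real \<Rightarrow> 'w measure" where
  "FA0 = gen_filtration (space M) (\<lambda>s \<omega>. (B s \<omega>, ini \<omega>, v \<omega>))"

definition FA :: "real \<Rightarrow> 'w measure" where "FA = augmented M FA0"

lemma FA_eq: "FA = aux_filtration M B ini v"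
  by (simp add: FA_def FA0_def aux_filtration_def)

text \<open>The null sets added are those of \<open>\<nu> u\<close>, so the filtration itself varies
  with the label.\<close>

definition FY :: "'u \<Rightarrow> real \<Rightarrow> ((real^'n) \<times> (real \<Rightarrow> real^'d)) measure" where
  "FY u = augmented (\<nu> u) (YF T)"

lemma space_FA0 [simp]: "space (FA0 t) = space M" by (simp add: FA0_def)
lemma space_FA [simp]: "space (FA t) = space M"
  unfolding FA_def by (rule space_augmented) simp
lemma space_FY [simp]: "space (FY u t) = space (YS T)"
  unfolding FY_def by (subst space_augmented[where F = "YF T" and t = t]) simp_all

lemma measurable_FY: "f \<in> YF T t \<rightarrow>\<^sub>M K \<Longrightarrow> f \<in> FY u t \<rightarrow>\<^sub>M K"
  by (rule measurable_mono_source)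
    (auto simp: FY_def intro!: sets_augmented_base[where F = "YF T" and t = t] space_augmented[where F = "YF T" and t = t, symmetric, THEN trans[rotated]])

lemma sets_FY_mono: "s \<le> t \<Longrightarrow> sets (FY u s) \<subseteq> sets (FY u t)"
  unfolding FY_def by (rule sets_augmented_mono) (simp_all add: sets_YF_mono)

lemma measurable_FY_mono: "s \<le> t \<Longrightarrow> f \<in> FY u s \<rightarrow>\<^sub>M K \<Longrightarrow> f \<in> FY u t \<rightarrow>\<^sub>M K"
  by (rule measurable_mono_source[OF sets_FY_mono]) simp_all

lemma measurable_FY_AE_cong:
  "f \<in> borel_measurable (FY u t) \<Longrightarrow> AE y in \<nu> u. f y = g y \<Longrightarrow> g \<in> borel_measurable (FY u t)"
  for f :: "_ \<Rightarrow> 'b::topological_space"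
  unfolding FY_def by (rule measurable_augmented_AE_cong[where F = "YF T"]) simp_all

lemma null_sets_in_M: "A \<in> null_sets (completion M) \<Longrightarrow> A \<in> sets M"
proof -
  assume "A \<in> null_sets (completion M)"
  then obtain N where "N \<in> null_sets M" "A \<subseteq> N" using null_sets_completion_iff2[of A M] by auto
  then show ?thesis using complete by auto
qed

lemma sets_FA0_sub: "t \<le> T \<Longrightarrow> sets (FA0 t) \<subseteq> sets M"
proof -
  assume t: "t \<le> T"
  have "(\<lambda>\<omega>. \<omega>) \<in> M \<rightarrow>\<^sub>M FA0 t"
    unfolding FA0_def by (rule measurable_into_gen_filtration)
      (use t in \<open>auto intro!: borel_measurable_Pair B_measurable\<close>)
  show ?thesis
  proof
    fix A assume A: "A \<in> sets (FA0 t)"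
    then have "A \<subseteq> space M" using sets.sets_into_space[OF A] by simp
    then show "A \<in> sets M" using measurable_sets[OF \<open>(\<lambda>\<omega>. \<omega>) \<in> M \<rightarrow>\<^sub>M FA0 t\<close> A] by (simp add: Int_absorb2)
  qed
qed

lemma sets_FA_sub: "t \<le> T \<Longrightarrow> sets (FA t) \<subseteq> sets M"
  unfolding FA_def sets_augmented[where F = FA0 and t = t, OF space_FA0]
  using sets_FA0_sub[of t] null_sets_in_M by (intro sets.sigma_sets_subset) auto

lemma measurable_FA: "t \<le> T \<Longrightarrow> f \<in> FA t \<rightarrow>\<^sub>M K \<Longrightarrow> f \<in> M \<rightarrow>\<^sub>M K"
  by (rule measurable_mono_source[OF sets_FA_sub]) simp_all

text \<open>The label is known from time 0 on, and nothing is augmented: sections of functionals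
  measurable here are adapted for every label.\<close>

definition XiF :: "real \<Rightarrow> ('u \<times> (real^'n) \<times> (real \<Rightarrow> real^'d)) measure" where "XiF t = m \<Otimes>\<^sub>M YF T t"

lemma space_XiF [simp]: "space (XiF t) = space Xi" by (simp add: XiF_def Xi_def space_pair_measure)
lemma space_Xi: "space Xi = UNIV \<times> space (YS T)" by (simp add: Xi_def space_pair_measure)

lemma sets_XiF_sub: "t \<le> T \<Longrightarrow> sets (XiF t) \<subseteq> sets Xi"
proof
  fix A assume t: "t \<le> T" and A: "A \<in> sets (XiF t)"
  have "(\<lambda>x. x) \<in> Xi \<rightarrow>\<^sub>M XiF t"
    unfolding Xi_def by (rule measurable_pair_mono[OF sets_YF_sub[OF t]]) (simp_all add: XiF_def)
  from measurable_sets[OF this A] show "A \<in> sets Xi"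
    using sets.sets_into_space[OF A] by (simp add: Int_absorb2)
qed

lemma FA0_vimage:
  assumes t: "t \<in> {0..T}" and A: "A \<in> sets (FA0 t)"
  shows "\<exists>C\<in>sets (XiF t). A = \<xi> -` C \<inter> space M"
proof (rule sets_gen_filtration_vimage[OF _ _ _ A[unfolded FA0_def]])
  show "\<xi> \<in> space M \<rightarrow> space (XiF t)" using measurable_space[OF \<xi>_measurable] by auto
  show "(B s \<omega>, ini \<omega>, v \<omega>) = (\<lambda>x. (snd (snd x) s, fst (snd x), fst x)) (\<xi> \<omega>)" if "s \<in> {0..t}" for s \<omega>
    using that t by (simp add: \<xi>_def)
  show "(\<lambda>x. (snd (snd x) s, fst (snd x), fst x)) \<in> borel_measurable (XiF t)" if "s \<in> {0..t}" for s
  proof (intro borel_measurable_Pair)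
    show "(\<lambda>x. snd (snd x) s) \<in> borel_measurable (XiF t)" "(\<lambda>x. fst (snd x)) \<in> borel_measurable (XiF t)"
      unfolding XiF_def using measurable_compose[OF measurable_snd[of m] measurable_YF_eval(1)[OF that, of T]]
        measurable_compose[OF measurable_snd[of m] measurable_YF_eval(2)[OF that, of T]] by simp_all
    show "fst \<in> borel_measurable (XiF t)"
      unfolding XiF_def using measurable_fst[of m] sets_m by (simp cong: measurable_cong_sets)
  qed
qed

lemma representation:
  fixes H :: "'s \<times> 'w \<Rightarrow> 'b::{banach, second_countable_topology}"
  assumes t: "t \<in> {0..T}" and H: "H \<in> borel_measurable (N \<Otimes>\<^sub>M FA t)"
  shows "\<exists>g\<in>borel_measurable (N \<Otimes>\<^sub>M XiF t). AE \<omega> in M. \<forall>s\<in>space N. H (s, \<omega>) = g (s, \<xi> \<omega>)"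
  using functional_representation[where F = FA0 and t = t and K = "XiF t" and \<xi> = \<xi>, OF space_FA0 _ FA0_vimage[OF t] H[unfolded FA_def]]
    measurable_space[OF \<xi>_measurable] by auto

lemma representation_static:
  fixes H :: "'w \<Rightarrow> 'b::{banach, second_countable_topology}"
  assumes t: "t \<in> {0..T}" and H: "H \<in> borel_measurable (FA t)"
  shows "\<exists>g\<in>borel_measurable (XiF t). AE \<omega> in M. H \<omega> = g (\<xi> \<omega>)"
  using functional_representation_static[where F = FA0 and t = t and K = "XiF t" and \<xi> = \<xi>, OF space_FA0 _ FA0_vimage[OF t] H[unfolded FA_def]]
    measurable_space[OF \<xi>_measurable] by auto

lemma measurable_XiF: "t \<le> T \<Longrightarrow> f \<in> XiF t \<rightarrow>\<^sub>M K \<Longrightarrow> f \<in> Xi \<rightarrow>\<^sub>M K"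
  by (rule measurable_mono_source[OF sets_XiF_sub]) simp_all

lemma measurable_section_XiF: "f \<in> XiF t \<rightarrow>\<^sub>M K \<Longrightarrow> (\<lambda>y. f (u, y)) \<in> YF T t \<rightarrow>\<^sub>M K"
  unfolding XiF_def by (rule measurable_compose[OF measurable_Pair1']) auto

lemma AE_disintegration_eq:
  fixes f g :: "_ \<Rightarrow> 'b::{second_countable_topology, t2_space}"
  assumes "f \<in> borel_measurable Xi" "g \<in> borel_measurable Xi" "AE \<omega> in M. f (\<xi> \<omega>) = g (\<xi> \<omega>)"
  shows "AE u in completion m. AE y in \<nu> u. f (u, y) = g (u, y)"
  by (rule AE_disintegration[OF _ assms(3)]) (use assms(1,2) in measurable)

text \<open>At each dense time the process agrees almost surely with a functional measurable for
  \<open>XiF\<close>, and the agreement survives on almost every fibre, with exceptional labels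
  common to all dense times. At any other time the value is a limit of values at earlier dense
  times.\<close>

lemma adapted_disintegration:
  fixes A :: "real \<Rightarrow> _ \<Rightarrow> 'b::{banach, second_countable_topology}"
  assumes meas: "\<And>t. t \<in> {0..T} \<Longrightarrow> A t \<in> borel_measurable Xi"
    and cont: "\<And>x. x \<in> space Xi \<Longrightarrow> continuous_on {0..T} (\<lambda>t. A t x)"
    and adapted: "\<And>t. t \<in> Icc_dense T \<Longrightarrow> \<exists>H\<in>borel_measurable (FA t). AE \<omega> in M. A t (\<xi> \<omega>) = H \<omega>"
  shows "AE u in completion m. \<forall>t\<in>{0..T}. (\<lambda>y. A t (u, y)) \<in> borel_measurable (FY u t)"
proof -
  note D = Icc_dense[OF T]
  have "AE u in completion m. (\<lambda>y. A r (u, y)) \<in> borel_measurable (FY u r)" if r: "r \<in> Icc_dense T" for r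
  proof -
    have rT: "r \<in> {0..T}" using r D(2) by auto
    obtain H where H: "H \<in> borel_measurable (FA r)" "AE \<omega> in M. A r (\<xi> \<omega>) = H \<omega>" using adapted[OF r] by blast
    obtain g where g: "g \<in> borel_measurable (XiF r)" "AE \<omega> in M. H \<omega> = g (\<xi> \<omega>)"
      using representation_static[OF rT H(1)] by blast
    have "AE \<omega> in M. g (\<xi> \<omega>) = A r (\<xi> \<omega>)" using H(2) g(2) by eventually_elim simp
    then have "AE u in completion m. AE y in \<nu> u. g (u, y) = A r (u, y)"
      using measurable_XiF[OF _ g(1)] meas[OF rT] rT by (intro AE_disintegration_eq) auto
    then show ?thesis
      by eventually_elim (rule measurable_FY_AE_cong[OF measurable_FY[OF measurable_section_XiF[OF g(1)]]])
  qed
  then have "AE u in completion m. \<forall>r\<in>Icc_dense T. (\<lambda>y. A r (u, y)) \<in> borel_measurable (FY u r)"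
    using D(1) by (simp add: AE_ball_countable)
  then show ?thesis
  proof eventually_elim
    case (elim u)
    show ?case
    proof
      fix t assume t: "t \<in> {0..T}"
      obtain r where r: "\<And>n. r n \<in> Icc_dense T" "\<And>n. r n \<le> t" "r \<longlonglongrightarrow> t"
        by (rule Icc_dense_from_left[OF T t]) blast
      have rT: "r n \<in> {0..T}" for n using r(1)[of n] D(2) by blast
      show "(\<lambda>y. A t (u, y)) \<in> borel_measurable (FY u t)"
      proof (rule borel_measurable_LIMSEQ_metric[where f = "\<lambda>n y. A (r n) (u, y)"])
        show "(\<lambda>y. A (r n) (u, y)) \<in> borel_measurable (FY u t)" for n
          using elim r(1) by (intro measurable_FY_mono[OF r(2)]) auto
        show "(\<lambda>n. A (r n) (u, y)) \<longlonglongrightarrow> A t (u, y)" if "y \<in> space (FY u t)" for y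
          by (rule continuous_on_tendsto_compose[OF cont r(3) t]) (use that rT in \<open>auto simp: space_Xi\<close>)
      qed
    qed
  qed
qed

text \<open>Representations at single times come with unrelated null sets and no regularity.
  Extending those at dense times by continuity gives continuous paths everywhere, and continuity of
  the original process identifies both at all times at once.\<close>

lemma continuous_functional:
  fixes H :: "real \<Rightarrow> 'w \<Rightarrow> 'b::{banach, second_countable_topology}"
  assumes meas: "\<And>t. t \<in> {0..T} \<Longrightarrow> H t \<in> borel_measurable (FA t)"
    and cont: "\<And>\<omega>. \<omega> \<in> space M \<Longrightarrow> continuous_on {0..T} (\<lambda>t. H t \<omega>)"
  shows "\<exists>\<eta>. (\<forall>t\<in>{0..T}. \<eta> t \<in> borel_measurable Xi) \<and> (\<forall>x. continuous_on {0..T} (\<lambda>t. \<eta> t x)) \<and>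
    (AE \<omega> in M. \<forall>t\<in>{0..T}. H t \<omega> = \<eta> t (\<xi> \<omega>)) \<and>
    (AE u in completion m. \<forall>t\<in>{0..T}. (\<lambda>y. \<eta> t (u, y)) \<in> borel_measurable (FY u t))"
proof -
  note D = Icc_dense[OF T]
  have "\<forall>r\<in>Icc_dense T. \<exists>g. g \<in> borel_measurable Xi \<and> (AE \<omega> in M. H r \<omega> = g (\<xi> \<omega>))"
  proof
    fix r assume "r \<in> Icc_dense T"
    then have r: "r \<in> {0..T}" using D(2) by auto
    obtain g where g: "g \<in> borel_measurable (XiF r)" "AE \<omega> in M. H r \<omega> = g (\<xi> \<omega>)"
      using representation_static[OF r meas[OF r]] by blast
    have "g \<in> borel_measurable Xi" by (rule measurable_XiF[OF _ g(1)]) (use r in simp)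
    then show "\<exists>g. g \<in> borel_measurable Xi \<and> (AE \<omega> in M. H r \<omega> = g (\<xi> \<omega>))" using g(2) by blast
  qed
  then obtain g where g: "\<forall>r\<in>Icc_dense T. g r \<in> borel_measurable Xi \<and> (AE \<omega> in M. H r \<omega> = g r (\<xi> \<omega>))"
    by (rule bchoice[THEN exE])
  obtain \<eta> where \<eta>: "\<forall>t\<in>{0..T}. \<eta> t \<in> borel_measurable Xi" "\<forall>x. continuous_on {0..T} (\<lambda>t. \<eta> t x)"
    "\<forall>x\<in>space Xi. \<forall>h. continuous_on {0..T} h \<and> (\<forall>r\<in>Icc_dense T. g r x = h r) \<longrightarrow> (\<forall>t\<in>{0..T}. \<eta> t x = h t)"
    using continuous_extension_from_dense[OF T, of g Xi] g by blast
  have "AE \<omega> in M. \<forall>r\<in>Icc_dense T. H r \<omega> = g r (\<xi> \<omega>)" using D(1) g by (simp add: AE_ball_countable)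
  with AE_space have ae: "AE \<omega> in M. \<forall>t\<in>{0..T}. H t \<omega> = \<eta> t (\<xi> \<omega>)"
  proof eventually_elim
    case (elim \<omega>)
    have x: "\<xi> \<omega> \<in> space Xi" by (rule measurable_space[OF \<xi>_measurable elim(1)])
    have "\<forall>r\<in>Icc_dense T. g r (\<xi> \<omega>) = H r \<omega>" using elim(2) by simp
    then show ?case using \<eta>(3)[rule_format, OF x, of "\<lambda>t. H t \<omega>"] cont[OF elim(1)] by simp
  qed
  moreover have "AE u in completion m. \<forall>t\<in>{0..T}. (\<lambda>y. \<eta> t (u, y)) \<in> borel_measurable (FY u t)"
  proof (rule adapted_disintegration)
    fix t assume "t \<in> Icc_dense T"
    then have t: "t \<in> {0..T}" using D(2) by auto
    from ae have "AE \<omega> in M. \<eta> t (\<xi> \<omega>) = H t \<omega>" by eventually_elim (use t in auto)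
    then show "\<exists>H\<in>borel_measurable (FA t). AE \<omega> in M. \<eta> t (\<xi> \<omega>) = H \<omega>" using meas[OF t] by blast
  qed (use \<eta> in auto)
  ultimately show ?thesis using \<eta>(1,2) by (intro exI[of _ \<eta>]) auto
qed

text \<open>The representation is made over the final sigma-algebra only. It keeps joint
  measurability and the uniformity of the null set in time, while adaptedness has to be recovered
  separately.\<close>

lemma progressive_functional:
  fixes H :: "real \<Rightarrow> 'w \<Rightarrow> 'b::{banach, second_countable_topology}"
  assumes "progressive T FA H"
  shows "\<exists>h. (\<lambda>(t, x). h t x) \<in> borel_measurable (restrict_space borel {0..T} \<Otimes>\<^sub>M Xi) \<and>
    (AE \<omega> in M. \<forall>t\<in>{0..T}. H t \<omega> = h t (\<xi> \<omega>))"
proof -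
  have TT: "T \<in> {0..T}" using T by simp
  obtain g where g: "g \<in> borel_measurable (restrict_space borel {0..T} \<Otimes>\<^sub>M XiF T)"
    "AE \<omega> in M. \<forall>s\<in>space (restrict_space borel {0..T}). (case (s, \<omega>) of (s, \<omega>) \<Rightarrow> H s \<omega>) = g (s, \<xi> \<omega>)"
    using representation[OF TT progressiveD[OF assms TT]] by blast
  have "g \<in> borel_measurable (restrict_space borel {0..T} \<Otimes>\<^sub>M Xi)"
    by (rule measurable_pair_mono[OF sets_XiF_sub _ g(1)]) simp_all
  then show ?thesis using g(2) by (intro exI[of _ "\<lambda>t x. g (t, x)"]) (simp add: space_restrict_space)
qed

lemma measurable_LINT_FA:
  fixes Z :: "real \<Rightarrow> 'w \<Rightarrow> 'b::euclidean_space"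
  assumes "progressive T FA Z" "t \<in> {0..T}"
  shows "(\<lambda>\<omega>. LINT s:{0..t}|lborel. Z s \<omega>) \<in> borel_measurable (FA t)"
  by (rule measurable_LINT[OF progressiveD[OF assms]]) auto

lemma measurable_Icc_section:
  assumes "(\<lambda>(t, x). h t x) \<in> borel_measurable (restrict_space borel {0..T} \<Otimes>\<^sub>M K)" "x \<in> space K"
  shows "(\<lambda>t. h t x) \<in> borel_measurable (Icc_measure T)"
proof -
  have "(\<lambda>t. h t x) \<in> borel_measurable (restrict_space borel {0..T})"
    using measurable_compose[OF measurable_Pair2'[OF assms(2)] assms(1)] by simp
  then show ?thesis by (simp add: restrict_space_lborel_borel cong: measurable_cong_sets)
qed

lemma measurable_Icc_pair:
  assumes "(\<lambda>(t, x). h t x) \<in> borel_measurable (restrict_space borel {0..T} \<Otimes>\<^sub>M K)"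
  shows "(\<lambda>(x, t). h t x) \<in> borel_measurable (K \<Otimes>\<^sub>M Icc_measure T)"
  using measurable_compose[OF measurable_pair_swap' assms]
  by (simp add: case_prod_beta' restrict_space_lborel_borel cong: measurable_cong_sets sets_pair_measure_cong)

text \<open>The process is read off the paths by the left densities of their primitives, and the
  primitives are continuous adapted processes.  Hence both the identity with the precise
  representative and progressive measurability survive disintegration.\<close>

lemma L2_functional:
  fixes Z :: "real \<Rightarrow> 'w \<Rightarrow> 'b::euclidean_space"
  assumes prog: "progressive T FA Z" and sq: "\<And>\<omega>. \<omega> \<in> space M \<Longrightarrow> (\<lambda>t. Z t \<omega>) \<in> sq_int T"
    and read: "\<And>\<omega> t. \<omega> \<in> space M \<Longrightarrow> t \<in> {0..T} \<Longrightarrow> precise (L2_class T (\<lambda>t. Z t \<omega>)) t = Z t \<omega>"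
  shows "\<exists>h. (\<lambda>(t, x). h t x) \<in> borel_measurable (restrict_space borel {0..T} \<Otimes>\<^sub>M Xi) \<and>
    (\<forall>x\<in>space Xi. (\<lambda>t. h t x) \<in> sq_int T \<and> (\<forall>t\<in>{0..T}. precise (L2_class T (\<lambda>t. h t x)) t = h t x)) \<and>
    (AE \<omega> in M. \<forall>t\<in>{0..T}. Z t \<omega> = h t (\<xi> \<omega>)) \<and>
    (AE u in completion m. progressive T (FY u) (\<lambda>t y. h t (u, y)))"
proof -
  let ?I = "restrict_space borel {0..T} :: real measure"
  interpret I: finite_measure "Icc_measure T" by (rule finite_measure_Icc)
  obtain \<zeta> where \<zeta>[measurable]: "(\<lambda>(t, x). \<zeta> t x) \<in> borel_measurable (?I \<Otimes>\<^sub>M Xi)"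
    and \<zeta>Z: "AE \<omega> in M. \<forall>t\<in>{0..T}. Z t \<omega> = \<zeta> t (\<xi> \<omega>)"
    using progressive_functional[OF prog] by auto
  \<comment> \<open>Replacing the functional by zero off \<open>G1\<close> gives it a square
    integrable path at every point of \<open>Xi\<close>, so that its primitive is continuous
    everywhere.\<close>
  define G1 where "G1 = {x \<in> space Xi. (\<integral>\<^sup>+t. ennreal ((norm (\<zeta> t x))\<^sup>2) \<partial>Icc_measure T) < \<infinity>}"
  have [measurable]: "(\<lambda>(x, t). \<zeta> t x) \<in> borel_measurable (Xi \<Otimes>\<^sub>M Icc_measure T)" by (rule measurable_Icc_pair[OF \<zeta>])
  have G1[measurable]: "G1 \<in> sets Xi" unfolding G1_def by measurable
  define \<zeta>1 where "\<zeta>1 t x = (if x \<in> G1 then \<zeta> t x else 0)" for t x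
  have \<zeta>1: "(\<lambda>(t, x). \<zeta>1 t x) \<in> borel_measurable (?I \<Otimes>\<^sub>M Xi)" unfolding \<zeta>1_def by measurable
  have sq1: "(\<lambda>t. \<zeta>1 t x) \<in> sq_int T" if x: "x \<in> space Xi" for x
  proof -
    have "(\<integral>\<^sup>+t. ennreal ((norm (\<zeta>1 t x))\<^sup>2) \<partial>Icc_measure T) < \<infinity>"
      by (cases "x \<in> G1") (simp_all add: \<zeta>1_def, simp add: G1_def)
    then show ?thesis unfolding sq_int_def using measurable_Icc_section[OF \<zeta>1 x] by simp
  qed
  define A where "A t x = (LINT s:{0..t}|lborel. \<zeta>1 s x)" for t x
  have Acont: "continuous_on {0..T} (\<lambda>t. A t x)" if "x \<in> space Xi" for x
    unfolding A_def by (rule continuous_on_LINT[OF set_integrable_sq_int[OF sq1[OF that]]])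
  have Am: "A t \<in> borel_measurable Xi" if "t \<in> {0..T}" for t
    unfolding A_def by (rule measurable_LINT[OF \<zeta>1]) (use that in auto)
  have Aj: "(\<lambda>(t, x). A t x) \<in> borel_measurable (?I \<Otimes>\<^sub>M Xi)"
    by (rule continuous_progressive) (use T Acont Am in auto)
  define P where "P t x = left_density (\<lambda>t. A t x) t" for t x
  have P: "(\<lambda>(t, x). P t x) \<in> borel_measurable (?I \<Otimes>\<^sub>M Xi)"
    unfolding P_def by (rule measurable_left_density[OF Acont Aj])
  have Pprec: "P t x = precise (L2_class T (\<lambda>t. \<zeta>1 t x)) t" if "x \<in> space Xi" "t \<in> {0..T}" for x t
    unfolding P_def A_def by (rule precise_L2_class[symmetric]) (use that sq1 in auto)
  \<comment> \<open>On this set the left density of the primitive belongs to the class it was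
    computed from, and is therefore its own precise representative.\<close>
  define G2 where "G2 = {x \<in> space Xi. x \<in> G1 \<and> (AE t in Icc_measure T. P t x = \<zeta>1 t x)}"
  have [measurable]: "(\<lambda>(x, t). P t x) \<in> borel_measurable (Xi \<Otimes>\<^sub>M Icc_measure T)"
    "(\<lambda>(x, t). \<zeta>1 t x) \<in> borel_measurable (Xi \<Otimes>\<^sub>M Icc_measure T)"
    by (rule measurable_Icc_pair[OF P], rule measurable_Icc_pair[OF \<zeta>1])
  have "(AE t in Icc_measure T. P t x = \<zeta>1 t x) \<longleftrightarrow> (\<integral>\<^sup>+t. (if P t x = \<zeta>1 t x then 0 else 1) \<partial>Icc_measure T) = 0"
    if x: "x \<in> space Xi" for x
  proof -
    have [measurable]: "(\<lambda>t. P t x) \<in> borel_measurable (Icc_measure T)" "(\<lambda>t. \<zeta>1 t x) \<in> borel_measurable (Icc_measure T)"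
      by (rule measurable_Icc_section[OF P x], rule measurable_Icc_section[OF \<zeta>1 x])
    show ?thesis by (subst nn_integral_0_iff_AE) (auto intro!: AE_cong)
  qed
  then have "G2 = {x \<in> space Xi. x \<in> G1 \<and> (\<integral>\<^sup>+t. (if P t x = \<zeta>1 t x then 0 else 1) \<partial>Icc_measure T) = 0}"
    unfolding G2_def by blast
  then have G2[measurable]: "G2 \<in> sets Xi" by simp
  define h where "h t x = (if x \<in> G2 then P t x else 0)" for t x
  have hm: "(\<lambda>(t, x). h t x) \<in> borel_measurable (?I \<Otimes>\<^sub>M Xi)" using P unfolding h_def by measurable
  have hsq: "(\<lambda>t. h t x) \<in> sq_int T \<and> (\<forall>t\<in>{0..T}. precise (L2_class T (\<lambda>t. h t x)) t = h t x)" if x: "x \<in> space Xi" for x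
  proof (cases "x \<in> G2")
    case True
    have hP: "(\<lambda>t. h t x) = (\<lambda>t. P t x)" using True by (simp add: h_def)
    have ae: "AE t in Icc_measure T. P t x = \<zeta>1 t x" using True by (simp add: G2_def)
    have "(\<integral>\<^sup>+t. ennreal ((norm (P t x))\<^sup>2) \<partial>Icc_measure T) = (\<integral>\<^sup>+t. ennreal ((norm (\<zeta>1 t x))\<^sup>2) \<partial>Icc_measure T)"
      using ae by (intro nn_integral_cong_AE) auto
    then have Psq: "(\<lambda>t. P t x) \<in> sq_int T"
      using sq_intD(2)[OF sq1[OF x]] measurable_Icc_section[OF P x] by (simp add: sq_int_def)
    then have "L2_class T (\<lambda>t. P t x) = L2_class T (\<lambda>t. \<zeta>1 t x)" using ae by (simp add: L2_class_eq_iff[OF _ sq1[OF x]])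
    moreover have "h t x = P t x" for t using True by (simp add: h_def)
    ultimately show ?thesis using Psq Pprec[OF x] by simp
  next
    case False
    then have "(\<lambda>t. h t x) = (\<lambda>_. 0)" by (simp add: h_def)
    moreover have "precise (L2_class T (\<lambda>_. 0 :: 'b)) t = 0" if "t \<in> {0..T}" for t
      using precise_L2_class[OF sq_int_zero that] by (simp add: left_density_const set_lebesgue_integral_def)
    moreover have "h t x = 0" for t using False by (simp add: h_def)
    ultimately show ?thesis by (simp add: sq_int_zero)
  qed
  have good: "AE \<omega> in M. \<xi> \<omega> \<in> G2 \<and> (\<forall>t\<in>{0..T}. Z t \<omega> = h t (\<xi> \<omega>)) \<and> (\<forall>t\<in>{0..T}. Z t \<omega> = \<zeta>1 t (\<xi> \<omega>))"
    using \<zeta>Z AE_space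
  proof eventually_elim
    case (elim \<omega>)
    let ?x = "\<xi> \<omega>"
    have x: "?x \<in> space Xi" by (rule measurable_space[OF \<xi>_measurable elim(2)])
    have "(\<integral>\<^sup>+t. ennreal ((norm (\<zeta> t ?x))\<^sup>2) \<partial>Icc_measure T) = (\<integral>\<^sup>+t. ennreal ((norm (Z t \<omega>))\<^sup>2) \<partial>Icc_measure T)"
      using elim(1) by (intro nn_integral_cong) (simp add: space_restrict_space)
    then have xG1: "?x \<in> G1" using sq_intD(2)[OF sq[OF elim(2)]] x by (simp add: G1_def)
    then have Z1: "\<forall>t\<in>{0..T}. Z t \<omega> = \<zeta>1 t ?x" using elim(1) by (simp add: \<zeta>1_def)
    then have "AE t in Icc_measure T. Z t \<omega> = \<zeta>1 t ?x" by (intro AE_I2) (simp add: space_restrict_space)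
    then have "L2_class T (\<lambda>t. Z t \<omega>) = L2_class T (\<lambda>t. \<zeta>1 t ?x)"
      by (simp add: L2_class_eq_iff[OF sq[OF elim(2)] sq1[OF x]])
    \<comment> \<open>That \<open>G2\<close> has full probability comes from the read-off identity:
      \<open>Z\<close> is its own precise representative, which is the left density of the
      primitive.\<close>
    then have ZP: "\<forall>t\<in>{0..T}. Z t \<omega> = P t ?x" using read[OF elim(2)] Pprec[OF x] by simp
    then have "AE t in Icc_measure T. P t ?x = \<zeta>1 t ?x" using Z1 by (intro AE_I2) (simp add: space_restrict_space)
    then have "?x \<in> G2" using x xG1 by (simp add: G2_def)
    then show ?case using ZP Z1 by (simp add: h_def)
  qed
  have "AE u in completion m. AE y in \<nu> u. (u, y) \<in> G2"
    by (rule AE_disintegration[where P = "\<lambda>x. x \<in> G2"]) (use good in \<open>auto elim!: eventually_mono\<close>)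
  moreover have "AE u in completion m. \<forall>t\<in>{0..T}. (\<lambda>y. A t (u, y)) \<in> borel_measurable (FY u t)"
  proof (rule adapted_disintegration[OF Am Acont])
    fix t assume "t \<in> Icc_dense T"
    then have t: "t \<in> {0..T}" using Icc_dense(2)[OF T] by auto
    from good have "AE \<omega> in M. A t (\<xi> \<omega>) = (LINT s:{0..t}|lborel. Z s \<omega>)"
    proof eventually_elim
      case (elim \<omega>)
      show ?case unfolding A_def set_lebesgue_integral_def
        by (intro Bochner_Integration.integral_cong) (use elim t in \<open>auto simp: indicator_def\<close>)
    qed
    then show "\<exists>H\<in>borel_measurable (FA t). AE \<omega> in M. A t (\<xi> \<omega>) = H \<omega>"
      by (rule bexI[OF _ measurable_LINT_FA[OF prog t]])
  qed
  ultimately have "AE u in completion m. progressive T (FY u) (\<lambda>t y. h t (u, y))"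
  proof eventually_elim
    case (elim u)
    show ?case unfolding progressive_def
    proof
      fix t assume t: "t \<in> {0..T}"
      have c: "continuous_on {0..t} (\<lambda>t. A t (u, y))" if "y \<in> space (YS T)" for y
        by (rule continuous_on_subset[OF Acont]) (use t that in \<open>auto simp: space_Xi\<close>)
      have "(\<lambda>(s, y). A s (u, y)) \<in> borel_measurable (restrict_space borel {0..t} \<Otimes>\<^sub>M FY u t)"
      proof (rule continuous_progressive)
        show "(\<lambda>y. A s (u, y)) \<in> borel_measurable (FY u t)" if "s \<in> {0..t}" for s
          using elim(2) that t by (intro measurable_FY_mono[of s t]) auto
      qed (use t c in auto)
      from measurable_left_density[OF _ this] c
      have "(\<lambda>(s, y). P s (u, y)) \<in> borel_measurable (restrict_space borel {0..t} \<Otimes>\<^sub>M FY u t)"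
        by (simp add: P_def)
      \<comment> \<open>Almost surely on the fibre the indicator equals 1, so it is measurable
        already at time \<open>t\<close> although \<open>G2\<close> involves the whole time
        interval.\<close>
      moreover have "(\<lambda>y. indicator G2 (u, y) :: real) \<in> borel_measurable (FY u t)"
        by (rule measurable_FY_AE_cong[of "\<lambda>_. 1"]) (use elim(1) in \<open>auto elim!: eventually_mono\<close>)
      then have "(\<lambda>z. indicator G2 (u, snd z) :: real) \<in> borel_measurable (restrict_space borel {0..t} \<Otimes>\<^sub>M FY u t)"
        by (rule measurable_compose[OF measurable_snd])
      ultimately have "(\<lambda>z. indicator G2 (u, snd z) *\<^sub>R P (fst z) (u, snd z)) \<in> borel_measurable (restrict_space borel {0..t} \<Otimes>\<^sub>M FY u t)"
        by (intro borel_measurable_scaleR) (simp_all add: case_prod_beta')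
      moreover have "(\<lambda>z. indicator G2 (u, snd z) *\<^sub>R P (fst z) (u, snd z)) = (\<lambda>(s, y). h s (u, y))"
        by (auto simp: h_def indicator_def)
      ultimately show "(\<lambda>(s, y). h s (u, y)) \<in> borel_measurable (restrict_space borel {0..t} \<Otimes>\<^sub>M FY u t)" by simp
    qed
  qed
  then show ?thesis using hm hsq good by (intro exI[of _ h]) (auto elim!: eventually_mono)
qed

end

subsection \<open>Convergence in probability and stochastic integrals\<close>

text \<open>Truncation at 1 turns convergence in probability into convergence in the mean, which
  yields an almost surely convergent subsequence. Once the truncated values are below 1 they
  coincide with the original ones.\<close>

lemma tends_to_0_in_prob_AE_subseq:
  assumes M: "prob_space M" and f: "tends_to_0_in_prob M f"
  shows "\<exists>r. strict_mono r \<and> (AE \<omega> in M. (\<lambda>j. f (r j) \<omega>) \<longlonglongrightarrow> 0)"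
proof -
  interpret prob_space M by fact
  have [measurable]: "f j \<in> borel_measurable M" for j using f by (simp add: tends_to_0_in_prob_def)
  define w where "w j \<omega> = enn2real (min 1 (f j \<omega>))" for j \<omega>
  have w01: "0 \<le> w j \<omega>" "w j \<omega> \<le> 1" for j \<omega>
    unfolding w_def by (auto intro!: enn2real_leI)
  have [measurable]: "w j \<in> borel_measurable M" for j unfolding w_def by measurable
  have wi: "integrable M (w j)" for j by (rule integrable_const_bound[of _ 1]) (use w01 in auto)
  have "(\<lambda>j. \<integral>\<omega>. norm (w j \<omega>) \<partial>M) \<longlonglongrightarrow> 0"
  proof (rule LIMSEQ_I)
    fix e :: real assume e: "e > 0"
    have "(\<lambda>j. measure M {\<omega> \<in> space M. f j \<omega> > ennreal (e/2)}) \<longlonglongrightarrow> 0"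
      using f e by (simp add: tends_to_0_in_prob_def)
    then obtain n where n: "\<And>j. j \<ge> n \<Longrightarrow> measure M {\<omega> \<in> space M. f j \<omega> > ennreal (e/2)} < e/2"
      using e order_tendstoD(2)[of _ 0 sequentially "e/2"] by (auto simp: eventually_sequentially)
    have "(\<integral>\<omega>. w j \<omega> \<partial>M) < e" if j: "j \<ge> n" for j
    proof -
      let ?S = "{\<omega> \<in> space M. f j \<omega> > ennreal (e/2)}"
      \<comment> \<open>Off the event the truncated value is at most \<open>e/2\<close>; on it the
        value is at most 1, and the event has probability below \<open>e/2\<close> from
        \<open>n\<close> on.\<close>
      have wle: "w j \<omega> \<le> e/2 + indicat_real ?S \<omega>" if "\<omega> \<in> space M" for \<omega>
      proof (cases "\<omega> \<in> ?S")
        case False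
        then have "min 1 (f j \<omega>) \<le> ennreal (e/2)" using that by (auto simp: min_le_iff_disj)
        then have "w j \<omega> \<le> e/2" unfolding w_def using e by (intro enn2real_leI) auto
        then show ?thesis using False by simp
      qed (use w01(2)[of j \<omega>] e in simp)
      have S[measurable]: "?S \<in> sets M" by measurable
      have iS: "integrable M (indicat_real ?S)" by (rule integrable_const_bound[of _ 1]) auto
      have "(\<integral>\<omega>. w j \<omega> \<partial>M) \<le> (\<integral>\<omega>. e/2 + indicat_real ?S \<omega> \<partial>M)"
        by (rule integral_mono[OF wi Bochner_Integration.integrable_add[OF integrable_const iS] wle])
      also have "\<dots> = e/2 + measure M ?S"
        by (subst Bochner_Integration.integral_add[OF integrable_const iS]) (use S in \<open>simp add: prob_space del: Collect_mem_eq\<close>)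
      finally show ?thesis using n[OF j] by simp
    qed
    moreover have "0 \<le> (\<integral>\<omega>. w j \<omega> \<partial>M)" for j by (rule integral_nonneg_AE) (simp add: w01)
    ultimately show "\<exists>n. \<forall>j\<ge>n. norm ((\<integral>\<omega>. norm (w j \<omega>) \<partial>M) - 0) < e"
      using w01(1) by (intro exI[of _ n]) simp
  qed
  from tendsto_L1_AE_subseq[OF wi this] obtain r where r: "strict_mono r" "AE \<omega> in M. (\<lambda>j. w (r j) \<omega>) \<longlonglongrightarrow> 0"
    by blast
  from r(2) have "AE \<omega> in M. (\<lambda>j. f (r j) \<omega>) \<longlonglongrightarrow> 0"
  proof eventually_elim
    case (elim \<omega>)
    have ev: "eventually (\<lambda>j. w (r j) \<omega> < 1) sequentially" by (rule order_tendstoD(2)[OF elim]) simp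
    have "(\<lambda>j. ennreal (w (r j) \<omega>)) \<longlonglongrightarrow> ennreal 0" by (rule tendsto_ennrealI[OF elim])
    then have "(\<lambda>j. ennreal (w (r j) \<omega>)) \<longlonglongrightarrow> 0" by simp
    moreover from ev have "eventually (\<lambda>j. ennreal (w (r j) \<omega>) = f (r j) \<omega>) sequentially"
    proof eventually_elim
      case (elim j)
      have fin: "min 1 (f (r j) \<omega>) < top" by (simp add: min_less_iff_disj)
      have e: "ennreal (w (r j) \<omega>) = min 1 (f (r j) \<omega>)" unfolding w_def by (rule ennreal_enn2real[OF fin])
      have "ennreal (w (r j) \<omega>) < 1" using elim by (simp add: ennreal_less_one_iff)
      then show ?case using e by (simp add: min_def split: if_splits)
    qed
    ultimately show ?case by (rule Lim_transform_eventually)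
  qed
  then show ?thesis using r(1) by blast
qed

lemma tends_to_0_in_prob_subseq:
  "tends_to_0_in_prob M f \<Longrightarrow> strict_mono r \<Longrightarrow> tends_to_0_in_prob M (\<lambda>j. f (r j))"
  unfolding tends_to_0_in_prob_def using LIMSEQ_subseq_LIMSEQ[unfolded o_def] by blast

lemma AE_tends_to_0_in_prob:
  assumes M: "prob_space M" and [measurable]: "\<And>j. f j \<in> borel_measurable M"
    and ae: "AE \<omega> in M. (\<lambda>j. f j \<omega>) \<longlonglongrightarrow> 0"
  shows "tends_to_0_in_prob M f"
  unfolding tends_to_0_in_prob_def
proof (intro conjI allI impI)
  interpret prob_space M by fact
  fix \<epsilon> :: real assume \<epsilon>: "\<epsilon> > 0"
  let ?S = "\<lambda>j. {\<omega> \<in> space M. f j \<omega> > ennreal \<epsilon>}"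
  have "(\<lambda>j. \<integral>\<omega>. indicat_real (?S j) \<omega> \<partial>M) \<longlonglongrightarrow> (\<integral>\<omega>. 0 \<partial>M)"
  proof (rule integral_dominated_convergence[where w = "\<lambda>_. 1"])
    show "AE \<omega> in M. (\<lambda>j. indicat_real (?S j) \<omega>) \<longlonglongrightarrow> 0"
      using ae
    proof eventually_elim
      case (elim \<omega>)
      have "eventually (\<lambda>j. f j \<omega> < ennreal \<epsilon>) sequentially" by (rule order_tendstoD(2)[OF elim]) (use \<epsilon> in simp)
      then have "eventually (\<lambda>j. indicat_real (?S j) \<omega> = 0) sequentially"
        by eventually_elim (auto simp: indicator_def dest: order.asym)
      then show ?case by (rule tendsto_eventually)
    qed
  qed auto
  then show "(\<lambda>j. measure M (?S j)) \<longlonglongrightarrow> 0" by simp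
qed measurable

lemma simple_data_times:
  assumes "simple_data T' M' F N \<tau> \<xi>s" "i \<le> N"
  shows "\<tau> i \<in> {0..T'}"
proof -
  have mono: "\<tau> j \<le> \<tau> k" if "j \<le> k" "k \<le> N" for j k
    using that
  proof (induction rule: dec_induct)
    case (step n)
    then have "\<tau> n \<le> \<tau> (Suc n)" using assms(1) by (simp add: simple_data_def)
    then show ?case using step by simp
  qed simp
  show ?thesis using mono[of 0 i] mono[of i N] assms by (simp add: simple_data_def)
qed

context aux_setting
begin

lemma prob_completion_\<nu>: "prob_space (completion (\<nu> u))"
  by (rule prob_space.prob_space_completion[OF prob_\<nu>])

text \<open>Convergence in probability need not pass to the fibres, but almost sure convergence
  along a subsequence does, and implies convergence in probability there. Both error terms must
  share the subsequence because they belong to the same simple integrands.\<close>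

lemma prob_disintegration:
  fixes F1 F2 :: "nat \<Rightarrow> _ \<Rightarrow> ennreal"
  assumes F1[measurable]: "\<And>j. F1 j \<in> borel_measurable Xi" and F2[measurable]: "\<And>j. F2 j \<in> borel_measurable Xi"
    and f: "tends_to_0_in_prob M f1" "tends_to_0_in_prob M f2"
    and eq: "AE \<omega> in M. \<forall>j. f1 j \<omega> = F1 j (\<xi> \<omega>) \<and> f2 j \<omega> = F2 j (\<xi> \<omega>)"
  shows "\<exists>r. AE u in completion m. tends_to_0_in_prob (completion (\<nu> u)) (\<lambda>j y. F1 (r j) (u, y)) \<and>
    tends_to_0_in_prob (completion (\<nu> u)) (\<lambda>j y. F2 (r j) (u, y))"
proof -
  obtain r1 where r1: "strict_mono r1" "AE \<omega> in M. (\<lambda>j. f1 (r1 j) \<omega>) \<longlonglongrightarrow> 0"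
    using tends_to_0_in_prob_AE_subseq[OF prob_space_axioms f(1)] by blast
  obtain r2 where r2: "strict_mono r2" "AE \<omega> in M. (\<lambda>j. f2 (r1 (r2 j)) \<omega>) \<longlonglongrightarrow> 0"
    using tends_to_0_in_prob_AE_subseq[OF prob_space_axioms tends_to_0_in_prob_subseq[OF f(2) r1(1)]] by blast
  define r where "r = r1 \<circ> r2"
  \<comment> \<open>Convergence of nonnegative values to 0 is written with the upper limit, which is
    visibly measurable on \<open>Xi\<close>.\<close>
  let ?P = "\<lambda>x. limsup (\<lambda>j. F1 (r j) x) = 0 \<and> limsup (\<lambda>j. F2 (r j) x) = 0"
  have "AE \<omega> in M. ?P (\<xi> \<omega>)"
    using eq r1(2) r2(2)
  proof eventually_elim
    case (elim \<omega>)
    have "(\<lambda>j. f1 (r1 (r2 j)) \<omega>) \<longlonglongrightarrow> 0" using LIMSEQ_subseq_LIMSEQ[OF elim(2) r2(1)] by (simp add: o_def)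
    with elim have "(\<lambda>j. F1 (r j) (\<xi> \<omega>)) \<longlonglongrightarrow> 0" "(\<lambda>j. F2 (r j) (\<xi> \<omega>)) \<longlonglongrightarrow> 0" by (simp_all add: r_def)
    then show ?case by (simp add: lim_imp_Limsup)
  qed
  then have "AE u in completion m. AE y in \<nu> u. ?P (u, y)" by (intro AE_disintegration) measurable
  then have "AE u in completion m. tends_to_0_in_prob (completion (\<nu> u)) (\<lambda>j y. F1 (r j) (u, y)) \<and>
    tends_to_0_in_prob (completion (\<nu> u)) (\<lambda>j y. F2 (r j) (u, y))"
  proof eventually_elim
    case (elim u)
    have m: "(\<lambda>y. F1 (r j) (u, y)) \<in> borel_measurable (completion (\<nu> u))"
      "(\<lambda>y. F2 (r j) (u, y)) \<in> borel_measurable (completion (\<nu> u))" for j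
      using measurable_section[OF F1, of "r j" u] measurable_section[OF F2, of "r j" u]
      by (auto intro!: measurable_completion simp: measurable_cong_sets[OF sets_\<nu> refl])
    have ae: "AE y in completion (\<nu> u). ?P (u, y)" using elim by (rule AE_completion)
    then have "AE y in completion (\<nu> u). (\<lambda>j. F1 (r j) (u, y)) \<longlonglongrightarrow> 0"
      by eventually_elim (simp add: tendsto_0_if_Limsup_eq_0_ennreal)
    moreover from ae have "AE y in completion (\<nu> u). (\<lambda>j. F2 (r j) (u, y)) \<longlonglongrightarrow> 0"
      by eventually_elim (simp add: tendsto_0_if_Limsup_eq_0_ennreal)
    ultimately show ?case by (intro conjI AE_tends_to_0_in_prob prob_completion_\<nu> m)
  qed
  then show ?thesis by blast
qed

text \<open>Once the coefficients of the approximating simple integrands are functionals of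
  \<open>\<xi>\<close>, so are both error terms in the definition of the integral. Along a common
  subsequence they tend to zero on almost every fibre, so the approximations with the label frozen
  define the integral there.\<close>

lemma ito_disintegration:
  fixes H :: "real \<Rightarrow> 'w \<Rightarrow> real^'d^'m::finite"
  assumes ito: "has_ito_integral T M FA B H I"
    and h: "(\<lambda>(t, x). h t x) \<in> borel_measurable (restrict_space borel {0..T} \<Otimes>\<^sub>M Xi)"
    and Hh: "AE \<omega> in M. \<forall>t\<in>{0..T}. H t \<omega> = h t (\<xi> \<omega>)"
    and prog: "AE u in completion m. progressive T (FY u) (\<lambda>t y. h t (u, y))"
  shows "\<exists>\<iota>. (\<forall>t\<in>{0..T}. \<iota> t \<in> borel_measurable Xi) \<and> (\<forall>x. continuous_on {0..T} (\<lambda>t. \<iota> t x)) \<and>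
    (AE \<omega> in M. \<forall>t\<in>{0..T}. I t \<omega> = \<iota> t (\<xi> \<omega>)) \<and>
    (AE u in completion m. has_ito_integral T (completion (\<nu> u)) (FY u) (\<lambda>t y. snd y t)
      (\<lambda>t y. h t (u, y)) (\<lambda>t y. \<iota> t (u, y)))"
proof -
  let ?In = "restrict_space borel {0..T} :: real measure"
  have Im: "\<And>t. t \<in> {0..T} \<Longrightarrow> I t \<in> borel_measurable (FA t)"
    and Ic: "\<And>\<omega>. \<omega> \<in> space M \<Longrightarrow> continuous_on {0..T} (\<lambda>t. I t \<omega>)"
    and Hsq: "AE \<omega> in M. (\<integral>\<^sup>+s\<in>{0..T}. ennreal ((norm (H s \<omega>))\<^sup>2) \<partial>lborel) < \<infinity>"
    using ito by (auto simp: has_ito_integral_def)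
  obtain N \<tau> \<theta> where sd: "\<And>j. simple_data T M FA (N j) (\<tau> j) (\<theta> j)"
    and c1: "tends_to_0_in_prob M (\<lambda>j \<omega>. \<integral>\<^sup>+s\<in>{0..T}.
          ennreal ((norm (simple_process (N j) (\<tau> j) (\<theta> j) s \<omega> - H s \<omega>))\<^sup>2) \<partial>lborel)"
    and c2: "tends_to_0_in_prob M (\<lambda>j \<omega>. SUP t\<in>{0..T}.
          ennreal (norm (simple_integral B (N j) (\<tau> j) (\<theta> j) t \<omega> - I t \<omega>)))"
    using ito unfolding has_ito_integral_def by blast
  obtain \<iota> where \<iota>: "\<forall>t\<in>{0..T}. \<iota> t \<in> borel_measurable Xi" "\<forall>x. continuous_on {0..T} (\<lambda>t. \<iota> t x)"
    "AE \<omega> in M. \<forall>t\<in>{0..T}. I t \<omega> = \<iota> t (\<xi> \<omega>)"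
    "AE u in completion m. \<forall>t\<in>{0..T}. (\<lambda>y. \<iota> t (u, y)) \<in> borel_measurable (FY u t)"
    using continuous_functional[OF Im Ic] by blast
  have \<tau>: "\<tau> j i \<in> {0..T}" if "i \<le> N j" for i j by (rule simple_data_times[OF sd that])
  \<comment> \<open>The implication makes the choice total: indices beyond the last interval are
    left unconstrained.\<close>
  let ?R = "\<lambda>j i g. i < N j \<longrightarrow> g \<in> borel_measurable (XiF (\<tau> j i)) \<and> (\<exists>C. \<forall>x. norm (g x) \<le> C) \<and>
    (AE \<omega> in M. \<theta> j i \<omega> = g (\<xi> \<omega>))"
  define g where "g j i = (SOME g. ?R j i g)" for j i
  have "?R j i (g j i)" for j i
    unfolding g_def
  proof (rule someI_ex[where P = "?R j i"], cases "i < N j")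
    case True
    then have \<theta>: "\<theta> j i \<in> borel_measurable (FA (\<tau> j i))" and "\<exists>C. \<forall>\<omega>\<in>space M. norm (\<theta> j i \<omega>) \<le> C"
      using sd[of j] by (auto simp: simple_data_def)
    then obtain C where C: "\<And>\<omega>. \<omega> \<in> space M \<Longrightarrow> norm (\<theta> j i \<omega>) \<le> C" by blast
    obtain g0 where [measurable]: "g0 \<in> borel_measurable (XiF (\<tau> j i))" and g0: "AE \<omega> in M. \<theta> j i \<omega> = g0 (\<xi> \<omega>)"
      using representation_static[OF \<tau> \<theta>] True by auto
    \<comment> \<open>The represented coefficient is bounded only almost surely. Cutting it off at
      \<open>C\<close> bounds it everywhere, as simple data require on each fibre.\<close>
    let ?g = "\<lambda>x. if norm (g0 x) \<le> C then g0 x else 0"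
    have "\<forall>x. norm (?g x) \<le> max C 0" by auto
    moreover have "AE \<omega> in M. \<theta> j i \<omega> = ?g (\<xi> \<omega>)"
      using g0 AE_space
    proof eventually_elim
      case (elim \<omega>)
      then show ?case using C[OF elim(2)] by simp
    qed
    moreover have "?g \<in> borel_measurable (XiF (\<tau> j i))" by measurable
    ultimately have "?R j i ?g" by blast
    then show "\<exists>g. ?R j i g" by blast
  qed simp
  then have gm: "\<And>j i. i < N j \<Longrightarrow> g j i \<in> borel_measurable (XiF (\<tau> j i))"
    and gb: "\<And>j i. i < N j \<Longrightarrow> \<exists>C. \<forall>x. norm (g j i x) \<le> C"
    and g\<theta>: "\<And>j i. i < N j \<Longrightarrow> AE \<omega> in M. \<theta> j i \<omega> = g j i (\<xi> \<omega>)" by simp_all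
  have gXi[measurable]: "g j i \<in> borel_measurable Xi" if "i < N j" for i j
    by (rule measurable_XiF[OF _ gm[OF that]]) (use \<tau>[of i j] that in simp)
  let ?Bx = "\<lambda>t x. snd (snd x) t"
  have Bx: "?Bx t \<in> borel_measurable Xi" if "t \<in> {0..T}" for t
    unfolding Xi_def by (rule measurable_compose[OF measurable_snd measurable_YS_eval[OF that]])
  have Bxc: "continuous_on {0..T} (\<lambda>t. ?Bx t x)" if "x \<in> space Xi" for x
    using that YS_continuous[of "snd x" T] by (auto simp: space_Xi)
  define F1 where "F1 j x = (\<integral>\<^sup>+s\<in>{0..T}. ennreal ((norm (simple_process (N j) (\<tau> j) (g j) s x - h s x))\<^sup>2) \<partial>lborel)" for j x
  define F2 where "F2 j x = (SUP t\<in>{0..T}. ennreal (norm (simple_integral ?Bx (N j) (\<tau> j) (g j) t x - \<iota> t x)))" for j x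
  have F1m: "F1 j \<in> borel_measurable Xi" for j
  proof -
    interpret finite_measure "Icc_measure T" by (rule finite_measure_Icc)
    have hm: "(\<lambda>(x, t). h t x) \<in> borel_measurable (Xi \<Otimes>\<^sub>M Icc_measure T)" by (rule measurable_Icc_pair[OF h])
    have ind: "(\<lambda>z. indicat_real {a<..b} (snd z)) \<in> borel_measurable (Xi \<Otimes>\<^sub>M Icc_measure T)" for a b
      by (rule measurable_compose[OF measurable_snd measurable_restrict_space1]) simp
    have "(\<lambda>z. simple_process (N j) (\<tau> j) (g j) (snd z) (fst z)) \<in> borel_measurable (Xi \<Otimes>\<^sub>M Icc_measure T)"
      unfolding simple_process_def
      by (intro borel_measurable_sum borel_measurable_scaleR ind measurable_compose[OF measurable_fst gXi]) simp
    then have "(\<lambda>(x, s). ennreal ((norm (simple_process (N j) (\<tau> j) (g j) s x - h s x))\<^sup>2)) \<in> borel_measurable (Xi \<Otimes>\<^sub>M Icc_measure T)"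
      using hm by (simp add: case_prod_beta')
    then have "(\<lambda>x. \<integral>\<^sup>+s. ennreal ((norm (simple_process (N j) (\<tau> j) (g j) s x - h s x))\<^sup>2) \<partial>Icc_measure T) \<in> borel_measurable Xi"
      by (rule borel_measurable_nn_integral)
    then show ?thesis unfolding F1_def by (simp add: nn_integral_restrict_space)
  qed
  \<comment> \<open>The path component of \<open>\<xi>\<close> is restricted to
    \<open>{0..T}\<close> and agrees with \<open>B\<close> at times known to lie there; the bound on
    \<open>i\<close> includes the right end of the last interval.\<close>
  have mt: "min t (\<tau> j i) \<in> {0..T}" if "t \<in> {0..T}" "i \<le> N j" for t i j
    using that \<tau>[OF that(2)] by (auto simp: min_def)
  have F2m: "F2 j \<in> borel_measurable Xi" for j
    unfolding F2_def
  proof (rule borel_measurable_SUP_continuous[OF T])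
    fix x assume x: "x \<in> space Xi"
    have "continuous_on {0..T} (\<lambda>t. ?Bx (min t (\<tau> j i)) x)" if "i \<le> N j" for i
      by (rule continuous_on_compose2[OF Bxc[OF x]]) (use mt that in \<open>auto intro!: continuous_intros\<close>)
    moreover have "continuous_on {0..T} (\<lambda>t. \<iota> t x)" using \<iota>(2) by blast
    ultimately show "continuous_on {0..T} (\<lambda>t. norm (simple_integral ?Bx (N j) (\<tau> j) (g j) t x - \<iota> t x))"
      unfolding simple_integral_def
      by (intro continuous_intros linear_continuous_on_compose[OF _ matrix_vector_mul_linear]) auto
  next
    fix t assume t: "t \<in> {0..T}"
    have [measurable]: "\<iota> t \<in> borel_measurable Xi" using \<iota>(1) t by simp
    have "(\<lambda>x. g j i x *v (?Bx (min t (\<tau> j (Suc i))) x - ?Bx (min t (\<tau> j i)) x)) \<in> borel_measurable Xi" if "i < N j" for i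
    proof -
      have [measurable]: "?Bx (min t (\<tau> j (Suc i))) \<in> borel_measurable Xi" "?Bx (min t (\<tau> j i)) \<in> borel_measurable Xi"
        by (rule Bx, rule mt[OF t], use that in simp)+
      have "continuous_on UNIV (\<lambda>z :: (real^'d^'m) \<times> (real^'d). fst z *v snd z)"
        unfolding matrix_vector_mult_def by (intro continuous_intros)
      from borel_measurable_continuous_on[OF this, of "\<lambda>x. (g j i x, ?Bx (min t (\<tau> j (Suc i))) x - ?Bx (min t (\<tau> j i)) x)" Xi]
      show ?thesis using gXi[OF that] by simp
    qed
    then show "(\<lambda>x. norm (simple_integral ?Bx (N j) (\<tau> j) (g j) t x - \<iota> t x)) \<in> borel_measurable Xi"
      unfolding simple_integral_def
      by (intro measurable_compose[OF _ borel_measurable_norm] borel_measurable_diff borel_measurable_sum) auto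
  qed
  have "AE \<omega> in M. \<forall>j. \<forall>i\<in>{..<N j}. \<theta> j i \<omega> = g j i (\<xi> \<omega>)"
    unfolding AE_all_countable by (intro allI AE_finite_allI) (auto intro: g\<theta>)
  then have "AE \<omega> in M. \<forall>j. (\<integral>\<^sup>+s\<in>{0..T}. ennreal ((norm (simple_process (N j) (\<tau> j) (\<theta> j) s \<omega> - H s \<omega>))\<^sup>2) \<partial>lborel) = F1 j (\<xi> \<omega>) \<and>
      (SUP t\<in>{0..T}. ennreal (norm (simple_integral B (N j) (\<tau> j) (\<theta> j) t \<omega> - I t \<omega>))) = F2 j (\<xi> \<omega>)"
    using Hh \<iota>(3)
  proof eventually_elim
    case (elim \<omega>)
    show ?case
    proof (intro allI conjI)
      fix j
      have sp: "simple_process (N j) (\<tau> j) (\<theta> j) s \<omega> = simple_process (N j) (\<tau> j) (g j) s (\<xi> \<omega>)" for s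
        unfolding simple_process_def using elim(1) by (intro sum.cong) auto
      show "(\<integral>\<^sup>+s\<in>{0..T}. ennreal ((norm (simple_process (N j) (\<tau> j) (\<theta> j) s \<omega> - H s \<omega>))\<^sup>2) \<partial>lborel) = F1 j (\<xi> \<omega>)"
        unfolding F1_def sp using elim(2) by (intro nn_integral_cong) (auto simp: indicator_def)
      have "simple_integral B (N j) (\<tau> j) (\<theta> j) t \<omega> = simple_integral ?Bx (N j) (\<tau> j) (g j) t (\<xi> \<omega>)" if t: "t \<in> {0..T}" for t
        unfolding simple_integral_def
      proof (intro sum.cong refl)
        fix i assume i: "i \<in> {..<N j}"
        then have "?Bx (min t (\<tau> j (Suc i))) (\<xi> \<omega>) = B (min t (\<tau> j (Suc i))) \<omega>" "?Bx (min t (\<tau> j i)) (\<xi> \<omega>) = B (min t (\<tau> j i)) \<omega>"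
          using mt[OF t, of "Suc i" j] mt[OF t, of i j] by (simp_all add: \<xi>_def)
        then show "\<theta> j i \<omega> *v (B (min t (\<tau> j (Suc i))) \<omega> - B (min t (\<tau> j i)) \<omega>) =
            g j i (\<xi> \<omega>) *v (?Bx (min t (\<tau> j (Suc i))) (\<xi> \<omega>) - ?Bx (min t (\<tau> j i)) (\<xi> \<omega>))"
          using elim(1) i by simp
      qed
      then show "(SUP t\<in>{0..T}. ennreal (norm (simple_integral B (N j) (\<tau> j) (\<theta> j) t \<omega> - I t \<omega>))) = F2 j (\<xi> \<omega>)"
        unfolding F2_def using elim(3) by (intro SUP_cong) auto
    qed
  qed
  from prob_disintegration[OF F1m F2m c1 c2 this] obtain r where
    r: "AE u in completion m. tends_to_0_in_prob (completion (\<nu> u)) (\<lambda>j y. F1 (r j) (u, y)) \<and>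
    tends_to_0_in_prob (completion (\<nu> u)) (\<lambda>j y. F2 (r j) (u, y))" by blast
  have "AE u in completion m. AE y in \<nu> u. (\<integral>\<^sup>+s\<in>{0..T}. ennreal ((norm (h s (u, y)))\<^sup>2) \<partial>lborel) < \<infinity>"
  proof (rule AE_disintegration[where P = "\<lambda>x. (\<integral>\<^sup>+s\<in>{0..T}. ennreal ((norm (h s x))\<^sup>2) \<partial>lborel) < \<infinity>"])
    interpret finite_measure "Icc_measure T" by (rule finite_measure_Icc)
    have [measurable]: "(\<lambda>(x, t). h t x) \<in> borel_measurable (Xi \<Otimes>\<^sub>M Icc_measure T)" by (rule measurable_Icc_pair[OF h])
    have "(\<lambda>x. \<integral>\<^sup>+s. ennreal ((norm (h s x))\<^sup>2) \<partial>Icc_measure T) \<in> borel_measurable Xi" by measurable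
    then have [measurable]: "(\<lambda>x. \<integral>\<^sup>+s\<in>{0..T}. ennreal ((norm (h s x))\<^sup>2) \<partial>lborel) \<in> borel_measurable Xi"
      by (simp add: nn_integral_restrict_space)
    show "Measurable.pred Xi (\<lambda>x. (\<integral>\<^sup>+s\<in>{0..T}. ennreal ((norm (h s x))\<^sup>2) \<partial>lborel) < \<infinity>)" by measurable
    show "AE \<omega> in M. (\<integral>\<^sup>+s\<in>{0..T}. ennreal ((norm (h s (\<xi> \<omega>)))\<^sup>2) \<partial>lborel) < \<infinity>"
      using Hsq Hh
    proof eventually_elim
      case (elim \<omega>)
      have "(\<integral>\<^sup>+s\<in>{0..T}. ennreal ((norm (h s (\<xi> \<omega>)))\<^sup>2) \<partial>lborel) = (\<integral>\<^sup>+s\<in>{0..T}. ennreal ((norm (H s \<omega>))\<^sup>2) \<partial>lborel)"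
        using elim(2) by (intro nn_integral_cong) (auto simp: indicator_def)
      then show ?case using elim(1) by simp
    qed
  qed
  then have "AE u in completion m. has_ito_integral T (completion (\<nu> u)) (FY u) (\<lambda>t y. snd y t)
      (\<lambda>t y. h t (u, y)) (\<lambda>t y. \<iota> t (u, y))"
    using r \<iota>(4) prog
  proof eventually_elim
    case (elim u)
    \<comment> \<open>Grid times are those of the randomised problem and only the coefficients are
      sectioned. They are adapted for every label, having been represented over the unaugmented
      noise up to the grid time.\<close>
    have sd': "simple_data T (completion (\<nu> u)) (FY u) (N (r j)) (\<tau> (r j)) (\<lambda>i y. g (r j) i (u, y))" for j
      unfolding simple_data_def
    proof (intro conjI allI impI)
      fix i assume i: "i < N (r j)"
      show "(\<lambda>y. g (r j) i (u, y)) \<in> borel_measurable (FY u (\<tau> (r j) i))"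
        by (rule measurable_FY[OF measurable_section_XiF[OF gm[OF i]]])
      show "\<exists>C. \<forall>\<omega>\<in>space (completion (\<nu> u)). norm (g (r j) i (u, \<omega>)) \<le> C" using gb[OF i] by blast
    qed (use sd[of "r j"] in \<open>simp_all add: simple_data_def\<close>)
    have "tends_to_0_in_prob (completion (\<nu> u)) (\<lambda>j y. \<integral>\<^sup>+s\<in>{0..T}.
          ennreal ((norm (simple_process (N (r j)) (\<tau> (r j)) (\<lambda>i y. g (r j) i (u, y)) s y - h s (u, y)))\<^sup>2) \<partial>lborel)"
      using elim(2) unfolding F1_def simple_process_def by simp
    moreover have "tends_to_0_in_prob (completion (\<nu> u)) (\<lambda>j y. SUP t\<in>{0..T}.
          ennreal (norm (simple_integral (\<lambda>t y. snd y t) (N (r j)) (\<tau> (r j)) (\<lambda>i y. g (r j) i (u, y)) t y - \<iota> t (u, y))))"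
      using elim(2) unfolding F2_def simple_integral_def by simp
    moreover have "AE y in completion (\<nu> u). (\<integral>\<^sup>+s\<in>{0..T}. ennreal ((norm (h s (u, y)))\<^sup>2) \<partial>lborel) < \<infinity>"
      using elim(1) by (rule AE_completion)
    ultimately show ?case unfolding has_ito_integral_def using elim(3,4) \<iota>(2) sd'
      by (intro conjI exI[of _ "\<lambda>j. N (r j)"] exI[of _ "\<lambda>j. \<tau> (r j)"] exI[of _ "\<lambda>j i y. g (r j) i (u, y)"] allI)
        (assumption | blast)+
  qed
  then show ?thesis using \<iota>(1,2,3) by blast
qed

end

subsection \<open>Laws inserted into the coefficients\<close>

text \<open>Finite intersections of a countable basis form a countable generator stable under
  intersection. Countably many exceptional sets of labels are united, after which the measures agree
  on the generator.\<close>

lemma kernel_AE_eqI: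
  fixes \<kappa> \<kappa>' :: "'u \<Rightarrow> 'a::second_countable_topology measure"
  assumes k: "\<kappa> \<in> N \<rightarrow>\<^sub>M prob_algebra borel" "\<kappa>' \<in> N \<rightarrow>\<^sub>M prob_algebra borel"
    and ae: "\<And>C. C \<in> sets borel \<Longrightarrow> AE u in N. emeasure (\<kappa> u) C = emeasure (\<kappa>' u) C"
  shows "AE u in N. \<kappa> u = \<kappa>' u"
proof -
  obtain B :: "'a set set" where B: "countable B" "topological_basis B" using ex_countable_basis by auto
  define G where "G = Inter ` {F. finite F \<and> F \<subseteq> B}"
  have cG: "countable G" unfolding G_def by (intro countable_image countable_Collect_finite_subset B(1))
  have BG: "B \<subseteq> G" unfolding G_def by (auto intro!: image_eqI[of _ _ "{_}"])
  have oG: "open A" if "A \<in> G" for A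
    using that topological_basis_open[OF B(2)] unfolding G_def by (auto intro!: open_Inter)
  have UG: "UNIV \<in> G" unfolding G_def by (intro image_eqI[of _ _ "{}"]) auto
  have IG: "Int_stable G"
  proof (rule Int_stableI)
    fix a b assume "a \<in> G" "b \<in> G"
    then obtain F F' where "finite F" "F \<subseteq> B" "a = \<Inter>F" "finite F'" "F' \<subseteq> B" "b = \<Inter>F'" unfolding G_def by auto
    then show "a \<inter> b \<in> G" unfolding G_def by (intro image_eqI[of _ _ "F \<union> F'"]) auto
  qed
  have sG: "sets borel = sigma_sets UNIV G"
  proof
    have "sets borel = sigma_sets UNIV B" by (simp add: borel_eq_countable_basis[OF B])
    also have "\<dots> \<subseteq> sigma_sets UNIV G" by (rule sigma_sets_mono') (rule BG)
    finally show "sets borel \<subseteq> sigma_sets UNIV G" .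
    show "sigma_sets UNIV G \<subseteq> sets borel"
    proof -
      have "G \<subseteq> sets borel" using oG by auto
      from sets.sigma_sets_subset[OF this] show ?thesis by simp
    qed
  qed
  have "AE u in N. \<forall>C\<in>G. emeasure (\<kappa> u) C = emeasure (\<kappa>' u) C"
    using cG oG by (subst AE_ball_countable) (auto intro: ae)
  with AE_space show ?thesis
  proof eventually_elim
    case (elim u)
    note p = prob_algebraD[OF k(1) elim(1)] prob_algebraD[OF k(2) elim(1)]
    show ?case
    proof (rule measure_eqI_generator_eq[where E = G and \<Omega> = UNIV and A = "\<lambda>_. UNIV", OF IG])
      show "emeasure (\<kappa> u) UNIV \<noteq> \<infinity>" for i :: nat
        using prob_space.emeasure_space_1[OF p(1)] p(3) by simp
    qed (use p elim(2) sG UG in auto)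
  qed
qed

text \<open>Integrals over all measurable sets determine a density with finite integral. Joint
  probabilities are known for sets of \<open>m\<close> only, and a set of the completion differs
  from its main part by a null set.\<close>

lemma AE_eq_completionI:
  fixes f g :: "'u \<Rightarrow> ennreal"
  assumes [measurable]: "f \<in> borel_measurable (completion m)" "g \<in> borel_measurable (completion m)"
    and fin: "(\<integral>\<^sup>+u. f u \<partial>completion m) \<noteq> \<infinity>"
    and eq: "\<And>A. A \<in> sets m \<Longrightarrow> (\<integral>\<^sup>+u\<in>A. f u \<partial>completion m) = (\<integral>\<^sup>+u\<in>A. g u \<partial>completion m)"
  shows "AE u in completion m. f u = g u"
proof -
  have main: "(\<integral>\<^sup>+u\<in>A. k u \<partial>completion m) = (\<integral>\<^sup>+u\<in>main_part m A. k u \<partial>completion m)"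
    if "A \<in> sets (completion m)" for A and k :: "'u \<Rightarrow> ennreal"
  proof -
    have "AE u in completion m. u \<in> main_part m A \<longleftrightarrow> u \<in> A" by (rule AE_completion[OF AE_in_main_part[OF that]])
    then show ?thesis by (intro nn_integral_cong_AE) (auto elim!: eventually_mono simp: indicator_def)
  qed
  have "density (completion m) f = density (completion m) g"
  proof (rule measure_eqI)
    fix A assume "A \<in> sets (density (completion m) f)"
    then have A: "A \<in> sets (completion m)" by simp
    then have "(\<integral>\<^sup>+u\<in>A. f u \<partial>completion m) = (\<integral>\<^sup>+u\<in>A. g u \<partial>completion m)"
      using main[OF A, of f] main[OF A, of g] eq[OF main_part_sets[OF A]] by simp
    then show "emeasure (density (completion m) f) A = emeasure (density (completion m) g) A"
      using A by (simp add: emeasure_density)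
  qed simp
  then show ?thesis using finite_density_unique[of f "completion m" g] fin by simp
qed

text \<open>The family enters only through the class of its almost everywhere versions, so both
  sides choose literally the same representative.\<close>

lemma at_family_cong:
  assumes "AE u in m. \<kappa> u = \<kappa>2 u"
  shows "at_family m c \<kappa> = at_family m c \<kappa>2"
proof -
  have "(AE u in m. \<kappa>' u = \<kappa> u) \<longleftrightarrow> (AE u in m. \<kappa>' u = \<kappa>2 u)" for \<kappa>'
  proof
    assume "AE u in m. \<kappa>' u = \<kappa> u" with assms show "AE u in m. \<kappa>' u = \<kappa>2 u" by eventually_elim simp
  next
    assume "AE u in m. \<kappa>' u = \<kappa>2 u" with assms show "AE u in m. \<kappa>' u = \<kappa> u" by eventually_elim simp
  qed
  then show ?thesis unfolding at_family_def by simp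
qed

lemma countably_based_const: "x \<in> topspace X \<Longrightarrow> countably_based M X (\<lambda>_. x)"
  by (rule countably_basedI[of "{space M}"]) auto

context aux_setting
begin

definition functional_law :: "(_ \<Rightarrow> 'b::euclidean_space) \<Rightarrow> 'u \<Rightarrow> 'b measure" where
  "functional_law f u = distr (\<nu> u) borel (\<lambda>y. f (u, y))"

lemma measurable_\<nu>_section: "f \<in> Xi \<rightarrow>\<^sub>M K \<Longrightarrow> (\<lambda>y. f (u, y)) \<in> \<nu> u \<rightarrow>\<^sub>M K"
  using measurable_section by (simp cong: measurable_cong_sets)

lemma measurable_completion_YS:
  assumes "f \<in> Xi \<rightarrow>\<^sub>M K" shows "(\<lambda>(u, y). f (u, y)) \<in> completion m \<Otimes>\<^sub>M YS T \<rightarrow>\<^sub>M K"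
proof -
  have "(\<lambda>z. (fst z, snd z)) \<in> completion m \<Otimes>\<^sub>M YS T \<rightarrow>\<^sub>M m \<Otimes>\<^sub>M YS T"
    by (intro measurable_Pair measurable_compose[OF measurable_fst] measurable_completion) simp_all
  then have "(\<lambda>z. f (fst z, snd z)) \<in> completion m \<Otimes>\<^sub>M YS T \<rightarrow>\<^sub>M K"
    by (rule measurable_compose) (use assms in \<open>simp add: Xi_def\<close>)
  then show ?thesis by (simp add: case_prod_beta')
qed

lemma functional_kernel:
  assumes "f \<in> Xi \<rightarrow>\<^sub>M K"
  shows "(\<lambda>u. distr (\<nu> u) K (\<lambda>y. f (u, y))) \<in> completion m \<rightarrow>\<^sub>M prob_algebra K"
  by (rule measurable_distr_prob_space2[OF \<nu>_kernel measurable_completion_YS[OF assms]])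

lemma functional_law_kernel:
  "f \<in> borel_measurable Xi \<Longrightarrow> functional_law f \<in> completion m \<rightarrow>\<^sub>M prob_algebra borel"
  using functional_kernel[of f borel] by (simp add: functional_law_def[abs_def])

text \<open>Integrated over the labels in \<open>A\<close>, both kernels give the probability that
  the label lies in \<open>A\<close> and \<open>X\<close> in \<open>C\<close>. This is uniqueness of
  the conditional law, with exceptional labels made independent of \<open>C\<close> by
  \<open>kernel_AE_eqI\<close>.\<close>

lemma cond_law_functional:
  fixes X :: "'w \<Rightarrow> 'b::euclidean_space"
  assumes f[measurable]: "f \<in> borel_measurable Xi" and [measurable]: "X \<in> borel_measurable M" and X: "AE \<omega> in M. X \<omega> = f (\<xi> \<omega>)"
    and \<kappa>: "cond_law M m v X \<kappa>"
  shows "AE u in m. \<kappa> u = functional_law f u"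
proof -
  have \<kappa>k: "\<kappa> \<in> completion m \<rightarrow>\<^sub>M prob_algebra borel" using \<kappa> by (simp add: cond_law_def)
  have "AE u in completion m. \<kappa> u = functional_law f u"
  proof (rule kernel_AE_eqI[OF \<kappa>k functional_law_kernel[OF f]])
    fix C :: "'b set" assume C[measurable]: "C \<in> sets borel"
    show "AE u in completion m. emeasure (\<kappa> u) C = emeasure (functional_law f u) C"
    proof (rule AE_eq_completionI)
      show "(\<lambda>u. emeasure (\<kappa> u) C) \<in> borel_measurable (completion m)"
        "(\<lambda>u. emeasure (functional_law f u) C) \<in> borel_measurable (completion m)"
        by (rule measurable_emeasure_prob_algebra[OF \<kappa>k C], rule measurable_emeasure_prob_algebra[OF functional_law_kernel[OF f] C])
      have "(\<integral>\<^sup>+u. emeasure (\<kappa> u) C \<partial>completion m) \<le> (\<integral>\<^sup>+u. 1 \<partial>completion m)"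
        by (intro nn_integral_mono prob_space.emeasure_le_1[OF prob_algebraD(1)[OF \<kappa>k]])
      also have "\<dots> = 1" using prob_space.emeasure_space_1[OF prob_space.prob_space_completion[OF prob_m]] by simp
      finally show "(\<integral>\<^sup>+u. emeasure (\<kappa> u) C \<partial>completion m) \<noteq> \<infinity>" by (auto simp: top_unique)
      fix A assume A[measurable]: "A \<in> sets m"
      have "(\<integral>\<^sup>+u\<in>A. emeasure (\<kappa> u) C \<partial>completion m) = emeasure M {\<omega> \<in> space M. v \<omega> \<in> A \<and> X \<omega> \<in> C}"
        using cond_law_emeasure[OF prob_space_axioms complete_measure_axioms sets_m v_measurable distr_v _ \<kappa>, of A C] A sets_m by simp
      also have "\<dots> = (\<integral>\<^sup>+\<omega>. indicator {\<omega> \<in> space M. v \<omega> \<in> A \<and> X \<omega> \<in> C} \<omega> \<partial>M)" by simp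
      also have "\<dots> = (\<integral>\<^sup>+\<omega>. (\<lambda>x. indicator A (fst x) * indicator C (f x)) (\<xi> \<omega>) \<partial>M)"
        using X AE_space by (intro nn_integral_cong_AE) (auto elim!: eventually_mono simp: \<xi>_def indicator_def)
      also have "\<dots> = (\<integral>\<^sup>+u. \<integral>\<^sup>+y. indicator A u * indicator C (f (u, y)) \<partial>\<nu> u \<partial>completion m)"
      proof -
        have "fst \<in> Xi \<rightarrow>\<^sub>M m" by (simp add: Xi_def)
        then have "(\<lambda>x. indicator A (fst x) * indicator C (f x) :: ennreal) \<in> borel_measurable Xi" by measurable
        from nn_integral_disintegration[OF this] show ?thesis by simp
      qed
      also have "\<dots> = (\<integral>\<^sup>+u\<in>A. emeasure (functional_law f u) C \<partial>completion m)"
      proof (rule nn_integral_cong)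
        fix u
        have fm[measurable]: "(\<lambda>y. f (u, y)) \<in> borel_measurable (\<nu> u)" by (rule measurable_\<nu>_section[OF f])
        have "(\<integral>\<^sup>+y. indicator C (f (u, y)) \<partial>\<nu> u) = (\<integral>\<^sup>+x. indicator C x \<partial>functional_law f u)"
          unfolding functional_law_def by (rule nn_integral_distr[symmetric]) measurable
        also have "\<dots> = emeasure (functional_law f u) C" by (rule nn_integral_indicator) (simp add: functional_law_def)
        finally show "(\<integral>\<^sup>+y. indicator A u * indicator C (f (u, y)) \<partial>\<nu> u) = emeasure (functional_law f u) C * indicator A u"
          by (simp add: indicator_def)
      qed
      finally show "(\<integral>\<^sup>+u\<in>A. emeasure (\<kappa> u) C \<partial>completion m) = (\<integral>\<^sup>+u\<in>A. emeasure (functional_law f u) C \<partial>completion m)" .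
    qed
  qed
  then show ?thesis by (simp add: AE_completion_iff)
qed

lemma nn_integral_functional_law:
  fixes f :: "_ \<Rightarrow> 'b::euclidean_space"
  assumes f: "f \<in> borel_measurable Xi" and [measurable]: "k \<in> borel_measurable borel"
  shows "(\<integral>\<^sup>+x. k x \<partial>functional_law f u) = (\<integral>\<^sup>+y. k (f (u, y)) \<partial>\<nu> u)"
  unfolding functional_law_def by (rule nn_integral_distr[OF measurable_\<nu>_section[OF f]]) simp

lemma second_moment_functional_law:
  fixes f :: "_ \<Rightarrow> 'b::euclidean_space"
  assumes f[measurable]: "f \<in> borel_measurable Xi"
  shows "(\<integral>\<^sup>+u. (\<integral>\<^sup>+x. ennreal ((norm x)\<^sup>2) \<partial>functional_law f u) \<partial>completion m) = (\<integral>\<^sup>+\<omega>. ennreal ((norm (f (\<xi> \<omega>)))\<^sup>2) \<partial>M)"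
  by (simp add: nn_integral_functional_law[OF f] nn_integral_disintegration[of "\<lambda>x. ennreal ((norm (f x))\<^sup>2)"])

text \<open>The existence condition inside \<open>at_family\<close> becomes finiteness of a second
  moment on the randomised space, and finiteness of such a moment can be checked measurably in
  time.\<close>

lemma P2m_representative_iff:
  fixes f :: "_ \<Rightarrow> 'b::euclidean_space"
  assumes f[measurable]: "f \<in> borel_measurable Xi"
  shows "(\<exists>\<kappa>'\<in>P2m m. AE u in m. \<kappa>' u = functional_law f u) \<longleftrightarrow> (\<integral>\<^sup>+\<omega>. ennreal ((norm (f (\<xi> \<omega>)))\<^sup>2) \<partial>M) < \<infinity>"
proof
  assume "\<exists>\<kappa>'\<in>P2m m. AE u in m. \<kappa>' u = functional_law f u"
  then obtain \<kappa>' where k: "\<kappa>' \<in> P2m m" "AE u in m. \<kappa>' u = functional_law f u" by blast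
  have "(\<integral>\<^sup>+u. (\<integral>\<^sup>+x. ennreal ((norm x)\<^sup>2) \<partial>functional_law f u) \<partial>completion m) =
      (\<integral>\<^sup>+u. (\<integral>\<^sup>+x. ennreal ((norm x)\<^sup>2) \<partial>\<kappa>' u) \<partial>completion m)"
    using AE_completion[OF k(2)] by (intro nn_integral_cong_AE) (auto elim!: eventually_mono)
  then show "(\<integral>\<^sup>+\<omega>. ennreal ((norm (f (\<xi> \<omega>)))\<^sup>2) \<partial>M) < \<infinity>"
    using k(1) by (simp add: P2m_def second_moment_functional_law[OF f])
next
  assume fin: "(\<integral>\<^sup>+\<omega>. ennreal ((norm (f (\<xi> \<omega>)))\<^sup>2) \<partial>M) < \<infinity>"
  let ?S = "\<lambda>u. \<integral>\<^sup>+x. ennreal ((norm x)\<^sup>2) \<partial>functional_law f u"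
  have Sm: "?S \<in> borel_measurable (completion m)"
    using measurable_nn_integral_\<nu>[of "\<lambda>x. ennreal ((norm (f x))\<^sup>2)"] by (simp add: nn_integral_functional_law[OF f])
  have Sfin: "(\<integral>\<^sup>+u. ?S u \<partial>completion m) < \<infinity>" using fin by (simp only: second_moment_functional_law[OF f])
  then have ae: "AE u in completion m. ?S u \<noteq> \<infinity>" using Sm by (intro nn_integral_PInf_AE) auto
  \<comment> \<open>\<open>P2m\<close> asks for a finite second moment at every label; the point
    mass at 0 fills in for the null set of labels where the law has none.\<close>
  define \<kappa>' where "\<kappa>' u = (if ?S u < \<infinity> then functional_law f u else return borel 0)" for u
  have "\<kappa>' \<in> completion m \<rightarrow>\<^sub>M prob_algebra borel"
    unfolding \<kappa>'_def
  proof (rule measurable_If[OF functional_law_kernel[OF f]])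
    show "(\<lambda>u. return borel 0) \<in> completion m \<rightarrow>\<^sub>M prob_algebra borel"
      by (rule measurable_const) (simp add: space_prob_algebra prob_space_return)
    show "{u \<in> space (completion m). ?S u < \<infinity>} \<in> sets (completion m)" using Sm by measurable
  qed
  moreover have "(\<integral>\<^sup>+x. ennreal ((norm x)\<^sup>2) \<partial>\<kappa>' u) < \<infinity>" for u
    by (cases "?S u < \<infinity>") (simp_all add: \<kappa>'_def nn_integral_return)
  moreover have eq: "AE u in completion m. \<kappa>' u = functional_law f u"
    using ae by eventually_elim (simp add: \<kappa>'_def top.not_eq_extremum)
  then have "(\<integral>\<^sup>+u. (\<integral>\<^sup>+x. ennreal ((norm x)\<^sup>2) \<partial>\<kappa>' u) \<partial>completion m) = (\<integral>\<^sup>+u. ?S u \<partial>completion m)"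
    by (intro nn_integral_cong_AE) (auto elim!: eventually_mono)
  ultimately have "\<kappa>' \<in> P2m m" using Sfin by (simp add: P2m_def)
  then show "\<exists>\<kappa>'\<in>P2m m. AE u in m. \<kappa>' u = functional_law f u" using eq by (auto simp: AE_completion_iff)
qed

text \<open>The joint law of the two functionals on the same fibre is a coupling.\<close>

lemma wasserstein2_functional_law_le:
  fixes f g :: "_ \<Rightarrow> 'b::euclidean_space"
  assumes f: "f \<in> borel_measurable Xi" and g: "g \<in> borel_measurable Xi"
  shows "ennreal ((wasserstein2 (functional_law f u) (functional_law g u))\<^sup>2) \<le> (\<integral>\<^sup>+y. ennreal ((norm (f (u, y) - g (u, y)))\<^sup>2) \<partial>\<nu> u)"
proof -
  have [measurable]: "(\<lambda>y. f (u, y)) \<in> borel_measurable (\<nu> u)" "(\<lambda>y. g (u, y)) \<in> borel_measurable (\<nu> u)"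
    by (rule measurable_\<nu>_section[OF f], rule measurable_\<nu>_section[OF g])
  define \<pi> where "\<pi> = distr (\<nu> u) borel (\<lambda>y. (f (u, y), g (u, y)))"
  have [measurable]: "(\<lambda>y. (f (u, y), g (u, y))) \<in> borel_measurable (\<nu> u)" by (rule borel_measurable_Pair) simp_all
  have fs: "fst \<in> borel_measurable (borel :: ('b \<times> 'b) measure)" "snd \<in> borel_measurable (borel :: ('b \<times> 'b) measure)"
    by (auto intro!: borel_measurable_continuous_onI continuous_intros)
  let ?C = "{\<pi> :: ('b \<times> 'b) measure. sets \<pi> = sets borel \<and> distr \<pi> borel fst = functional_law f u \<and> distr \<pi> borel snd = functional_law g u}"
  let ?I = "INF \<pi>\<in>?C. \<integral>\<^sup>+p. ennreal ((norm (fst p - snd p))\<^sup>2) \<partial>\<pi>"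
  have "\<pi> \<in> ?C" using fs by (simp add: \<pi>_def functional_law_def distr_distr o_def)
  then have "?I \<le> (\<integral>\<^sup>+p. ennreal ((norm (fst p - snd p))\<^sup>2) \<partial>\<pi>)" by (rule INF_lower)
  also have "\<dots> = (\<integral>\<^sup>+y. ennreal ((norm (f (u, y) - g (u, y)))\<^sup>2) \<partial>\<nu> u)"
    unfolding \<pi>_def using fs by (subst nn_integral_distr) auto
  finally have "?I \<le> (\<integral>\<^sup>+y. ennreal ((norm (f (u, y) - g (u, y)))\<^sup>2) \<partial>\<nu> u)" .
  moreover have "ennreal ((wasserstein2 (functional_law f u) (functional_law g u))\<^sup>2) = ennreal (enn2real ?I)"
    unfolding wasserstein2_def by simp
  \<comment> \<open>The conversion to a real number can only lower the value, as infinity is sent to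
    0, so the estimate survives it.\<close>
  moreover have "ennreal (enn2real ?I) \<le> ?I" by (cases ?I) auto
  ultimately show ?thesis by simp
qed

lemma W2m_functional_law_le:
  fixes f g :: "_ \<Rightarrow> 'b::euclidean_space"
  assumes f[measurable]: "f \<in> borel_measurable Xi" and g[measurable]: "g \<in> borel_measurable Xi"
    and k: "AE u in m. \<kappa> u = functional_law f u" "AE u in m. \<kappa>' u = functional_law g u"
    and e: "(\<integral>\<^sup>+\<omega>. ennreal ((norm (f (\<xi> \<omega>) - g (\<xi> \<omega>)))\<^sup>2) \<partial>M) < ennreal (e\<^sup>2)" "e > 0"
  shows "W2m m \<kappa> \<kappa>' < e"
proof -
  let ?W = "\<integral>\<^sup>+u. ennreal ((wasserstein2 (\<kappa> u) (\<kappa>' u))\<^sup>2) \<partial>completion m"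
  have "?W = (\<integral>\<^sup>+u. ennreal ((wasserstein2 (functional_law f u) (functional_law g u))\<^sup>2) \<partial>completion m)"
  proof (rule nn_integral_cong_AE)
    show "AE u in completion m. ennreal ((wasserstein2 (\<kappa> u) (\<kappa>' u))\<^sup>2) = ennreal ((wasserstein2 (functional_law f u) (functional_law g u))\<^sup>2)"
      using AE_completion[OF k(1)] AE_completion[OF k(2)] by eventually_elim simp
  qed
  also have "\<dots> \<le> (\<integral>\<^sup>+u. \<integral>\<^sup>+y. ennreal ((norm (f (u, y) - g (u, y)))\<^sup>2) \<partial>\<nu> u \<partial>completion m)"
    by (intro nn_integral_mono wasserstein2_functional_law_le[OF f g])
  also have "\<dots> = (\<integral>\<^sup>+\<omega>. ennreal ((norm (f (\<xi> \<omega>) - g (\<xi> \<omega>)))\<^sup>2) \<partial>M)"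
    by (rule nn_integral_disintegration[symmetric]) measurable
  also have "\<dots> < ennreal (e\<^sup>2)" by (rule e)
  finally have "enn2real ?W < e\<^sup>2" by (subst enn2real_less_iff) (auto simp: top.not_eq_extremum intro: less_trans)
  then show ?thesis unfolding W2m_def using e(2) by (simp add: real_less_lsqrt)
qed

text \<open>The inserted law depends on time alone. It therefore suffices that the map from time to
  a representative in \<open>P2m\<close> is countably based; then the tuple of label, time, state
  and law is, and the Borel coefficient may be composed with it.\<close>

lemma mean_field_measurable:
  fixes q :: "real \<Rightarrow> _ \<Rightarrow> 'e::euclidean_space" and c :: "'u \<Rightarrow> real \<Rightarrow> 'e \<Rightarrow> ('u \<Rightarrow> 'e measure) \<Rightarrow> 'b::{real_normed_vector, second_countable_topology}"
  assumes c: "coeff_measurable T m c"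
    and q: "(\<lambda>(t, x). q t x) \<in> borel_measurable (restrict_space borel {0..T} \<Otimes>\<^sub>M Xi)"
  shows "(\<lambda>(u, t, e). at_family m (c u t e) (functional_law (q t))) \<in>
    borel_measurable (borel \<Otimes>\<^sub>M restrict_space borel {0..T} \<Otimes>\<^sub>M borel)"
proof -
  let ?I = "restrict_space borel {0..T} :: real measure"
  define \<mu> where "\<mu> = distr M Xi \<xi>"
  interpret \<mu>: prob_space \<mu> unfolding \<mu>_def by (rule prob_space_distr) simp
  have s\<mu>[measurable_cong]: "sets \<mu> = sets Xi" by (simp add: \<mu>_def)
  have qm: "q t \<in> borel_measurable Xi" if "t \<in> {0..T}" for t
    using measurable_compose[OF measurable_Pair1' q, of t] that by (simp add: space_restrict_space)
  have q\<mu>: "(\<lambda>z. q (fst z) (snd z)) \<in> borel_measurable (?I \<Otimes>\<^sub>M \<mu>)"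
    using q by (simp add: case_prod_beta' cong: measurable_cong_sets sets_pair_measure_cong)
  define J where "J t = (\<integral>\<^sup>+x. ennreal ((norm (q t x))\<^sup>2) \<partial>\<mu>)" for t
  have "(\<lambda>(t, x). ennreal ((norm (q t x))\<^sup>2)) \<in> borel_measurable (?I \<Otimes>\<^sub>M \<mu>)"
    using q\<mu> by (simp add: case_prod_beta')
  then have Jm[measurable]: "J \<in> borel_measurable ?I" unfolding J_def by (rule \<mu>.borel_measurable_nn_integral)
  have J: "J t = (\<integral>\<^sup>+\<omega>. ennreal ((norm (q t (\<xi> \<omega>)))\<^sup>2) \<partial>M)" if "t \<in> {0..T}" for t
    unfolding J_def \<mu>_def using qm[OF that] by (subst nn_integral_distr) auto
  \<comment> \<open>The times with finite second moment; outside them \<open>at_family\<close> takes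
    its conventional value 0.\<close>
  define TG where "TG = {t \<in> space ?I. J t < \<infinity>}"
  have TG: "TG \<in> sets ?I" unfolding TG_def by measurable
  have TG_sub: "TG \<subseteq> {0..T}" by (auto simp: TG_def space_restrict_space)
  define \<kappa>s where "\<kappa>s t = (SOME \<kappa>'. \<kappa>' \<in> P2m m \<and> (AE u in m. \<kappa>' u = functional_law (q t) u))" for t
  have \<kappa>s: "\<kappa>s t \<in> P2m m" "AE u in m. \<kappa>s t u = functional_law (q t) u" if "t \<in> TG" for t
  proof -
    have "t \<in> {0..T}" "J t < \<infinity>" using that TG_sub by (auto simp: TG_def)
    then have "\<exists>\<kappa>'. \<kappa>' \<in> P2m m \<and> (AE u in m. \<kappa>' u = functional_law (q t) u)"
      using P2m_representative_iff[OF qm] J by auto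
    from someI_ex[OF this] show "\<kappa>s t \<in> P2m m" "AE u in m. \<kappa>s t u = functional_law (q t) u"
      unfolding \<kappa>s_def by blast+
  qed
  have at: "at_family m (c u t e) (functional_law (q t)) = (if t \<in> TG then c u t e (\<kappa>s t) else 0)" if "t \<in> {0..T}" for u t e
    unfolding at_family_def P2m_representative_iff[OF qm[OF that]] J[OF that, symmetric] \<kappa>s_def TG_def
    using that by (simp add: space_restrict_space)
  let ?N = "restrict_space borel TG :: real measure"
  have NI: "(\<lambda>t. t) \<in> ?N \<rightarrow>\<^sub>M ?I"
    by (rule measurable_restrict_space3) (use TG_sub in auto)
  \<comment> \<open>A mean square base for the functionals under the law of \<open>\<xi>\<close> is
    a base for the laws, since \<open>W2m\<close> is dominated by the mean square distance. The
    bound holds for any almost everywhere versions, so the arbitrary choice of representatives does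
    no harm.\<close>
  have cb\<kappa>: "countably_based ?N (P2m_top m) \<kappa>s"
  proof -
    have qN: "(\<lambda>z. q (fst z) (snd z)) \<in> borel_measurable (?N \<Otimes>\<^sub>M \<mu>)"
      using measurable_compose[OF measurable_Pair[OF measurable_compose[OF measurable_fst NI] measurable_snd] q\<mu>] by simp
    have fin: "(\<integral>\<^sup>+x. ennreal ((norm (q (fst (t, x)) (snd (t, x))))\<^sup>2) \<partial>\<mu>) < \<infinity>" if "t \<in> space ?N" for t
      using that by (auto simp: space_restrict_space TG_def J_def)
    obtain \<B> where B: "countable \<B>" "\<B> \<subseteq> sets ?N" "\<And>t e. t \<in> space ?N \<Longrightarrow> e > 0 \<Longrightarrow> \<exists>B\<in>\<B>. t \<in> B \<and>
      (\<forall>t'\<in>B. (\<integral>\<^sup>+x. ennreal ((norm (q t x - q t' x))\<^sup>2) \<partial>\<mu>) < ennreal e)"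
      using \<mu>.L2_countable_base[OF qN fin] by auto
    show ?thesis
    proof (rule countably_basedI[OF B(1,2)])
      show "\<kappa>s t \<in> topspace (P2m_top m)" if "t \<in> space ?N" for t using \<kappa>s(1) that by (simp add: space_restrict_space)
      fix t V assume t: "t \<in> space ?N" and V: "openin (P2m_top m) V" "\<kappa>s t \<in> V"
      then have tG: "t \<in> TG" by (simp add: space_restrict_space)
      obtain e where e: "e > 0" "\<forall>\<kappa>\<in>P2m m. W2m m (\<kappa>s t) \<kappa> < e \<longrightarrow> \<kappa> \<in> V"
        using V unfolding openin_dist_topology by blast
      obtain B1 where B1: "B1 \<in> \<B>" "t \<in> B1" "\<forall>t'\<in>B1. (\<integral>\<^sup>+x. ennreal ((norm (q t x - q t' x))\<^sup>2) \<partial>\<mu>) < ennreal (e\<^sup>2)"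
        using B(3)[OF t, of "e\<^sup>2"] e(1) by auto
      have "\<kappa>s t' \<in> V" if t': "t' \<in> B1" for t'
      proof -
        have "B1 \<subseteq> space ?N" using B1(1) B(2) by (intro sets.sets_into_space) auto
        then have t'G: "t' \<in> TG" using t' by (auto simp: space_restrict_space)
        have [measurable]: "q t \<in> borel_measurable Xi" "q t' \<in> borel_measurable Xi" using qm tG t'G TG_sub by auto
        have "(\<integral>\<^sup>+\<omega>. ennreal ((norm (q t (\<xi> \<omega>) - q t' (\<xi> \<omega>)))\<^sup>2) \<partial>M) = (\<integral>\<^sup>+x. ennreal ((norm (q t x - q t' x))\<^sup>2) \<partial>\<mu>)"
          unfolding \<mu>_def by (subst nn_integral_distr) auto
        then have "W2m m (\<kappa>s t) (\<kappa>s t') < e"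
          using B1(3) t' e(1) \<kappa>s(2)[OF tG] \<kappa>s(2)[OF t'G] by (intro W2m_functional_law_le[of "q t" "q t'"]) auto
        then show ?thesis using e(2) \<kappa>s(1)[OF t'G] by blast
      qed
      then show "\<exists>B\<in>\<B>. t \<in> B \<and> B \<subseteq> \<kappa>s -` V" using B1(1,2) by blast
    qed
  qed
  let ?Q = "borel \<Otimes>\<^sub>M ?I \<Otimes>\<^sub>M borel :: ('u \<times> real \<times> 'e) measure"
  \<comment> \<open>Measurability is shown on the arguments with time in \<open>TG\<close>, and the
    product with the indicator supplies the value 0 elsewhere.\<close>
  define S where "S = {z \<in> space ?Q. fst (snd z) \<in> TG}"
  have S: "S \<in> sets ?Q" unfolding S_def using TG by measurable
  let ?R = "restrict_space ?Q S"
  have r1: "fst \<in> borel_measurable ?R" "(\<lambda>z. fst (snd z)) \<in> ?R \<rightarrow>\<^sub>M ?N" "(\<lambda>z. snd (snd z)) \<in> borel_measurable ?R"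
  proof -
    show "fst \<in> borel_measurable ?R" "(\<lambda>z. snd (snd z)) \<in> borel_measurable ?R"
      by (rule measurable_restrict_space1, measurable)+
    have "(\<lambda>z. fst (snd z)) \<in> borel_measurable ?Q"
      by (rule measurable_compose[OF measurable_compose[OF measurable_snd measurable_fst]]) (rule measurable_restrict_space1, simp)
    then have "(\<lambda>z. fst (snd z)) \<in> borel_measurable ?R" by (rule measurable_restrict_space1)
    then show "(\<lambda>z. fst (snd z)) \<in> ?R \<rightarrow>\<^sub>M ?N"
      by (rule measurable_restrict_space2[rotated]) (auto simp: space_restrict_space S_def)
  qed
  have "countably_based ?R (prod_topology euclidean (prod_topology (top_of_set {0..T}) (prod_topology euclidean (P2m_top m))))
      (\<lambda>z. (fst z, fst (snd z), snd (snd z), \<kappa>s (fst (snd z))))"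
  proof (intro countably_based_pair countably_based_euclidean countably_based_top_of_set r1)
    show "countably_based ?R (P2m_top m) (\<lambda>z. \<kappa>s (fst (snd z)))" by (rule countably_based_compose[OF cb\<kappa> r1(2)])
    show "fst (snd z) \<in> {0..T}" if "z \<in> space ?R" for z using that TG_sub by (auto simp: space_restrict_space S_def)
    have "(\<lambda>t. t) \<in> borel_measurable ?N" by (rule measurable_restrict_space1) simp
    from measurable_compose[OF r1(2) this] show "(\<lambda>z. fst (snd z)) \<in> borel_measurable ?R" .
  qed
  from countably_based_subset[OF c[unfolded coeff_measurable_def] this]
  have "(\<lambda>z. c (fst z) (fst (snd z)) (snd (snd z)) (\<kappa>s (fst (snd z)))) \<in> borel_measurable ?R" by simp
  then have "(\<lambda>z. indicat_real S z *\<^sub>R c (fst z) (fst (snd z)) (snd (snd z)) (\<kappa>s (fst (snd z)))) \<in> borel_measurable ?Q"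
    using S by (subst (asm) borel_measurable_restrict_space_iff) auto
  also have "?this \<longleftrightarrow> ?thesis"
    by (rule measurable_cong) (auto simp: at space_pair_measure space_restrict_space S_def indicator_def)
  finally show ?thesis .
qed

text \<open>Here the law argument is constant, and a constant map is countably based for trivial
  reasons.\<close>

lemma terminal_measurable_at_family:
  fixes g :: "'u \<Rightarrow> 'e::euclidean_space \<Rightarrow> ('u \<Rightarrow> 'e measure) \<Rightarrow> 'b::{real_normed_vector, second_countable_topology}"
  assumes g: "terminal_measurable m g"
  shows "(\<lambda>(u, x). at_family m (g u x) \<kappa>) \<in> borel_measurable (borel \<Otimes>\<^sub>M borel)"
proof (cases "\<exists>\<kappa>'\<in>P2m m. AE u in m. \<kappa>' u = \<kappa> u")
  case True
  define \<kappa>s where "\<kappa>s = (SOME \<kappa>'. \<kappa>' \<in> P2m m \<and> (AE u in m. \<kappa>' u = \<kappa> u))"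
  have "\<kappa>s \<in> P2m m" using someI_ex[of "\<lambda>\<kappa>'. \<kappa>' \<in> P2m m \<and> (AE u in m. \<kappa>' u = \<kappa> u)"] True by (auto simp: \<kappa>s_def)
  then have "countably_based (borel \<Otimes>\<^sub>M borel) (prod_topology euclidean (prod_topology euclidean (P2m_top m))) (\<lambda>z :: 'u \<times> 'e. (fst z, snd z, \<kappa>s))"
    by (intro countably_based_pair countably_based_euclidean countably_based_const) auto
  from countably_based_subset[OF g[unfolded terminal_measurable_def] this] show ?thesis
    using True by (simp add: at_family_def \<kappa>s_def case_prod_beta')
next
  case False
  then have "at_family m (g u x) \<kappa> = 0" for u x by (auto simp: at_family_def)
  then show ?thesis by simp
qed

text \<open>Stopping a continuous path at \<open>t\<close> gives a continuous path whose coordinates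
  are jointly measurable in \<open>t\<close> and the noise; the tubes then supply the countable base
  for the path argument.\<close>

lemma control_measurable_functional:
  fixes \<Lambda> :: "'u \<Rightarrow> real \<Rightarrow> real^'n \<Rightarrow> (real \<Rightarrow> real^'d) \<Rightarrow> 'b::{real_normed_vector, second_countable_topology}"
  assumes \<Lambda>: "control_measurable T \<Lambda>"
  shows "(\<lambda>(t, x). \<Lambda> (fst x) t (fst (snd x)) (stopped_path T (\<lambda>s x. snd (snd x) s) t x)) \<in>
    borel_measurable (restrict_space borel {0..T} \<Otimes>\<^sub>M Xi)"
proof -
  let ?Q = "restrict_space borel {0..T} \<Otimes>\<^sub>M Xi"
  have f1: "fst \<in> borel_measurable ?Q" by (rule measurable_compose[OF measurable_fst measurable_restrict_space1]) simp
  have sn: "snd \<in> ?Q \<rightarrow>\<^sub>M m \<Otimes>\<^sub>M YS T" by (simp add: Xi_def[symmetric])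
  have f2: "(\<lambda>z. fst (snd z)) \<in> borel_measurable ?Q"
    using measurable_compose[OF sn measurable_fst] sets_m by (simp cong: measurable_cong_sets)
  have ys: "(\<lambda>z. snd (snd z)) \<in> ?Q \<rightarrow>\<^sub>M YS T" using measurable_compose[OF sn measurable_snd] .
  have f3: "(\<lambda>z. fst (snd (snd z))) \<in> borel_measurable ?Q" by (rule measurable_compose[OF ys measurable_YS_fst])
  have in_T: "fst z \<in> {0..T}" "snd (snd z) \<in> space (YS T)" if "z \<in> space ?Q" for z
    using that by (auto simp: space_pair_measure space_restrict_space Xi_def)
  have w: "(\<lambda>(s, y). snd y s) \<in> borel_measurable (restrict_space borel {0..T} \<Otimes>\<^sub>M YS T)"
    by (rule continuous_progressive[where f = "\<lambda>s y. snd y s", OF _ YS_continuous measurable_YS_eval]) (use T in auto)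
  have st: "countably_based ?Q (C_top T) (\<lambda>z. \<lambda>s\<in>{0..T}. snd (snd (snd z)) (min s (fst z)))"
  proof (rule countably_based_C[OF T])
    fix z assume z: "z \<in> space ?Q"
    show "continuous_on {0..T} (\<lambda>s. snd (snd (snd z)) (min s (fst z)))"
      by (rule continuous_on_compose2[OF YS_continuous[OF in_T(2)[OF z]]]) (use in_T(1)[OF z] in \<open>auto intro!: continuous_intros\<close>)
  next
    fix s assume s: "s \<in> {0..T}"
    have m: "(\<lambda>z. min s (fst z)) \<in> ?Q \<rightarrow>\<^sub>M restrict_space borel {0..T}"
      by (rule measurable_restrict_space2) (use f1 s in_T in \<open>auto simp: min_def\<close>)
    from measurable_compose[OF measurable_Pair[OF m ys] w]
    show "(\<lambda>z. snd (snd (snd z)) (min s (fst z))) \<in> borel_measurable ?Q" by simp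
  qed
  have "countably_based ?Q (prod_topology euclidean (prod_topology (top_of_set {0..T}) (prod_topology euclidean (C_top T))))
    (\<lambda>z. (fst (snd z), fst z, fst (snd (snd z)), \<lambda>s\<in>{0..T}. snd (snd (snd z)) (min s (fst z))))"
    by (intro countably_based_pair countably_based_euclidean countably_based_top_of_set f1 f2 f3 st in_T(1))
  from countably_based_subset[OF \<Lambda>[unfolded control_measurable_def] this] show ?thesis
    by (simp add: case_prod_beta' stopped_path_def)
qed

end

subsection \<open>Disintegration of the equation\<close>

lemma topspace_S1:
  fixes p :: "('n::finite, 'l::finite, 'd::finite, 'k::finite) S1"
  shows "p \<in> topspace (S1_top T) \<longleftrightarrow>
    fst p \<in> topspace (C_top T) \<and> fst (snd p) \<in> topspace (C_top T) \<and>
    fst (snd (snd p)) \<in> sq_int T // L2_rel T \<and> snd (snd (snd p)) \<in> sq_int T // L2_rel T"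
  by (cases p) (auto simp: S1_top_def)

text \<open>The class of a function that is not square integrable is empty, whereas equivalence
  classes are not. Membership of a path in \<open>S1\<close> thus carries the integrability.\<close>

lemma L2_class_in_quotientD:
  assumes "L2_class T z \<in> sq_int T // L2_rel T" shows "z \<in> sq_int T"
proof -
  have "L2_class T z \<noteq> {}" using assms in_quotient_imp_non_empty[OF equiv_L2_rel] by blast
  then show ?thesis by (auto simp: L2_class_def L2_rel_def)
qed

lemma borel_measurable_quad:
  fixes X :: "'w \<Rightarrow> 'a::second_countable_topology" and Y :: "'w \<Rightarrow> 'b::second_countable_topology"
    and Z :: "'w \<Rightarrow> 'c::second_countable_topology" and L :: "'w \<Rightarrow> 'e::second_countable_topology"
  shows "(\<lambda>\<omega>. (X \<omega>, Y \<omega>, Z \<omega>, L \<omega>)) \<in> borel_measurable N \<longleftrightarrow>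
    X \<in> borel_measurable N \<and> Y \<in> borel_measurable N \<and> Z \<in> borel_measurable N \<and> L \<in> borel_measurable N"
proof
  assume *: "(\<lambda>\<omega>. (X \<omega>, Y \<omega>, Z \<omega>, L \<omega>)) \<in> borel_measurable N"
  have c: "(\<lambda>p :: 'a \<times> 'b \<times> 'c \<times> 'e. fst p) \<in> borel_measurable borel"
    "(\<lambda>p :: 'a \<times> 'b \<times> 'c \<times> 'e. fst (snd p)) \<in> borel_measurable borel"
    "(\<lambda>p :: 'a \<times> 'b \<times> 'c \<times> 'e. fst (snd (snd p))) \<in> borel_measurable borel"
    "(\<lambda>p :: 'a \<times> 'b \<times> 'c \<times> 'e. snd (snd (snd p))) \<in> borel_measurable borel"
    by (auto intro!: borel_measurable_continuous_onI continuous_intros)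
  show "X \<in> borel_measurable N \<and> Y \<in> borel_measurable N \<and> Z \<in> borel_measurable N \<and> L \<in> borel_measurable N"
    using measurable_compose[OF * c(1)] measurable_compose[OF * c(2)] measurable_compose[OF * c(3)] measurable_compose[OF * c(4)] by simp
qed (auto intro!: borel_measurable_Pair)

lemma progressive_quad:
  fixes X :: "real \<Rightarrow> 'w \<Rightarrow> 'a::second_countable_topology" and Y :: "real \<Rightarrow> 'w \<Rightarrow> 'b::second_countable_topology"
    and Z :: "real \<Rightarrow> 'w \<Rightarrow> 'c::second_countable_topology" and L :: "real \<Rightarrow> 'w \<Rightarrow> 'e::second_countable_topology"
  shows "progressive T F (quad X Y Z L) \<longleftrightarrow>
    progressive T F X \<and> progressive T F Y \<and> progressive T F Z \<and> progressive T F L"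
  unfolding progressive_def quad_def[abs_def] case_prod_beta' borel_measurable_quad by blast

context aux_setting
begin

abbreviation (input) Ic :: "real measure" where "Ic \<equiv> restrict_space borel {0..T}"

lemma continuous_joint_functional:
  fixes \<eta> :: "real \<Rightarrow> _ \<Rightarrow> 'b::metric_space"
  assumes "\<forall>t\<in>{0..T}. \<eta> t \<in> borel_measurable Xi" "\<forall>x. continuous_on {0..T} (\<lambda>t. \<eta> t x)"
  shows "(\<lambda>(t, x). \<eta> t x) \<in> borel_measurable (Ic \<Otimes>\<^sub>M Xi)"
  by (rule continuous_progressive) (use T assms in auto)

lemma continuous_adapted_progressive:
  fixes \<eta> :: "real \<Rightarrow> _ \<Rightarrow> 'b::metric_space"
  assumes "\<forall>x. continuous_on {0..T} (\<lambda>t. \<eta> t x)"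
    and "\<forall>t\<in>{0..T}. (\<lambda>y. \<eta> t (u, y)) \<in> borel_measurable (FY u t)"
  shows "progressive T (FY u) (\<lambda>t y. \<eta> t (u, y))"
  unfolding progressive_def
proof
  fix t assume t: "t \<in> {0..T}"
  show "(\<lambda>(s, y). \<eta> s (u, y)) \<in> borel_measurable (restrict_space borel {0..t} \<Otimes>\<^sub>M FY u t)"
  proof (rule continuous_progressive)
    show "continuous_on {0..t} (\<lambda>t. \<eta> t (u, y))" for y
      by (rule continuous_on_subset[OF assms(1)[rule_format]]) (use t in auto)
    show "(\<lambda>y. \<eta> s (u, y)) \<in> borel_measurable (FY u t)" if "s \<in> {0..t}" for s
      using assms(2) that t by (intro measurable_FY_mono[of s t]) auto
  qed (use t in auto)
qed

lemma joint_at_time: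
  assumes "(\<lambda>(t, x). \<beta> t x) \<in> K \<rightarrow>\<^sub>M N" "K = Ic \<Otimes>\<^sub>M Xi" "t \<in> {0..T}"
  shows "\<beta> t \<in> Xi \<rightarrow>\<^sub>M N"
  using measurable_compose[OF measurable_Pair1'[of t Ic Xi] assms(1)[unfolded assms(2)]] assms(3)
  by (simp add: space_restrict_space)

lemma set_integrable_Icc: "set_integrable lborel {0..T} f \<longleftrightarrow> integrable (Icc_measure T) f"
  for f :: "real \<Rightarrow> 'b::euclidean_space"
  by (subst integrable_restrict_space) (simp_all add: set_integrable_def)

lemma pred_set_integrable:
  fixes \<beta> :: "real \<Rightarrow> _ \<Rightarrow> 'b::euclidean_space"
  assumes "(\<lambda>(t, x). \<beta> t x) \<in> borel_measurable (Ic \<Otimes>\<^sub>M Xi)"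
  shows "Measurable.pred Xi (\<lambda>x. set_integrable lborel {0..T} (\<lambda>s. \<beta> s x))"
proof -
  interpret finite_measure "Icc_measure T" by (rule finite_measure_Icc)
  have [measurable]: "(\<lambda>(x, t). \<beta> t x) \<in> borel_measurable (Xi \<Otimes>\<^sub>M Icc_measure T)"
    by (rule measurable_Icc_pair[OF assms])
  show ?thesis unfolding set_integrable_Icc by measurable
qed

lemma set_integrable_cong_Icc:
  assumes "\<And>s. s \<in> {0..T} \<Longrightarrow> f s = g s"
  shows "set_integrable lborel {0..T} f \<longleftrightarrow> set_integrable lborel {0..T} g"
  unfolding set_integrable_def by (rule arg_cong[where f = "integrable lborel"]) (auto simp: fun_eq_iff indicator_def assms)

lemma LINT_cong_Icc:
  assumes "\<And>s. s \<in> {0..T} \<Longrightarrow> f s = g s" "S \<subseteq> {0..T}"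
  shows "(LINT s:S|lborel. f s) = (LINT s:S|lborel. g s)"
  unfolding set_lebesgue_integral_def by (intro Bochner_Integration.integral_cong) (use assms in \<open>auto simp: indicator_def\<close>)

text \<open>An identity required at all times is not visibly measurable on \<open>Xi\<close>; at the
  dense times it is a countable conjunction. On the fibre both sides are continuous in time, which
  restores the remaining times.\<close>

lemma forward_disintegration:
  fixes x' \<beta> \<iota> :: "real \<Rightarrow> _ \<Rightarrow> 'b::euclidean_space"
  assumes x': "\<forall>t\<in>{0..T}. x' t \<in> borel_measurable Xi" "\<forall>x. continuous_on {0..T} (\<lambda>t. x' t x)"
    and \<iota>: "\<forall>t\<in>{0..T}. \<iota> t \<in> borel_measurable Xi" "\<forall>x. continuous_on {0..T} (\<lambda>t. \<iota> t x)"
    and \<beta>: "(\<lambda>(t, x). \<beta> t x) \<in> borel_measurable (Ic \<Otimes>\<^sub>M Xi)"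
    and ae: "AE \<omega> in M. set_integrable lborel {0..T} (\<lambda>s. \<beta> s (\<xi> \<omega>)) \<and>
      (\<forall>t\<in>{0..T}. x' t (\<xi> \<omega>) = x' 0 (\<xi> \<omega>) + (LINT s:{0..t}|lborel. \<beta> s (\<xi> \<omega>)) + \<iota> t (\<xi> \<omega>))"
  shows "AE u in completion m. AE y in \<nu> u. set_integrable lborel {0..T} (\<lambda>s. \<beta> s (u, y)) \<and>
      (\<forall>t\<in>{0..T}. x' t (u, y) = x' 0 (u, y) + (LINT s:{0..t}|lborel. \<beta> s (u, y)) + \<iota> t (u, y))"
proof -
  note D = Icc_dense[OF T]
  let ?P = "\<lambda>x. set_integrable lborel {0..T} (\<lambda>s. \<beta> s x) \<and>
      (\<forall>t\<in>Icc_dense T. x' t x = x' 0 x + (LINT s:{0..t}|lborel. \<beta> s x) + \<iota> t x)"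
  have "Measurable.pred Xi ?P"
  proof (intro pred_intros_logic pred_set_integrable[OF \<beta>])
    have "{x \<in> space Xi. \<forall>t\<in>Icc_dense T. x' t x = x' 0 x + (LINT s:{0..t}|lborel. \<beta> s x) + \<iota> t x} \<in> sets Xi"
    proof (rule sets.sets_Collect_countable_All'[OF _ D(1)])
      fix t assume "t \<in> Icc_dense T"
      then have t: "t \<in> {0..T}" using D(2) by auto
      have [measurable]: "x' t \<in> borel_measurable Xi" "x' 0 \<in> borel_measurable Xi" "\<iota> t \<in> borel_measurable Xi"
        using x'(1) \<iota>(1) t T by auto
      have [measurable]: "(\<lambda>x. LINT s:{0..t}|lborel. \<beta> s x) \<in> borel_measurable Xi"
        by (rule measurable_LINT[OF \<beta>]) (use t in auto)
      show "{x \<in> space Xi. x' t x = x' 0 x + (LINT s:{0..t}|lborel. \<beta> s x) + \<iota> t x} \<in> sets Xi" by measurable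
    qed
    then show "Measurable.pred Xi (\<lambda>x. \<forall>t\<in>Icc_dense T. x' t x = x' 0 x + (LINT s:{0..t}|lborel. \<beta> s x) + \<iota> t x)"
      by (simp add: pred_def)
  qed
  moreover from ae have "AE \<omega> in M. ?P (\<xi> \<omega>)" by eventually_elim (use D(2) in blast)
  ultimately have "AE u in completion m. AE y in \<nu> u. ?P (u, y)" by (rule AE_disintegration)
  then show ?thesis
  proof eventually_elim
    case (elim u)
    then show ?case
    proof eventually_elim
      case (elim y)
      then have si: "set_integrable lborel {0..T} (\<lambda>s. \<beta> s (u, y))" by simp
      have "x' t (u, y) = x' 0 (u, y) + (LINT s:{0..t}|lborel. \<beta> s (u, y)) + \<iota> t (u, y)" if t: "t \<in> {0..T}" for t
      proof (rule continuous_eq_on_dense[OF T _ _ _ t])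
        show "continuous_on {0..T} (\<lambda>t. x' t (u, y))" using x'(2) by blast
        show "continuous_on {0..T} (\<lambda>t. x' 0 (u, y) + (LINT s:{0..t}|lborel. \<beta> s (u, y)) + \<iota> t (u, y))"
          by (intro continuous_intros continuous_on_LINT[OF si] \<iota>(2)[rule_format])
      qed (use elim in blast)
      then show ?case using si by blast
    qed
  qed
qed

text \<open>With drift \<open>- f\<close> and noise term \<open>j t - j 0\<close> the backward
  equation is a forward one. Hence a single transport argument serves both equations.\<close>

lemma backward_as_forward:
  fixes y j :: "real \<Rightarrow> 'b::euclidean_space"
  assumes "set_integrable lborel {0..T} f"
  shows "(\<forall>t\<in>{0..T}. y t = y T + (LINT s:{t..T}|lborel. f s) - (j T - j t)) \<longleftrightarrow>
    (\<forall>t\<in>{0..T}. y t = y 0 + (LINT s:{0..t}|lborel. - f s) + (j t - j 0))"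
proof -
  have d: "(LINT s:{t..T}|lborel. f s) = (LINT s:{0..T}|lborel. f s) - (LINT s:{0..t}|lborel. f s)" if "t \<in> {0..T}" for t
    by (rule LINT_Icc_diff[OF assms]) (use that in auto)
  have n: "(LINT s:{0..t}|lborel. - f s) = - (LINT s:{0..t}|lborel. f s)" for t
    by (simp add: set_lebesgue_integral_def)
  have z: "(LINT s:{0..0}|lborel. f s) = 0"
    using d[of 0] T LINT_Icc_diff[OF assms, of 0 0] by simp
  show ?thesis
  proof
    assume *: "\<forall>t\<in>{0..T}. y t = y T + (LINT s:{t..T}|lborel. f s) - (j T - j t)"
    show "\<forall>t\<in>{0..T}. y t = y 0 + (LINT s:{0..t}|lborel. - f s) + (j t - j 0)"
    proof
      fix t assume t: "t \<in> {0..T}"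
      have i0: "0 \<in> {0..T}" using T by simp
      have "y t = y T + ((LINT s:{0..T}|lborel. f s) - (LINT s:{0..t}|lborel. f s)) - (j T - j t)"
        using *[rule_format, OF t] by (simp only: d[OF t])
      moreover have "y 0 = y T + (LINT s:{0..T}|lborel. f s) - (j T - j 0)"
        by (rule *[rule_format, OF i0])
      ultimately show "y t = y 0 + (LINT s:{0..t}|lborel. - f s) + (j t - j 0)" unfolding n by simp
    qed
  next
    assume *: "\<forall>t\<in>{0..T}. y t = y 0 + (LINT s:{0..t}|lborel. - f s) + (j t - j 0)"
    show "\<forall>t\<in>{0..T}. y t = y T + (LINT s:{t..T}|lborel. f s) - (j T - j t)"
    proof
      fix t assume t: "t \<in> {0..T}"
      have iT: "T \<in> {0..T}" using T by simp
      have "y t = y 0 + - (LINT s:{0..t}|lborel. f s) + (j t - j 0)"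
        using *[rule_format, OF t] by (simp only: n)
      moreover have "y T = y 0 + - (LINT s:{0..T}|lborel. f s) + (j T - j 0)"
        using *[rule_format, OF iT] by (simp only: n)
      ultimately show "y t = y T + (LINT s:{t..T}|lborel. f s) - (j T - j t)" unfolding d[OF t] by simp
    qed
  qed
qed

text \<open>Tonelli against \<open>M\<close> and against each fibre. The time integral is brought
  inside first, because it is functionals of \<open>\<xi>\<close> that disintegrate.\<close>

lemma time_integral_disintegration:
  fixes k :: "real \<Rightarrow> _ \<Rightarrow> ennreal"
  assumes k: "(\<lambda>(t, x). k t x) \<in> borel_measurable (Ic \<Otimes>\<^sub>M Xi)"
  shows "(\<lambda>x. \<integral>\<^sup>+t\<in>{0..T}. k t x \<partial>lborel) \<in> borel_measurable Xi"
    and "(\<integral>\<^sup>+t\<in>{0..T}. (\<integral>\<^sup>+y. k t (u, y) \<partial>\<nu> u) \<partial>lborel) = (\<integral>\<^sup>+y. (\<integral>\<^sup>+t\<in>{0..T}. k t (u, y) \<partial>lborel) \<partial>\<nu> u)"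
    and "(\<integral>\<^sup>+t\<in>{0..T}. (\<integral>\<^sup>+\<omega>. k t (\<xi> \<omega>) \<partial>M) \<partial>lborel) =
      (\<integral>\<^sup>+u. (\<integral>\<^sup>+t\<in>{0..T}. (\<integral>\<^sup>+y. k t (u, y) \<partial>\<nu> u) \<partial>lborel) \<partial>completion m)"
proof -
  interpret I: finite_measure "Icc_measure T" by (rule finite_measure_Icc)
  have restr: "(\<integral>\<^sup>+t\<in>{0..T}. g t \<partial>lborel) = (\<integral>\<^sup>+t. g t \<partial>Icc_measure T)" for g :: "real \<Rightarrow> ennreal"
    by (simp add: nn_integral_restrict_space)
  have km[measurable]: "(\<lambda>(x, t). k t x) \<in> borel_measurable (Xi \<Otimes>\<^sub>M Icc_measure T)"
    using measurable_compose[OF measurable_pair_swap' k]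
    by (simp add: case_prod_beta' restrict_space_lborel_borel cong: measurable_cong_sets sets_pair_measure_cong)
  show K: "(\<lambda>x. \<integral>\<^sup>+t\<in>{0..T}. k t x \<partial>lborel) \<in> borel_measurable Xi"
    unfolding restr by (rule I.borel_measurable_nn_integral[OF km])
  have sw: "(\<integral>\<^sup>+t\<in>{0..T}. (\<integral>\<^sup>+y. k t (u, y) \<partial>\<nu> u) \<partial>lborel) = (\<integral>\<^sup>+y. (\<integral>\<^sup>+t\<in>{0..T}. k t (u, y) \<partial>lborel) \<partial>\<nu> u)" for u
  proof -
    interpret n: prob_space "\<nu> u" by (rule prob_\<nu>)
    interpret pair_sigma_finite "\<nu> u" "Icc_measure T" by unfold_locales
    have "(\<lambda>z. (u, z)) \<in> \<nu> u \<rightarrow>\<^sub>M Xi" by (rule measurable_\<nu>_section) simp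
    then have "(\<lambda>z. ((u, fst z), snd z)) \<in> \<nu> u \<Otimes>\<^sub>M Icc_measure T \<rightarrow>\<^sub>M Xi \<Otimes>\<^sub>M Icc_measure T"
      by (intro measurable_Pair measurable_compose[OF measurable_fst] measurable_snd)
    from measurable_compose[OF this km] have "(\<lambda>(y, t). k t (u, y)) \<in> borel_measurable (\<nu> u \<Otimes>\<^sub>M Icc_measure T)"
      by (simp add: case_prod_beta')
    from Fubini'[OF this] show ?thesis unfolding restr by simp
  qed
  then show "(\<integral>\<^sup>+t\<in>{0..T}. (\<integral>\<^sup>+y. k t (u, y) \<partial>\<nu> u) \<partial>lborel) = (\<integral>\<^sup>+y. (\<integral>\<^sup>+t\<in>{0..T}. k t (u, y) \<partial>lborel) \<partial>\<nu> u)" .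
  interpret p: pair_sigma_finite M "Icc_measure T" by unfold_locales
  have "(\<lambda>z. (\<xi> (fst z), snd z)) \<in> M \<Otimes>\<^sub>M Icc_measure T \<rightarrow>\<^sub>M Xi \<Otimes>\<^sub>M Icc_measure T" by measurable
  from measurable_compose[OF this km] have "(\<lambda>(\<omega>, t). k t (\<xi> \<omega>)) \<in> borel_measurable (M \<Otimes>\<^sub>M Icc_measure T)"
    by (simp add: case_prod_beta')
  from p.Fubini'[OF this] have "(\<integral>\<^sup>+t\<in>{0..T}. (\<integral>\<^sup>+\<omega>. k t (\<xi> \<omega>) \<partial>M) \<partial>lborel) = (\<integral>\<^sup>+\<omega>. (\<integral>\<^sup>+t\<in>{0..T}. k t (\<xi> \<omega>) \<partial>lborel) \<partial>M)"
    unfolding restr by simp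
  also have "\<dots> = (\<integral>\<^sup>+u. \<integral>\<^sup>+y. (\<integral>\<^sup>+t\<in>{0..T}. k t (u, y) \<partial>lborel) \<partial>\<nu> u \<partial>completion m)"
    by (rule nn_integral_disintegration[OF K])
  finally show "(\<integral>\<^sup>+t\<in>{0..T}. (\<integral>\<^sup>+\<omega>. k t (\<xi> \<omega>) \<partial>M) \<partial>lborel) =
      (\<integral>\<^sup>+u. (\<integral>\<^sup>+t\<in>{0..T}. (\<integral>\<^sup>+y. k t (u, y) \<partial>\<nu> u) \<partial>lborel) \<partial>completion m)" by (simp only: sw)
qed

text \<open>On a fibre the coefficient is a measurable function of time and of the current value of
  the process, because the law argument is deterministic; progressive measurability is
  inherited.\<close>

lemma coefficient_functional:
  fixes q :: "real \<Rightarrow> _ \<Rightarrow> 'e::euclidean_space" and c :: "'u \<Rightarrow> real \<Rightarrow> 'e \<Rightarrow> ('u \<Rightarrow> 'e measure) \<Rightarrow> 'b::{real_normed_vector, second_countable_topology}"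
  assumes c: "coeff_measurable T m c" and q: "(\<lambda>(t, x). q t x) \<in> borel_measurable (Ic \<Otimes>\<^sub>M Xi)"
  shows "(\<lambda>(t, x). at_family m (c (fst x) t (q t x)) (functional_law (q t))) \<in> borel_measurable (Ic \<Otimes>\<^sub>M Xi)"
    and "progressive T (FY u) (\<lambda>t y. q t (u, y)) \<Longrightarrow>
      progressive T (FY u) (\<lambda>t y. at_family m (c u t (q t (u, y))) (functional_law (q t)))"
proof -
  note mf = mean_field_measurable[OF c q]
  have f: "(\<lambda>z. fst (snd z)) \<in> borel_measurable (Ic \<Otimes>\<^sub>M Xi)"
  proof -
    have "fst \<in> borel_measurable Xi" unfolding Xi_def using measurable_fst[of m] sets_m by (simp cong: measurable_cong_sets)
    then show ?thesis by (rule measurable_compose[OF measurable_snd])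
  qed
  have "(\<lambda>z. (fst (snd z), fst z, q (fst z) (snd z))) \<in> Ic \<Otimes>\<^sub>M Xi \<rightarrow>\<^sub>M borel \<Otimes>\<^sub>M Ic \<Otimes>\<^sub>M borel"
    using f q by (intro measurable_Pair) (simp_all add: case_prod_beta')
  from measurable_compose[OF this mf] show "(\<lambda>(t, x). at_family m (c (fst x) t (q t x)) (functional_law (q t))) \<in> borel_measurable (Ic \<Otimes>\<^sub>M Xi)"
    by (simp add: case_prod_beta')
  assume pr: "progressive T (FY u) (\<lambda>t y. q t (u, y))"
  show "progressive T (FY u) (\<lambda>t y. at_family m (c u t (q t (u, y))) (functional_law (q t)))"
    unfolding progressive_def
  proof
    fix t assume t: "t \<in> {0..T}"
    let ?N = "restrict_space borel {0..t} \<Otimes>\<^sub>M FY u t"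
    have "fst \<in> ?N \<rightarrow>\<^sub>M Ic"
      by (rule measurable_compose[OF measurable_fst measurable_restrict_space3]) (use t in auto)
    moreover have "(\<lambda>z. q (fst z) (u, snd z)) \<in> borel_measurable ?N"
      using progressiveD[OF pr t] by (simp add: case_prod_beta')
    ultimately have "(\<lambda>z. (u, fst z, q (fst z) (u, snd z))) \<in> ?N \<rightarrow>\<^sub>M borel \<Otimes>\<^sub>M Ic \<Otimes>\<^sub>M borel"
      by (intro measurable_Pair) auto
    from measurable_compose[OF this mf] show "(\<lambda>(s, y). at_family m (c u s (q s (u, y))) (functional_law (q s))) \<in> borel_measurable ?N"
      by (simp add: case_prod_beta')
  qed
qed

end

section \<open>Energy and the equation on almost every fibre\<close>

context aux_setting
begin

abbreviation sec :: "'u \<Rightarrow> (real \<Rightarrow> 'u \<times> 'y \<Rightarrow> 'b) \<Rightarrow> real \<Rightarrow> 'y \<Rightarrow> 'b" where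
  "sec u F \<equiv> \<lambda>t y. F t (u, y)"

text \<open>Continuity in time makes the suprema measurable functionals, so each of the three terms
  is an expectation or a time integral of expectations of functionals of
  \<open>\<xi>\<close>.\<close>

lemma energy_disintegration:
  fixes X' :: "real \<Rightarrow> _ \<Rightarrow> real^'nn::finite" and Y' :: "real \<Rightarrow> _ \<Rightarrow> real^'l::finite"
    and Z' :: "real \<Rightarrow> _ \<Rightarrow> real^'dd::finite^'l" and L' :: "real \<Rightarrow> _ \<Rightarrow> real^'k::finite"
  assumes X': "\<forall>t\<in>{0..T}. X' t \<in> borel_measurable Xi" "\<forall>x. continuous_on {0..T} (\<lambda>t. X' t x)"
    and Y': "\<forall>t\<in>{0..T}. Y' t \<in> borel_measurable Xi" "\<forall>x. continuous_on {0..T} (\<lambda>t. Y' t x)"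
    and Z': "(\<lambda>(t, x). Z' t x) \<in> borel_measurable (Ic \<Otimes>\<^sub>M Xi)" and L': "(\<lambda>(t, x). L' t x) \<in> borel_measurable (Ic \<Otimes>\<^sub>M Xi)"
    and eq: "AE \<omega> in M. \<forall>t\<in>{0..T}. quad X Y Z L t \<omega> = quad X' Y' Z' L' t (\<xi> \<omega>)"
    and Zm: "\<And>t. t \<in> {0..T} \<Longrightarrow> quad X Y Z L t \<in> borel_measurable M"
  shows "(\<lambda>u. energy T (\<nu> u) (sec u X') (sec u Y') (sec u Z') (sec u L')) \<in> borel_measurable (completion m)"
    and "energy T M X Y Z L = (\<integral>\<^sup>+u. energy T (\<nu> u) (sec u X') (sec u Y') (sec u Z') (sec u L') \<partial>completion m)"
proof -
  define eX where "eX x = (SUP t\<in>{0..T}. ennreal ((norm (X' t x))\<^sup>2))" for x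
  define eY where "eY x = (SUP t\<in>{0..T}. ennreal ((norm (Y' t x))\<^sup>2))" for x
  define k where "k t x = ennreal ((norm (Z' t x))\<^sup>2 + (norm (L' t x))\<^sup>2)" for t x
  have eX: "eX \<in> borel_measurable Xi" unfolding eX_def
    by (rule borel_measurable_SUP_continuous[OF T]) (use X' in \<open>auto intro!: continuous_intros borel_measurable_power measurable_compose[OF _ borel_measurable_norm]\<close>)
  have eY: "eY \<in> borel_measurable Xi" unfolding eY_def
    by (rule borel_measurable_SUP_continuous[OF T]) (use Y' in \<open>auto intro!: continuous_intros borel_measurable_power measurable_compose[OF _ borel_measurable_norm]\<close>)
  have k: "(\<lambda>(t, x). k t x) \<in> borel_measurable (Ic \<Otimes>\<^sub>M Xi)"
    using Z' L' unfolding k_def by (simp add: case_prod_beta')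
  have e: "energy T (\<nu> u) (sec u X') (sec u Y') (sec u Z') (sec u L') =
      (\<integral>\<^sup>+y. eX (u, y) \<partial>\<nu> u) + (\<integral>\<^sup>+y. eY (u, y) \<partial>\<nu> u) + (\<integral>\<^sup>+y. (\<integral>\<^sup>+t\<in>{0..T}. k t (u, y) \<partial>lborel) \<partial>\<nu> u)" for u
    unfolding energy_def eX_def eY_def time_integral_disintegration(2)[OF k, symmetric] by (simp add: k_def)
  have [measurable]: "(\<lambda>u. \<integral>\<^sup>+y. eX (u, y) \<partial>\<nu> u) \<in> borel_measurable (completion m)"
    "(\<lambda>u. \<integral>\<^sup>+y. eY (u, y) \<partial>\<nu> u) \<in> borel_measurable (completion m)"
    "(\<lambda>u. \<integral>\<^sup>+y. (\<integral>\<^sup>+t\<in>{0..T}. k t (u, y) \<partial>lborel) \<partial>\<nu> u) \<in> borel_measurable (completion m)"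
    using measurable_nn_integral_\<nu>[OF eX] measurable_nn_integral_\<nu>[OF eY] measurable_nn_integral_\<nu>[OF time_integral_disintegration(1)[OF k]]
    by simp_all
  show "(\<lambda>u. energy T (\<nu> u) (sec u X') (sec u Y') (sec u Z') (sec u L')) \<in> borel_measurable (completion m)"
    unfolding e by measurable
  have "(\<integral>\<^sup>+\<omega>. (SUP t\<in>{0..T}. ennreal ((norm (X t \<omega>))\<^sup>2)) \<partial>M) = (\<integral>\<^sup>+\<omega>. eX (\<xi> \<omega>) \<partial>M)"
    using eq by (intro nn_integral_cong_AE) (auto elim!: eventually_mono simp: eX_def quad_def intro!: SUP_cong)
  moreover have "(\<integral>\<^sup>+\<omega>. (SUP t\<in>{0..T}. ennreal ((norm (Y t \<omega>))\<^sup>2)) \<partial>M) = (\<integral>\<^sup>+\<omega>. eY (\<xi> \<omega>) \<partial>M)"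
    using eq by (intro nn_integral_cong_AE) (auto elim!: eventually_mono simp: eY_def quad_def intro!: SUP_cong)
  moreover have "(\<integral>\<^sup>+t\<in>{0..T}. (\<integral>\<^sup>+\<omega>. ennreal ((norm (Z t \<omega>))\<^sup>2 + (norm (L t \<omega>))\<^sup>2) \<partial>M) \<partial>lborel) =
      (\<integral>\<^sup>+t\<in>{0..T}. (\<integral>\<^sup>+\<omega>. k t (\<xi> \<omega>) \<partial>M) \<partial>lborel)"
  proof (rule nn_integral_cong)
    fix t :: real
    show "(\<integral>\<^sup>+\<omega>. ennreal ((norm (Z t \<omega>))\<^sup>2 + (norm (L t \<omega>))\<^sup>2) \<partial>M) * indicator {0..T} t = (\<integral>\<^sup>+\<omega>. k t (\<xi> \<omega>) \<partial>M) * indicator {0..T} t"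
    proof (cases "t \<in> {0..T}")
      case True
      from eq have "AE \<omega> in M. ennreal ((norm (Z t \<omega>))\<^sup>2 + (norm (L t \<omega>))\<^sup>2) = k t (\<xi> \<omega>)"
        by eventually_elim (use True in \<open>auto simp: k_def quad_def\<close>)
      then show ?thesis by (simp cong: nn_integral_cong_AE)
    qed simp
  qed
  ultimately have "energy T M X Y Z L = (\<integral>\<^sup>+\<omega>. eX (\<xi> \<omega>) \<partial>M) + (\<integral>\<^sup>+\<omega>. eY (\<xi> \<omega>) \<partial>M) + (\<integral>\<^sup>+t\<in>{0..T}. (\<integral>\<^sup>+\<omega>. k t (\<xi> \<omega>) \<partial>M) \<partial>lborel)"
    by (simp add: energy_def)
  also have "\<dots> = (\<integral>\<^sup>+u. energy T (\<nu> u) (sec u X') (sec u Y') (sec u Z') (sec u L') \<partial>completion m)"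
    unfolding e nn_integral_disintegration[OF eX] nn_integral_disintegration[OF eY] time_integral_disintegration(3,2)[OF k]
    by (subst nn_integral_add, measurable)+
  finally show "energy T M X Y Z L = (\<integral>\<^sup>+u. energy T (\<nu> u) (sec u X') (sec u Y') (sec u Z') (sec u L') \<partial>completion m)" .
qed

text \<open>Each part of the solution is rewritten as an almost sure statement about functionals
  that is measurable on \<open>Xi\<close>, and the finitely many exceptional sets of labels are
  united. Continuity and the read-off identity hold without exception, by construction of the
  functionals.\<close>

theorem aux_solution_disintegration:
  fixes b :: "'u \<Rightarrow> real \<Rightarrow> ('n, 'l::finite, 'd, 'k::finite) E \<Rightarrow> ('u \<Rightarrow> ('n, 'l, 'd, 'k) E measure) \<Rightarrow> real^'n"
    and \<sigma> :: "'u \<Rightarrow> real \<Rightarrow> ('n, 'l, 'd, 'k) E \<Rightarrow> ('u \<Rightarrow> ('n, 'l, 'd, 'k) E measure) \<Rightarrow> real^'d^'n"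
    and f :: "'u \<Rightarrow> real \<Rightarrow> ('n, 'l, 'd, 'k) E \<Rightarrow> ('u \<Rightarrow> ('n, 'l, 'd, 'k) E measure) \<Rightarrow> real^'l"
    and G :: "'u \<Rightarrow> real^'n \<Rightarrow> ('u \<Rightarrow> (real^'n) measure) \<Rightarrow> real^'l"
    and \<Lambda> :: "'u \<Rightarrow> real \<Rightarrow> real^'n \<Rightarrow> (real \<Rightarrow> real^'d) \<Rightarrow> real^'k"
  assumes b: "coeff_measurable T m b" and \<sigma>: "coeff_measurable T m \<sigma>" and f: "coeff_measurable T m f"
    and G: "terminal_measurable m G" and \<Lambda>: "control_measurable T \<Lambda>"
    and sol: "aux_solution T m b \<sigma> f G \<Lambda> M B ini v X Y Z L"
  shows "\<exists>X' Y' Z' L'.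
    (\<forall>x. continuous_on {0..T} (\<lambda>t. X' t x)) \<and> (\<forall>x. continuous_on {0..T} (\<lambda>t. Y' t x)) \<and>
    (\<forall>x\<in>space Xi. (\<lambda>t. Z' t x) \<in> sq_int T \<and> (\<forall>t\<in>{0..T}. precise (L2_class T (\<lambda>t. Z' t x)) t = Z' t x)) \<and>
    (\<forall>x\<in>space Xi. (\<lambda>t. L' t x) \<in> sq_int T \<and> (\<forall>t\<in>{0..T}. precise (L2_class T (\<lambda>t. L' t x)) t = L' t x)) \<and>
    (\<lambda>(t, x). quad X' Y' Z' L' t x) \<in> borel_measurable (Ic \<Otimes>\<^sub>M Xi) \<and>
    (\<integral>\<^sup>+u. energy T (\<nu> u) (sec u X') (sec u Y') (sec u Z') (sec u L') \<partial>completion m) < \<infinity> \<and>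
    (AE u in completion m. progressive T (FY u) (quad (sec u X') (sec u Y') (sec u Z') (sec u L')) \<and>
      solves_fbsde T m b \<sigma> f G (completion (\<nu> u)) (FY u) (\<lambda>t y. snd y t) fst (\<lambda>_. u)
        (\<lambda>t. functional_law (quad X' Y' Z' L' t)) (sec u X') (sec u Y') (sec u Z') (sec u L') \<and>
      (\<integral>\<^sup>+t\<in>{0..T}. (\<integral>\<^sup>+y. ennreal ((norm (L' t (u, y) - \<Lambda> u t (fst y) (stopped_path T (\<lambda>s y. snd y s) t y)))\<^sup>2) \<partial>\<nu> u) \<partial>lborel) = 0 \<and>
      energy T (\<nu> u) (sec u X') (sec u Y') (sec u Z') (sec u L') < \<infinity>)"
proof -
  note D = Icc_dense[OF T]
  have prog: "progressive T FA (quad X Y Z L)" and en: "energy T M X Y Z L < \<infinity>"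
    and S1: "S1_path T X Y Z L \<in> M \<rightarrow>\<^sub>M borel_of (S1_top T)" and ro: "canonical_read_off T M X Y Z L"
    and \<Lambda>0: "(\<integral>\<^sup>+t\<in>{0..T}. (\<integral>\<^sup>+\<omega>. ennreal ((norm (L t \<omega> - \<Lambda> (v \<omega>) t (ini \<omega>) (stopped_path T B t \<omega>)))\<^sup>2) \<partial>M) \<partial>lborel) = 0"
    using sol by (auto simp: aux_solution_def S1_valued_def FA_eq)
  obtain P where P: "\<forall>t\<in>{0..T}. cond_law M m v (quad X Y Z L t) (P t)"
    and fb: "solves_fbsde T m b \<sigma> f G M FA B ini v P X Y Z L"
    using sol by (auto simp: aux_solution_def FA_eq)
  have pX: "progressive T FA X" and pY: "progressive T FA Y" and pZ: "progressive T FA Z" and pL: "progressive T FA L"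
    using prog by (simp_all add: progressive_quad)
  have top: "S1_path T X Y Z L \<omega> \<in> topspace (S1_top T)" if "\<omega> \<in> space M" for \<omega>
    using measurable_space[OF S1 that] by simp
  have cX: "continuous_on {0..T} (\<lambda>t. X t \<omega>)" and cY: "continuous_on {0..T} (\<lambda>t. Y t \<omega>)"
    and sZ: "(\<lambda>t. Z t \<omega>) \<in> sq_int T" and sL: "(\<lambda>t. L t \<omega>) \<in> sq_int T" if "\<omega> \<in> space M" for \<omega>
  proof -
    have *: "restrict (\<lambda>t. X t \<omega>) {0..T} \<in> topspace (C_top T)" "restrict (\<lambda>t. Y t \<omega>) {0..T} \<in> topspace (C_top T)"
      "L2_class T (\<lambda>t. Z t \<omega>) \<in> sq_int T // L2_rel T" "L2_class T (\<lambda>t. L t \<omega>) \<in> sq_int T // L2_rel T"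
      using top[OF that] by (simp_all add: topspace_S1 S1_path_def del: topspace_mtopology_of)
    then show "continuous_on {0..T} (\<lambda>t. X t \<omega>)" "continuous_on {0..T} (\<lambda>t. Y t \<omega>)"
      using continuous_on_cong[of "{0..T}" "{0..T}" "restrict (\<lambda>t. X t \<omega>) {0..T}" "\<lambda>t. X t \<omega>"]
        continuous_on_cong[of "{0..T}" "{0..T}" "restrict (\<lambda>t. Y t \<omega>) {0..T}" "\<lambda>t. Y t \<omega>"]
      unfolding topspace_C_top by auto
    show "(\<lambda>t. Z t \<omega>) \<in> sq_int T" "(\<lambda>t. L t \<omega>) \<in> sq_int T" using * by (auto dest: L2_class_in_quotientD)
  qed
  have rZ: "precise (L2_class T (\<lambda>t. Z t \<omega>)) t = Z t \<omega>" and rL: "precise (L2_class T (\<lambda>t. L t \<omega>)) t = L t \<omega>"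
    if "\<omega> \<in> space M" "t \<in> {0..T}" for \<omega> t
    using ro that by (auto simp: canonical_read_off_def canon_S1_def S1_path_def quad_def)
  obtain X' where X': "\<forall>t\<in>{0..T}. X' t \<in> borel_measurable Xi" "\<forall>x. continuous_on {0..T} (\<lambda>t. X' t x)"
    "AE \<omega> in M. \<forall>t\<in>{0..T}. X t \<omega> = X' t (\<xi> \<omega>)"
    "AE u in completion m. \<forall>t\<in>{0..T}. (\<lambda>y. X' t (u, y)) \<in> borel_measurable (FY u t)"
    using continuous_functional[OF progressive_adapted[OF pX] cX] by blast
  obtain Y' where Y': "\<forall>t\<in>{0..T}. Y' t \<in> borel_measurable Xi" "\<forall>x. continuous_on {0..T} (\<lambda>t. Y' t x)"
    "AE \<omega> in M. \<forall>t\<in>{0..T}. Y t \<omega> = Y' t (\<xi> \<omega>)"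
    "AE u in completion m. \<forall>t\<in>{0..T}. (\<lambda>y. Y' t (u, y)) \<in> borel_measurable (FY u t)"
    using continuous_functional[OF progressive_adapted[OF pY] cY] by blast
  obtain Z' where Z': "(\<lambda>(t, x). Z' t x) \<in> borel_measurable (Ic \<Otimes>\<^sub>M Xi)"
    "\<forall>x\<in>space Xi. (\<lambda>t. Z' t x) \<in> sq_int T \<and> (\<forall>t\<in>{0..T}. precise (L2_class T (\<lambda>t. Z' t x)) t = Z' t x)"
    "AE \<omega> in M. \<forall>t\<in>{0..T}. Z t \<omega> = Z' t (\<xi> \<omega>)" "AE u in completion m. progressive T (FY u) (sec u Z')"
    using L2_functional[OF pZ sZ rZ] by blast
  obtain L' where L': "(\<lambda>(t, x). L' t x) \<in> borel_measurable (Ic \<Otimes>\<^sub>M Xi)"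
    "\<forall>x\<in>space Xi. (\<lambda>t. L' t x) \<in> sq_int T \<and> (\<forall>t\<in>{0..T}. precise (L2_class T (\<lambda>t. L' t x)) t = L' t x)"
    "AE \<omega> in M. \<forall>t\<in>{0..T}. L t \<omega> = L' t (\<xi> \<omega>)" "AE u in completion m. progressive T (FY u) (sec u L')"
    using L2_functional[OF pL sL rL] by blast
  note Xj = continuous_joint_functional[OF X'(1,2)] and Yj = continuous_joint_functional[OF Y'(1,2)]
  define q where "q = quad X' Y' Z' L'"
  have q: "(\<lambda>(t, x). q t x) \<in> borel_measurable (Ic \<Otimes>\<^sub>M Xi)"
    using Xj Yj Z'(1) L'(1) unfolding q_def quad_def case_prod_beta' borel_measurable_quad by simp
  have q_sec: "quad (sec u X') (sec u Y') (sec u Z') (sec u L') t y = q t (u, y)" for u t y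
    by (simp add: q_def quad_def)
  have eq: "AE \<omega> in M. \<forall>t\<in>{0..T}. quad X Y Z L t \<omega> = q t (\<xi> \<omega>)"
    using X'(3) Y'(3) Z'(3) L'(3) by eventually_elim (simp add: q_def quad_def)
  have qm: "q t \<in> borel_measurable Xi" if "t \<in> {0..T}" for t by (rule joint_at_time[OF q refl that])
  have Qm: "quad X Y Z L t \<in> borel_measurable M" if "t \<in> {0..T}" for t
    by (rule measurable_FA[OF _ progressive_adapted[OF prog that]]) (use that in simp)
  \<comment> \<open>The exceptional labels may depend on \<open>t\<close>. That is harmless, because
    the family enters the coefficients only up to almost everywhere equality.\<close>
  have Plaw: "AE u in m. P t u = functional_law (q t) u" if t: "t \<in> {0..T}" for t
  proof (rule cond_law_functional[OF qm[OF t] Qm[OF t] _ P[rule_format, OF t]])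
    from eq show "AE \<omega> in M. quad X Y Z L t \<omega> = q t (\<xi> \<omega>)" by eventually_elim (use t in blast)
  qed
  have fst_\<xi>: "fst (\<xi> \<omega>) = v \<omega>" for \<omega> by (simp add: \<xi>_def)
  define \<beta>b where "\<beta>b t x = at_family m (b (fst x) t (q t x)) (functional_law (q t))" for t x
  define \<beta>s where "\<beta>s t x = at_family m (\<sigma> (fst x) t (q t x)) (functional_law (q t))" for t x
  define \<beta>f where "\<beta>f t x = at_family m (f (fst x) t (q t x)) (functional_law (q t))" for t x
  have \<beta>b: "(\<lambda>(t, x). \<beta>b t x) \<in> borel_measurable (Ic \<Otimes>\<^sub>M Xi)" unfolding \<beta>b_def by (rule coefficient_functional(1)[OF b q])
  have \<beta>s: "(\<lambda>(t, x). \<beta>s t x) \<in> borel_measurable (Ic \<Otimes>\<^sub>M Xi)" unfolding \<beta>s_def by (rule coefficient_functional(1)[OF \<sigma> q])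
  have \<beta>f: "(\<lambda>(t, x). \<beta>f t x) \<in> borel_measurable (Ic \<Otimes>\<^sub>M Xi)" unfolding \<beta>f_def by (rule coefficient_functional(1)[OF f q])
  let ?bt = "\<lambda>t \<omega>. at_family m (b (v \<omega>) t (quad X Y Z L t \<omega>)) (P t)"
  let ?st = "\<lambda>t \<omega>. at_family m (\<sigma> (v \<omega>) t (quad X Y Z L t \<omega>)) (P t)"
  let ?ft = "\<lambda>t \<omega>. at_family m (f (v \<omega>) t (quad X Y Z L t \<omega>)) (P t)"
  have eqb: "AE \<omega> in M. \<forall>t\<in>{0..T}. ?bt t \<omega> = \<beta>b t (\<xi> \<omega>)"
    using eq by eventually_elim (simp add: \<beta>b_def fst_\<xi> at_family_cong[OF Plaw])
  have eqs: "AE \<omega> in M. \<forall>t\<in>{0..T}. ?st t \<omega> = \<beta>s t (\<xi> \<omega>)"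
    using eq by eventually_elim (simp add: \<beta>s_def fst_\<xi> at_family_cong[OF Plaw])
  have eqf: "AE \<omega> in M. \<forall>t\<in>{0..T}. ?ft t \<omega> = \<beta>f t (\<xi> \<omega>)"
    using eq by eventually_elim (simp add: \<beta>f_def fst_\<xi> at_family_cong[OF Plaw])
  have fb_int: "AE \<omega> in M. set_integrable lborel {0..T} (\<lambda>s. ?bt s \<omega>)" "AE \<omega> in M. set_integrable lborel {0..T} (\<lambda>s. ?ft s \<omega>)"
    and fb_ini: "AE \<omega> in M. X 0 \<omega> = ini \<omega>"
    and fb_ter: "AE \<omega> in M. Y T \<omega> = at_family m (G (v \<omega>) (X T \<omega>)) (\<lambda>u. distr (P T u) borel fst)"
    using fb unfolding solves_fbsde_def Let_def by blast+
  obtain I where I: "has_ito_integral T M FA B ?st I"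
    "AE \<omega> in M. \<forall>t\<in>{0..T}. X t \<omega> = X 0 \<omega> + (LINT s:{0..t}|lborel. ?bt s \<omega>) + I t \<omega>"
    using fb unfolding solves_fbsde_def Let_def by blast
  obtain J where J: "has_ito_integral T M FA B Z J"
    "AE \<omega> in M. \<forall>t\<in>{0..T}. Y t \<omega> = Y T \<omega> + (LINT s:{t..T}|lborel. ?ft s \<omega>) - (J T \<omega> - J t \<omega>)"
    using fb unfolding solves_fbsde_def Let_def by blast
  have prq: "AE u in completion m. progressive T (FY u) (sec u q)"
    using X'(4) Y'(4) Z'(4) L'(4)
  proof eventually_elim
    case (elim u)
    have "progressive T (FY u) (quad (sec u X') (sec u Y') (sec u Z') (sec u L'))"
      unfolding progressive_quad using elim continuous_adapted_progressive[OF X'(2)] continuous_adapted_progressive[OF Y'(2)] by blast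
    then show ?case by (simp add: q_sec[abs_def])
  qed
  have prs: "AE u in completion m. progressive T (FY u) (sec u \<beta>s)"
    using prq by eventually_elim (simp add: \<beta>s_def coefficient_functional(2)[OF \<sigma> q])
  obtain \<iota> where \<iota>: "\<forall>t\<in>{0..T}. \<iota> t \<in> borel_measurable Xi" "\<forall>x. continuous_on {0..T} (\<lambda>t. \<iota> t x)"
    "AE \<omega> in M. \<forall>t\<in>{0..T}. I t \<omega> = \<iota> t (\<xi> \<omega>)"
    "AE u in completion m. has_ito_integral T (completion (\<nu> u)) (FY u) (\<lambda>t y. snd y t) (sec u \<beta>s) (sec u \<iota>)"
    using ito_disintegration[OF I(1) \<beta>s eqs prs] by blast
  obtain j where j: "\<forall>t\<in>{0..T}. j t \<in> borel_measurable Xi" "\<forall>x. continuous_on {0..T} (\<lambda>t. j t x)"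
    "AE \<omega> in M. \<forall>t\<in>{0..T}. J t \<omega> = j t (\<xi> \<omega>)"
    "AE u in completion m. has_ito_integral T (completion (\<nu> u)) (FY u) (\<lambda>t y. snd y t) (sec u Z') (sec u j)"
    using ito_disintegration[OF J(1) Z'(1,3,4)] by blast
  have fwd: "AE u in completion m. AE y in \<nu> u. set_integrable lborel {0..T} (\<lambda>s. \<beta>b s (u, y)) \<and>
      (\<forall>t\<in>{0..T}. X' t (u, y) = X' 0 (u, y) + (LINT s:{0..t}|lborel. \<beta>b s (u, y)) + \<iota> t (u, y))"
  proof (rule forward_disintegration[OF X'(1,2) \<iota>(1,2) \<beta>b])
    show "AE \<omega> in M. set_integrable lborel {0..T} (\<lambda>s. \<beta>b s (\<xi> \<omega>)) \<and>
      (\<forall>t\<in>{0..T}. X' t (\<xi> \<omega>) = X' 0 (\<xi> \<omega>) + (LINT s:{0..t}|lborel. \<beta>b s (\<xi> \<omega>)) + \<iota> t (\<xi> \<omega>))"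
      using X'(3) \<iota>(3) eqb fb_int(1) I(2)
    proof eventually_elim
      case (elim \<omega>)
      have "set_integrable lborel {0..T} (\<lambda>s. \<beta>b s (\<xi> \<omega>))"
        using elim(4) set_integrable_cong_Icc[of "\<lambda>s. ?bt s \<omega>" "\<lambda>s. \<beta>b s (\<xi> \<omega>)"] elim(3) by blast
      moreover have "X' t (\<xi> \<omega>) = X' 0 (\<xi> \<omega>) + (LINT s:{0..t}|lborel. \<beta>b s (\<xi> \<omega>)) + \<iota> t (\<xi> \<omega>)" if t: "t \<in> {0..T}" for t
      proof -
        have i: "(LINT s:{0..t}|lborel. ?bt s \<omega>) = (LINT s:{0..t}|lborel. \<beta>b s (\<xi> \<omega>))"
          by (rule LINT_cong_Icc) (use elim(3) t in auto)
        have z: "0 \<in> {0..T}" using T by simp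
        show ?thesis
          using elim(5)[rule_format, OF t]
          unfolding i elim(1)[rule_format, OF t] elim(1)[rule_format, OF z] elim(2)[rule_format, OF t] .
      qed
      ultimately show ?case by blast
    qed
  qed
  \<comment> \<open>The backward equation is transported in forward form, with the increment from
    time 0 as its noise term.\<close>
  define j0 where "j0 t x = j t x - j 0 x" for t x
  define nf where "nf t x = - \<beta>f t x" for t x
  have bwd: "AE u in completion m. AE y in \<nu> u. set_integrable lborel {0..T} (\<lambda>s. nf s (u, y)) \<and>
      (\<forall>t\<in>{0..T}. Y' t (u, y) = Y' 0 (u, y) + (LINT s:{0..t}|lborel. nf s (u, y)) + j0 t (u, y))"
  proof (rule forward_disintegration[OF Y'(1,2)])
    have j0m: "j 0 \<in> borel_measurable Xi" using j(1) T by simp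
    show "\<forall>t\<in>{0..T}. j0 t \<in> borel_measurable Xi" unfolding j0_def[abs_def] using j(1) j0m by (auto intro!: borel_measurable_diff)
    show "\<forall>x. continuous_on {0..T} (\<lambda>t. j0 t x)" unfolding j0_def using j(2) by (intro allI continuous_intros) blast
    show "(\<lambda>(t, x). nf t x) \<in> borel_measurable (Ic \<Otimes>\<^sub>M Xi)" unfolding nf_def using \<beta>f by (simp add: case_prod_beta')
    show "AE \<omega> in M. set_integrable lborel {0..T} (\<lambda>s. nf s (\<xi> \<omega>)) \<and>
      (\<forall>t\<in>{0..T}. Y' t (\<xi> \<omega>) = Y' 0 (\<xi> \<omega>) + (LINT s:{0..t}|lborel. nf s (\<xi> \<omega>)) + j0 t (\<xi> \<omega>))"
      using Y'(3) j(3) eqf fb_int(2) J(2)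
    proof eventually_elim
      case (elim \<omega>)
      have si: "set_integrable lborel {0..T} (\<lambda>s. \<beta>f s (\<xi> \<omega>))"
        using elim(4) set_integrable_cong_Icc[of "\<lambda>s. ?ft s \<omega>" "\<lambda>s. \<beta>f s (\<xi> \<omega>)"] elim(3) by blast
      have "Y' t (\<xi> \<omega>) = Y' T (\<xi> \<omega>) + (LINT s:{t..T}|lborel. \<beta>f s (\<xi> \<omega>)) - (j T (\<xi> \<omega>) - j t (\<xi> \<omega>))" if t: "t \<in> {0..T}" for t
      proof -
        have i: "(LINT s:{t..T}|lborel. ?ft s \<omega>) = (LINT s:{t..T}|lborel. \<beta>f s (\<xi> \<omega>))"
          by (rule LINT_cong_Icc) (use elim(3) t in auto)
        have z: "T \<in> {0..T}" using T by simp
        show ?thesis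
          using elim(5)[rule_format, OF t]
          unfolding i elim(1)[rule_format, OF t] elim(1)[rule_format, OF z]
            elim(2)[rule_format, OF t] elim(2)[rule_format, OF z] .
      qed
      then have "\<forall>t\<in>{0..T}. Y' t (\<xi> \<omega>) = Y' 0 (\<xi> \<omega>) + (LINT s:{0..t}|lborel. - \<beta>f s (\<xi> \<omega>)) + (j t (\<xi> \<omega>) - j 0 (\<xi> \<omega>))"
        using backward_as_forward[OF si, of "\<lambda>t. Y' t (\<xi> \<omega>)" "\<lambda>t. j t (\<xi> \<omega>)"] by blast
      moreover have "set_integrable lborel {0..T} (\<lambda>s. nf s (\<xi> \<omega>))"
        using si unfolding nf_def set_integrable_def by simp
      ultimately show ?case unfolding nf_def j0_def by blast
    qed
  qed
  have fstXi: "fst \<in> borel_measurable Xi" unfolding Xi_def using measurable_fst[of m] sets_m by (simp cong: measurable_cong_sets)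
  have "AE \<omega> in M. X' 0 (\<xi> \<omega>) = fst (snd (\<xi> \<omega>))"
    using X'(3) fb_ini by eventually_elim (use T in \<open>auto simp: \<xi>_def\<close>)
  moreover have "(\<lambda>x. fst (snd x)) \<in> borel_measurable Xi"
    unfolding Xi_def by (rule measurable_compose[OF measurable_snd measurable_YS_fst])
  moreover have "X' 0 \<in> borel_measurable Xi" using X'(1) T by simp
  ultimately have initial: "AE u in completion m. AE y in \<nu> u. X' 0 (u, y) = fst y"
    using AE_disintegration_eq[of "X' 0" "\<lambda>x. fst (snd x)"] by simp
  have TT: "T \<in> {0..T}" using T by simp
  let ?PT = "\<lambda>u. distr (functional_law (q T) u) borel fst"
  have ter: "AE \<omega> in M. Y' T (\<xi> \<omega>) = at_family m (G (fst (\<xi> \<omega>)) (X' T (\<xi> \<omega>))) ?PT"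
    using X'(3) Y'(3) fb_ter
  proof eventually_elim
    case (elim \<omega>)
    have "AE u in m. distr (P T u) borel fst = ?PT u" using Plaw[OF TT] by eventually_elim simp
    from at_family_cong[OF this] show ?case using elim TT by (simp add: \<xi>_def)
  qed
  have "(\<lambda>x. at_family m (G (fst x) (X' T x)) ?PT) \<in> borel_measurable Xi"
    using measurable_compose[OF measurable_Pair[OF fstXi X'(1)[rule_format, OF TT]] terminal_measurable_at_family[OF G]] by simp
  from AE_disintegration_eq[OF Y'(1)[rule_format, OF TT] this ter]
  have terminal: "AE u in completion m. AE y in \<nu> u. Y' T (u, y) = at_family m (G u (X' T (u, y))) ?PT" by simp
  define dl where "dl t x = ennreal ((norm (L' t x - \<Lambda> (fst x) t (fst (snd x)) (stopped_path T (\<lambda>s x. snd (snd x) s) t x)))\<^sup>2)" for t x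
  have dl: "(\<lambda>(t, x). dl t x) \<in> borel_measurable (Ic \<Otimes>\<^sub>M Xi)"
    using L'(1) control_measurable_functional[OF \<Lambda>] unfolding dl_def by (simp add: case_prod_beta')
  have "(\<integral>\<^sup>+t\<in>{0..T}. (\<integral>\<^sup>+\<omega>. dl t (\<xi> \<omega>) \<partial>M) \<partial>lborel) =
      (\<integral>\<^sup>+t\<in>{0..T}. (\<integral>\<^sup>+\<omega>. ennreal ((norm (L t \<omega> - \<Lambda> (v \<omega>) t (ini \<omega>) (stopped_path T B t \<omega>)))\<^sup>2) \<partial>M) \<partial>lborel)"
  proof (rule nn_integral_cong)
    fix t :: real
    show "(\<integral>\<^sup>+\<omega>. dl t (\<xi> \<omega>) \<partial>M) * indicator {0..T} t =
      (\<integral>\<^sup>+\<omega>. ennreal ((norm (L t \<omega> - \<Lambda> (v \<omega>) t (ini \<omega>) (stopped_path T B t \<omega>)))\<^sup>2) \<partial>M) * indicator {0..T} t"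
    proof (cases "t \<in> {0..T}")
      case True
      \<comment> \<open>For \<open>t\<close> in the interval the stopped time stays in the interval,
        so restricting the path in \<open>\<xi>\<close> changes nothing.\<close>
      have st: "stopped_path T (\<lambda>s x. snd (snd x) s) t (\<xi> \<omega>) = stopped_path T B t \<omega>" for \<omega>
        unfolding stopped_path_def \<xi>_def using True by (intro restrict_ext) (auto simp: min_def)
      from L'(3) have "AE \<omega> in M. dl t (\<xi> \<omega>) = ennreal ((norm (L t \<omega> - \<Lambda> (v \<omega>) t (ini \<omega>) (stopped_path T B t \<omega>)))\<^sup>2)"
        by eventually_elim (use True st in \<open>auto simp: dl_def \<xi>_def\<close>)
      then show ?thesis by (simp cong: nn_integral_cong_AE)
    qed simp
  qed
  then have "(\<integral>\<^sup>+u. (\<integral>\<^sup>+t\<in>{0..T}. (\<integral>\<^sup>+y. dl t (u, y) \<partial>\<nu> u) \<partial>lborel) \<partial>completion m) = 0"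
    using \<Lambda>0 time_integral_disintegration(3)[OF dl] by simp
  moreover have "(\<lambda>u. \<integral>\<^sup>+t\<in>{0..T}. (\<integral>\<^sup>+y. dl t (u, y) \<partial>\<nu> u) \<partial>lborel) \<in> borel_measurable (completion m)"
    unfolding time_integral_disintegration(2)[OF dl] by (rule measurable_nn_integral_\<nu>[OF time_integral_disintegration(1)[OF dl]])
  ultimately have control: "AE u in completion m. (\<integral>\<^sup>+t\<in>{0..T}. (\<integral>\<^sup>+y. dl t (u, y) \<partial>\<nu> u) \<partial>lborel) = 0"
    by (simp add: nn_integral_0_iff_AE)
  note en' = energy_disintegration[OF X'(1,2) Y'(1,2) Z'(1) L'(1) eq[unfolded q_def] Qm]
  have en_fin: "(\<integral>\<^sup>+u. energy T (\<nu> u) (sec u X') (sec u Y') (sec u Z') (sec u L') \<partial>completion m) < \<infinity>"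
    using en en'(2) by simp
  then have en_ae: "AE u in completion m. energy T (\<nu> u) (sec u X') (sec u Y') (sec u Z') (sec u L') \<noteq> \<infinity>"
    using en'(1) by (intro nn_integral_PInf_AE) auto
  have main: "AE u in completion m. progressive T (FY u) (quad (sec u X') (sec u Y') (sec u Z') (sec u L')) \<and>
      solves_fbsde T m b \<sigma> f G (completion (\<nu> u)) (FY u) (\<lambda>t y. snd y t) fst (\<lambda>_. u)
        (\<lambda>t. functional_law (quad X' Y' Z' L' t)) (sec u X') (sec u Y') (sec u Z') (sec u L') \<and>
      (\<integral>\<^sup>+t\<in>{0..T}. (\<integral>\<^sup>+y. ennreal ((norm (L' t (u, y) - \<Lambda> u t (fst y) (stopped_path T (\<lambda>s y. snd y s) t y)))\<^sup>2) \<partial>\<nu> u) \<partial>lborel) = 0 \<and>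
      energy T (\<nu> u) (sec u X') (sec u Y') (sec u Z') (sec u L') < \<infinity>"
    using prq fwd bwd initial terminal \<iota>(4) j(4) control en_ae
  proof eventually_elim
    case (elim u)
    have pq: "progressive T (FY u) (quad (sec u X') (sec u Y') (sec u Z') (sec u L'))"
      using elim(1) by (simp add: q_sec[abs_def])
    have bt: "at_family m (b u t (quad (sec u X') (sec u Y') (sec u Z') (sec u L') t y)) (functional_law (quad X' Y' Z' L' t)) = \<beta>b t (u, y)" for t y
      by (simp add: \<beta>b_def q_sec) (simp add: q_def)
    have st: "at_family m (\<sigma> u t (quad (sec u X') (sec u Y') (sec u Z') (sec u L') t y)) (functional_law (quad X' Y' Z' L' t)) = \<beta>s t (u, y)" for t y
      by (simp add: \<beta>s_def q_sec) (simp add: q_def)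
    have ft: "at_family m (f u t (quad (sec u X') (sec u Y') (sec u Z') (sec u L') t y)) (functional_law (quad X' Y' Z' L' t)) = \<beta>f t (u, y)" for t y
      by (simp add: \<beta>f_def q_sec) (simp add: q_def)
    have f1: "AE y in completion (\<nu> u). set_integrable lborel {0..T} (\<lambda>s. \<beta>b s (u, y))"
      using AE_completion[OF elim(2)] by eventually_elim blast
    have f2: "AE y in completion (\<nu> u). \<forall>t\<in>{0..T}. X' t (u, y) = X' 0 (u, y) + (LINT s:{0..t}|lborel. \<beta>b s (u, y)) + \<iota> t (u, y)"
      using AE_completion[OF elim(2)] by eventually_elim blast
    have b12: "AE y in completion (\<nu> u). set_integrable lborel {0..T} (\<lambda>s. \<beta>f s (u, y)) \<and>
      (\<forall>t\<in>{0..T}. Y' t (u, y) = Y' T (u, y) + (LINT s:{t..T}|lborel. \<beta>f s (u, y)) - (j T (u, y) - j t (u, y)))"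
      using AE_completion[OF elim(3)]
    proof eventually_elim
      case (elim y)
      have "set_integrable lborel {0..T} (\<lambda>s. - nf s (u, y))" using elim unfolding set_integrable_def by simp
      then have si: "set_integrable lborel {0..T} (\<lambda>s. \<beta>f s (u, y))" by (simp add: nf_def)
      then show ?case using backward_as_forward[OF si, of "\<lambda>t. Y' t (u, y)" "\<lambda>t. j t (u, y)"] elim
        unfolding nf_def j0_def by blast
    qed
    then have b1: "AE y in completion (\<nu> u). set_integrable lborel {0..T} (\<lambda>s. \<beta>f s (u, y))" by eventually_elim blast
    have b2: "AE y in completion (\<nu> u). \<forall>t\<in>{0..T}. Y' t (u, y) = Y' T (u, y) + (LINT s:{t..T}|lborel. \<beta>f s (u, y)) - (j T (u, y) - j t (u, y))"
      using b12 by eventually_elim blast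
    have "solves_fbsde T m b \<sigma> f G (completion (\<nu> u)) (FY u) (\<lambda>t y. snd y t) fst (\<lambda>_. u)
        (\<lambda>t. functional_law (quad X' Y' Z' L' t)) (sec u X') (sec u Y') (sec u Z') (sec u L')"
      unfolding solves_fbsde_def Let_def bt st ft
    proof (intro conjI)
      show "AE y in completion (\<nu> u). X' 0 (u, y) = fst y" by (rule AE_completion[OF elim(4)])
      show "AE y in completion (\<nu> u). Y' T (u, y) = at_family m (G u (X' T (u, y))) (\<lambda>u. distr (functional_law (quad X' Y' Z' L' T) u) borel fst)"
        using AE_completion[OF elim(5)] by (simp only: q_def)
      show "\<exists>I. has_ito_integral T (completion (\<nu> u)) (FY u) (\<lambda>t y. snd y t) (\<lambda>t y. \<beta>s t (u, y)) I \<and>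
        (AE y in completion (\<nu> u). \<forall>t\<in>{0..T}. X' t (u, y) = X' 0 (u, y) + (LINT s:{0..t}|lborel. \<beta>b s (u, y)) + I t y)"
        using elim(6) f2 by blast
      show "\<exists>J. has_ito_integral T (completion (\<nu> u)) (FY u) (\<lambda>t y. snd y t) (\<lambda>t y. Z' t (u, y)) J \<and>
        (AE y in completion (\<nu> u). \<forall>t\<in>{0..T}. Y' t (u, y) = Y' T (u, y) + (LINT s:{t..T}|lborel. \<beta>f s (u, y)) - (J T y - J t y))"
        using elim(7) b2 by blast
    qed (rule f1 b1)+
    moreover have "(\<integral>\<^sup>+t\<in>{0..T}. (\<integral>\<^sup>+y. ennreal ((norm (L' t (u, y) - \<Lambda> u t (fst y) (stopped_path T (\<lambda>s y. snd y s) t y)))\<^sup>2) \<partial>\<nu> u) \<partial>lborel) = 0"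
      using elim(8) by (simp add: dl_def stopped_path_def)
    ultimately show ?case using pq elim(9) by (simp add: top.not_eq_extremum)
  qed
  show ?thesis
    by (rule exI[of _ X'], rule exI[of _ Y'], rule exI[of _ Z'], rule exI[of _ L'])
      (use X'(2) Y'(2) Z'(2) L'(2) q[unfolded q_def] en_fin main in blast)
qed

end

subsection \<open>Pulling a solution back along a measure-preserving map\<close>

text \<open>The map preserves the measure and is measurable between the filtrations at each time.
  All that the equation asserts, namely adaptedness, almost sure identities and convergence in
  probability, is inherited by composition. The instance of interest is the projection
  \<open>noise\<close>.\<close>

locale filtered_pullback =
  fixes T :: real and M' :: "'a measure" and F' :: "real \<Rightarrow> 'a measure"
    and M :: "'b measure" and F :: "real \<Rightarrow> 'b measure" and h :: "'a \<Rightarrow> 'b"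
  assumes h: "h \<in> M' \<rightarrow>\<^sub>M M" and dist_h: "distr M' M h = M"
    and hF: "\<And>t. t \<in> {0..T} \<Longrightarrow> h \<in> F' t \<rightarrow>\<^sub>M F t"
begin

lemma AE_pullback: "AE x in M. P x \<Longrightarrow> AE \<omega> in M'. P (h \<omega>)"
  using AE_distrD[OF h, of P] by (simp only: dist_h)

lemma progressive_pullback:
  assumes "progressive T F X" shows "progressive T F' (\<lambda>t \<omega>. X t (h \<omega>))"
  unfolding progressive_def
proof
  fix t assume t: "t \<in> {0..T}"
  have "(\<lambda>z. (fst z, h (snd z))) \<in> restrict_space borel {0..t} \<Otimes>\<^sub>M F' t \<rightarrow>\<^sub>M restrict_space borel {0..t} \<Otimes>\<^sub>M F t"
    by (intro measurable_Pair measurable_fst measurable_compose[OF measurable_snd hF[OF t]])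
  from measurable_compose[OF this progressiveD[OF assms t]]
  show "(\<lambda>(s, \<omega>). X s (h \<omega>)) \<in> borel_measurable (restrict_space borel {0..t} \<Otimes>\<^sub>M F' t)" by (simp add: case_prod_beta')
qed

text \<open>A deviation event upstairs is the preimage of the one below, so their probabilities are
  equal for each index.\<close>

lemma tends_to_0_in_prob_pullback:
  assumes "tends_to_0_in_prob M g" shows "tends_to_0_in_prob M' (\<lambda>j \<omega>. g j (h \<omega>))"
  unfolding tends_to_0_in_prob_def
proof (intro conjI allI impI)
  have g: "g j \<in> borel_measurable M" for j using assms by (simp add: tends_to_0_in_prob_def)
  show "(\<lambda>\<omega>. g j (h \<omega>)) \<in> borel_measurable M'" for j by (rule measurable_compose[OF h g])
  fix \<epsilon> :: real assume "\<epsilon> > 0"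
  have "measure M' {\<omega> \<in> space M'. g j (h \<omega>) > ennreal \<epsilon>} = measure M {x \<in> space M. g j x > ennreal \<epsilon>}" for j
  proof -
    have "{x \<in> space M. g j x > ennreal \<epsilon>} \<in> sets M" using g by measurable
    then have "measure (distr M' M h) {x \<in> space M. g j x > ennreal \<epsilon>} = measure M' (h -` {x \<in> space M. g j x > ennreal \<epsilon>} \<inter> space M')"
      by (rule measure_distr[OF h])
    moreover have "h -` {x \<in> space M. g j x > ennreal \<epsilon>} \<inter> space M' = {\<omega> \<in> space M'. g j (h \<omega>) > ennreal \<epsilon>}"
      using measurable_space[OF h] by auto
    ultimately show ?thesis by (simp add: dist_h)
  qed
  then show "(\<lambda>j. measure M' {\<omega> \<in> space M'. g j (h \<omega>) > ennreal \<epsilon>}) \<longlonglongrightarrow> 0"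
    using assms \<open>\<epsilon> > 0\<close> by (simp add: tends_to_0_in_prob_def)
qed

lemma has_ito_integral_pullback:
  assumes "has_ito_integral T M F B H I"
  shows "has_ito_integral T M' F' (\<lambda>t \<omega>. B t (h \<omega>)) (\<lambda>t \<omega>. H t (h \<omega>)) (\<lambda>t \<omega>. I t (h \<omega>))"
proof -
  note a = assms[unfolded has_ito_integral_def]
  obtain N \<tau> \<theta> where sd: "\<And>j. simple_data T M F (N j) (\<tau> j) (\<theta> j)"
    and c: "tends_to_0_in_prob M (\<lambda>j \<omega>. \<integral>\<^sup>+s\<in>{0..T}.
          ennreal ((norm (simple_process (N j) (\<tau> j) (\<theta> j) s \<omega> - H s \<omega>))\<^sup>2) \<partial>lborel)"
        "tends_to_0_in_prob M (\<lambda>j \<omega>. SUP t\<in>{0..T}.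
          ennreal (norm (simple_integral B (N j) (\<tau> j) (\<theta> j) t \<omega> - I t \<omega>)))"
    using a by blast
  have sd': "simple_data T M' F' (N j) (\<tau> j) (\<lambda>i \<omega>. \<theta> j i (h \<omega>))" for j
    unfolding simple_data_def
  proof (intro conjI allI impI)
    fix i assume i: "i < N j"
    have t: "\<tau> j i \<in> {0..T}" by (rule simple_data_times[OF sd]) (use i in simp)
    have "\<theta> j i \<in> borel_measurable (F (\<tau> j i))" using sd[of j] i by (simp add: simple_data_def)
    then show "(\<lambda>\<omega>. \<theta> j i (h \<omega>)) \<in> borel_measurable (F' (\<tau> j i))" by (rule measurable_compose[OF hF[OF t]])
    obtain C where "\<forall>\<omega>\<in>space M. norm (\<theta> j i \<omega>) \<le> C" using sd[of j] i by (auto simp: simple_data_def)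
    then show "\<exists>C. \<forall>\<omega>\<in>space M'. norm (\<theta> j i (h \<omega>)) \<le> C" using measurable_space[OF h] by blast
  qed (use sd[of j] in \<open>simp_all add: simple_data_def\<close>)
  have p: "simple_process (N j) (\<tau> j) (\<lambda>i \<omega>. \<theta> j i (h \<omega>)) s \<omega> = simple_process (N j) (\<tau> j) (\<theta> j) s (h \<omega>)" for j s \<omega>
    by (simp add: simple_process_def)
  have q: "simple_integral (\<lambda>t \<omega>. B t (h \<omega>)) (N j) (\<tau> j) (\<lambda>i \<omega>. \<theta> j i (h \<omega>)) s \<omega> = simple_integral B (N j) (\<tau> j) (\<theta> j) s (h \<omega>)" for j s \<omega>
    by (simp add: simple_integral_def)
  have "\<exists>N \<tau> \<theta>. (\<forall>j. simple_data T M' F' (N j) (\<tau> j) (\<theta> j)) \<and>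
        tends_to_0_in_prob M' (\<lambda>j \<omega>. \<integral>\<^sup>+s\<in>{0..T}.
          ennreal ((norm (simple_process (N j) (\<tau> j) (\<theta> j) s \<omega> - H s (h \<omega>)))\<^sup>2) \<partial>lborel) \<and>
        tends_to_0_in_prob M' (\<lambda>j \<omega>. SUP t\<in>{0..T}.
          ennreal (norm (simple_integral (\<lambda>t \<omega>. B t (h \<omega>)) (N j) (\<tau> j) (\<theta> j) t \<omega> - I t (h \<omega>))))"
    by (rule exI[of _ N], rule exI[of _ \<tau>], rule exI[of _ "\<lambda>j i \<omega>. \<theta> j i (h \<omega>)"])
      (simp only: p q sd' tends_to_0_in_prob_pullback[OF c(1)] tends_to_0_in_prob_pullback[OF c(2)] simp_thms)
  moreover have "progressive T F' (\<lambda>t \<omega>. H t (h \<omega>))" using a by (intro progressive_pullback) blast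
  moreover have "AE \<omega> in M'. (\<integral>\<^sup>+s\<in>{0..T}. ennreal ((norm (H s (h \<omega>)))\<^sup>2) \<partial>lborel) < \<infinity>"
    using a by (intro AE_pullback) blast
  moreover have "\<forall>t\<in>{0..T}. (\<lambda>\<omega>. I t (h \<omega>)) \<in> borel_measurable (F' t)"
    using a measurable_compose[OF hF] by blast
  moreover have "\<forall>\<omega>\<in>space M'. continuous_on {0..T} (\<lambda>t. I t (h \<omega>))"
    using a measurable_space[OF h] by blast
  ultimately show ?thesis unfolding has_ito_integral_def by blast
qed

lemma solves_fbsde_pullback:
  assumes "solves_fbsde T m b \<sigma> f G M F B ini (\<lambda>_. u) P X Y Z L"
  shows "solves_fbsde T m b \<sigma> f G M' F' (\<lambda>t \<omega>. B t (h \<omega>)) (\<lambda>\<omega>. ini (h \<omega>)) (\<lambda>_. u) P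
    (\<lambda>t \<omega>. X t (h \<omega>)) (\<lambda>t \<omega>. Y t (h \<omega>)) (\<lambda>t \<omega>. Z t (h \<omega>)) (\<lambda>t \<omega>. L t (h \<omega>))"
proof -
  let ?q = "\<lambda>t \<omega>. quad X Y Z L t (h \<omega>)"
  have q: "quad (\<lambda>t \<omega>. X t (h \<omega>)) (\<lambda>t \<omega>. Y t (h \<omega>)) (\<lambda>t \<omega>. Z t (h \<omega>)) (\<lambda>t \<omega>. L t (h \<omega>)) t \<omega> = ?q t \<omega>" for t \<omega>
    by (simp add: quad_def)
  note a = assms[unfolded solves_fbsde_def Let_def]
  obtain I where I: "has_ito_integral T M F B (\<lambda>t \<omega>. at_family m (\<sigma> u t (quad X Y Z L t \<omega>)) (P t)) I"
    "AE \<omega> in M. \<forall>t\<in>{0..T}. X t \<omega> = X 0 \<omega> + (LINT s:{0..t}|lborel. at_family m (b u s (quad X Y Z L s \<omega>)) (P s)) + I t \<omega>"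
    using a by blast
  obtain J where J: "has_ito_integral T M F B Z J"
    "AE \<omega> in M. \<forall>t\<in>{0..T}. Y t \<omega> = Y T \<omega> + (LINT s:{t..T}|lborel. at_family m (f u s (quad X Y Z L s \<omega>)) (P s)) - (J T \<omega> - J t \<omega>)"
    using a by blast
  have "AE \<omega> in M. set_integrable lborel {0..T} (\<lambda>s. at_family m (b u s (quad X Y Z L s \<omega>)) (P s))"
    "AE \<omega> in M. set_integrable lborel {0..T} (\<lambda>s. at_family m (f u s (quad X Y Z L s \<omega>)) (P s))"
    "AE \<omega> in M. X 0 \<omega> = ini \<omega>" "AE \<omega> in M. Y T \<omega> = at_family m (G u (X T \<omega>)) (\<lambda>u. distr (P T u) borel fst)"
    using a by blast+
  note rest = this[THEN AE_pullback]
  show ?thesis unfolding solves_fbsde_def Let_def q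
    using rest has_ito_integral_pullback[OF I(1)] AE_pullback[OF I(2)] has_ito_integral_pullback[OF J(1)] AE_pullback[OF J(2)]
    by blast
qed

end

subsection \<open>The canonical space\<close>

definition S1_zero :: "real \<Rightarrow> ('n::finite, 'l::finite, 'd::finite, 'k::finite) S1" where
  "S1_zero T = (\<lambda>t\<in>{0..T}. 0, \<lambda>t\<in>{0..T}. 0, L2_class T (\<lambda>_. 0), L2_class T (\<lambda>_. 0))"

lemma space_Omega_bar:
  "\<omega> \<in> space (Omega_bar T) \<longleftrightarrow> fst \<omega> \<in> topspace (S1_top T) \<and> fst (snd \<omega>) \<in> space (CS T)"
  by (cases \<omega>) (auto simp: Omega_bar_def S2_top_def topspace_C_top space_CS simp del: topspace_mtopology_of)

lemma zero_path_in_C: "(\<lambda>t\<in>{0..T}. 0) \<in> topspace (C_top T :: (real \<Rightarrow> 'a::euclidean_space) topology)"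
  using continuous_on_cong[of "{0..T}" "{0..T}" "restrict (\<lambda>t. 0 :: 'a) {0..T}" "\<lambda>t. 0"] unfolding topspace_C_top by simp

lemma S1_zero_in: "S1_zero T \<in> topspace (S1_top T)"
  unfolding topspace_S1 S1_zero_def fst_conv snd_conv by (intro conjI zero_path_in_C L2_class_in sq_int_zero)

text \<open>A metrizable space has closed points; with the corresponding fact for the zero classes
  this makes \<open>S1_zero\<close> a closed point of the product.\<close>

lemma closedin_zero_path:
  "closedin (C_top T) {\<lambda>t\<in>{0..T}. 0 :: 'a::euclidean_space}"
proof -
  let ?m = "cfunspace (top_of_set {0..T}) (euclidean_metric :: 'a metric)"
  interpret Metric_space "mspace ?m" "mdist ?m" by (rule Metric_space_mspace_mdist)
  have "t1_space (C_top T :: (real \<Rightarrow> 'a) topology)" unfolding mtopology_of_def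
    by (rule metrizable_imp_t1_space[OF metrizable_space_mtopology])
  from this[unfolded t1_space_closedin_singleton] show ?thesis by (rule bspec[OF _ zero_path_in_C])
qed

lemma closedin_S1_zero:
  "closedin (S1_top T) {S1_zero T :: ('n::finite, 'l::finite, 'd::finite, 'k::finite) S1}"
proof -
  have eq: "{S1_zero T} = {\<lambda>t\<in>{0..T}. 0 :: real^'n} \<times> {\<lambda>t\<in>{0..T}. 0 :: real^'l} \<times> {L2_class T (\<lambda>_. 0 :: real^'d^'l)} \<times> {L2_class T (\<lambda>_. 0 :: real^'k)}"
    by (auto simp: S1_zero_def)
  show ?thesis unfolding S1_top_def eq closedin_prod_Times_iff
    by (intro disjI2 conjI closedin_zero_path closedin_L2_singleton sq_int_zero)
qed

definition noise :: "('n::finite, 'l::finite, 'd::finite, 'k::finite) S1 \<times> ('n, 'd) S2 \<Rightarrow> (real^'n) \<times> (real \<Rightarrow> real^'d)" where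
  "noise \<omega> = (snd (snd \<omega>), fst (snd \<omega>))"

definition embed :: "real \<Rightarrow> (real^'n) \<times> (real \<Rightarrow> real^'d) \<Rightarrow> ('n::finite, 'l::finite, 'd::finite, 'k::finite) S1 \<times> ('n, 'd) S2" where
  "embed T y = (S1_zero T, snd y, fst y)"

lemma noise_embed [simp]: "noise (embed T y) = y"
  by (simp add: noise_def embed_def)

lemma measurable_embed:
  assumes "T > 0" shows "embed T \<in> YS T \<rightarrow>\<^sub>M Omega_bar T"
proof -
  have "countably_based (YS T) (C_top T) (\<lambda>y. snd y)"
    by (rule countably_based_compose[OF countably_based_CS[OF assms] measurable_YS_snd])
  then have "countably_based (YS T) (prod_topology (S1_top T) (S2_top T)) (\<lambda>y. (S1_zero T, snd y, fst y))"
    unfolding S2_top_def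
    by (intro countably_based_pair countably_based_const S1_zero_in countably_based_euclidean measurable_YS_fst)
  then show ?thesis unfolding Omega_bar_def embed_def[abs_def] by (rule countably_based_measurable)
qed

lemma measurable_noise_eval:
  assumes "t \<in> {0..T}"
  shows "(\<lambda>\<omega>. fst (snd \<omega>) t) \<in> borel_measurable (Omega_bar T)"
proof -
  have "continuous_map (prod_topology (S1_top T) (S2_top T)) euclidean ((\<lambda>w. w t) \<circ> (fst \<circ> snd))"
    unfolding S2_top_def
    by (intro continuous_map_compose[OF continuous_map_compose[OF continuous_map_snd continuous_map_fst] continuous_map_C_eval[OF assms]])
  from measurable_continuous_map[OF this] show ?thesis by (simp add: Omega_bar_def borel_of_euclidean o_def)
qed

lemma measurable_noise:
  "(noise :: ('n::finite, 'l::finite, 'd::finite, 'k::finite) S1 \<times> ('n, 'd) S2 \<Rightarrow> _) \<in> Omega_bar T \<rightarrow>\<^sub>M YS T"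
proof -
  let ?O = "Omega_bar T :: (('n, 'l, 'd, 'k) S1 \<times> ('n, 'd) S2) measure"
  have "continuous_map (prod_topology (S1_top T :: ('n, 'l, 'd, 'k) S1 topology) (S2_top T :: ('n, 'd) S2 topology)) euclidean (snd \<circ> snd)"
    unfolding S2_top_def by (rule continuous_map_compose[OF continuous_map_snd continuous_map_snd])
  from measurable_continuous_map[OF this] have 1: "(\<lambda>\<omega>. snd (snd \<omega>)) \<in> borel_measurable ?O"
    by (simp add: Omega_bar_def borel_of_euclidean o_def)
  have "(\<lambda>\<omega>. \<lambda>t\<in>{0..T}. fst (snd \<omega>) t) \<in> ?O \<rightarrow>\<^sub>M CS T"
    by (rule measurable_into_CS[OF _ measurable_noise_eval]) (auto simp: space_Omega_bar space_CS)
  also have "?this \<longleftrightarrow> (\<lambda>\<omega>. fst (snd \<omega>)) \<in> ?O \<rightarrow>\<^sub>M CS T"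
    by (rule measurable_cong) (simp add: space_Omega_bar CS_restrict)
  finally show ?thesis using 1 unfolding noise_def[abs_def] YS_def by (intro measurable_Pair)
qed

context aux_setting
begin

text \<open>
  Since the \<open>S\<^sub>1\<close>-component is frozen, the canonical filtration is that of the noise up to null sets, and
  \<^const>\<open>precise\<close> need not be shown to be Borel on \<open>S\<^sub>1\<close>.
\<close>

definition Pbar :: "'u \<Rightarrow> (('n, 'l::finite, 'd, 'k::finite) S1 \<times> ('n, 'd) S2) measure" where
  "Pbar u = distr (\<nu> u) (Omega_bar T) (embed T)"

lemma measurable_embed_\<nu> [measurable]: "embed T \<in> \<nu> u \<rightarrow>\<^sub>M Omega_bar T"
  using measurable_embed[OF T] by (simp cong: measurable_cong_sets)

lemma sets_Pbar [simp, measurable_cong]: "sets (Pbar u) = sets (Omega_bar T)"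
  and space_Pbar [simp]: "space (Pbar u) = space (Omega_bar T)"
  by (simp_all add: Pbar_def)

lemma prob_Pbar: "prob_space (Pbar u)"
  unfolding Pbar_def by (rule prob_space.prob_space_distr[OF prob_\<nu> measurable_embed_\<nu>])

lemma measurable_noise_Pbar: "noise \<in> Pbar u \<rightarrow>\<^sub>M YS T"
  using measurable_noise by (simp cong: measurable_cong_sets)

lemma distr_noise:
  assumes "sets K = sets (YS T)"
  shows "distr (Pbar u :: (('n, 'l::finite, 'd, 'k::finite) S1 \<times> ('n, 'd) S2) measure) K noise = \<nu> u"
proof -
  let ?P = "Pbar u :: (('n, 'l, 'd, 'k) S1 \<times> ('n, 'd) S2) measure"
  have "noise \<in> (Omega_bar T :: (('n, 'l, 'd, 'k) S1 \<times> ('n, 'd) S2) measure) \<rightarrow>\<^sub>M K"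
    using measurable_noise assms by (simp cong: measurable_cong_sets)
  from distr_distr[OF this measurable_embed_\<nu>]
  have "distr ?P K noise = distr (\<nu> u) K (\<lambda>y. noise (embed T y :: ('n, 'l, 'd, 'k) S1 \<times> ('n, 'd) S2))"
    unfolding Pbar_def by (simp add: o_def)
  then show ?thesis by (simp add: distr_id2 assms)
qed

lemma distr_functional:
  assumes f: "f \<in> YS T \<rightarrow>\<^sub>M K"
  shows "distr (completion (Pbar u :: (('n, 'l::finite, 'd, 'k::finite) S1 \<times> ('n, 'd) S2) measure)) K (\<lambda>\<omega>. f (noise \<omega>)) = distr (\<nu> u) K f"
proof -
  let ?P = "Pbar u :: (('n, 'l, 'd, 'k) S1 \<times> ('n, 'd) S2) measure"
  have "distr (completion ?P) K (\<lambda>\<omega>. f (noise \<omega>)) = distr ?P K (\<lambda>\<omega>. f (noise \<omega>))"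
    by (rule distr_completion) (rule measurable_compose[OF measurable_noise_Pbar f])
  also have "\<dots> = distr (distr ?P (YS T) noise) K f"
    by (subst distr_distr[OF f measurable_noise_Pbar]) (simp add: o_def)
  also have "distr ?P (YS T) noise = \<nu> u" by (rule distr_noise[OF refl])
  finally show ?thesis .
qed

lemma nn_integral_Pbar:
  assumes f: "f \<in> borel_measurable (YS T)"
  shows "(\<integral>\<^sup>+\<omega>. f (noise \<omega>) \<partial>completion (Pbar u :: (('n, 'l::finite, 'd, 'k::finite) S1 \<times> ('n, 'd) S2) measure)) = (\<integral>\<^sup>+y. f y \<partial>\<nu> u)"
proof -
  let ?P = "Pbar u :: (('n, 'l, 'd, 'k) S1 \<times> ('n, 'd) S2) measure"
  have "(\<integral>\<^sup>+y. f y \<partial>distr ?P (YS T) noise) = (\<integral>\<^sup>+\<omega>. f (noise \<omega>) \<partial>?P)"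
    by (rule nn_integral_distr[OF measurable_noise_Pbar]) (use f in simp)
  also have "distr ?P (YS T) noise = \<nu> u" by (rule distr_noise[OF refl])
  finally show ?thesis by (simp add: nn_integral_completion)
qed

text \<open>The singleton of \<open>S1_zero\<close> is closed, so the statement concerns an event
  and can be tested on the image of \<open>embed\<close>.\<close>

lemma AE_S1_zero: "AE \<omega> in Pbar u. fst \<omega> = S1_zero T"
proof -
  have "closedin (prod_topology (S1_top T) (S2_top T)) {\<omega> \<in> topspace (prod_topology (S1_top T) (S2_top T)). fst \<omega> \<in> {S1_zero T}}"
    by (rule closedin_continuous_map_preimage[OF continuous_map_fst closedin_S1_zero])
  then have "{\<omega> \<in> space (Omega_bar T). fst \<omega> = S1_zero T} \<in> sets (Omega_bar T)"
    using closedin_borel_of by (fastforce simp: Omega_bar_def)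
  then show ?thesis unfolding Pbar_def by (subst AE_distr_iff[OF measurable_embed_\<nu>]) (auto simp: embed_def)
qed

text \<open>Preimages of \<open>\<nu> u\<close>-null sets are null because \<open>noise\<close>
  carries \<open>Pbar u\<close> to \<open>\<nu> u\<close>. Completions stand on both sides since
  augmented filtrations contain sets measurable only for them.\<close>

lemma noise_completion:
  fixes u
  defines "P \<equiv> Pbar u :: (('n, 'l::finite, 'd, 'k::finite) S1 \<times> ('n, 'd) S2) measure"
  shows "noise \<in> completion P \<rightarrow>\<^sub>M completion (\<nu> u)" "distr (completion P) (completion (\<nu> u)) noise = completion (\<nu> u)"
proof -
  have n0: "noise \<in> P \<rightarrow>\<^sub>M \<nu> u" unfolding P_def using measurable_noise_Pbar[of u] by (simp cong: measurable_cong_sets)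
  then have n: "noise \<in> completion P \<rightarrow>\<^sub>M \<nu> u" by (rule measurable_completion)
  have "distr P (\<nu> u) noise = \<nu> u" unfolding P_def by (rule distr_noise) simp
  then have d: "distr (completion P) (\<nu> u) noise = \<nu> u" by (simp only: distr_completion[OF n0])
  show "noise \<in> completion P \<rightarrow>\<^sub>M completion (\<nu> u)" by (rule completion.measurable_completion2[OF n]) (simp add: d)
  show "distr (completion P) (completion (\<nu> u)) noise = completion (\<nu> u)"
    using completion.completion_distr_eq[OF n] by (simp add: d)
qed

definition CF0 :: "real \<Rightarrow> (('n, 'l::finite, 'd, 'k::finite) S1 \<times> ('n, 'd) S2) measure" where
  "CF0 = gen_filtration (space (Omega_bar T)) (\<lambda>s (p, w, c). (canon_S1 s p, w s, c))"

lemma canonical_filtration_eq: "canonical_filtration T (Pbar u) = augmented (Pbar u) CF0"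
  by (simp add: canonical_filtration_def CF0_def)

lemma space_CF0 [simp]: "space (CF0 t) = space (Omega_bar T)" by (simp add: CF0_def)

lemma space_canonical_filtration [simp]: "space (canonical_filtration T (Pbar u) t) = space (Omega_bar T)"
  unfolding canonical_filtration_eq by (subst space_augmented[where F = CF0 and t = t]) simp_all

lemma noise_in_space: "\<omega> \<in> space (Omega_bar T) \<Longrightarrow> noise \<omega> \<in> space (YS T)"
  by (rule measurable_space[OF measurable_noise])

lemma noise_CF0:
  assumes "t \<in> {0..T}"
  shows "(noise :: ('n, 'l::finite, 'd, 'k::finite) S1 \<times> ('n, 'd) S2 \<Rightarrow> _) \<in> CF0 t \<rightarrow>\<^sub>M YF T t"
  unfolding YF_def
proof (rule measurable_into_gen_filtration)
  show "noise \<in> space (CF0 t) \<rightarrow> space (YS T)" using noise_in_space by auto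
  fix s assume s: "s \<in> {0..t}"
  have "(\<lambda>(p, w, c). (canon_S1 s p, w s, c)) \<in> borel_measurable (CF0 t :: (('n, 'l, 'd, 'k) S1 \<times> ('n, 'd) S2) measure)"
    unfolding CF0_def by (rule measurable_gen_filtration[OF s])
  moreover have "snd \<in> borel_measurable (borel :: (('n, 'l, 'd, 'k) E \<times> (real^'d) \<times> (real^'n)) measure)"
    by (intro borel_measurable_continuous_onI continuous_intros)
  ultimately have "(\<lambda>\<omega>. snd ((\<lambda>(p, w, c). (canon_S1 s p, w s, c)) \<omega>)) \<in> borel_measurable (CF0 t :: (('n, 'l, 'd, 'k) S1 \<times> ('n, 'd) S2) measure)"
    by (rule measurable_compose)
  then show "(\<lambda>\<omega>. (snd (noise \<omega>) s, fst (noise \<omega>))) \<in> borel_measurable (CF0 t :: (('n, 'l, 'd, 'k) S1 \<times> ('n, 'd) S2) measure)"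
    by (simp add: noise_def case_prod_beta')
qed

text \<open>Events of the unaugmented noise pull back because the canonical process shows the noise
  directly; null sets pull back because \<open>noise\<close> preserves the measure.\<close>

lemma noise_filtration:
  assumes t: "t \<in> {0..T}"
  shows "noise \<in> canonical_filtration T (Pbar u :: (('n, 'l::finite, 'd, 'k::finite) S1 \<times> ('n, 'd) S2) measure) t \<rightarrow>\<^sub>M FY u t"
proof (rule measurableI)
  let ?P = "Pbar u :: (('n, 'l, 'd, 'k) S1 \<times> ('n, 'd) S2) measure"
  show "noise \<omega> \<in> space (FY u t)" if "\<omega> \<in> space (canonical_filtration T ?P t)" for \<omega>
    using that noise_in_space by simp
  fix A assume "A \<in> sets (FY u t)"
  then have "A \<in> sigma_sets (space (YS T)) (sets (YF T t) \<union> null_sets (completion (\<nu> u)))"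
    unfolding FY_def by (subst (asm) sets_augmented[where F = "YF T" and t = t]) simp_all
  then have "noise -` A \<inter> space ?P \<in> sets (canonical_filtration T ?P t)"
  proof induction
    case (Basic a)
    then show ?case
    proof
      assume "a \<in> sets (YF T t)"
      then show ?thesis using measurable_sets[OF noise_CF0[OF t], of a] unfolding canonical_filtration_eq
        by (intro sets_augmented_base[where F = CF0 and t = t]) simp_all
    next
      assume a: "a \<in> null_sets (completion (\<nu> u))"
      have "noise -` a \<inter> space ?P \<in> null_sets (completion ?P)"
      proof (rule null_setsI)
        have as: "a \<in> sets (completion (\<nu> u))" using a by auto
        show "noise -` a \<inter> space ?P \<in> sets (completion ?P)"
          using measurable_sets[OF noise_completion(1) as] by simp
        have "emeasure (distr (completion ?P) (completion (\<nu> u)) noise) a = emeasure (completion ?P) (noise -` a \<inter> space (completion ?P))"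
          by (rule emeasure_distr[OF noise_completion(1) as])
        then show "emeasure (completion ?P) (noise -` a \<inter> space ?P) = 0"
          using a by (simp only: noise_completion(2) space_completion null_setsD1)
      qed
      then show ?thesis unfolding canonical_filtration_eq by (intro sets_augmented_null[where F = CF0 and t = t]) simp_all
    qed
  next
    case (Compl a)
    have eq: "noise -` (space (YS T) - a) \<inter> space ?P = space (canonical_filtration T ?P t) - (noise -` a \<inter> space ?P)"
      using noise_in_space by auto
    show ?case unfolding eq by (rule sets.compl_sets[OF Compl.IH])
  next
    case (Union a)
    have eq: "noise -` (\<Union>i. a i) \<inter> space ?P = (\<Union>i. noise -` a i \<inter> space ?P)" by auto
    show ?case unfolding eq by (rule sets.countable_UN) (use Union.IH in auto)
  qed simp
  then show "noise -` A \<inter> space (canonical_filtration T ?P t) \<in> sets (canonical_filtration T ?P t)" by simp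
qed

sublocale pb: filtered_pullback T "completion (Pbar u)" "canonical_filtration T (Pbar u)" "completion (\<nu> u)" "FY u" noise for u
  by unfold_locales (rule noise_completion noise_filtration, assumption?)+

lemma canonical_set_representation:
  assumes s: "s \<in> {0..T}"
    and A: "A \<in> sets (canonical_filtration T (Pbar u :: (('n, 'l::finite, 'd, 'k::finite) S1 \<times> ('n, 'd) S2) measure) s)"
  shows "\<exists>C\<in>sets (YF T s). AE \<omega> in Pbar u. \<omega> \<in> A \<longleftrightarrow> noise \<omega> \<in> C"
proof (rule sigma_sets_AE_representation)
  let ?P = "Pbar u :: (('n, 'l, 'd, 'k) S1 \<times> ('n, 'd) S2) measure"
  show "noise \<in> space ?P \<rightarrow> space (YF T s)" using noise_in_space by auto
  show "A \<in> sigma_sets (space ?P) (sets (CF0 s) \<union> null_sets (completion ?P))"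
    using A unfolding canonical_filtration_eq by (subst (asm) sets_augmented[where F = CF0 and t = s]) simp_all
  fix a assume "a \<in> sets (CF0 s) \<union> null_sets (completion ?P)"
  then consider "a \<in> sets (CF0 s)" | "a \<in> null_sets (completion ?P)" by blast
  then show "\<exists>C\<in>sets (YF T s). AE \<omega> in ?P. \<omega> \<in> a \<longleftrightarrow> noise \<omega> \<in> C"
  proof cases
    case 1
    show ?thesis
    proof (rule sigma_sets_AE_representation)
      show "noise \<in> space ?P \<rightarrow> space (YF T s)" using noise_in_space by auto
      show "a \<in> sigma_sets (space ?P) {(\<lambda>(p, w, c). (canon_S1 r p, w r, c)) -` C \<inter> space (Omega_bar T) | r C. r \<in> {0..s} \<and> C \<in> sets borel}"
        using 1 unfolding CF0_def sets_gen_filtration by simp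
      fix g assume "g \<in> {(\<lambda>(p, w, c). (canon_S1 r p, w r, c)) -` C \<inter> space (Omega_bar T :: (('n, 'l, 'd, 'k) S1 \<times> ('n, 'd) S2) measure) | r C. r \<in> {0..s} \<and> C \<in> sets borel}"
      then obtain r C where g: "g = (\<lambda>(p, w, c). (canon_S1 r p, w r, c)) -` C \<inter> space (Omega_bar T)" "r \<in> {0..s}"
        and C: "C \<in> sets (borel :: (('n, 'l, 'd, 'k) E \<times> (real^'d) \<times> (real^'n)) measure)" by blast
      let ?v = "\<lambda>y. (canon_S1 r (S1_zero T) :: ('n, 'l, 'd, 'k) E, snd y r, fst y)"
      have "?v \<in> borel_measurable (YF T s)"
        by (intro borel_measurable_Pair borel_measurable_const measurable_YF_eval[OF g(2)])
      then have "?v -` C \<inter> space (YS T) \<in> sets (YF T s)" using measurable_sets[of ?v "YF T s" borel C] C by simp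
      moreover have "AE \<omega> in ?P. \<omega> \<in> g \<longleftrightarrow> noise \<omega> \<in> ?v -` C \<inter> space (YS T)"
        using AE_S1_zero AE_space
      proof eventually_elim
        case (elim \<omega>)
        then have "noise \<omega> \<in> space (YS T)" using noise_in_space by simp
        moreover obtain p w c where "\<omega> = (p, w, c)" by (cases \<omega>) auto
        ultimately show ?case using elim by (auto simp: g(1) noise_def)
      qed
      ultimately show "\<exists>C\<in>sets (YF T s). AE \<omega> in ?P. \<omega> \<in> g \<longleftrightarrow> noise \<omega> \<in> C" by blast
    qed
  next
    case 2
    then have "AE \<omega> in completion ?P. \<omega> \<notin> a" by (rule AE_not_in)
    then have "AE \<omega> in ?P. \<omega> \<in> a \<longleftrightarrow> noise \<omega> \<in> {}" by (simp add: AE_completion_iff)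
    then show ?thesis by blast
  qed
qed

end

subsection \<open>The noise under the canonical measures\<close>

context aux_setting
begin

lemma W_increment:
  assumes "0 \<le> s" "s < t" "t \<le> T"
  shows "distr W borel (\<lambda>w. w t - w s) = gaussian (t - s)"
proof -
  have f: "(\<lambda>w. w t - w s) \<in> borel_measurable (CS T)"
    by (intro borel_measurable_diff measurable_CS_eval) (use assms in auto)
  have "distr W borel (\<lambda>w. w t - w s) = distr M borel (\<lambda>\<omega>. B t \<omega> - B s \<omega>)"
    unfolding W_def by (subst distr_distr[OF f path_measurable]) (use assms in \<open>auto intro!: distr_cong\<close>)
  also have "\<dots> = gaussian (t - s)" using bm assms by (simp add: brownian_motion_def)
  finally show ?thesis .
qed

lemma W_start: "AE w in W. w 0 = 0"
proof -
  have z: "(0::real) \<in> {0..T}" using T by simp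
  have "{w \<in> space (CS T). w 0 = 0} \<in> sets (CS T)"
    using measurable_CS_eval[OF z] by measurable
  then have "(AE w in W. w 0 = 0) \<longleftrightarrow> (AE \<omega> in M. path \<omega> 0 = 0)"
    unfolding W_def by (rule AE_distr_iff[OF path_measurable])
  then show ?thesis using bm z by (simp add: brownian_motion_def)
qed

text \<open>Transported from \<open>M\<close>: the map \<open>path\<close> pulls events of the
  coordinate filtration back to events of the filtration generated by \<open>B\<close>.\<close>

lemma W_indep:
  assumes st: "0 \<le> s" "s < t" "t \<le> T" and D: "D \<in> sets (gen_filtration (space (CS T)) (\<lambda>r w. w r) s)"
    and E: "E \<in> sets borel"
  shows "emeasure W (D \<inter> {w \<in> space (CS T). w t - w s \<in> E}) = emeasure W D * emeasure W {w \<in> space (CS T). w t - w s \<in> E}"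
proof -
  let ?H = "{w \<in> space (CS T). w t - w s \<in> E}"
  let ?F = "gen_filtration (space M) B s"
  have path: "path \<in> ?F \<rightarrow>\<^sub>M gen_filtration (space (CS T)) (\<lambda>r w. w r) s"
  proof (rule measurable_into_gen_filtration)
    show "path \<in> space ?F \<rightarrow> space (CS T)" using measurable_space[OF path_measurable] by auto
    fix r assume r: "r \<in> {0..s}"
    have "(\<lambda>\<omega>. path \<omega> r) = B r" using r st by auto
    then show "(\<lambda>\<omega>. path \<omega> r) \<in> borel_measurable ?F" using measurable_gen_filtration[OF r] by simp
  qed
  have "(\<lambda>w. w) \<in> CS T \<rightarrow>\<^sub>M gen_filtration (space (CS T)) (\<lambda>r w. w r) s"
    by (rule measurable_into_gen_filtration) (use st in \<open>auto intro: measurable_CS_eval\<close>)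
  from measurable_sets[OF this D] sets.sets_into_space[OF D] have D': "D \<in> sets (CS T)" by (simp add: Int_absorb2)
  have H: "?H \<in> sets (CS T)"
    using measurable_sets[OF borel_measurable_diff[OF measurable_CS_eval[of t T] measurable_CS_eval[of s T]] E] st
    by (simp add: vimage_def Int_def conj_commute)
  let ?b = "(\<lambda>\<omega>. B t \<omega> - B s \<omega>) -` E \<inter> space M"
  have b: "path -` ?H \<inter> space M = ?b" using measurable_space[OF path_measurable] st by auto
  have "indep_set (sets ?F) (sets (vimage_algebra (space M) (\<lambda>\<omega>. B t \<omega> - B s \<omega>) borel))"
    using bm st by (simp add: brownian_motion_def)
  from indep_setD[OF this measurable_sets[OF path D] in_vimage_algebra[OF E]]
  have i: "prob (path -` D \<inter> space M \<inter> ?b) = prob (path -` D \<inter> space M) * prob ?b"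
    by (simp only: space_gen_filtration)
  have e: "emeasure W S = ennreal (prob (path -` S \<inter> space M))" if "S \<in> sets (CS T)" for S
    unfolding W_def emeasure_distr[OF path_measurable that] by (rule emeasure_eq_measure)
  have "path -` (D \<inter> ?H) \<inter> space M = path -` D \<inter> space M \<inter> (path -` ?H \<inter> space M)" by blast
  then have "prob (path -` (D \<inter> ?H) \<inter> space M) = prob (path -` D \<inter> space M) * prob (path -` ?H \<inter> space M)"
    by (simp only: b i)
  then show ?thesis by (simp only: e[OF D'] e[OF H] e[OF sets.Int[OF D' H]] ennreal_mult measure_nonneg)
qed

lemma emeasure_\<nu>:
  "S \<in> sets (YS T) \<Longrightarrow> emeasure (\<nu> u) S = (\<integral>\<^sup>+c. emeasure W (Pair c -` S) \<partial>law_ini u)"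
proof -
  interpret W: prob_space W by (rule prob_W)
  assume "S \<in> sets (YS T)"
  then have "S \<in> sets (law_ini u \<Otimes>\<^sub>M W)" by (simp add: YS_def cong: sets_pair_measure_cong)
  then show ?thesis unfolding \<nu>_def by (rule W.emeasure_pair_measure_alt)
qed

lemma emeasure_\<nu>_Times:
  assumes "E \<in> sets borel" "D \<in> sets (CS T)"
  shows "emeasure (\<nu> u) (E \<times> D) = emeasure (law_ini u) E * emeasure W D"
proof -
  interpret W: prob_space W by (rule prob_W)
  show ?thesis unfolding \<nu>_def by (rule W.emeasure_pair_measure_Times) (use assms in simp_all)
qed

lemma distr_\<nu>_fst: "distr (\<nu> u) borel fst = law_ini u"
proof (rule measure_eqI)
  interpret W: prob_space W by (rule prob_W)
  fix A :: "(real^'n) set" assume "A \<in> sets (distr (\<nu> u) borel fst)"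
  then have A: "A \<in> sets borel" by simp
  have "fst -` A \<inter> space (\<nu> u) = A \<times> space (CS T)"
    using sets_eq_imp_space_eq[OF sets_\<nu>[of u]] by (auto simp: space_YS)
  moreover have "fst \<in> borel_measurable (\<nu> u)" by measurable
  ultimately show "emeasure (distr (\<nu> u) borel fst) A = emeasure (law_ini u) A"
    using A W.emeasure_space_1 sets_eq_imp_space_eq[OF sets_W] by (simp add: emeasure_distr emeasure_\<nu>_Times)
qed simp

lemma distr_\<nu>_snd: "distr (\<nu> u) (CS T) snd = W"
proof (rule measure_eqI)
  interpret l: prob_space "law_ini u" by (rule prob_law)
  fix A assume "A \<in> sets (distr (\<nu> u) (CS T) snd)"
  then have A: "A \<in> sets (CS T)" by simp
  have "snd -` A \<inter> space (\<nu> u) = UNIV \<times> A"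
    using sets_eq_imp_space_eq[OF sets_\<nu>[of u]] sets.sets_into_space[OF A] by (auto simp: space_YS)
  moreover have "snd \<in> \<nu> u \<rightarrow>\<^sub>M CS T" using measurable_YS_snd by (simp cong: measurable_cong_sets)
  ultimately show "emeasure (distr (\<nu> u) (CS T) snd) A = emeasure W A"
    using A l.emeasure_space_1 sets_eq_imp_space_eq[OF sets_law[of u]] by (simp add: emeasure_distr emeasure_\<nu>_Times)
qed simp

text \<open>Initial enlargement by an independent variable. For a fixed initial value the section of
  \<open>A\<close> is an event of the path up to time \<open>s\<close>, where \<open>W_indep\<close>
  applies; the resulting product is integrated over the initial law.\<close>

lemma YF_indep:
  assumes st: "0 \<le> s" "s < t" "t \<le> T" and A: "A \<in> sets (YF T s)" and E: "E \<in> sets borel"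
  shows "emeasure (\<nu> u) (A \<inter> {y \<in> space (YS T). snd y t - snd y s \<in> E}) =
    emeasure (\<nu> u) A * emeasure (\<nu> u) {y \<in> space (YS T). snd y t - snd y s \<in> E}"
proof -
  interpret l: prob_space "law_ini u" by (rule prob_law)
  let ?H = "{w \<in> space (CS T). w t - w s \<in> E}"
  let ?K = "(UNIV :: (real^'n) set) \<times> ?H"
  have A': "A \<in> sets (YS T)" using A sets_YF_sub[of s T] st by auto
  have H: "?H \<in> sets (CS T)"
    using measurable_sets[OF borel_measurable_diff[OF measurable_CS_eval[of t T] measurable_CS_eval[of s T]] E] st
    by (simp add: vimage_def Int_def conj_commute)
  have eq: "{y \<in> space (YS T). snd y t - snd y s \<in> E} = ?K" by (auto simp: space_YS)
  have "?K \<in> sets (YS T)" using H unfolding YS_def by (intro pair_measureI) simp_all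
  then have AH: "A \<inter> ?K \<in> sets (YS T)" using A' by simp
  have sec: "emeasure W (Pair c -` (A \<inter> ?K)) = emeasure W (Pair c -` A) * emeasure W ?H" for c
  proof -
    have "Pair c \<in> gen_filtration (space (CS T)) (\<lambda>r w. w r) s \<rightarrow>\<^sub>M YF T s"
      unfolding YF_def
    proof (rule measurable_into_gen_filtration)
      show "Pair c \<in> space (gen_filtration (space (CS T)) (\<lambda>r w. w r) s) \<rightarrow> space (YS T)" by (auto simp: space_YS)
      fix r assume r: "r \<in> {0..s}"
      show "(\<lambda>w. (snd (c, w) r, fst (c, w))) \<in> borel_measurable (gen_filtration (space (CS T)) (\<lambda>r w. w r) s)"
        using measurable_gen_filtration[OF r, of "\<lambda>r w. w r"] by (intro borel_measurable_Pair) simp_all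
    qed
    from measurable_sets[OF this A]
    have "Pair c -` A \<inter> space (CS T) \<in> sets (gen_filtration (space (CS T)) (\<lambda>r w. w r) s)"
      by (simp only: space_gen_filtration)
    also have "Pair c -` A \<inter> space (CS T) = Pair c -` A" using sets.sets_into_space[OF A'] by (auto simp: space_YS)
    finally have "Pair c -` A \<in> sets (gen_filtration (space (CS T)) (\<lambda>r w. w r) s)" .
    from W_indep[OF st this E] have "emeasure W (Pair c -` A \<inter> ?H) = emeasure W (Pair c -` A) * emeasure W ?H" .
    moreover have "Pair c -` (A \<inter> ?K) = Pair c -` A \<inter> ?H" by auto
    ultimately show ?thesis by simp
  qed
  have "emeasure (\<nu> u) (A \<inter> ?K) = (\<integral>\<^sup>+c. emeasure W (Pair c -` A) * emeasure W ?H \<partial>law_ini u)"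
    unfolding emeasure_\<nu>[OF AH] by (rule nn_integral_cong) (rule sec)
  also have "\<dots> = (\<integral>\<^sup>+c. emeasure W (Pair c -` A) \<partial>law_ini u) * emeasure W ?H"
  proof (rule nn_integral_multc)
    interpret W: prob_space W by (rule prob_W)
    have "A \<in> sets (borel \<Otimes>\<^sub>M W)" using A' by (simp add: YS_def cong: sets_pair_measure_cong)
    then show "(\<lambda>c. emeasure W (Pair c -` A)) \<in> borel_measurable (law_ini u)"
      using W.measurable_emeasure_Pair[of A borel] by (simp cong: measurable_cong_sets)
  qed
  also have "emeasure W ?H = emeasure (\<nu> u) (?K)"
    using emeasure_\<nu>_Times[OF _ H, of UNIV u] l.emeasure_space_1 sets_eq_imp_space_eq[OF sets_law[of u]] by simp
  finally show ?thesis by (simp only: eq emeasure_\<nu>[OF A'])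
qed

lemma measure_noise:
  assumes "S \<in> sets (YS T)"
  shows "measure (Pbar u :: (('n, 'l::finite, 'd, 'k::finite) S1 \<times> ('n, 'd) S2) measure) (noise -` S \<inter> space (Omega_bar T)) = measure (\<nu> u) S"
proof -
  let ?P = "Pbar u :: (('n, 'l, 'd, 'k) S1 \<times> ('n, 'd) S2) measure"
  have "measure (distr ?P (YS T) noise) S = measure ?P (noise -` S \<inter> space ?P)"
    by (rule measure_distr[OF measurable_noise_Pbar assms])
  then show ?thesis by (simp add: distr_noise)
qed

lemma sets_noise: "S \<in> sets (YS T) \<Longrightarrow> noise -` S \<inter> space (Omega_bar T) \<in> sets (Omega_bar T)"
  by (rule measurable_sets[OF measurable_noise])

lemma canonical_brownian_motion:
  fixes u
  defines "P \<equiv> Pbar u :: (('n, 'l::finite, 'd, 'k::finite) S1 \<times> ('n, 'd) S2) measure"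
  shows "brownian_motion T (completion P) (canonical_filtration T P) (\<lambda>t \<omega>. fst (snd \<omega>) t)"
  unfolding brownian_motion_def
proof (intro conjI ballI allI impI; (elim conjE)?)
  have sp: "space P = space (Omega_bar T)" by (simp add: P_def)
  interpret C: prob_space "completion P"
    unfolding P_def by (rule prob_space.prob_space_completion[OF prob_Pbar])
  interpret N: prob_space "\<nu> u" by (rule prob_\<nu>)
  fix t assume t: "t \<in> {0..T}"
  have "noise \<in> canonical_filtration T P t \<rightarrow>\<^sub>M FY u t" unfolding P_def by (rule noise_filtration[OF t])
  moreover have "(\<lambda>y. snd y t) \<in> borel_measurable (FY u t)"
    by (rule measurable_FY, rule measurable_YF_eval) (use t in auto)
  ultimately have "(\<lambda>\<omega>. snd (noise \<omega>) t) \<in> borel_measurable (canonical_filtration T P t)" by (rule measurable_compose)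
  then show "(\<lambda>\<omega>. fst (snd \<omega>) t) \<in> borel_measurable (canonical_filtration T P t)" by (simp add: noise_def)
next
  fix \<omega> assume "\<omega> \<in> space (completion P)"
  then show "continuous_on {0..T} (\<lambda>t. fst (snd \<omega>) t)"
    by (simp add: P_def space_Omega_bar space_CS)
next
  have s: "snd \<in> \<nu> u \<rightarrow>\<^sub>M CS T" using measurable_YS_snd by (simp cong: measurable_cong_sets)
  have "AE w in distr (\<nu> u) (CS T) snd. w 0 = 0" unfolding distr_\<nu>_snd by (rule W_start)
  then have "AE y in \<nu> u. snd y 0 = 0" by (rule AE_distrD[OF s])
  then have "AE y in completion (\<nu> u). snd y 0 = 0" by (rule AE_completion)
  then have "AE \<omega> in completion (Pbar u :: (('n, 'l, 'd, 'k) S1 \<times> ('n, 'd) S2) measure). snd (noise \<omega>) 0 = 0" by (rule pb.AE_pullback)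
  then show "AE \<omega> in completion P. fst (snd \<omega>) 0 = 0" unfolding P_def noise_def snd_conv .
next
  fix s t assume st: "0 \<le> s" "s < t" "t \<le> T"
  have f: "(\<lambda>y. snd y t - snd y s) \<in> borel_measurable (YS T)"
    by (intro borel_measurable_diff measurable_YS_eval) (use st in auto)
  have g: "(\<lambda>w. w t - w s) \<in> borel_measurable (CS T)"
    by (intro borel_measurable_diff measurable_CS_eval) (use st in auto)
  have sn: "snd \<in> \<nu> u \<rightarrow>\<^sub>M CS T" using measurable_YS_snd by (simp cong: measurable_cong_sets)
  have "distr (completion P) borel (\<lambda>\<omega>. fst (snd \<omega>) t - fst (snd \<omega>) s) = distr (\<nu> u) borel (\<lambda>y. snd y t - snd y s)"
    using distr_functional[OF f, of u] by (simp add: P_def noise_def)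
  also have "\<dots> = distr (distr (\<nu> u) (CS T) snd) borel (\<lambda>w. w t - w s)"
    by (subst distr_distr[OF g sn]) (simp add: o_def)
  finally show "distr (completion P) borel (\<lambda>\<omega>. fst (snd \<omega>) t - fst (snd \<omega>) s) = gaussian (t - s)"
    by (simp add: distr_\<nu>_snd W_increment[OF st])
  have sp: "space P = space (Omega_bar T)" and sets: "sets P = sets (Omega_bar T)" by (simp_all add: P_def)
  interpret C: prob_space "completion P"
    unfolding P_def by (rule prob_space.prob_space_completion[OF prob_Pbar])
  interpret N: prob_space "\<nu> u" by (rule prob_\<nu>)
  let ?i = "\<lambda>\<omega>. fst (snd \<omega>) t - fst (snd \<omega>) s"
  show "C.indep_set (sets (canonical_filtration T P s)) (sets (vimage_algebra (space (completion P)) ?i borel))"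
  proof (rule C.indep_setI)
    have i0: "?i \<in> borel_measurable (Omega_bar T)" by (intro borel_measurable_diff measurable_noise_eval) (use st in auto)
    have iP: "?i \<in> borel_measurable (completion P)"
      by (rule measurable_completion) (use i0 sets in \<open>simp cong: measurable_cong_sets\<close>)
    show "sets (vimage_algebra (space (completion P)) ?i borel) \<subseteq> C.events"
      using iP by (simp add: measurable_iff_sets)
    have n0: "noise -` S \<inter> space (Omega_bar T) \<in> sets P" if "S \<in> sets (YS T)" for S
      unfolding sets by (rule sets_noise[OF that])
    then have n: "noise -` S \<inter> space (Omega_bar T) \<in> sets (completion P)" if "S \<in> sets (YS T)" for S
      using that by (intro sets_completionI_sets) simp
    have m: "measure (completion P) (noise -` S \<inter> space (Omega_bar T)) = measure (\<nu> u) S" if "S \<in> sets (YS T)" for S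
      unfolding measure_completion[OF n0[OF that]] unfolding P_def by (rule measure_noise[OF that])
    \<comment> \<open>An event of the filtration agrees almost surely with the preimage of a noise
      event, hence is measurable for the completed measure.\<close>
    have CFs: "A \<in> sets (completion P)" if A: "A \<in> sets (canonical_filtration T P s)" for A
    proof -
      obtain C where C: "C \<in> sets (YF T s)" "AE \<omega> in P. \<omega> \<in> A \<longleftrightarrow> noise \<omega> \<in> C"
        using canonical_set_representation[of s A u] A st unfolding P_def by auto
      have C': "C \<in> sets (YS T)" using C(1) sets_YF_sub[of s T] st by auto
      have "AE \<omega> in completion P. \<omega> \<in> noise -` C \<inter> space (Omega_bar T) \<longleftrightarrow> \<omega> \<in> A"
        using AE_completion[OF C(2)] AE_space by eventually_elim (auto simp: sp)
      moreover have "A \<subseteq> space (completion P)" using sets.sets_into_space[OF A] by (simp add: P_def)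
      ultimately show ?thesis by (rule completion.in_sets_AE[OF _ n[OF C']])
    qed
    show "sets (canonical_filtration T P s) \<subseteq> C.events" by (rule subsetI) (rule CFs)
    fix a b assume a: "a \<in> sets (canonical_filtration T P s)" and "b \<in> sets (vimage_algebra (space (completion P)) ?i borel)"
    then have "b \<in> {?i -` E \<inter> space P | E. E \<in> sets borel}"
      by (simp only: sets_vimage_algebra2 Pi_I space_borel UNIV_I space_completion)
    then obtain E where E: "E \<in> sets borel" "b = ?i -` E \<inter> space (Omega_bar T)" unfolding sp by blast
    obtain C where C: "C \<in> sets (YF T s)" "AE \<omega> in P. \<omega> \<in> a \<longleftrightarrow> noise \<omega> \<in> C"
      using canonical_set_representation[of s a u] a st unfolding P_def by auto
    let ?H = "{y \<in> space (YS T). snd y t - snd y s \<in> E}"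
    have H: "?H \<in> sets (YS T)" using measurable_sets[OF f E(1)] by (simp add: vimage_def Int_def conj_commute)
    have C': "C \<in> sets (YS T)" using C(1) sets_YF_sub[of s T] st by auto
    have b: "b = noise -` ?H \<inter> space (Omega_bar T)"
      using noise_in_space unfolding E(2) by (auto simp: noise_def)
    have ae: "AE \<omega> in completion P. \<omega> \<in> a \<longleftrightarrow> noise \<omega> \<in> C" by (rule AE_completion[OF C(2)])
    \<comment> \<open>Replacing \<open>a\<close> by its noise version reduces the claim to
      \<open>YF_indep\<close> on the noise space; afterwards the probabilities are translated
      back.\<close>
    have "C.prob (a \<inter> b) = C.prob (noise -` (C \<inter> ?H) \<inter> space (Omega_bar T))"
    proof (rule measure_eq_AE)
      show "AE \<omega> in completion P. \<omega> \<in> a \<inter> b \<longleftrightarrow> \<omega> \<in> noise -` (C \<inter> ?H) \<inter> space (Omega_bar T)"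
        using ae AE_space by eventually_elim (auto simp: b)
      show "a \<inter> b \<in> sets (completion P)" unfolding b by (rule sets.Int[OF CFs[OF a] n[OF H]])
    qed (rule n[OF sets.Int[OF C' H]])
    also have "\<dots> = measure (\<nu> u) C * measure (\<nu> u) ?H"
      unfolding m[OF sets.Int[OF C' H]] using YF_indep[OF st C(1) E(1), of u]
      by (simp add: N.emeasure_eq_measure ennreal_mult[symmetric])
    also have "measure (\<nu> u) C = C.prob (noise -` C \<inter> space (Omega_bar T))" by (rule m[OF C', symmetric])
    also have "\<dots> = C.prob a"
    proof (rule measure_eq_AE)
      show "AE \<omega> in completion P. \<omega> \<in> noise -` C \<inter> space (Omega_bar T) \<longleftrightarrow> \<omega> \<in> a"
        using ae AE_space by eventually_elim (auto simp: sp)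
    qed (use n[OF C'] CFs[OF a] in auto)
    also have "measure (\<nu> u) ?H = C.prob b" unfolding b by (rule m[OF H, symmetric])
    finally show "C.prob (a \<inter> b) = C.prob a * C.prob b" .
  qed
qed

text \<open>The law of the noise is a product measure, and events of path and initial value are the
  preimages of its strips.\<close>

lemma canonical_indep:
  fixes u
  defines "P \<equiv> Pbar u :: (('n, 'l::finite, 'd, 'k::finite) S1 \<times> ('n, 'd) S2) measure"
  shows "indep_process T P (\<lambda>t \<omega>. fst (snd \<omega>) t) (\<lambda>\<omega>. snd (snd \<omega>))"
  unfolding indep_process_def indep_rv_def
proof (intro conjI)
  interpret P: prob_space P unfolding P_def by (rule prob_Pbar)
  interpret N: prob_space "\<nu> u" by (rule prob_\<nu>)
  interpret W: prob_space W by (rule prob_W)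
  interpret l: prob_space "law_ini u" by (rule prob_law)
  have sp: "space P = space (Omega_bar T)" and sets: "sets P = sets (Omega_bar T)" by (simp_all add: P_def)
  let ?p = "\<lambda>\<omega>. \<lambda>t\<in>{0..T}. fst (snd \<omega>) t"
  have r: "(\<lambda>w. \<lambda>t\<in>{0..T}. w t) \<in> CS T \<rightarrow>\<^sub>M (\<Pi>\<^sub>M t\<in>{0..T}. borel)"
    by (intro measurable_restrict measurable_CS_eval)
  have "noise \<in> P \<rightarrow>\<^sub>M YS T" unfolding P_def by (rule measurable_noise_Pbar)
  from measurable_compose[OF measurable_compose[OF this measurable_YS_snd] r] measurable_compose[OF this measurable_YS_fst]
  show p: "?p \<in> P \<rightarrow>\<^sub>M (\<Pi>\<^sub>M t\<in>{0..T}. borel)" and i: "(\<lambda>\<omega>. snd (snd \<omega>)) \<in> borel_measurable P"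
    by (simp_all add: noise_def)
  show "P.indep_set (sets (vimage_algebra (space P) ?p (\<Pi>\<^sub>M t\<in>{0..T}. borel))) (sets (vimage_algebra (space P) (\<lambda>\<omega>. snd (snd \<omega>)) borel))"
  proof (rule P.indep_setI)
    show "sets (vimage_algebra (space P) ?p (\<Pi>\<^sub>M t\<in>{0..T}. borel)) \<subseteq> P.events"
      "sets (vimage_algebra (space P) (\<lambda>\<omega>. snd (snd \<omega>)) borel) \<subseteq> P.events"
      using p i by (simp_all add: measurable_iff_sets)
    fix a b assume "a \<in> sets (vimage_algebra (space P) ?p (\<Pi>\<^sub>M t\<in>{0..T}. borel))" "b \<in> sets (vimage_algebra (space P) (\<lambda>\<omega>. snd (snd \<omega>)) borel)"
    then have "a \<in> {?p -` D \<inter> space P | D. D \<in> sets (\<Pi>\<^sub>M t\<in>{0..T}. borel)}"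
      "b \<in> {(\<lambda>\<omega>. snd (snd \<omega>)) -` E \<inter> space P | E. E \<in> sets borel}"
      using measurable_space[OF p] by (simp_all only: sets_vimage_algebra2 Pi_I space_borel UNIV_I)
    then obtain D E where D: "D \<in> sets (\<Pi>\<^sub>M t\<in>{0..T}. borel)" "a = ?p -` D \<inter> space (Omega_bar T)"
      and E: "E \<in> sets borel" "b = (\<lambda>\<omega>. snd (snd \<omega>)) -` E \<inter> space (Omega_bar T)" by (auto simp: sp)
    let ?D = "(\<lambda>w. \<lambda>t\<in>{0..T}. w t) -` D \<inter> space (CS T)"
    have D': "?D \<in> sets (CS T)" by (rule measurable_sets[OF r D(1)])
    \<comment> \<open>Applied to the rectangle and to both strips: the factor belonging to a full
      side is 1.\<close>
    have m: "P.prob (noise -` (E' \<times> D'') \<inter> space (Omega_bar T)) = l.prob E' * W.prob D''"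
      if "E' \<in> sets borel" "D'' \<in> sets (CS T)" for E' D''
    proof -
      have "E' \<times> D'' \<in> sets (YS T)" using that unfolding YS_def by (intro pair_measureI)
      from measure_noise[OF this, of u] emeasure_\<nu>_Times[OF that, of u] show ?thesis
        by (simp add: P_def N.emeasure_eq_measure W.emeasure_eq_measure l.emeasure_eq_measure ennreal_mult[symmetric])
    qed
    have "a \<inter> b = noise -` (E \<times> ?D) \<inter> space (Omega_bar T)"
      unfolding D E by (auto simp: noise_def space_Omega_bar)
    moreover have "a = noise -` (UNIV \<times> ?D) \<inter> space (Omega_bar T)"
      unfolding D by (auto simp: noise_def space_Omega_bar)
    moreover have "b = noise -` (E \<times> space (CS T)) \<inter> space (Omega_bar T)"
      unfolding E by (auto simp: noise_def space_Omega_bar)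
    ultimately show "P.prob (a \<inter> b) = P.prob a * P.prob b"
      using m[OF E(1) D'] m[OF _ D', of UNIV] m[OF E(1), of "space (CS T)"] W.prob_space l.prob_space
        sets_eq_imp_space_eq[OF sets_W] sets_eq_imp_space_eq[OF sets_law[of u]] by simp
  qed
qed

lemma canonical_initial_law:
  "distr (Pbar u :: (('n, 'l::finite, 'd, 'k::finite) S1 \<times> ('n, 'd) S2) measure) borel (\<lambda>\<omega>. snd (snd \<omega>)) = law_ini u"
proof -
  let ?P = "Pbar u :: (('n, 'l, 'd, 'k) S1 \<times> ('n, 'd) S2) measure"
  have "distr ?P borel (\<lambda>\<omega>. fst (noise \<omega>)) = distr (distr ?P (YS T) noise) borel fst"
    by (subst distr_distr[OF measurable_YS_fst measurable_noise_Pbar]) (simp add: o_def)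
  also have "distr ?P (YS T) noise = \<nu> u" by (rule distr_noise[OF refl])
  finally show ?thesis by (simp add: distr_\<nu>_fst noise_def)
qed

end

subsection \<open>The solutions on the canonical space\<close>

context aux_setting
begin

lemma joint_quad:
  fixes X' :: "real \<Rightarrow> 'u \<times> (real^'n) \<times> (real \<Rightarrow> real^'d) \<Rightarrow> 'b1::euclidean_space"
    and Y' :: "real \<Rightarrow> _ \<Rightarrow> 'b2::euclidean_space" and Z' :: "real \<Rightarrow> _ \<Rightarrow> 'b3::euclidean_space" and L' :: "real \<Rightarrow> _ \<Rightarrow> 'b4::euclidean_space"
  assumes q: "(\<lambda>(t, x). quad X' Y' Z' L' t x) \<in> borel_measurable (Ic \<Otimes>\<^sub>M Xi)"
  shows "(\<lambda>(t, x). X' t x) \<in> borel_measurable (Ic \<Otimes>\<^sub>M Xi)" "(\<lambda>(t, x). Y' t x) \<in> borel_measurable (Ic \<Otimes>\<^sub>M Xi)"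
    "(\<lambda>(t, x). Z' t x) \<in> borel_measurable (Ic \<Otimes>\<^sub>M Xi)" "(\<lambda>(t, x). L' t x) \<in> borel_measurable (Ic \<Otimes>\<^sub>M Xi)"
  using q by (simp_all add: quad_def case_prod_beta' borel_measurable_quad)

text \<open>Since \<open>S1\<close> carries the Borel sets of a product topology, each component is
  shown to be countably based: the continuous ones by tubes, the classes by the mean square
  base.\<close>

lemma measurable_S1_path:
  fixes X' :: "real \<Rightarrow> 'u \<times> (real^'n) \<times> (real \<Rightarrow> real^'d) \<Rightarrow> real^'n" and Y' :: "real \<Rightarrow> _ \<Rightarrow> real^'l::finite"
    and Z' :: "real \<Rightarrow> _ \<Rightarrow> real^'d^'l" and L' :: "real \<Rightarrow> _ \<Rightarrow> real^'k::finite"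
  assumes q: "(\<lambda>(t, x). quad X' Y' Z' L' t x) \<in> borel_measurable (Ic \<Otimes>\<^sub>M Xi)"
    and X': "\<forall>x. continuous_on {0..T} (\<lambda>t. X' t x)" and Y': "\<forall>x. continuous_on {0..T} (\<lambda>t. Y' t x)"
    and Z': "\<forall>x\<in>space Xi. (\<lambda>t. Z' t x) \<in> sq_int T" and L': "\<forall>x\<in>space Xi. (\<lambda>t. L' t x) \<in> sq_int T"
  shows "S1_path T X' Y' Z' L' \<in> Xi \<rightarrow>\<^sub>M borel_of (S1_top T)"
proof -
  note j = joint_quad[OF q]
  have sw: "(\<lambda>(x, t). h t x) \<in> borel_measurable (Xi \<Otimes>\<^sub>M Icc_measure T)"
    if "(\<lambda>(t, x). h t x) \<in> borel_measurable (Ic \<Otimes>\<^sub>M Xi)" for h :: "real \<Rightarrow> _ \<Rightarrow> 'b::euclidean_space"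
  proof -
    have "(\<lambda>(x, t). h t x) \<in> borel_measurable (Xi \<Otimes>\<^sub>M Ic)"
      using measurable_pair_swap[OF that] by (simp add: case_prod_beta')
    then show ?thesis
      using sets_pair_measure_cong[OF refl restrict_space_lborel_borel[of "{0..T}"], of Xi] by (simp cong: measurable_cong_sets)
  qed
  have "countably_based Xi (S1_top T) (\<lambda>x. (\<lambda>t\<in>{0..T}. X' t x, \<lambda>t\<in>{0..T}. Y' t x, L2_class T (\<lambda>t. Z' t x), L2_class T (\<lambda>t. L' t x)))"
    unfolding S1_top_def
  proof (intro countably_based_pair countably_based_C[OF T] countably_based_L2)
    show "(\<lambda>x. X' t x) \<in> borel_measurable Xi" "(\<lambda>x. Y' t x) \<in> borel_measurable Xi" if "t \<in> {0..T}" for t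
      using joint_at_time[OF j(1) refl that] joint_at_time[OF j(2) refl that] by simp_all
    show "(\<lambda>(x, t). Z' t x) \<in> borel_measurable (Xi \<Otimes>\<^sub>M Icc_measure T)" "(\<lambda>(x, t). L' t x) \<in> borel_measurable (Xi \<Otimes>\<^sub>M Icc_measure T)"
      by (rule sw[OF j(3)], rule sw[OF j(4)])
  qed (use X' Y' Z' L' in auto)
  then have "S1_path T X' Y' Z' L' = (\<lambda>x. (\<lambda>t\<in>{0..T}. X' t x, \<lambda>t\<in>{0..T}. Y' t x, L2_class T (\<lambda>t. Z' t x), L2_class T (\<lambda>t. L' t x)))
      \<Longrightarrow> ?thesis" by (simp add: countably_based_measurable)
  then show ?thesis by (simp add: S1_path_def fun_eq_iff)
qed

lemma time_nn_integral_cong: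
  assumes "\<And>t. t \<in> {0..T} \<Longrightarrow> g t = h t"
  shows "(\<integral>\<^sup>+t\<in>{0..T}. g t \<partial>lborel) = (\<integral>\<^sup>+t\<in>{0..T}. h t \<partial>lborel)"
  by (rule nn_integral_cong) (use assms in \<open>auto split: split_indicator\<close>)

lemma energy_Pbar:
  fixes X' :: "real \<Rightarrow> 'u \<times> (real^'n) \<times> (real \<Rightarrow> real^'d) \<Rightarrow> real^'n" and Y' :: "real \<Rightarrow> _ \<Rightarrow> real^'l::finite"
    and Z' :: "real \<Rightarrow> _ \<Rightarrow> real^'d^'l" and L' :: "real \<Rightarrow> _ \<Rightarrow> real^'k::finite" and u
  defines "P \<equiv> Pbar u :: (('n, 'l::finite, 'd, 'k::finite) S1 \<times> ('n, 'd) S2) measure"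
  assumes q: "(\<lambda>(t, x). quad X' Y' Z' L' t x) \<in> borel_measurable (Ic \<Otimes>\<^sub>M Xi)"
    and X': "\<forall>x. continuous_on {0..T} (\<lambda>t. X' t x)" and Y': "\<forall>x. continuous_on {0..T} (\<lambda>t. Y' t x)"
  shows "energy T (completion P) (\<lambda>t \<omega>. X' t (u, noise \<omega>)) (\<lambda>t \<omega>. Y' t (u, noise \<omega>)) (\<lambda>t \<omega>. Z' t (u, noise \<omega>)) (\<lambda>t \<omega>. L' t (u, noise \<omega>)) =
    energy T (\<nu> u) (sec u X') (sec u Y') (sec u Z') (sec u L')"
proof -
  note j = joint_quad[OF q]
  have m: "(\<lambda>y. h t (u, y)) \<in> borel_measurable (YS T)"
    if "(\<lambda>(t, x). h t x) \<in> borel_measurable (Ic \<Otimes>\<^sub>M Xi)" "t \<in> {0..T}" for h :: "real \<Rightarrow> _ \<Rightarrow> 'b::euclidean_space" and t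
    by (rule measurable_section[OF joint_at_time[OF that(1) refl that(2)]])
  have 1: "(\<integral>\<^sup>+\<omega>. (SUP t\<in>{0..T}. ennreal ((norm (h t (u, noise \<omega>)))\<^sup>2)) \<partial>completion P) = (\<integral>\<^sup>+y. (SUP t\<in>{0..T}. ennreal ((norm (h t (u, y)))\<^sup>2)) \<partial>\<nu> u)"
    if h: "(\<lambda>(t, x). h t x) \<in> borel_measurable (Ic \<Otimes>\<^sub>M Xi)" "\<forall>x. continuous_on {0..T} (\<lambda>t. h t x)" for h :: "real \<Rightarrow> _ \<Rightarrow> 'b::euclidean_space"
    unfolding P_def
  proof (rule nn_integral_Pbar)
    show "(\<lambda>y. SUP t\<in>{0..T}. ennreal ((norm (h t (u, y)))\<^sup>2)) \<in> borel_measurable (YS T)"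
      by (rule borel_measurable_SUP_continuous[OF T])
        (use h(2) in \<open>auto intro!: continuous_intros borel_measurable_power measurable_compose[OF m[OF h(1)] borel_measurable_norm]\<close>)
  qed
  have 2: "(\<integral>\<^sup>+\<omega>. ennreal ((norm (Z' t (u, noise \<omega>)))\<^sup>2 + (norm (L' t (u, noise \<omega>)))\<^sup>2) \<partial>completion P) =
      (\<integral>\<^sup>+y. ennreal ((norm (Z' t (u, y)))\<^sup>2 + (norm (L' t (u, y)))\<^sup>2) \<partial>\<nu> u)" if t: "t \<in> {0..T}" for t
    unfolding P_def
  proof (rule nn_integral_Pbar)
    show "(\<lambda>y. ennreal ((norm (Z' t (u, y)))\<^sup>2 + (norm (L' t (u, y)))\<^sup>2)) \<in> borel_measurable (YS T)"
      using m[OF j(3) t] m[OF j(4) t] by measurable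
  qed
  show ?thesis unfolding energy_def
    by (simp only: 1[OF j(1) X'] 1[OF j(2) Y'] time_nn_integral_cong[OF 2])
qed

text \<open>On the canonical space every process is the functional with frozen label, evaluated at
  \<open>noise\<close>. Driving path and initial value are coordinates, so the solution on the noise
  space is pulled back unchanged.\<close>

theorem canonical_disintegration:
  fixes b :: "'u \<Rightarrow> real \<Rightarrow> ('n, 'l::finite, 'd, 'k::finite) E \<Rightarrow> ('u \<Rightarrow> ('n, 'l, 'd, 'k) E measure) \<Rightarrow> real^'n"
    and \<sigma> :: "'u \<Rightarrow> real \<Rightarrow> ('n, 'l, 'd, 'k) E \<Rightarrow> ('u \<Rightarrow> ('n, 'l, 'd, 'k) E measure) \<Rightarrow> real^'d^'n"
    and f :: "'u \<Rightarrow> real \<Rightarrow> ('n, 'l, 'd, 'k) E \<Rightarrow> ('u \<Rightarrow> ('n, 'l, 'd, 'k) E measure) \<Rightarrow> real^'l"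
    and G :: "'u \<Rightarrow> real^'n \<Rightarrow> ('u \<Rightarrow> (real^'n) measure) \<Rightarrow> real^'l"
    and \<Lambda> :: "'u \<Rightarrow> real \<Rightarrow> real^'n \<Rightarrow> (real \<Rightarrow> real^'d) \<Rightarrow> real^'k"
  assumes b: "coeff_measurable T m b" and \<sigma>: "coeff_measurable T m \<sigma>" and f: "coeff_measurable T m f"
    and G: "terminal_measurable m G" and \<Lambda>: "control_measurable T \<Lambda>"
    and sol: "aux_solution T m b \<sigma> f G \<Lambda> M B ini v X0 Y0 Z0 L0"
  shows "\<exists>U0\<in>sets (borel :: 'u measure). measure m U0 = 1 \<and>
    (\<exists>(Pbar :: 'u \<Rightarrow> (('n, 'l, 'd, 'k) S1 \<times> ('n, 'd) S2) measure) B ini X Y Z L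
      (Phat :: real \<Rightarrow> 'u \<Rightarrow> ('n, 'l, 'd, 'k) E measure).
      (\<forall>u\<in>U0.
         prob_space (Pbar u) \<and> sets (Pbar u) = sets (Omega_bar T) \<and>
         brownian_motion T (completion (Pbar u)) (canonical_filtration T (Pbar u)) (B u) \<and>
         indep_process T (Pbar u) (B u) (ini u) \<and> distr (Pbar u) borel (ini u) = law_ini u \<and>
         progressive T (canonical_filtration T (Pbar u)) (quad (X u) (Y u) (Z u) (L u)) \<and>
         S1_valued T (completion (Pbar u)) (X u) (Y u) (Z u) (L u) \<and>
         solves_fbsde T m b \<sigma> f G (completion (Pbar u)) (canonical_filtration T (Pbar u))
           (B u) (ini u) (\<lambda>\<omega>. u) Phat (X u) (Y u) (Z u) (L u) \<and>
         (\<forall>t\<in>{0..T}. Phat t u = distr (completion (Pbar u)) borel (quad (X u) (Y u) (Z u) (L u) t)) \<and>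
         canonical_read_off T (Pbar u) (X u) (Y u) (Z u) (L u) \<and>
         (\<integral>\<^sup>+s\<in>{0..T}. (\<integral>\<^sup>+\<omega>. ennreal ((norm (L u s \<omega> - \<Lambda> u s (ini u \<omega>) (stopped_path T (B u) s \<omega>)))\<^sup>2)
            \<partial>completion (Pbar u)) \<partial>lborel) = 0) \<and>
      (\<lambda>u. distr (completion (Pbar u)) (borel_of (S1_top T)) (S1_path T (X u) (Y u) (Z u) (L u)))
         \<in> restrict_space (completion m) U0 \<rightarrow>\<^sub>M prob_algebra (borel_of (S1_top T)) \<and>
      S2H2m T m U0 (\<lambda>u. completion (Pbar u)) (\<lambda>u. canonical_filtration T (Pbar u)) X Y Z L)"
proof -
  obtain X' :: "real \<Rightarrow> 'u \<times> (real^'n) \<times> (real \<Rightarrow> real^'d) \<Rightarrow> real^'n" and Y' :: "real \<Rightarrow> _ \<Rightarrow> real^'l"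
    and Z' :: "real \<Rightarrow> _ \<Rightarrow> real^'d^'l" and L' :: "real \<Rightarrow> _ \<Rightarrow> real^'k"
    where D: "(\<forall>x. continuous_on {0..T} (\<lambda>t. X' t x)) \<and> (\<forall>x. continuous_on {0..T} (\<lambda>t. Y' t x)) \<and>
    (\<forall>x\<in>space Xi. (\<lambda>t. Z' t x) \<in> sq_int T \<and> (\<forall>t\<in>{0..T}. precise (L2_class T (\<lambda>t. Z' t x)) t = Z' t x)) \<and>
    (\<forall>x\<in>space Xi. (\<lambda>t. L' t x) \<in> sq_int T \<and> (\<forall>t\<in>{0..T}. precise (L2_class T (\<lambda>t. L' t x)) t = L' t x)) \<and>
    (\<lambda>(t, x). quad X' Y' Z' L' t x) \<in> borel_measurable (Ic \<Otimes>\<^sub>M Xi) \<and>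
    (\<integral>\<^sup>+u. energy T (\<nu> u) (sec u X') (sec u Y') (sec u Z') (sec u L') \<partial>completion m) < \<infinity> \<and>
    (AE u in completion m. progressive T (FY u) (quad (sec u X') (sec u Y') (sec u Z') (sec u L')) \<and>
      solves_fbsde T m b \<sigma> f G (completion (\<nu> u)) (FY u) (\<lambda>t y. snd y t) fst (\<lambda>_. u)
        (\<lambda>t. functional_law (quad X' Y' Z' L' t)) (sec u X') (sec u Y') (sec u Z') (sec u L') \<and>
      (\<integral>\<^sup>+t\<in>{0..T}. (\<integral>\<^sup>+y. ennreal ((norm (L' t (u, y) - \<Lambda> u t (fst y) (stopped_path T (\<lambda>s y. snd y s) t y)))\<^sup>2) \<partial>\<nu> u) \<partial>lborel) = 0 \<and>
      energy T (\<nu> u) (sec u X') (sec u Y') (sec u Z') (sec u L') < \<infinity>)"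
    using aux_solution_disintegration[OF b \<sigma> f G \<Lambda> sol] by (elim exE) (rule that)
  note X' = D[THEN conjunct1] and Y' = D[THEN conjunct2, THEN conjunct1]
    and Z' = D[THEN conjunct2, THEN conjunct2, THEN conjunct1]
    and L' = D[THEN conjunct2, THEN conjunct2, THEN conjunct2, THEN conjunct1]
    and q = D[THEN conjunct2, THEN conjunct2, THEN conjunct2, THEN conjunct2, THEN conjunct1]
    and en = D[THEN conjunct2, THEN conjunct2, THEN conjunct2, THEN conjunct2, THEN conjunct2, THEN conjunct1]
    and ae = D[THEN conjunct2, THEN conjunct2, THEN conjunct2, THEN conjunct2, THEN conjunct2, THEN conjunct2]
  define good where "good u \<longleftrightarrow> progressive T (FY u) (quad (sec u X') (sec u Y') (sec u Z') (sec u L')) \<and>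
        solves_fbsde T m b \<sigma> f G (completion (\<nu> u)) (FY u) (\<lambda>t y. snd y t) fst (\<lambda>_. u)
          (\<lambda>t. functional_law (quad X' Y' Z' L' t)) (sec u X') (sec u Y') (sec u Z') (sec u L') \<and>
        (\<integral>\<^sup>+t\<in>{0..T}. (\<integral>\<^sup>+y. ennreal ((norm (L' t (u, y) - \<Lambda> u t (fst y) (stopped_path T (\<lambda>s y. snd y s) t y)))\<^sup>2) \<partial>\<nu> u) \<partial>lborel) = 0 \<and>
        energy T (\<nu> u) (sec u X') (sec u Y') (sec u Z') (sec u L') < \<infinity>" for u
  have "AE u in m. good u" using ae unfolding good_def[symmetric] by (simp add: AE_completion_iff)
  \<comment> \<open>Returning from the completion to \<open>m\<close> before choosing the
    exceptional set makes its complement Borel.\<close>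
  then obtain N where N: "{u \<in> space m. \<not> good u} \<subseteq> N" "emeasure m N = 0" "N \<in> sets m" by (rule AE_E)
  define U0 where "U0 = - N"
  have U0: "space m - N = U0" by (auto simp: U0_def)
  have U0s: "U0 \<in> sets borel" using sets.compl_sets[OF N(3)] unfolding U0 sets_m .
  have U0m: "measure m U0 = 1"
    using prob_space.prob_compl[OF prob_m N(3)] N(2) unfolding U0 by (simp add: measure_def)
  have good: "good u" if "u \<in> U0" for u using N(1) that by (auto simp: U0_def)
  define P where "P u = (Pbar u :: (('n, 'l, 'd, 'k) S1 \<times> ('n, 'd) S2) measure)" for u
  define Bc where "Bc u t \<omega> = fst (snd \<omega>) t" for u :: 'u and t :: real and \<omega> :: "('n, 'l, 'd, 'k) S1 \<times> ('n, 'd) S2"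
  define ic where "ic u \<omega> = snd (snd \<omega>)" for u :: 'u and \<omega> :: "('n, 'l, 'd, 'k) S1 \<times> ('n, 'd) S2"
  define X where "X u t \<omega> = X' t (u, noise \<omega>)" for u t and \<omega> :: "('n, 'l, 'd, 'k) S1 \<times> ('n, 'd) S2"
  define Y where "Y u t \<omega> = Y' t (u, noise \<omega>)" for u t and \<omega> :: "('n, 'l, 'd, 'k) S1 \<times> ('n, 'd) S2"
  define Z where "Z u t \<omega> = Z' t (u, noise \<omega>)" for u t and \<omega> :: "('n, 'l, 'd, 'k) S1 \<times> ('n, 'd) S2"
  define L where "L u t \<omega> = L' t (u, noise \<omega>)" for u t and \<omega> :: "('n, 'l, 'd, 'k) S1 \<times> ('n, 'd) S2"
  \<comment> \<open>The family is defined for every label and is the same in all equations; it is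
    the only coupling between different labels.\<close>
  let ?Phat = "\<lambda>t. functional_law (quad X' Y' Z' L' t)"
  let ?S = "\<lambda>u. S1_path T (X u) (Y u) (Z u) (L u)"
  have quad: "quad (X u) (Y u) (Z u) (L u) t \<omega> = quad X' Y' Z' L' t (u, noise \<omega>)" for u t \<omega>
    by (simp add: quad_def X_def Y_def Z_def L_def)
  have S: "?S u \<omega> = S1_path T X' Y' Z' L' (u, noise \<omega>)" for u \<omega>
    by (simp add: S1_path_def X_def Y_def Z_def L_def)
  have Sm: "S1_path T X' Y' Z' L' \<in> Xi \<rightarrow>\<^sub>M borel_of (S1_top T)"
    by (rule measurable_S1_path[OF q X' Y']) (use Z' L' in blast)+
  have PT: "t \<in> {0..T} \<Longrightarrow> quad X' Y' Z' L' t \<in> borel_measurable Xi" for t by (rule joint_at_time[OF q refl])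
  have prog: "progressive T (canonical_filtration T (P u)) (quad (X u) (Y u) (Z u) (L u))" if u: "u \<in> U0" for u
  proof -
    have "progressive T (FY u) (quad (sec u X') (sec u Y') (sec u Z') (sec u L'))" using good[OF u] unfolding good_def by blast
    then have "progressive T (canonical_filtration T (P u)) (\<lambda>t \<omega>. quad (sec u X') (sec u Y') (sec u Z') (sec u L') t (noise \<omega>))"
      unfolding P_def by (rule pb.progressive_pullback)
    moreover have "quad (X u) (Y u) (Z u) (L u) = (\<lambda>t \<omega>. quad (sec u X') (sec u Y') (sec u Z') (sec u L') t (noise \<omega>))"
      by (simp add: fun_eq_iff quad_def X_def Y_def Z_def L_def)
    ultimately show ?thesis by simp
  qed
  have sv: "S1_valued T (completion (P u)) (X u) (Y u) (Z u) (L u)" for u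
  proof -
    have "(\<lambda>\<omega>. S1_path T X' Y' Z' L' (u, noise \<omega>)) \<in> P u \<rightarrow>\<^sub>M borel_of (S1_top T)"
      unfolding P_def by (rule measurable_compose[OF measurable_noise_Pbar measurable_section[OF Sm]])
    then have "?S u \<in> P u \<rightarrow>\<^sub>M borel_of (S1_top T)" by (simp add: S[symmetric] cong: measurable_cong)
    then show ?thesis unfolding S1_valued_def by (rule measurable_completion)
  qed
  have solves: "solves_fbsde T m b \<sigma> f G (completion (P u)) (canonical_filtration T (P u)) (Bc u) (ic u) (\<lambda>\<omega>. u) ?Phat (X u) (Y u) (Z u) (L u)"
    if u: "u \<in> U0" for u
  proof -
    have "solves_fbsde T m b \<sigma> f G (completion (\<nu> u)) (FY u) (\<lambda>t y. snd y t) fst (\<lambda>_. u) ?Phat (sec u X') (sec u Y') (sec u Z') (sec u L')"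
      using good[OF u] unfolding good_def by blast
    then have "solves_fbsde T m b \<sigma> f G (completion (P u)) (canonical_filtration T (P u)) (\<lambda>t \<omega>. snd (noise \<omega>) t) (\<lambda>\<omega>. fst (noise \<omega>)) (\<lambda>_. u) ?Phat
        (\<lambda>t \<omega>. sec u X' t (noise \<omega>)) (\<lambda>t \<omega>. sec u Y' t (noise \<omega>)) (\<lambda>t \<omega>. sec u Z' t (noise \<omega>)) (\<lambda>t \<omega>. sec u L' t (noise \<omega>))"
      unfolding P_def by (rule pb.solves_fbsde_pullback)
    moreover have "Bc u = (\<lambda>t \<omega>. snd (noise \<omega>) t)" "ic u = (\<lambda>\<omega>. fst (noise \<omega>))"
      "X u = (\<lambda>t \<omega>. sec u X' t (noise \<omega>))" "Y u = (\<lambda>t \<omega>. sec u Y' t (noise \<omega>))"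
      "Z u = (\<lambda>t \<omega>. sec u Z' t (noise \<omega>))" "L u = (\<lambda>t \<omega>. sec u L' t (noise \<omega>))"
      by (simp_all add: fun_eq_iff Bc_def ic_def X_def Y_def Z_def L_def noise_def)
    ultimately show ?thesis by (simp only:)
  qed
  have phat: "?Phat t u = distr (completion (P u)) borel (quad (X u) (Y u) (Z u) (L u) t)" if t: "t \<in> {0..T}" for t u
  proof -
    have eq: "quad (X u) (Y u) (Z u) (L u) t = (\<lambda>\<omega>. quad X' Y' Z' L' t (u, noise \<omega>))" by (simp add: fun_eq_iff quad)
    show ?thesis unfolding P_def functional_law_def eq
      by (rule distr_functional[OF measurable_section[OF PT[OF t]], symmetric])
  qed
  have ro: "canonical_read_off T (P u) (X u) (Y u) (Z u) (L u)" for u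
    unfolding canonical_read_off_def
  proof (intro ballI)
    fix \<omega> t assume "\<omega> \<in> space (P u)" and t: "t \<in> {0..T}"
    \<comment> \<open>The functionals satisfy the read-off identity at every point of
      \<open>Xi\<close>, so it holds on the whole canonical space without an exceptional
      set.\<close>
    then have "(u, noise \<omega>) \<in> space Xi" using noise_in_space[of \<omega>] by (simp add: P_def space_Xi)
    with Z' L' t show "canon_S1 t (?S u \<omega>) = quad (X u) (Y u) (Z u) (L u) t \<omega>"
      unfolding S quad by (simp add: canon_S1_def S1_path_def quad_def)
  qed
  have control: "(\<integral>\<^sup>+s\<in>{0..T}. (\<integral>\<^sup>+\<omega>. ennreal ((norm (L u s \<omega> - \<Lambda> u s (ic u \<omega>) (stopped_path T (Bc u) s \<omega>)))\<^sup>2) \<partial>completion (P u)) \<partial>lborel) = 0"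
    if u: "u \<in> U0" for u
  proof -
    define dl where "dl t x = ennreal ((norm (L' t x - \<Lambda> (fst x) t (fst (snd x)) (stopped_path T (\<lambda>s x. snd (snd x) s) t x)))\<^sup>2)" for t x
    have dl: "(\<lambda>(t, x). dl t x) \<in> borel_measurable (Ic \<Otimes>\<^sub>M Xi)"
      using joint_quad(4)[OF q] control_measurable_functional[OF \<Lambda>] unfolding dl_def by (simp add: case_prod_beta')
    have "(\<integral>\<^sup>+\<omega>. ennreal ((norm (L u s \<omega> - \<Lambda> u s (ic u \<omega>) (stopped_path T (Bc u) s \<omega>)))\<^sup>2) \<partial>completion (P u)) = (\<integral>\<^sup>+y. dl s (u, y) \<partial>\<nu> u)"
      if s: "s \<in> {0..T}" for s
    proof -
      have "ennreal ((norm (L u s \<omega> - \<Lambda> u s (ic u \<omega>) (stopped_path T (Bc u) s \<omega>)))\<^sup>2) = dl s (u, noise \<omega>)" for \<omega>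
        by (simp add: dl_def L_def ic_def Bc_def stopped_path_def noise_def)
      then show ?thesis unfolding P_def
        by (simp only: nn_integral_Pbar[OF measurable_section[OF joint_at_time[OF dl refl s]]])
    qed
    then have "(\<integral>\<^sup>+s\<in>{0..T}. (\<integral>\<^sup>+\<omega>. ennreal ((norm (L u s \<omega> - \<Lambda> u s (ic u \<omega>) (stopped_path T (Bc u) s \<omega>)))\<^sup>2) \<partial>completion (P u)) \<partial>lborel) =
        (\<integral>\<^sup>+s\<in>{0..T}. (\<integral>\<^sup>+y. dl s (u, y) \<partial>\<nu> u) \<partial>lborel)" by (rule time_nn_integral_cong)
    also have "\<dots> = 0" using good[OF u] unfolding good_def dl_def by (simp add: stopped_path_def)
    finally show ?thesis .
  qed
  have kernel: "(\<lambda>u. distr (completion (P u)) (borel_of (S1_top T)) (?S u)) \<in> restrict_space (completion m) U0 \<rightarrow>\<^sub>M prob_algebra (borel_of (S1_top T))"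
  \<comment> \<open>The laws form a kernel over all labels, which is then restricted to
    \<open>U0\<close>.\<close>
  proof (rule measurable_restrict_space1)
    have "distr (completion (P u)) (borel_of (S1_top T)) (?S u) = distr (\<nu> u) (borel_of (S1_top T)) (\<lambda>y. S1_path T X' Y' Z' L' (u, y))" for u
    proof -
      have eq: "?S u = (\<lambda>\<omega>. S1_path T X' Y' Z' L' (u, noise \<omega>))" by (simp add: fun_eq_iff S)
      show ?thesis unfolding P_def eq by (rule distr_functional[OF measurable_section[OF Sm]])
    qed
    then show "(\<lambda>u. distr (completion (P u)) (borel_of (S1_top T)) (?S u)) \<in> completion m \<rightarrow>\<^sub>M prob_algebra (borel_of (S1_top T))"
      using functional_kernel[OF Sm] by simp
  qed
  have e: "energy T (completion (P u)) (X u) (Y u) (Z u) (L u) = energy T (\<nu> u) (sec u X') (sec u Y') (sec u Z') (sec u L')" for u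
  proof -
    have "X u = (\<lambda>t \<omega>. X' t (u, noise \<omega>))" "Y u = (\<lambda>t \<omega>. Y' t (u, noise \<omega>))" "Z u = (\<lambda>t \<omega>. Z' t (u, noise \<omega>))" "L u = (\<lambda>t \<omega>. L' t (u, noise \<omega>))"
      by (simp_all add: fun_eq_iff X_def Y_def Z_def L_def)
    then show ?thesis using energy_Pbar[OF q X' Y', of u] by (simp only: P_def)
  qed
  have S2H2: "S2H2m T m U0 (\<lambda>u. completion (P u)) (\<lambda>u. canonical_filtration T (P u)) X Y Z L"
    unfolding S2H2m_def
  proof (intro conjI ballI kernel)
    fix u assume u: "u \<in> U0"
    show "progressive T (canonical_filtration T (P u)) (quad (X u) (Y u) (Z u) (L u))" by (rule prog[OF u])
    show "S1_valued T (completion (P u)) (X u) (Y u) (Z u) (L u)" by (rule sv)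
    show "energy T (completion (P u)) (X u) (Y u) (Z u) (L u) < \<infinity>" unfolding e using good[OF u] unfolding good_def by blast
  next
    have "(\<integral>\<^sup>+u\<in>U0. energy T (\<nu> u) (sec u X') (sec u Y') (sec u Z') (sec u L') \<partial>completion m)
        \<le> (\<integral>\<^sup>+u. energy T (\<nu> u) (sec u X') (sec u Y') (sec u Z') (sec u L') \<partial>completion m)"
      by (rule nn_integral_mono) (simp split: split_indicator)
    then show "(\<integral>\<^sup>+u\<in>U0. energy T (completion (P u)) (X u) (Y u) (Z u) (L u) \<partial>completion m) < \<infinity>"
      unfolding e using en by (rule le_less_trans)
  qed
  have Bc: "Bc u = (\<lambda>t \<omega>. fst (snd \<omega>) t)" and ic: "ic u = (\<lambda>\<omega>. snd (snd \<omega>))" for u by (simp_all add: fun_eq_iff Bc_def ic_def)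
  have bmc: "brownian_motion T (completion (P u)) (canonical_filtration T (P u)) (Bc u)" for u
    unfolding P_def Bc by (rule canonical_brownian_motion)
  have ind: "indep_process T (P u) (Bc u) (ic u)" for u unfolding P_def Bc ic by (rule canonical_indep)
  have law: "distr (P u) borel (ic u) = law_ini u" for u unfolding P_def ic by (rule canonical_initial_law)
  have prob: "prob_space (P u)" and sets: "sets (P u) = sets (Omega_bar T)" for u
    unfolding P_def by (rule prob_Pbar, rule sets_Pbar)
  show ?thesis
  proof (rule bexI[OF _ U0s], intro conjI U0m exI)
    show "\<forall>u\<in>U0. prob_space (P u) \<and> sets (P u) = sets (Omega_bar T) \<and>
         brownian_motion T (completion (P u)) (canonical_filtration T (P u)) (Bc u) \<and>
         indep_process T (P u) (Bc u) (ic u) \<and> distr (P u) borel (ic u) = law_ini u \<and>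
         progressive T (canonical_filtration T (P u)) (quad (X u) (Y u) (Z u) (L u)) \<and>
         S1_valued T (completion (P u)) (X u) (Y u) (Z u) (L u) \<and>
         solves_fbsde T m b \<sigma> f G (completion (P u)) (canonical_filtration T (P u))
           (Bc u) (ic u) (\<lambda>\<omega>. u) ?Phat (X u) (Y u) (Z u) (L u) \<and>
         (\<forall>t\<in>{0..T}. ?Phat t u = distr (completion (P u)) borel (quad (X u) (Y u) (Z u) (L u) t)) \<and>
         canonical_read_off T (P u) (X u) (Y u) (Z u) (L u) \<and>
         (\<integral>\<^sup>+s\<in>{0..T}. (\<integral>\<^sup>+\<omega>. ennreal ((norm (L u s \<omega> - \<Lambda> u s (ic u \<omega>) (stopped_path T (Bc u) s \<omega>)))\<^sup>2)
            \<partial>completion (P u)) \<partial>lborel) = 0"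
      by (intro ballI conjI prob sets bmc ind law prog sv solves phat ro control)
  qed (rule kernel S2H2)+
qed

end

theorem theorem4p2:
  fixes T :: real
    and m :: "'u::polish_space measure"
    and law_ini :: "'u \<Rightarrow> (real^'n::finite) measure"
    and N0 :: "'u \<Rightarrow> 'w0 measure"
    and B0 :: "'u \<Rightarrow> real \<Rightarrow> 'w0 \<Rightarrow> real^'d::finite"
    and ini0 :: "'u \<Rightarrow> 'w0 \<Rightarrow> real^'n"
    and b :: "'u \<Rightarrow> real \<Rightarrow> ('n, 'l::finite, 'd, 'k::finite) E \<Rightarrow> ('u \<Rightarrow> ('n, 'l, 'd, 'k) E measure) \<Rightarrow> real^'n"
    and \<sigma> :: "'u \<Rightarrow> real \<Rightarrow> ('n, 'l, 'd, 'k) E \<Rightarrow> ('u \<Rightarrow> ('n, 'l, 'd, 'k) E measure) \<Rightarrow> real^'d^'n"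
    and f :: "'u \<Rightarrow> real \<Rightarrow> ('n, 'l, 'd, 'k) E \<Rightarrow> ('u \<Rightarrow> ('n, 'l, 'd, 'k) E measure) \<Rightarrow> real^'l"
    and G :: "'u \<Rightarrow> real^'n \<Rightarrow> ('u \<Rightarrow> (real^'n) measure) \<Rightarrow> real^'l"
    and \<Lambda> :: "'u \<Rightarrow> real \<Rightarrow> real^'n \<Rightarrow> (real \<Rightarrow> real^'d) \<Rightarrow> real^'k"
    and Mh :: "'w measure"
    and Bh :: "real \<Rightarrow> 'w \<Rightarrow> real^'d"
    and inih :: "'w \<Rightarrow> real^'n"
    and vh :: "'w \<Rightarrow> 'u"
  assumes "T > 0"
    and "prob_space m" and "sets m = sets borel"
    and "law_ini \<in> completion m \<rightarrow>\<^sub>M prob_algebra borel"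
    and "\<forall>u. prob_space (N0 u) \<and>
           brownian_motion T (N0 u) (gen_filtration (space (N0 u)) (B0 u)) (B0 u) \<and>
           indep_process T (N0 u) (B0 u) (ini0 u) \<and> distr (N0 u) borel (ini0 u) = law_ini u"
    and "coeff_measurable T m b" and "coeff_measurable T m \<sigma>" and "coeff_measurable T m f"
    and "terminal_measurable m G"
    and "control_measurable T \<Lambda>"
    and "\<forall>u. (\<integral>\<^sup>+t\<in>{0..T}. (\<integral>\<^sup>+\<omega>. ennreal ((norm (\<Lambda> u t (ini0 u \<omega>) (stopped_path T (B0 u) t \<omega>)))\<^sup>2) \<partial>N0 u) \<partial>lborel) < \<infinity>"
    and "(\<integral>\<^sup>+u. (\<integral>\<^sup>+t\<in>{0..T}. (\<integral>\<^sup>+\<omega>. ennreal ((norm (\<Lambda> u t (ini0 u \<omega>) (stopped_path T (B0 u) t \<omega>)))\<^sup>2) \<partial>N0 u) \<partial>lborel)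
            \<partial>completion m) < \<infinity>"
    and "aux_space T m law_ini Mh Bh inih vh"
    and "\<exists>X Y Z L. aux_solution T m b \<sigma> f G \<Lambda> Mh Bh inih vh X Y Z L"
  shows "\<exists>U0\<in>sets (borel :: 'u measure). measure m U0 = 1 \<and>
    (\<exists>(Pbar :: 'u \<Rightarrow> (('n, 'l, 'd, 'k) S1 \<times> ('n, 'd) S2) measure) B ini X Y Z L
      (Phat :: real \<Rightarrow> 'u \<Rightarrow> ('n, 'l, 'd, 'k) E measure).
      (\<forall>u\<in>U0.
         prob_space (Pbar u) \<and> sets (Pbar u) = sets (Omega_bar T) \<and>
         brownian_motion T (completion (Pbar u)) (canonical_filtration T (Pbar u)) (B u) \<and>
         indep_process T (Pbar u) (B u) (ini u) \<and> distr (Pbar u) borel (ini u) = law_ini u \<and>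
         progressive T (canonical_filtration T (Pbar u)) (quad (X u) (Y u) (Z u) (L u)) \<and>
         S1_valued T (completion (Pbar u)) (X u) (Y u) (Z u) (L u) \<and>
         solves_fbsde T m b \<sigma> f G (completion (Pbar u)) (canonical_filtration T (Pbar u))
           (B u) (ini u) (\<lambda>\<omega>. u) Phat (X u) (Y u) (Z u) (L u) \<and>
         (\<forall>t\<in>{0..T}. Phat t u = distr (completion (Pbar u)) borel (quad (X u) (Y u) (Z u) (L u) t)) \<and>
         canonical_read_off T (Pbar u) (X u) (Y u) (Z u) (L u) \<and>
         (\<integral>\<^sup>+s\<in>{0..T}. (\<integral>\<^sup>+\<omega>. ennreal ((norm (L u s \<omega> - \<Lambda> u s (ini u \<omega>) (stopped_path T (B u) s \<omega>)))\<^sup>2)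
            \<partial>completion (Pbar u)) \<partial>lborel) = 0) \<and>
      (\<lambda>u. distr (completion (Pbar u)) (borel_of (S1_top T)) (S1_path T (X u) (Y u) (Z u) (L u)))
         \<in> restrict_space (completion m) U0 \<rightarrow>\<^sub>M prob_algebra (borel_of (S1_top T)) \<and>
      S2H2m T m U0 (\<lambda>u. completion (Pbar u)) (\<lambda>u. canonical_filtration T (Pbar u)) X Y Z L)"
proof -
  interpret aux_setting T m law_ini Mh Bh inih vh by (rule aux_setting.intro) (rule assms)+
  from assms(14) obtain X Y Z L where "aux_solution T m b \<sigma> f G \<Lambda> Mh Bh inih vh X Y Z L" by (elim exE)
  then show ?thesis by (rule canonical_disintegration[OF assms(6-10)])
qed

end
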